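(* Let $C$ be a geometrically integral and regular curve over $K$, $P\in C$ a closed point, and let $C_1$, $P_1$ be as in the context. If $d(C_1,P_1)=1$, then $$\Gamma_{C^{\overline{K}},P^{\overline{K}}}=d(C,P)\,\mathbb{Z}_{\geq 0}+p\,\mathbb{Z}_{\geq 0}.$$
   Context: $K$ is a non-perfect, separably closed field of characteristic $p>0$ with algebraic closure $\overline{K}$. For a geometrically integral regular curve $E$ over $K$ and a closed point $Q\in E$: $E^{\overline{K}}=E\times_{\operatorname{Spec}K}\operatorname{Spec}\overline{K}$, $Q^{\overline{K}}$ is its unique point over $Q$, with local ring $\overline{K}\mathcal{O}_{E,Q}$; $\widetilde{E^{\overline{K}}}$ is the normalization and $\widetilde{Q^{\overline{K}}}$ its unique point over $Q$. The differential degree is $d(E,Q)=1+\dim_{\overline{K}}\operatorname{Coker}(\alpha)$, where $\alpha\colon\mathcal{O}_{\widetilde{E^{\overline{K}}},\widetilde{Q^{\overline{K}}}}\,\Omega_{\overline{K}\mathcal{O}_{E,Q}/\overline{K}}\to\Omega_{\mathcal{O}_{\widetilde{E^{\overline{K}}},\widetilde{Q^{\overline{K}}}}/\overline{K}}$ is the natural homomorphism (its image is the $\mathcal{O}_{\widetilde{E^{\overline{K}}},\widetilde{Q^{\overline{K}}}}$-submodule generated by all $dx$, $x\in\overline{K}\mathcal{O}_{E,Q}$). $C_1$ is the normalization of $C^{(p)}$, the image of $C$ under the relative Frobenius morphism $F_{C/K}\colon C\to C^{(p)}$ (so $C_1$ has function field $K\cdot K(C)^p$), and $P_1$ is the point of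 $C_1$ lying over $F_{C/K}(P)$. $\Gamma_{C^{\overline{K}},P^{\overline{K}}}=\{l\in\mathbb{Z} : l=\nu_0(x)\text{ for some }x\in\overline{K}\mathcal{O}_{C,P}\}$, where $\nu_0$ is the normalized discrete valuation with valuation ring $\mathcal{O}_{\widetilde{C^{\overline{K}}},\widetilde{P^{\overline{K}}}}$. *)

theory Defs
  imports
    "HOL-Computational_Algebra.Computational_Algebra"
    "HOL-Library.Poly_Mapping"
    "HOL-Library.Extended_Nat"
begin

text \<open>
  Curves are rendered in the language of Zariski and Chevalley: an integral separated scheme of
  finite type over a field is identified with the set of the local rings of its points, all of them
  subrings of its function field.  A point \<^emph>\<open>is\<close> its local ring; the generic point is the function
  field itself.  All fields in play are subfields (sets) of one ambient field, the type \<open>'l\<close>.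
\<close>


section \<open>Subrings of a field\<close>

definition subring :: "'l::field set \<Rightarrow> bool" where
  "subring A \<longleftrightarrow> 1 \<in> A \<and> (\<forall>x\<in>A. \<forall>y\<in>A. x - y \<in> A \<and> x * y \<in> A)"

definition subfield :: "'l::field set \<Rightarrow> bool" where
  "subfield k \<longleftrightarrow> subring k \<and> (\<forall>x\<in>k. inverse x \<in> k)"

definition ring_adjoin :: "'l::field set \<Rightarrow> 'l set \<Rightarrow> 'l set" where
  "ring_adjoin k S = subring hull (k \<union> S)"

definition fraction_field :: "'l::field set \<Rightarrow> 'l set" where
  "fraction_field A = {x / y | x y. x \<in> A \<and> y \<in> A}"

definition ideal :: "'l::field set \<Rightarrow> 'l set \<Rightarrow> bool" where
  "ideal A I \<longleftrightarrow> I \<subseteq> A \<and> 0 \<in> I \<and> (\<forall>x\<in>I. \<forall>y\<in>I. x - y \<in> I) \<and> (\<forall>a\<in>A. \<forall>x\<in>I. a * x \<in> I)"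

definition prime_ideal :: "'l::field set \<Rightarrow> 'l set \<Rightarrow> bool" where
  "prime_ideal A I \<longleftrightarrow> ideal A I \<and> 1 \<notin> I \<and>
     (\<forall>x\<in>A. \<forall>y\<in>A. x * y \<in> I \<longrightarrow> x \<in> I \<or> y \<in> I)"

definition localization :: "'l::field set \<Rightarrow> 'l set \<Rightarrow> 'l set" where
  "localization A I = {x / y | x y. x \<in> A \<and> y \<in> A - I}"

definition nonunits :: "'l::field set \<Rightarrow> 'l set" where
  "nonunits R = {x \<in> R. x = 0 \<or> inverse x \<notin> R}"

definition local_ring :: "'l::field set \<Rightarrow> bool" where
  "local_ring R \<longleftrightarrow> subring R \<and> ideal R (nonunits R)"

text \<open>For local rings \<open>R\<close>, \<open>S\<close> of points: the point with local ring \<open>S\<close> lies over that of \<open>R\<close>.\<close>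

definition dominates :: "'l::field set \<Rightarrow> 'l set \<Rightarrow> bool" where
  "dominates S R \<longleftrightarrow> R \<subseteq> S \<and> nonunits S \<inter> R = nonunits R"

definition noetherian :: "'l::field set \<Rightarrow> bool" where
  "noetherian A \<longleftrightarrow> (\<forall>I. ideal A I \<longrightarrow> (\<exists>S. finite S \<and> S \<subseteq> A \<and> I = ideal A hull S))"

definition krull_dim :: "'l::field set \<Rightarrow> enat" where
  "krull_dim A = Sup {enat n | n. \<exists>c :: nat \<Rightarrow> 'l set.
     (\<forall>i\<le>n. prime_ideal A (c i)) \<and> (\<forall>i<n. c i \<subset> c (Suc i))}"

definition regular_local_ring :: "'l::field set \<Rightarrow> bool" where
  "regular_local_ring R \<longleftrightarrow> local_ring R \<and> noetherian R \<and>
     (\<exists>S. finite S \<and> S \<subseteq> R \<and> enat (card S) = krull_dim R \<and> nonunits R = ideal R hull S)"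

definition valuation_ring :: "'l::field set \<Rightarrow> 'l set \<Rightarrow> bool" where
  "valuation_ring F V \<longleftrightarrow> subring V \<and> V \<subseteq> F \<and> (\<forall>x\<in>F. x \<in> V \<or> inverse x \<in> V)"

definition integral_over :: "'l::field set \<Rightarrow> 'l \<Rightarrow> bool" where
  "integral_over A x \<longleftrightarrow> (\<exists>f. set (coeffs f) \<subseteq> A \<and> lead_coeff f = 1 \<and> poly f x = 0)"

definition integral_closure :: "'l::field set \<Rightarrow> 'l set" where
  "integral_closure A = {x \<in> fraction_field A. integral_over A x}"


section \<open>Fields\<close>

definition algebraic_over :: "'l::field set \<Rightarrow> 'l \<Rightarrow> bool" where
  "algebraic_over k x \<longleftrightarrow> (\<exists>f. set (coeffs f) \<subseteq> k \<and> f \<noteq> 0 \<and> poly f x = 0)"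

definition algebraically_closed :: "'l::field set \<Rightarrow> bool" where
  "algebraically_closed k \<longleftrightarrow>
     (\<forall>f. set (coeffs f) \<subseteq> k \<longrightarrow> degree f > 0 \<longrightarrow> (\<exists>x\<in>k. poly f x = 0))"

definition algebraic_closure_of :: "'l::field set \<Rightarrow> 'l set \<Rightarrow> bool" where
  "algebraic_closure_of K Kbar \<longleftrightarrow> subfield Kbar \<and> K \<subseteq> Kbar \<and>
     (\<forall>x\<in>Kbar. algebraic_over K x) \<and> algebraically_closed Kbar"

definition separably_closed :: "'l::field set \<Rightarrow> bool" where
  "separably_closed k \<longleftrightarrow>
     (\<forall>f. set (coeffs f) \<subseteq> k \<longrightarrow> degree f > 0 \<longrightarrow> coprime f (pderiv f) \<longrightarrow> (\<exists>x\<in>k. poly f x = 0))"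

text \<open>Only meaningful when the characteristic is positive, which is the case of interest.\<close>

definition perfect :: "'l::field set \<Rightarrow> bool" where
  "perfect k \<longleftrightarrow> (\<forall>a\<in>k. \<exists>b\<in>k. b ^ CHAR('l) = a)"

definition transcendence_degree_one :: "'l::field set \<Rightarrow> 'l set \<Rightarrow> bool" where
  "transcendence_degree_one K F \<longleftrightarrow>
     (\<exists>t\<in>F. \<not> algebraic_over K t \<and>
        (\<forall>x\<in>F. algebraic_over (fraction_field (ring_adjoin K {t})) x))"


section \<open>Tensor products of subrings over a common subfield\<close>

text \<open>
  \<open>A \<otimes>\<^sub>K B\<close> is the monoid ring \<open>\<int>[A \<times> B]\<close> of formal sums of pairs (multiplied
  componentwise), modulo the ideal that as an additive group is generated by the bilinearity
  relations.
\<close>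

type_synonym 'l formal_tensor = "('l \<times> 'l) \<Rightarrow>\<^sub>0 int"

definition pure_tensor :: "'l \<Rightarrow> 'l \<Rightarrow> 'l formal_tensor" where
  "pure_tensor a b = Poly_Mapping.single (a, b) 1"

definition formal_tensors :: "'l set \<Rightarrow> 'l set \<Rightarrow> 'l formal_tensor set" where
  "formal_tensors A B = {z. Poly_Mapping.keys z \<subseteq> A \<times> B}"

definition tensor_mult :: "'l::field formal_tensor \<Rightarrow> 'l formal_tensor \<Rightarrow> 'l formal_tensor" where
  "tensor_mult z w = (\<Sum>(a, b)\<in>Poly_Mapping.keys z. \<Sum>(a', b')\<in>Poly_Mapping.keys w.
     Poly_Mapping.single (a * a', b * b')
       (Poly_Mapping.lookup z (a, b) * Poly_Mapping.lookup w (a', b')))"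

definition tensor_relations :: "'l::field set \<Rightarrow> 'l set \<Rightarrow> 'l set \<Rightarrow> 'l formal_tensor set" where
  "tensor_relations K A B = group_closure (
     {pure_tensor (a + a') b - pure_tensor a b - pure_tensor a' b | a a' b.
        a \<in> A \<and> a' \<in> A \<and> b \<in> B} \<union>
     {pure_tensor a (b + b') - pure_tensor a b - pure_tensor a b' | a b b'.
        a \<in> A \<and> b \<in> B \<and> b' \<in> B} \<union>
     {pure_tensor (c * a) b - pure_tensor a (c * b) | c a b.
        c \<in> K \<and> a \<in> A \<and> b \<in> B})"

definition tensor_product_is_domain :: "'l::field set \<Rightarrow> 'l set \<Rightarrow> 'l set \<Rightarrow> bool" where
  "tensor_product_is_domain K A B \<longleftrightarrow>
     pure_tensor 1 1 \<notin> tensor_relations K A B \<and>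
     (\<forall>z\<in>formal_tensors A B. \<forall>w\<in>formal_tensors A B.
        tensor_mult z w \<in> tensor_relations K A B \<longrightarrow>
        z \<in> tensor_relations K A B \<or> w \<in> tensor_relations K A B)"


section \<open>Curves\<close>

text \<open>\<open>A\<close> is the coordinate ring of a (nonempty) affine scheme of finite type with function field
  \<open>F\<close>; \<open>spec_points A\<close> is its set of points.\<close>

definition affine_algebra :: "'l::field set \<Rightarrow> 'l set \<Rightarrow> 'l set \<Rightarrow> bool" where
  "affine_algebra K F A \<longleftrightarrow> (\<exists>S. finite S \<and> A = ring_adjoin K S) \<and> fraction_field A = F"

definition spec_points :: "'l::field set \<Rightarrow> 'l set set" where
  "spec_points A = {localization A I | I. prime_ideal A I}"

text \<open>The last conjunct is separatedness, by the valuative criterion.\<close>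

definition integral_scheme :: "'l::field set \<Rightarrow> 'l set \<Rightarrow> 'l set set \<Rightarrow> bool" where
  "integral_scheme K F C \<longleftrightarrow> subfield K \<and> subfield F \<and> K \<subseteq> F \<and>
     (\<exists>\<A>. finite \<A> \<and> \<A> \<noteq> {} \<and> (\<forall>A\<in>\<A>. affine_algebra K F A) \<and> C = (\<Union>A\<in>\<A>. spec_points A)) \<and>
     (\<forall>R\<in>C. \<forall>R'\<in>C. \<forall>V. valuation_ring F V \<and> dominates V R \<and> dominates V R' \<longrightarrow> R = R')"

definition integral_curve :: "'l::field set \<Rightarrow> 'l set \<Rightarrow> 'l set set \<Rightarrow> bool" where
  "integral_curve K F C \<longleftrightarrow> integral_scheme K F C \<and> transcendence_degree_one K F"

definition regular_scheme :: "'l::field set set \<Rightarrow> bool" where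
  "regular_scheme C \<longleftrightarrow> (\<forall>R\<in>C. regular_local_ring R)"

text \<open>\<open>C \<times>\<^sub>K Kbar\<close> is covered by the spectra of \<open>A \<otimes>\<^sub>K Kbar\<close>, for \<open>A\<close> the coordinate rings of
  the nonempty affine open subschemes of \<open>C\<close>.\<close>

definition geometrically_integral ::
    "'l::field set \<Rightarrow> 'l set \<Rightarrow> 'l set \<Rightarrow> 'l set set \<Rightarrow> bool" where
  "geometrically_integral K Kbar F C \<longleftrightarrow>
     (\<forall>A. affine_algebra K F A \<and> spec_points A \<subseteq> C \<longrightarrow> tensor_product_is_domain K A Kbar)"

text \<open>A point specializes to another one iff its local ring contains that of the other.\<close>

definition closed_point :: "'l::field set set \<Rightarrow> 'l set \<Rightarrow> bool" where
  "closed_point C P \<longleftrightarrow> P \<in> C \<and> (\<forall>R\<in>C. R \<subseteq> P \<longrightarrow> R = P)"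

definition point_over :: "'l::field set set \<Rightarrow> 'l set \<Rightarrow> 'l set" where
  "point_over X R = (THE S. S \<in> X \<and> dominates S R)"

text \<open>
  Let \<open>X \<rightarrow> Y\<close> be affine and let \<open>B\<close> be the pullback of \<open>X\<close> to the spectrum of the local ring \<open>R\<close>
  of a point of \<open>Y\<close>.  The points of \<open>X\<close> over that point are the primes of \<open>B\<close> over the maximal
  ideal of \<open>R\<close>.
\<close>

definition points_above :: "'l::field set \<Rightarrow> 'l set \<Rightarrow> 'l set set" where
  "points_above B R = {localization B I | I. prime_ideal B I \<and> I \<inter> R = nonunits R}"

text \<open>
  For a geometrically integral \<open>E\<close> over a separably closed field, \<open>R \<otimes> Kbar\<close> embeds into any common
  overfield of \<open>Kbar\<close> and the function field, so it can be replaced by the compositum; the function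
  field of \<open>E \<times> Kbar\<close> is the compositum of \<open>Kbar\<close> and the function field of \<open>E\<close>.
\<close>

definition base_change :: "'l::field set \<Rightarrow> 'l set set \<Rightarrow> 'l set set" where
  "base_change Kbar E = (\<Union>R\<in>E. points_above (ring_adjoin Kbar R) R)"

definition normalization :: "'l::field set set \<Rightarrow> 'l set set" where
  "normalization X = (\<Union>R\<in>X. points_above (integral_closure R) R)"

text \<open>
  The relative Frobenius is a homeomorphism from \<open>C\<close> onto its Frobenius twist, whose local ring at
  the image of the point \<open>R\<close> is \<open>R \<otimes> K\<close>, formed along the Frobenius of \<open>K\<close>.  For geometrically
  integral \<open>C\<close> the comorphism sending the class of \<open>(x, c)\<close> to \<open>c * x ^ p\<close> is injective, hence
  identifies this local ring with \<open>K[R\<^sup>p]\<close> and the function field of the twist with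
  \<open>K \<cdot> F\<^sup>p\<close>.
\<close>

definition frobenius_image :: "'l::field set \<Rightarrow> 'l set \<Rightarrow> 'l set" where
  "frobenius_image K R = ring_adjoin K ((\<lambda>x. x ^ CHAR('l)) ` R)"

definition frobenius_curve :: "'l::field set \<Rightarrow> 'l set set \<Rightarrow> 'l set set" where
  "frobenius_curve K C = frobenius_image K ` C"

definition normalized_frobenius_curve :: "'l::field set \<Rightarrow> 'l set set \<Rightarrow> 'l set set" where
  "normalized_frobenius_curve K C = normalization (frobenius_curve K C)"

definition normalized_frobenius_point :: "'l::field set \<Rightarrow> 'l set set \<Rightarrow> 'l set \<Rightarrow> 'l set" where
  "normalized_frobenius_point K C P =
     point_over (normalized_frobenius_curve K C) (frobenius_image K P)"


section \<open>Kaehler differentials and the differential degree\<close>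

text \<open>
  \<open>\<Omega>\<^bsub>B/k\<^esub>\<close> is the free \<open>B\<close>-module on symbols \<open>dx\<close> (\<open>x \<in> B\<close>), modulo the submodule generated by
  additivity, the Leibniz rule and \<open>dc = 0\<close> for \<open>c \<in> k\<close>.
\<close>

type_synonym 'l formal_differential = "'l \<Rightarrow>\<^sub>0 'l"

definition formal_d :: "'l::field \<Rightarrow> 'l formal_differential" where
  "formal_d x = Poly_Mapping.single x 1"

definition scale :: "'l::field \<Rightarrow> 'l formal_differential \<Rightarrow> 'l formal_differential" where
  "scale r u = Poly_Mapping.map (\<lambda>y. r * y) u"

definition formal_differentials :: "'l::field set \<Rightarrow> 'l formal_differential set" where
  "formal_differentials B = {u. Poly_Mapping.keys u \<subseteq> B \<and> (\<forall>x. Poly_Mapping.lookup u x \<in> B)}"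

definition submodule_generated ::
    "'l::field set \<Rightarrow> 'l formal_differential set \<Rightarrow> 'l formal_differential set" where
  "submodule_generated B G = group_closure {scale r g | r g. r \<in> B \<and> g \<in> G}"

definition kaehler_relations :: "'l::field set \<Rightarrow> 'l set \<Rightarrow> 'l formal_differential set" where
  "kaehler_relations k B =
     {formal_d (x + y) - formal_d x - formal_d y | x y. x \<in> B \<and> y \<in> B} \<union>
     {formal_d (x * y) - scale x (formal_d y) - scale y (formal_d x) | x y. x \<in> B \<and> y \<in> B} \<union>
     {formal_d c | c. c \<in> k}"

text \<open>\<open>dim\<^sub>k (M/N)\<close>, as the supremum of the sizes of the finite families in \<open>M\<close> that are linearly
  independent modulo \<open>N\<close>.\<close>

definition quotient_dim ::
    "'l::field set \<Rightarrow> 'l formal_differential set \<Rightarrow> 'l formal_differential set \<Rightarrow> enat" where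
  "quotient_dim k M N = Sup {enat n | n. \<exists>b :: nat \<Rightarrow> 'l formal_differential.
     (\<forall>i<n. b i \<in> M) \<and>
     (\<forall>c. (\<forall>i<n. c i \<in> k) \<and> (\<Sum>i<n. scale (c i) (b i)) \<in> N \<longrightarrow> (\<forall>i<n. c i = 0))}"

text \<open>
  The dimension of the cokernel of \<open>B \<Omega>\<^bsub>A/k\<^esub> \<rightarrow> \<Omega>\<^bsub>B/k\<^esub>\<close> for \<open>k \<subseteq> A \<subseteq> B\<close>: the quotient of
  \<open>\<Omega>\<^bsub>B/k\<^esub>\<close> by its \<open>B\<close>-submodule generated by all \<open>dx\<close> with \<open>x \<in> A\<close>.
\<close>

definition kaehler_coker_dim :: "'l::field set \<Rightarrow> 'l set \<Rightarrow> 'l set \<Rightarrow> enat" where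
  "kaehler_coker_dim k A B =
     quotient_dim k (formal_differentials B)
       (submodule_generated B (kaehler_relations k B \<union> formal_d ` A))"

definition differential_degree :: "'l::field set \<Rightarrow> 'l set set \<Rightarrow> 'l set \<Rightarrow> enat" where
  "differential_degree Kbar E Q =
     1 + kaehler_coker_dim Kbar
           (point_over (base_change Kbar E) Q)
           (point_over (normalization (base_change Kbar E)) Q)"


section \<open>The value semigroup\<close>

text \<open>The value at \<open>0\<close> and outside the field of fractions is fixed to \<open>0\<close>, just to make the
  valuation unique as a total function.\<close>

definition is_normalized_valuation :: "'l::field set \<Rightarrow> ('l \<Rightarrow> int) \<Rightarrow> bool" where
  "is_normalized_valuation V v \<longleftrightarrow>
     (\<forall>x\<in>fraction_field V - {0}. \<forall>y\<in>fraction_field V - {0}.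
        v (x * y) = v x + v y \<and> (x + y \<noteq> 0 \<longrightarrow> v (x + y) \<ge> min (v x) (v y))) \<and>
     v ` (fraction_field V - {0}) = UNIV \<and>
     V = {x \<in> fraction_field V. x = 0 \<or> v x \<ge> 0} \<and>
     (\<forall>x. x \<notin> fraction_field V - {0} \<longrightarrow> v x = 0)"

definition normalized_valuation :: "'l::field set \<Rightarrow> 'l \<Rightarrow> int" where
  "normalized_valuation V = (THE v. is_normalized_valuation V v)"

definition value_semigroup :: "'l::field set \<Rightarrow> 'l set set \<Rightarrow> 'l set \<Rightarrow> int set" where
  "value_semigroup Kbar C P =
     normalized_valuation (point_over (normalization (base_change Kbar C)) P) `
       (point_over (base_change Kbar C) P - {0})"

end

theory Submission
  imports Defs
begin

text \<open>
  Write \<open>p\<close> for the characteristic and \<open>k\<close> for the algebraic closure, which is purely inseparable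
  over \<open>K\<close>.  The local ring \<open>P\<close> is a discrete valuation ring of \<open>F\<close>; the points over it have the local
  rings \<open>A = k[P]\<close> and \<open>V = {x \<in> L. x ^ (p ^ n) \<in> P for some n}\<close>, where \<open>L = k F\<close>.  If \<open>t\<close> is a
  uniformizer of \<open>V\<close> then \<open>1, t, \<dots>, t ^ (p - 1)\<close> is a basis of \<open>L\<close> over \<open>L\<^sup>p\<close> whose terms have values
  that are distinct modulo \<open>p\<close>, and the differential degree is one more than the least value of
  \<open>da/dt\<close> for \<open>a \<in> A\<close>.

  On the Frobenius side \<open>F\<^sub>1 = K F\<^sup>p\<close>, \<open>P\<^sub>1 = P \<inter> F\<^sub>1\<close>, \<open>k F\<^sub>1 = L\<^sup>p\<close>, and differential degree one provides
  \<open>y \<in> A\<^sub>1 = k[P\<^sub>1]\<close> of value \<open>p\<close>.  Geometric integrality makes \<open>F\<close> and \<open>k\<close> linearly disjoint over \<open>K\<close>,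
  so that \<open>F\<close> has degree \<open>p\<close> over \<open>F\<^sub>1\<close>, and \<open>P = P\<^sub>1[x]\<close> for some \<open>x\<close>.  Subtracting from \<open>x\<close> a suitable
  element of \<open>A\<^sub>1\<close> makes its value \<open>s\<close> prime to \<open>p\<close>.  Then \<open>A = A\<^sub>1[x]\<close> has the value semigroup generated
  by \<open>s\<close> and \<open>p\<close>, and the least value of \<open>da/dt\<close> is \<open>s - 1\<close>.
\<close>

section \<open>Subrings and polynomials over them\<close>

text \<open>The engine is the derivation \<open>D\<close> = d/dt. As \<open>k\<close> is perfect,
  \<open>L\<close> has degree at most \<open>p\<close> over its \<open>p\<close>-th powers
  \<open>Lp\<close>, and these are exactly the constants of \<open>D\<close>. Since \<open>D\<close>
  lowers values by at most one, an element outside \<open>Lp\<close> cannot be approximated well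
  from \<open>Lp\<close>: v (x - l) \<le> v (D x) + 1. This bound is used twice. It excludes that
  \<open>P\<close> is immediate over P \<inter> F1, the one case without a visible generator of
  \<open>P\<close>. It also makes the correction of the generator \<open>x\<close> stop: a best
  approximation by elements of \<open>A1\<close> exists. There the value \<open>s\<close> is prime
  to \<open>p\<close>, for otherwise a constant times a power of \<open>y\<close>, the element of
  value \<open>p\<close>, would improve it. As \<open>A1\<close> lies in \<open>Lp\<close>, the
  terms of degree below \<open>p\<close> in the corrected generator have values distinct modulo
  \<open>p\<close>, which gives the semigroup; and D (h(x)) = h'(x) D x gives the degree. Geometric
  integrality is a statement about tensor products. It enters because the kernel of multiplication
  on A \<otimes> k is nil when \<open>k\<close> is purely inseparable over \<open>K\<close>, and a
  domain has no nilpotents; so A \<otimes> k embeds into \<open>L\<close>.\<close>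

lemma subring_1: "subring A \<Longrightarrow> 1 \<in> A"
  by (simp add: subring_def)

lemma subring_diff: "subring A \<Longrightarrow> x \<in> A \<Longrightarrow> y \<in> A \<Longrightarrow> x - y \<in> A"
  by (simp add: subring_def)

lemma subring_mult: "subring A \<Longrightarrow> x \<in> A \<Longrightarrow> y \<in> A \<Longrightarrow> x * y \<in> A"
  by (simp add: subring_def)

lemma subring_0: "subring A \<Longrightarrow> 0 \<in> A"
  using subring_diff[of A 1 1] subring_1 by force

lemma subring_uminus: "subring A \<Longrightarrow> x \<in> A \<Longrightarrow> - x \<in> A"
  using subring_diff[of A 0 x] subring_0 by force

lemma subring_add: "subring A \<Longrightarrow> x \<in> A \<Longrightarrow> y \<in> A \<Longrightarrow> x + y \<in> A"
  using subring_diff[of A x "- y"] subring_uminus by force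

lemma subring_power: "subring A \<Longrightarrow> x \<in> A \<Longrightarrow> x ^ n \<in> A"
  by (induction n) (auto intro: subring_1 subring_mult)

lemma subring_sum: "subring A \<Longrightarrow> (\<And>i. i \<in> I \<Longrightarrow> f i \<in> A) \<Longrightarrow> sum f I \<in> A"
  by (induction I rule: infinite_finite_induct) (auto intro: subring_0 subring_add)

lemma subring_of_nat: "subring A \<Longrightarrow> of_nat n \<in> A"
  by (induction n) (auto intro: subring_0 subring_1 subring_add)

lemma subring_of_int: "subring A \<Longrightarrow> of_int n \<in> A"
  by (cases n rule: int_cases2) (auto intro: subring_of_nat subring_uminus)

lemmas subring_closed = subring_0 subring_1 subring_diff subring_add subring_mult subring_uminus
  subring_power subring_sum subring_of_nat subring_of_int

lemma subfield_subring: "subfield A \<Longrightarrow> subring A"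
  by (simp add: subfield_def)

lemma subfield_inverse: "subfield A \<Longrightarrow> x \<in> A \<Longrightarrow> inverse x \<in> A"
  by (simp add: subfield_def)

lemma subfield_divide: "subfield A \<Longrightarrow> x \<in> A \<Longrightarrow> y \<in> A \<Longrightarrow> x / y \<in> A"
  by (simp add: divide_inverse subfield_inverse subfield_subring subring_mult)

lemma subfield_power_int: "subfield A \<Longrightarrow> x \<in> A \<Longrightarrow> x powi n \<in> A"
  by (simp add: power_int_def subfield_subring subring_power subfield_inverse)

lemma subringI:
  assumes "1 \<in> A" "\<And>x y. x \<in> A \<Longrightarrow> y \<in> A \<Longrightarrow> x - y \<in> A" "\<And>x y. x \<in> A \<Longrightarrow> y \<in> A \<Longrightarrow> x * y \<in> A"
  shows "subring A"
  using assms by (simp add: subring_def)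

lemma subring_Int: "subring A \<Longrightarrow> subring B \<Longrightarrow> subring (A \<inter> B)"
  by (auto simp: subring_def)

lemma subring_ring_adjoin: "subring (ring_adjoin k S)"
  unfolding ring_adjoin_def by (rule hull_in) (auto simp: subring_def)

lemma ring_adjoin_base: "k \<subseteq> ring_adjoin k S"
  unfolding ring_adjoin_def by (meson hull_subset le_sup_iff)

lemma ring_adjoin_gens: "S \<subseteq> ring_adjoin k S"
  unfolding ring_adjoin_def by (meson hull_subset le_sup_iff)

lemma ring_adjoin_least: "subring B \<Longrightarrow> k \<subseteq> B \<Longrightarrow> S \<subseteq> B \<Longrightarrow> ring_adjoin k S \<subseteq> B"
  unfolding ring_adjoin_def by (rule hull_minimal) auto

lemma ring_adjoin_mono: "k \<subseteq> k' \<Longrightarrow> S \<subseteq> S' \<Longrightarrow> ring_adjoin k S \<subseteq> ring_adjoin k' S'"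
  unfolding ring_adjoin_def by (rule hull_mono) auto

lemma fraction_field_superset: "subring A \<Longrightarrow> A \<subseteq> fraction_field A"
  unfolding fraction_field_def using subring_1 by force

lemma subfield_fraction_field:
  assumes A: "subring A"
  shows "subfield (fraction_field A)"
proof -
  have "x - y \<in> fraction_field A \<and> x * y \<in> fraction_field A"
    if "x \<in> fraction_field A" "y \<in> fraction_field A" for x y
  proof -
    obtain a b c d where *: "x = a / b" "y = c / d" "a \<in> A" "b \<in> A" "c \<in> A" "d \<in> A"
      using \<open>x \<in> _\<close> \<open>y \<in> _\<close> by (auto simp: fraction_field_def)
    have "x * y = (a * c) / (b * d)" by (simp add: *)
    moreover have "x - y \<in> fraction_field A"
    \<comment> \<open>Since x / 0 = 0, vanishing denominators are allowed in
      \<open>fraction_field\<close>; then one of \<open>x\<close>, \<open>y\<close> is 0.\<close>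
    proof (cases "b = 0 \<or> d = 0")
      case True
      then have "x - y = a / b \<or> x - y = - c / d" by (auto simp: *)
      moreover have "- c / d \<in> fraction_field A" "a / b \<in> fraction_field A"
        using * A subring_uminus unfolding fraction_field_def by blast+
      ultimately show ?thesis by metis
    next
      case False
      then have "x - y = (a * d - c * b) / (b * d)" by (simp add: * field_simps)
      then show ?thesis using * A by (auto simp: fraction_field_def intro!: subring_closed exI)
    qed
    ultimately show ?thesis using * A by (auto simp: fraction_field_def intro!: subring_closed exI)
  qed
  moreover have "inverse x \<in> fraction_field A" if "x \<in> fraction_field A" for x
    using that by (auto simp: fraction_field_def) (metis)
  moreover have "1 \<in> fraction_field A"
    using A fraction_field_superset subring_1 by blast
  ultimately show ?thesis by (auto simp: subfield_def subring_def)
qed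

lemma fraction_field_least: "subfield E \<Longrightarrow> A \<subseteq> E \<Longrightarrow> fraction_field A \<subseteq> E"
  by (auto simp: fraction_field_def intro: subfield_divide)

lemma fraction_field_mono: "A \<subseteq> B \<Longrightarrow> fraction_field A \<subseteq> fraction_field B"
  by (auto simp: fraction_field_def)

lemma fraction_field_subfield: "subfield E \<Longrightarrow> fraction_field E = E"
  by (meson fraction_field_least fraction_field_superset order_refl subfield_subring subset_antisym)

lemma valuation_ring_fraction_field:
  assumes "subfield F" "valuation_ring F V"
  shows "fraction_field V = F"
proof
  show "fraction_field V \<subseteq> F"
    using assms by (intro fraction_field_least) (auto simp: valuation_ring_def)
  show "F \<subseteq> fraction_field V"
  proof
    fix x assume "x \<in> F"
    then have "x \<in> V \<or> inverse x \<in> V" using assms by (simp add: valuation_ring_def)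
    moreover have "x = 1 / inverse x" by (simp add: field_simps)
    moreover have "1 \<in> V" "x = x / 1" using assms by (auto simp: valuation_ring_def subring_1)
    ultimately show "x \<in> fraction_field V" unfolding fraction_field_def by blast
  qed
qed

section \<open>Polynomials with coefficients in a subring\<close>

definition poly_over :: "'a::comm_ring_1 set \<Rightarrow> 'a poly set" where
  "poly_over A = {f. \<forall>i. coeff f i \<in> A}"

lemma poly_over_iff: "0 \<in> A \<Longrightarrow> f \<in> poly_over A \<longleftrightarrow> set (coeffs f) \<subseteq> A"
  unfolding poly_over_def using forall_coeffs_conv[of "\<lambda>x. x \<in> A" f] by auto

context
  fixes A :: "'l::field set"
  assumes A: "subring A"
begin

lemma poly_over_0: "0 \<in> poly_over A"
  and poly_over_1: "1 \<in> poly_over A"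
  and poly_over_const: "c \<in> A \<Longrightarrow> [:c:] \<in> poly_over A"
  and poly_over_monom: "c \<in> A \<Longrightarrow> monom c n \<in> poly_over A"
  and poly_over_add: "f \<in> poly_over A \<Longrightarrow> g \<in> poly_over A \<Longrightarrow> f + g \<in> poly_over A"
  and poly_over_diff: "f \<in> poly_over A \<Longrightarrow> g \<in> poly_over A \<Longrightarrow> f - g \<in> poly_over A"
  and poly_over_smult: "c \<in> A \<Longrightarrow> f \<in> poly_over A \<Longrightarrow> smult c f \<in> poly_over A"
  and poly_over_mult: "f \<in> poly_over A \<Longrightarrow> g \<in> poly_over A \<Longrightarrow> f * g \<in> poly_over A"
  and poly_over_pCons: "c \<in> A \<Longrightarrow> f \<in> poly_over A \<Longrightarrow> pCons c f \<in> poly_over A"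
  and poly_over_pderiv: "f \<in> poly_over A \<Longrightarrow> pderiv f \<in> poly_over A"
  using A by (auto simp: poly_over_def coeff_1 coeff_pCons coeff_mult coeff_pderiv
      split: nat.splits intro!: subring_closed[OF A] simp del: of_nat_Suc)

lemma poly_over_power: "f \<in> poly_over A \<Longrightarrow> f ^ n \<in> poly_over A"
  by (induction n) (auto intro: poly_over_1 poly_over_mult)

lemma poly_over_eval: "f \<in> poly_over A \<Longrightarrow> x \<in> A \<Longrightarrow> poly f x \<in> A"
  unfolding poly_altdef poly_over_def using A by (auto intro!: subring_closed[OF A])

end

lemma poly_over_mono: "A \<subseteq> B \<Longrightarrow> poly_over A \<subseteq> poly_over B"
  by (auto simp: poly_over_def)

text \<open>Long division: each step subtracts a monomial multiple of \<open>g\<close>, and no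
  inverse occurs because \<open>g\<close> is monic. Quotient and remainder are those of the ambient
  field, so all polynomial arithmetic can be done there.\<close>

lemma poly_over_divmod_monic:
  fixes A :: "'l::field set"
  assumes A: "subring A" and g: "g \<in> poly_over A" "lead_coeff g = 1"
  shows "f \<in> poly_over A \<Longrightarrow> f div g \<in> poly_over A \<and> f mod g \<in> poly_over A"
proof (induction "degree f" arbitrary: f rule: less_induct)
  case less
  have gn0: "g \<noteq> 0" using g by auto
  show ?case
  proof (cases "degree f < degree g \<or> f = 0")
    case True
    then show ?thesis using less.prems A by (auto simp: div_poly_less mod_poly_less poly_over_0)
  next
    case False
    define h where "h = monom (lead_coeff f) (degree f - degree g)"
    define f' where "f' = f - h * g"
    have h: "h \<in> poly_over A" unfolding h_def
      using less.prems A by (intro poly_over_monom) (auto simp: poly_over_def)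
    have f': "f' \<in> poly_over A" unfolding f'_def
      using less.prems A g h by (intro poly_over_diff poly_over_mult) auto
    have f: "f = h * g + f'" by (simp add: f'_def)
    have dh: "h \<noteq> 0" "degree h = degree f - degree g"
      using False by (auto simp: h_def degree_monom_eq monom_eq_0_iff)
    then have dm: "f div g = h + f' div g" "f mod g = f' mod g"
      using gn0 by (simp_all add: f)
    show ?thesis
    proof (cases "degree f' < degree f")
      case True
      then show ?thesis using less.hyps f' dm h A by (simp add: poly_over_add)
    next
      \<comment> \<open>The leading terms of \<open>f\<close> and \<open>h * g\<close> cancel, so
        the degree can fail to drop only if nothing is left.\<close>
      case nless: False
      have "degree (h * g) = degree f"
        using False gn0 dh by (simp add: degree_mult_eq)
      moreover have "lead_coeff (h * g) = lead_coeff f"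
        using g dh(2) by (simp add: lead_coeff_mult) (simp add: h_def)
      ultimately have "degree f' \<le> degree f" "coeff f' (degree f) = 0"
        unfolding f'_def using degree_diff_le[of f "degree f" "h * g"] by (auto simp del: coeff_mult)
      with nless have "f' = 0" by (metis le_antisym leading_coeff_0_iff not_le_imp_less)
      then show ?thesis using dm h A by (simp add: poly_over_0)
    qed
  qed
qed

lemma poly_over_divmod:
  fixes A :: "'l::field set"
  assumes A: "subfield A" and g: "g \<in> poly_over A" and f: "f \<in> poly_over A"
  shows "f div g \<in> poly_over A" "f mod g \<in> poly_over A"
proof -
  note sA = subfield_subring[OF A]
  have "f div g \<in> poly_over A \<and> f mod g \<in> poly_over A"
  proof (cases "g = 0")
    case True
    then show ?thesis using f sA by (simp add: poly_over_0)
  next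
    case False
    define c where "c = lead_coeff g"
    have c: "c \<noteq> 0" "c \<in> A" using False g by (auto simp: c_def poly_over_def)
    then have ic: "inverse c \<in> A" using A subfield_inverse by blast
    define g' where "g' = smult (inverse c) g"
    have g': "g' \<in> poly_over A" "lead_coeff g' = 1"
      using c ic g sA by (auto simp: g'_def poly_over_smult c_def[symmetric])
    have "g = smult c g'" using c by (simp add: g'_def)
    then show ?thesis
      using poly_over_divmod_monic[OF sA g' f] c ic sA
      by (simp add: div_smult_right mod_smult_right poly_over_smult)
  qed
  then show "f div g \<in> poly_over A" "f mod g \<in> poly_over A" by auto
qed

text \<open>The Euclidean algorithm never leaves \<open>A\<close>. The cofactors merely transfer
  common divisors and common roots to \<open>d\<close>, so they may be any polynomials. The measure
  separates \<open>g = 0\<close> from nonzero constants.\<close>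

lemma poly_over_bezout:
  fixes A :: "'l::field set"
  assumes A: "subfield A"
  shows "f \<in> poly_over A \<Longrightarrow> g \<in> poly_over A \<Longrightarrow>
    \<exists>d\<in>poly_over A. d dvd f \<and> d dvd g \<and> (\<exists>a b. d = a * f + b * g)"
proof (induction "if g = 0 then 0 else Suc (degree g)" arbitrary: f g rule: less_induct)
  case less
  show ?case
  proof (cases "g = 0")
    case True
    then have "f dvd f \<and> f dvd g \<and> f = 1 * f + 0 * g" by simp
    then show ?thesis using less.prems by metis
  next
    case False
    then have "(if f mod g = 0 then 0 else Suc (degree (f mod g))) < (if g = 0 then 0 else Suc (degree g))"
      using degree_mod_less'[of g f] by auto
    then obtain d a b where d: "d \<in> poly_over A" "d dvd g" "d dvd f mod g" "d = a * g + b * (f mod g)"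
      using less.hyps[of "f mod g" g] less.prems poly_over_divmod[OF A] by blast
    then have "d dvd f" by (metis dvd_mod_iff)
    moreover have "d = b * f + (a - b * (f div g)) * g"
      unfolding d(4) by (simp add: minus_mult_div_eq_mod[symmetric] algebra_simps)
    ultimately show ?thesis using d by blast
  qed
qed

section \<open>Linear algebra over a subfield\<close>

text \<open>Gaussian elimination by cross-multiplication instead of division, so that the solution
  stays in a mere subring.\<close>

lemma homogeneous_system:
  fixes a :: "'i \<Rightarrow> 'j \<Rightarrow> 'l::field"
  assumes M: "subring M"
  shows "finite J \<Longrightarrow> finite I \<Longrightarrow> card J < card I \<Longrightarrow> (\<And>i j. i \<in> I \<Longrightarrow> j \<in> J \<Longrightarrow> a i j \<in> M) \<Longrightarrow>
    \<exists>c. (\<forall>i\<in>I. c i \<in> M) \<and> (\<exists>i\<in>I. c i \<noteq> 0) \<and> (\<forall>j\<in>J. (\<Sum>i\<in>I. c i * a i j) = 0)"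
proof (induction J arbitrary: I a rule: finite_induct)
  case empty
  then obtain i where "i \<in> I" by fastforce
  then show ?case using subring_1[OF M] by (intro exI[of _ "\<lambda>_. 1"]) auto
next
  case (insert k J)
  show ?case
  proof (cases "\<forall>i\<in>I. a i k = 0")
    case True
    have "card J < card I" using insert by auto
    then obtain c where "(\<forall>i\<in>I. c i \<in> M) \<and> (\<exists>i\<in>I. c i \<noteq> 0) \<and> (\<forall>j\<in>J. (\<Sum>i\<in>I. c i * a i j) = 0)"
      using insert.IH[of I a] insert.prems by auto
    then show ?thesis using True by (intro exI[of _ c]) (auto intro!: sum.neutral)
  next
    case False
    then obtain r where r: "r \<in> I" "a r k \<noteq> 0" by blast
    define I' where "I' = I - {r}"
    define a' where "a' i j = a r k * a i j - a i k * a r j" for i j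
    have "card J < card I'" using insert r by (auto simp: I'_def)
    moreover have "a' i j \<in> M" if "i \<in> I'" "j \<in> J" for i j
      unfolding a'_def using that r insert.prems M I'_def by (intro subring_diff subring_mult) auto
    ultimately obtain c where c: "\<forall>i\<in>I'. c i \<in> M" "\<exists>i\<in>I'. c i \<noteq> 0"
      "\<forall>j\<in>J. (\<Sum>i\<in>I'. c i * a' i j) = 0"
      using insert.IH[of I' a'] insert.prems I'_def by auto
    \<comment> \<open>Back substitution: scaling the other unknowns by the pivot
      \<open>a r k\<close> lets the unknown \<open>r\<close> be found inside
      \<open>M\<close>.\<close>
    define d where "d i = (if i = r then - (\<Sum>i\<in>I'. c i * a i k) else c i * a r k)" for i
    have eq: "(\<Sum>i\<in>I. d i * a i j) = (\<Sum>i\<in>I'. c i * a' i j)" for j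
    proof -
      have "(\<Sum>i\<in>I. d i * a i j) = d r * a r j + (\<Sum>i\<in>I'. d i * a i j)"
        using r insert.prems by (simp add: I'_def sum.remove)
      also have "(\<Sum>i\<in>I'. d i * a i j) = (\<Sum>i\<in>I'. c i * a r k * a i j)"
        by (intro sum.cong) (auto simp: d_def I'_def)
      finally show ?thesis
        by (simp add: d_def a'_def sum_distrib_left sum_distrib_right sum_subtractf algebra_simps)
    qed
    have "a' i k = 0" for i by (simp add: a'_def)
    then have "(\<Sum>i\<in>I. d i * a i j) = 0" if "j \<in> insert k J" for j
      using that c eq by auto
    moreover have "d i \<in> M" if "i \<in> I" for i
      using that c r insert.prems M unfolding d_def I'_def
      by (auto intro!: subring_uminus subring_sum subring_mult)
    moreover have "\<exists>i\<in>I. d i \<noteq> 0"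
    proof -
      obtain i where "i \<in> I'" "c i \<noteq> 0" using c by blast
      then show ?thesis using r by (intro bexI[of _ i]) (auto simp: d_def I'_def)
    qed
    ultimately show ?thesis by blast
  qed
qed

definition lin_span :: "'l::field set \<Rightarrow> 'l set \<Rightarrow> 'l set" where
  "lin_span M B = {\<Sum>b\<in>B. a b * b | a. \<forall>b\<in>B. a b \<in> M}"

definition lin_indep :: "'l::field set \<Rightarrow> 'l set \<Rightarrow> bool" where
  "lin_indep M B \<longleftrightarrow>
     finite B \<and> (\<forall>a. (\<forall>b\<in>B. a b \<in> M) \<and> (\<Sum>b\<in>B. a b * b) = 0 \<longrightarrow> (\<forall>b\<in>B. a b = 0))"

lemma lin_spanI: "(\<And>b. b \<in> B \<Longrightarrow> a b \<in> M) \<Longrightarrow> (\<Sum>b\<in>B. a b * b) \<in> lin_span M B"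
  unfolding lin_span_def by blast

lemma lin_spanE:
  assumes "x \<in> lin_span M B"
  obtains a where "\<And>b. b \<in> B \<Longrightarrow> a b \<in> M" "x = (\<Sum>b\<in>B. a b * b)"
  using assms unfolding lin_span_def by blast

lemma lin_indepD:
  "lin_indep M B \<Longrightarrow> (\<And>b. b \<in> B \<Longrightarrow> a b \<in> M) \<Longrightarrow> (\<Sum>b\<in>B. a b * b) = 0 \<Longrightarrow> b \<in> B \<Longrightarrow> a b = 0"
  by (simp add: lin_indep_def)

context
  fixes M :: "'l::field set"
  assumes M: "subring M"
begin

lemma lin_span_add:
  assumes "x \<in> lin_span M B" "y \<in> lin_span M B"
  shows "x + y \<in> lin_span M B"
proof -
  obtain a c where a: "\<And>b. b \<in> B \<Longrightarrow> a b \<in> M" "x = (\<Sum>b\<in>B. a b * b)"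
    and c: "\<And>b. b \<in> B \<Longrightarrow> c b \<in> M" "y = (\<Sum>b\<in>B. c b * b)"
    using assms by (auto elim!: lin_spanE)
  have "x + y = (\<Sum>b\<in>B. (a b + c b) * b)" by (simp add: a c sum.distrib algebra_simps)
  also have "\<dots> \<in> lin_span M B" using a c subring_add[OF M] by (intro lin_spanI) auto
  finally show ?thesis .
qed

lemma lin_span_smult:
  assumes "x \<in> lin_span M B" "c \<in> M"
  shows "c * x \<in> lin_span M B"
proof -
  obtain a where a: "\<And>b. b \<in> B \<Longrightarrow> a b \<in> M" "x = (\<Sum>b\<in>B. a b * b)"
    using assms by (auto elim!: lin_spanE)
  have "c * x = (\<Sum>b\<in>B. (c * a b) * b)" by (simp add: a sum_distrib_left algebra_simps)
  also have "\<dots> \<in> lin_span M B" using a assms subring_mult[OF M] by (intro lin_spanI) auto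
  finally show ?thesis .
qed

lemma lin_span_0: "0 \<in> lin_span M B"
proof -
  have "(\<Sum>b\<in>B. 0 * b) \<in> lin_span M B" using subring_0[OF M] by (intro lin_spanI)
  then show ?thesis by simp
qed

lemma lin_span_sum: "(\<And>i. i \<in> I \<Longrightarrow> f i \<in> lin_span M B) \<Longrightarrow> sum f I \<in> lin_span M B"
  by (induction I rule: infinite_finite_induct) (auto intro: lin_span_0 lin_span_add)

lemma lin_span_base:
  assumes "finite B" "b \<in> B"
  shows "b \<in> lin_span M B"
proof -
  have "(\<Sum>c\<in>B. (if c = b then 1 else 0) * c) \<in> lin_span M B"
    using subring_0[OF M] subring_1[OF M] by (intro lin_spanI) auto
  also have "(\<Sum>c\<in>B. (if c = b then 1 else 0) * c) = (\<Sum>c\<in>B. if c = b then c else 0)"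
    by (intro sum.cong) auto
  finally show ?thesis using assms by simp
qed

lemma lin_span_mult_right:
  assumes "x \<in> lin_span M B" "\<And>b. b \<in> B \<Longrightarrow> b * s \<in> lin_span M B'"
  shows "x * s \<in> lin_span M B'"
proof -
  obtain a where a: "\<And>b. b \<in> B \<Longrightarrow> a b \<in> M" "x = (\<Sum>b\<in>B. a b * b)"
    using assms by (auto elim!: lin_spanE)
  have "x * s = (\<Sum>b\<in>B. a b * (b * s))" by (simp add: a sum_distrib_right mult.assoc)
  then show ?thesis using a assms(2) by (simp add: lin_span_sum lin_span_smult)
qed

text \<open>The coordinates form a homogeneous system with fewer equations than unknowns. The
  vectors form a family over \<open>I\<close>, so repetitions count, as they must for the powers of
  an element.\<close>

lemma lin_span_dependent:
  assumes "finite B" "finite I" "card B < card I" "\<And>i. i \<in> I \<Longrightarrow> f i \<in> lin_span M B"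
  shows "\<exists>c. (\<forall>i\<in>I. c i \<in> M) \<and> (\<exists>i\<in>I. c i \<noteq> 0) \<and> (\<Sum>i\<in>I. c i * f i) = 0"
proof -
  have "\<forall>i\<in>I. \<exists>a. (\<forall>b\<in>B. a b \<in> M) \<and> f i = (\<Sum>b\<in>B. a b * b)"
    using assms(4) unfolding lin_span_def by blast
  then obtain a where "\<forall>i\<in>I. (\<forall>b\<in>B. a i b \<in> M) \<and> f i = (\<Sum>b\<in>B. a i b * b)"
    by (rule bchoice[THEN exE])
  then have a: "\<And>i b. i \<in> I \<Longrightarrow> b \<in> B \<Longrightarrow> a i b \<in> M" "\<And>i. i \<in> I \<Longrightarrow> f i = (\<Sum>b\<in>B. a i b * b)"
    by auto
  obtain c where c: "\<forall>i\<in>I. c i \<in> M" "\<exists>i\<in>I. c i \<noteq> 0" "\<forall>b\<in>B. (\<Sum>i\<in>I. c i * a i b) = 0"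
    using homogeneous_system[OF M assms(1-3), of a] a by blast
  have "(\<Sum>i\<in>I. c i * f i) = (\<Sum>i\<in>I. \<Sum>b\<in>B. c i * a i b * b)"
    by (simp add: a sum_distrib_left mult.assoc)
  also have "\<dots> = (\<Sum>b\<in>B. (\<Sum>i\<in>I. c i * a i b) * b)"
    by (subst sum.swap) (simp add: sum_distrib_right)
  also have "\<dots> = 0" using c by simp
  finally show ?thesis using c by blast
qed

lemma powers_dependent:
  assumes "finite B" "\<And>i. x ^ i \<in> lin_span M B"
  obtains f where "f \<in> poly_over M" "f \<noteq> 0" "degree f \<le> card B" "poly f x = 0"
proof -
  obtain c where c: "\<forall>i\<in>{..card B}. c i \<in> M" "\<exists>i\<in>{..card B}. c i \<noteq> 0"
    "(\<Sum>i\<in>{..card B}. c i * x ^ i) = 0"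
    using lin_span_dependent[OF assms(1), of "{..card B}" "\<lambda>i. x ^ i"] assms(2) by auto
  define f where "f = (\<Sum>i\<le>card B. monom (c i) i)"
  have coeff: "coeff f i = (if i \<le> card B then c i else 0)" for i
    by (simp add: f_def coeff_sum coeff_monom)
  have "f \<in> poly_over M" using c subring_0[OF M] by (auto simp: poly_over_def coeff)
  moreover have "f \<noteq> 0" using c coeff by (metis atMost_iff coeff_0)
  moreover have "degree f \<le> card B" by (rule degree_le) (auto simp: coeff)
  moreover have "poly f x = 0" using c by (simp add: f_def poly_sum poly_monom)
  ultimately show ?thesis using that by blast
qed

end

lemma algebraic_over_iff:
  "subring k \<Longrightarrow> algebraic_over k x \<longleftrightarrow> (\<exists>f\<in>poly_over k. f \<noteq> 0 \<and> poly f x = 0)"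
  unfolding algebraic_over_def using poly_over_iff[OF subring_0] by blast

lemma algebraic_over_mono: "k \<subseteq> k' \<Longrightarrow> algebraic_over k x \<Longrightarrow> algebraic_over k' x"
  unfolding algebraic_over_def by blast

text \<open>Cancel factors \<open>x\<close> until the constant term \<open>c\<close> is nonzero;
  then c + x h(x) = 0 gives the inverse -h(x)/c.\<close>

lemma poly_over_inverse:
  fixes M :: "'l::field set"
  assumes M: "subfield M"
  shows "f \<in> poly_over M \<Longrightarrow> f \<noteq> 0 \<Longrightarrow> poly f x = 0 \<Longrightarrow> x \<noteq> 0 \<Longrightarrow> \<exists>g\<in>poly_over M. inverse x = poly g x"
proof (induction f)
  case (pCons c h)
  have h: "h \<in> poly_over M" "c \<in> M"
    using pCons.prems(1) unfolding poly_over_def by (auto simp: coeff_pCons split: nat.splits)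
  show ?case
  proof (cases "c = 0")
    case True
    then show ?thesis using pCons h by auto
  next
    case False
    then have "inverse x = poly (smult (- inverse c) h) x"
      using pCons.prems by (simp add: field_simps eq_neg_iff_add_eq_0)
    moreover have "smult (- inverse c) h \<in> poly_over M"
      using h M by (intro poly_over_smult) (auto intro: subfield_subring subring_uminus subfield_inverse)
    ultimately show ?thesis by blast
  qed
qed simp

text \<open>Each nonzero element of a finite-dimensional domain is algebraic, and its inverse is a
  polynomial in it.\<close>

lemma subfield_of_finite_span:
  assumes M: "subfield M" and E: "subring E" "M \<subseteq> E" and B: "finite B" "E \<subseteq> lin_span M B"
  shows "subfield E"
  unfolding subfield_def
proof (intro conjI ballI E)
  fix x assume x: "x \<in> E"
  show "inverse x \<in> E"
  proof (cases "x = 0")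
    case True
    then show ?thesis using E subring_0 by simp
  next
    case False
    have "x ^ i \<in> lin_span M B" for i using x E B subring_power by blast
    then obtain f where "f \<in> poly_over M" "f \<noteq> 0" "poly f x = 0"
      using powers_dependent[OF subfield_subring[OF M] B(1)] by metis
    then obtain g where "g \<in> poly_over M" "inverse x = poly g x"
      using poly_over_inverse[OF M] False by blast
    then show ?thesis using poly_over_eval[OF E(1) _ x] poly_over_mono[OF E(2)] by auto
  qed
qed

lemma algebraic_over_of_finite_span:
  assumes M: "subring M" and E: "subring E" and B: "finite B" "E \<subseteq> lin_span M B" and x: "x \<in> E"
  shows "algebraic_over M x"
proof -
  have "x ^ i \<in> lin_span M B" for i using x E B subring_power by blast
  then show ?thesis
    using powers_dependent[OF M B(1)] algebraic_over_iff[OF M] by metis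
qed

lemma ring_adjoin_singleton:
  assumes E: "subring E"
  shows "ring_adjoin E {s} = {poly f s | f. f \<in> poly_over E}"
proof
  have "subring {poly f s | f. f \<in> poly_over E}"
  proof (rule subringI)
    show "1 \<in> {poly f s | f. f \<in> poly_over E}"
      using poly_over_1[OF E] by (metis (mono_tags, lifting) mem_Collect_eq poly_1)
  next
    fix x y assume "x \<in> {poly f s | f. f \<in> poly_over E}" "y \<in> {poly f s | f. f \<in> poly_over E}"
    then obtain f g where "f \<in> poly_over E" "g \<in> poly_over E" "x = poly f s" "y = poly g s" by blast
    then show "x - y \<in> {poly f s | f. f \<in> poly_over E}" "x * y \<in> {poly f s | f. f \<in> poly_over E}"
      using poly_over_diff[OF E, of f g] poly_over_mult[OF E, of f g]
      by (metis (mono_tags, lifting) mem_Collect_eq poly_diff poly_mult)+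
  qed
  moreover have "E \<subseteq> {poly f s | f. f \<in> poly_over E}"
  proof
    fix c assume "c \<in> E"
    then have "[:c:] \<in> poly_over E" "poly [:c:] s = c" by (auto simp: poly_over_const[OF E])
    then show "c \<in> {poly f s | f. f \<in> poly_over E}" by (metis (mono_tags, lifting) mem_Collect_eq)
  qed
  moreover have "s \<in> {poly f s | f. f \<in> poly_over E}"
  proof -
    have "[:0, 1:] \<in> poly_over E" "poly [:0, 1:] s = s"
      by (auto intro!: poly_over_pCons[OF E] poly_over_0[OF E] simp: subring_0[OF E] subring_1[OF E])
    then show ?thesis by (metis (mono_tags, lifting) mem_Collect_eq)
  qed
  ultimately show "ring_adjoin E {s} \<subseteq> {poly f s | f. f \<in> poly_over E}"
    by (intro ring_adjoin_least) auto
  have "f \<in> poly_over (ring_adjoin E {s})" if "f \<in> poly_over E" for f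
    using that poly_over_mono[OF ring_adjoin_base] by blast
  then show "{poly f s | f. f \<in> poly_over E} \<subseteq> ring_adjoin E {s}"
    using poly_over_eval[OF subring_ring_adjoin] ring_adjoin_gens by blast
qed

text \<open>Division by the monic \<open>g\<close> bounds the powers of \<open>s\<close> that occur;
  their products with the old generators suffice.\<close>

lemma finite_span_adjoin:
  assumes M: "subring M" and E: "subring E" and B: "finite B" "E \<subseteq> lin_span M B"
    and g: "g \<in> poly_over E" "lead_coeff g = 1" "poly g s = 0"
  obtains B' where "finite B'" "ring_adjoin E {s} \<subseteq> lin_span M B'"
proof -
  define B' where "B' = (\<lambda>(b, i). b * s ^ i) ` (B \<times> {..degree g})"
  have fB': "finite B'" using B by (simp add: B'_def)
  have *: "e * s ^ i \<in> lin_span M B'" if "e \<in> E" "i \<le> degree g" for e i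
  proof (rule lin_span_mult_right[OF M])
    show "e \<in> lin_span M B" using that B by blast
    show "b * s ^ i \<in> lin_span M B'" if "b \<in> B" for b
      using that \<open>i \<le> degree g\<close> by (intro lin_span_base[OF M fB']) (auto simp: B'_def)
  qed
  have "poly f s \<in> lin_span M B'" if f: "f \<in> poly_over E" for f
  proof -
    have r: "f mod g \<in> poly_over E" using poly_over_divmod_monic[OF E g(1,2) f] by simp
    have "poly f s = poly (f div g) s * poly g s + poly (f mod g) s"
      by (metis div_mult_mod_eq poly_add poly_mult)
    also have "\<dots> = poly (f mod g) s" using g by simp
    also have "\<dots> = (\<Sum>i\<le>degree (f mod g). coeff (f mod g) i * s ^ i)" by (rule poly_altdef)
    also have "\<dots> \<in> lin_span M B'"
    proof (intro lin_span_sum[OF M] *)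
      have "g \<noteq> 0" using g by auto
      then have "degree (f mod g) \<le> degree g"
        using degree_mod_less[of g f] by fastforce
      then show "i \<le> degree g" if "i \<in> {..degree (f mod g)}" for i using that by auto
    qed (use r in \<open>auto simp: poly_over_def\<close>)
    finally show ?thesis .
  qed
  then have "ring_adjoin E {s} \<subseteq> lin_span M B'"
    unfolding ring_adjoin_singleton[OF E] by auto
  then show ?thesis by (rule that[OF fB'])
qed

lemma algebraic_over_monic:
  assumes M: "subfield M" and x: "algebraic_over M x"
  obtains g where "g \<in> poly_over M" "lead_coeff g = 1" "poly g x = 0"
proof -
  note sM = subfield_subring[OF M]
  obtain f where f: "f \<in> poly_over M" "f \<noteq> 0" "poly f x = 0"
    using x algebraic_over_iff[OF sM] by blast
  then have "inverse (lead_coeff f) \<in> M" using M by (auto simp: poly_over_def intro: subfield_inverse)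
  then have "smult (inverse (lead_coeff f)) f \<in> poly_over M" using f poly_over_smult[OF sM] by blast
  then show ?thesis using that[of "smult (inverse (lead_coeff f)) f"] f by simp
qed

lemma finite_span_adjoin_algebraic:
  assumes M: "subfield M"
  shows "finite S \<Longrightarrow> (\<And>s. s \<in> S \<Longrightarrow> algebraic_over M s) \<Longrightarrow>
    \<exists>B. finite B \<and> ring_adjoin M S \<subseteq> lin_span M B"
proof (induction S rule: finite_induct)
  case empty
  have "ring_adjoin M {} \<subseteq> M" using subfield_subring[OF M] by (intro ring_adjoin_least) auto
  moreover have "M \<subseteq> lin_span M {1}" unfolding lin_span_def by force
  ultimately show ?case by blast
next
  case (insert s S)
  then obtain B where B: "finite B" "ring_adjoin M S \<subseteq> lin_span M B" by auto
  obtain g where g: "g \<in> poly_over M" "lead_coeff g = 1" "poly g s = 0"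
    using algebraic_over_monic[OF M] insert by blast
  have "g \<in> poly_over (ring_adjoin M S)" using g poly_over_mono[OF ring_adjoin_base] by blast
  then obtain B' where B': "finite B'" "ring_adjoin (ring_adjoin M S) {s} \<subseteq> lin_span M B'"
    using finite_span_adjoin[OF subfield_subring[OF M] subring_ring_adjoin B] g by blast
  have "ring_adjoin M (insert s S) \<subseteq> ring_adjoin (ring_adjoin M S) {s}"
  proof (intro ring_adjoin_least subring_ring_adjoin)
    have *: "ring_adjoin M S \<subseteq> ring_adjoin (ring_adjoin M S) {s}" by (rule ring_adjoin_base)
    show "M \<subseteq> ring_adjoin (ring_adjoin M S) {s}" using * ring_adjoin_base by (rule order_trans[rotated])
    have "S \<subseteq> ring_adjoin (ring_adjoin M S) {s}" using * ring_adjoin_gens by (rule order_trans[rotated])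
    then show "insert s S \<subseteq> ring_adjoin (ring_adjoin M S) {s}" using ring_adjoin_gens[of "{s}"] by simp
  qed
  then show ?case using B' by (meson order_trans)
qed

text \<open>Finite spans compose: M[S] is a field with a finite span over \<open>M\<close>, hence so
  has M[S][x], and its elements are algebraic over \<open>M\<close>.\<close>

lemma algebraic_over_trans:
  assumes M: "subfield M" and S: "finite S" "\<And>s. s \<in> S \<Longrightarrow> algebraic_over M s"
    and x: "algebraic_over (ring_adjoin M S) x"
  shows "algebraic_over M x"
proof -
  note sM = subfield_subring[OF M]
  obtain B where B: "finite B" "ring_adjoin M S \<subseteq> lin_span M B"
    using finite_span_adjoin_algebraic[OF M S] by blast
  have E: "subfield (ring_adjoin M S)"
    using subfield_of_finite_span[OF M subring_ring_adjoin ring_adjoin_base B] .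
  obtain g where g: "g \<in> poly_over (ring_adjoin M S)" "lead_coeff g = 1" "poly g x = 0"
    using algebraic_over_monic[OF E x] .
  obtain B' where B': "finite B'" "ring_adjoin (ring_adjoin M S) {x} \<subseteq> lin_span M B'"
    using finite_span_adjoin[OF sM subring_ring_adjoin B g] .
  show ?thesis
    using algebraic_over_of_finite_span[OF sM subring_ring_adjoin B'] ring_adjoin_gens by blast
qed

text \<open>Take an independent set between \<open>B0\<close> and \<open>E\<close> of greatest
  cardinality, which \<open>card B\<close> bounds; a vector outside its span could be added.\<close>

lemma extend_to_basis:
  assumes M: "subfield M" and B: "finite B" "E \<subseteq> lin_span M B"
    and B0: "lin_indep M B0" "B0 \<subseteq> E"
  obtains B' where "lin_indep M B'" "B0 \<subseteq> B'" "B' \<subseteq> E" "E \<subseteq> lin_span M B'"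
proof -
  note sM = subfield_subring[OF M]
  define P where "P B' \<longleftrightarrow> lin_indep M B' \<and> B0 \<subseteq> B' \<and> B' \<subseteq> E" for B'
  have bound: "card B' < Suc (card B)" if "P B'" for B'
  proof (rule ccontr)
    assume "\<not> ?thesis"
    then have "card B < card B'" by simp
    moreover have "finite B'" "\<And>b. b \<in> B' \<Longrightarrow> b \<in> lin_span M B"
      using that B by (auto simp: P_def lin_indep_def)
    ultimately obtain c where "\<forall>b\<in>B'. c b \<in> M" "\<exists>b\<in>B'. c b \<noteq> 0" "(\<Sum>b\<in>B'. c b * b) = 0"
      using lin_span_dependent[OF sM B(1), of B' "\<lambda>b. b"] by blast
    then show False using that unfolding P_def lin_indep_def by blast
  qed
  have "P B0" using B0 by (simp add: P_def)
  then obtain B' where B': "P B'" "\<And>B''. P B'' \<Longrightarrow> card B'' \<le> card B'"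
    using ex_has_greatest_nat[of P B0 card "Suc (card B)"] bound by (metis less_imp_le)
  have fB': "finite B'" and ind: "lin_indep M B'" using B' by (auto simp: P_def lin_indep_def)
  have "x \<in> lin_span M B'" if x: "x \<in> E" for x
  proof (cases "x \<in> B'")
    case True
    then show ?thesis using lin_span_base[OF sM fB'] by blast
  next
    case False
    have "\<not> P (insert x B')" using B'(2)[of "insert x B'"] False fB' by auto
    then have "\<not> lin_indep M (insert x B')" using x B' by (auto simp: P_def)
    then obtain a where a: "\<forall>b\<in>insert x B'. a b \<in> M" "(\<Sum>b\<in>insert x B'. a b * b) = 0"
      "\<exists>b\<in>insert x B'. a b \<noteq> 0" using fB' by (auto simp: lin_indep_def)
    have eq: "a x * x + (\<Sum>b\<in>B'. a b * b) = 0" using a False fB' by simp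
    have "a x \<noteq> 0"
    proof
      assume "a x = 0"
      then show False using eq a ind unfolding lin_indep_def by auto
    qed
    then have "x = - inverse (a x) * (\<Sum>b\<in>B'. a b * b)"
      using eq by (simp add: field_simps eq_neg_iff_add_eq_0)
    moreover have "- inverse (a x) \<in> M" using a M subfield_inverse subring_uminus[OF sM] by blast
    ultimately show ?thesis
      using lin_span_smult[OF sM lin_spanI] a by (metis insertCI)
  qed
  then have "E \<subseteq> lin_span M B'" by auto
  then show ?thesis using that[of B'] B'(1) by (simp add: P_def)
qed

lemma lin_indep_unique:
  assumes M: "subring M" and B: "lin_indep M B"
    and a: "\<And>b. b \<in> B \<Longrightarrow> a b \<in> M" "\<And>b. b \<in> B \<Longrightarrow> c b \<in> M" "(\<Sum>b\<in>B. a b * b) = (\<Sum>b\<in>B. c b * b)"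
    and b: "b \<in> B"
  shows "a b = c b"
proof -
  have sum: "(\<Sum>b\<in>B. (a b - c b) * b) = 0" using a(3) by (simp add: left_diff_distrib sum_subtractf)
  have "a b - c b \<in> M" if "b \<in> B" for b
    using subring_diff[OF M a(1)[OF that] a(2)[OF that]] .
  from lin_indepD[OF B this sum b] show ?thesis by simp
qed

section \<open>Function fields of transcendence degree one\<close>

lemma common_denominator:
  assumes A: "subring A"
  shows "finite I \<Longrightarrow> (\<And>i. i \<in> I \<Longrightarrow> f i \<in> fraction_field A) \<Longrightarrow>
    \<exists>d\<in>A. d \<noteq> 0 \<and> (\<forall>i\<in>I. d * f i \<in> A)"
proof (induction I rule: finite_induct)
  case empty
  then show ?case using subring_1[OF A] by (intro bexI[of _ 1]) auto
next
  case (insert i I)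
  then obtain d where d: "d \<in> A" "d \<noteq> 0" "\<And>i. i \<in> I \<Longrightarrow> d * f i \<in> A" by auto
  have "\<exists>y\<in>A. y \<noteq> 0 \<and> y * f i \<in> A"
  proof -
    obtain x y where xy: "f i = x / y" "x \<in> A" "y \<in> A"
      using insert.prems[of i] unfolding fraction_field_def by blast
    show ?thesis
    proof (cases "y = 0")
      case True
      then show ?thesis using xy subring_1[OF A] subring_0[OF A] by (intro bexI[of _ 1]) auto
    next
      case False
      then show ?thesis using xy by (intro bexI[of _ y]) auto
    qed
  qed
  then obtain y where y: "y \<in> A" "y \<noteq> 0" "y * f i \<in> A" by blast
  have "d * y * f j \<in> A" if "j \<in> insert i I" for j
  proof (cases "j = i")
    case True
    then show ?thesis using y d subring_mult[OF A, of d "y * f i"] by (simp add: mult.assoc)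
  next
    case False
    then have "d * f j \<in> A" using d that by auto
    then show ?thesis using subring_mult[OF A, of y "d * f j"] y by (simp add: ac_simps)
  qed
  then show ?case using d y subring_mult[OF A] by (intro bexI[of _ "d * y"]) auto
qed

lemma algebraic_over_fraction_field:
  assumes A: "subring A" and x: "algebraic_over (fraction_field A) x"
  obtains f where "f \<in> poly_over A" "f \<noteq> 0" "poly f x = 0"
proof -
  note sF = subfield_subring[OF subfield_fraction_field[OF A]]
  obtain f where f: "f \<in> poly_over (fraction_field A)" "f \<noteq> 0" "poly f x = 0"
    using x algebraic_over_iff[OF sF] by blast
  obtain d where d: "d \<in> A" "d \<noteq> 0" "\<And>i. i \<le> degree f \<Longrightarrow> d * coeff f i \<in> A"
    using common_denominator[OF A, of "{..degree f}" "coeff f"] f(1) by (auto simp: poly_over_def)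
  have "d * coeff f i \<in> A" for i
    using d(3)[of i] subring_0[OF A] by (cases "i \<le> degree f") (auto simp: coeff_eq_0)
  then have "smult d f \<in> poly_over A" by (auto simp: poly_over_def)
  then show ?thesis using that[of "smult d f"] d f by simp
qed

lemma poly_over_adjoin_coeffs:
  assumes K: "subring K" and f: "f \<in> poly_over (ring_adjoin K {t})"
  obtains h where "\<And>i. h i \<in> poly_over K" "\<And>i. coeff f i = poly (h i) t"
proof -
  have "\<forall>i. \<exists>h. h \<in> poly_over K \<and> coeff f i = poly h t"
    using f unfolding ring_adjoin_singleton[OF K] poly_over_def by blast
  then obtain h where "\<forall>i. h i \<in> poly_over K \<and> coeff f i = poly (h i) t"
    by (rule choice[THEN exE])
  then show ?thesis using that by blast
qed

text \<open>Clear denominators and reorder the relation by powers of \<open>t\<close>: the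
  coefficient of t^j is the polynomial \<open>g j\<close> at \<open>u\<close>. Not all of these
  vanish, because \<open>u\<close> is transcendental.\<close>

lemma algebraic_over_swap:
  assumes K: "subring K" and u: "\<not> algebraic_over K u"
    and alg: "algebraic_over (fraction_field (ring_adjoin K {t})) u"
  shows "algebraic_over (ring_adjoin K {u}) t"
proof -
  obtain f where f: "f \<in> poly_over (ring_adjoin K {t})" "f \<noteq> 0" "poly f u = 0"
    using algebraic_over_fraction_field[OF subring_ring_adjoin alg] by blast
  obtain h where h: "\<And>i. h i \<in> poly_over K" "\<And>i. coeff f i = poly (h i) t"
    using poly_over_adjoin_coeffs[OF K f(1)] by blast
  define d where "d = degree f"
  define e where "e = Max ((\<lambda>i. degree (h i)) ` {..d})"
  have e: "degree (h i) \<le> e" if "i \<le> d" for i using that by (auto simp: e_def)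
  define g where "g j = (\<Sum>i\<le>d. monom (coeff (h i) j) i)" for j
  have coeff_g: "coeff (g j) i = (if i \<le> d then coeff (h i) j else 0)" for i j
    by (simp add: g_def coeff_sum)
  define G where "G = (\<Sum>j\<le>e. monom (poly (g j) u) j)"
  have coeff_G: "coeff G j = (if j \<le> e then poly (g j) u else 0)" for j
    by (simp add: G_def coeff_sum)
  have g_K: "g j \<in> poly_over K" for j
    using h(1) subring_0[OF K] by (auto simp: poly_over_def coeff_g)
  have "coeff G j \<in> ring_adjoin K {u}" for j
    using g_K subring_0[OF subring_ring_adjoin, of K "{u}"] ring_adjoin_singleton[OF K, of u]
    by (cases "j \<le> e") (auto simp: coeff_G)
  then have "G \<in> poly_over (ring_adjoin K {u})" by (simp add: poly_over_def)
  moreover have "poly G t = 0"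
  proof -
    have "poly G t = (\<Sum>j\<le>e. \<Sum>i\<le>d. coeff (h i) j * u ^ i * t ^ j)"
      by (simp add: G_def g_def poly_sum poly_monom sum_distrib_right)
    also have "\<dots> = (\<Sum>i\<le>d. (\<Sum>j\<le>e. coeff (h i) j * t ^ j) * u ^ i)"
      by (subst sum.swap) (simp add: sum_distrib_right sum_distrib_left ac_simps)
    also have "\<dots> = (\<Sum>i\<le>d. coeff f i * u ^ i)"
    proof (intro sum.cong refl arg_cong2[of _ _ _ _ "(*)"])
      fix i assume "i \<in> {..d}"
      then have "degree (h i) \<le> e" using e by simp
      then show "(\<Sum>j\<le>e. coeff (h i) j * t ^ j) = coeff f i"
        unfolding h(2)
        using arg_cong[OF poly_as_sum_of_monoms', of "h i" e "\<lambda>q. poly q t"]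
        by (simp add: poly_sum poly_monom)
    qed
    also have "\<dots> = 0" using f by (simp add: poly_altdef d_def)
    finally show ?thesis .
  qed
  moreover have "G \<noteq> 0"
  proof -
    have "coeff f d \<noteq> 0" using f by (simp add: d_def)
    then have "h d \<noteq> 0" using h by auto
    then have "coeff (h d) (degree (h d)) \<noteq> 0" by simp
    then have "coeff (g (degree (h d))) d \<noteq> 0" by (simp add: coeff_g)
    then have "g (degree (h d)) \<noteq> 0" by auto
    then have "poly (g (degree (h d))) u \<noteq> 0"
      using u g_K algebraic_over_iff[OF K] by blast
    then have "coeff G (degree (h d)) \<noteq> 0" using e[of d] by (simp add: coeff_G)
    then show ?thesis by auto
  qed
  ultimately show ?thesis using algebraic_over_iff[OF subring_ring_adjoin] by blast
qed

text \<open>Exchange: \<open>t\<close> is algebraic over K(u) and all of \<open>F\<close> is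
  algebraic over K(t). Thus any nonconstant function, such as a nonunit of a local ring, can serve
  as the variable.\<close>

lemma algebraic_over_transcendental:
  assumes K: "subfield K" and F: "transcendence_degree_one K F"
    and u: "u \<in> F" "\<not> algebraic_over K u" and x: "x \<in> F"
  shows "algebraic_over (fraction_field (ring_adjoin K {u})) x"
proof -
  define M where "M = fraction_field (ring_adjoin K {u})"
  have M: "subfield M" "ring_adjoin K {u} \<subseteq> M"
    unfolding M_def using subfield_fraction_field fraction_field_superset subring_ring_adjoin by blast+
  obtain t where t: "\<And>y. y \<in> F \<Longrightarrow> algebraic_over (fraction_field (ring_adjoin K {t})) y"
    using F unfolding transcendence_degree_one_def by blast
  have "algebraic_over (ring_adjoin K {u}) t"
    using algebraic_over_swap[OF subfield_subring[OF K] u(2) t[OF u(1)]] .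
  then have tM: "algebraic_over M t" using algebraic_over_mono[OF M(2)] by blast
  define E where "E = ring_adjoin M {t}"
  obtain B where "finite B" "E \<subseteq> lin_span M B"
    using finite_span_adjoin_algebraic[OF M(1), of "{t}"] tM by (auto simp: E_def)
  then have E: "subfield E"
    using subfield_of_finite_span[OF M(1) subring_ring_adjoin ring_adjoin_base] by (simp add: E_def)
  have "K \<subseteq> E" using M(2) ring_adjoin_base unfolding E_def by (meson order_trans)
  moreover have "t \<in> E" using ring_adjoin_gens unfolding E_def by blast
  ultimately have "fraction_field (ring_adjoin K {t}) \<subseteq> E"
    using E by (intro fraction_field_least ring_adjoin_least) (auto intro: subfield_subring)
  then have "algebraic_over E x" using t[OF x] algebraic_over_mono by blast
  then show ?thesis
    using algebraic_over_trans[OF M(1), of "{t}" x] tM by (simp add: E_def M_def)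
qed

text \<open>Zariski's lemma in transcendence degree one. If \<open>F\<close> were finitely generated
  as a ring, it would lie in a free module of finite rank over K[t][1/h] for a single
  \<open>h\<close>; but 1 + t h is coprime to \<open>h\<close>, and no power of \<open>h\<close>
  clears the denominator of its inverse.\<close>

lemma finitely_generated_not_field:
  fixes K F :: "'l::field set"
  assumes K: "subfield K" and F: "subfield F" and trdeg: "transcendence_degree_one K F"
    and S: "finite S" "F = ring_adjoin K S"
  shows False
proof -
  note sK = subfield_subring[OF K]
  obtain t where t: "t \<in> F" "\<not> algebraic_over K t"
    "\<And>y. y \<in> F \<Longrightarrow> algebraic_over (fraction_field (ring_adjoin K {t})) y"
    using trdeg unfolding transcendence_degree_one_def by blast
  define A where "A = ring_adjoin K {t}"
  define M where "M = fraction_field A"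
  have A: "subring A" "K \<subseteq> A" "t \<in> A" and A_eq: "A = {poly f t | f. f \<in> poly_over K}"
    unfolding A_def
    by (rule subring_ring_adjoin ring_adjoin_base ring_adjoin_singleton[OF sK]
        ring_adjoin_gens[THEN subsetD] singletonI)+
  have M: "subfield M" "A \<subseteq> M"
    unfolding M_def using subfield_fraction_field[OF A(1)] fraction_field_superset[OF A(1)] by blast+
  note sM = subfield_subring[OF M(1)]
  have MF: "M \<subseteq> F"
    unfolding M_def A_def using S t ring_adjoin_base F
    by (intro fraction_field_least ring_adjoin_least) (auto intro: subfield_subring)
  have "F \<subseteq> ring_adjoin M S" unfolding S(2)
    using A(2) M(2) by (intro ring_adjoin_mono) auto
  moreover have "\<And>s. s \<in> S \<Longrightarrow> algebraic_over M s"
    using t(3) ring_adjoin_gens S(2) unfolding M_def A_def by blast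
  ultimately obtain B0 where B0: "finite B0" "F \<subseteq> lin_span M B0"
    using finite_span_adjoin_algebraic[OF M(1) S(1)] by (meson order_trans)
  have "lin_indep M {1}" "{1} \<subseteq> F"
    using subring_1[OF subfield_subring[OF F]] by (auto simp: lin_indep_def)
  then obtain B where B: "lin_indep M B" "1 \<in> B" "B \<subseteq> F" "F \<subseteq> lin_span M B"
    using extend_to_basis[OF M(1) B0] by (metis insert_subset)
  have finB: "finite B" using B by (simp add: lin_indep_def)
  have "\<forall>x. x \<in> F \<longrightarrow> (\<exists>a. (\<forall>b\<in>B. a b \<in> M) \<and> x = (\<Sum>b\<in>B. a b * b))"
    using B(4) unfolding lin_span_def by blast
  then have "\<forall>x. \<exists>a. x \<in> F \<longrightarrow> (\<forall>b\<in>B. a b \<in> M) \<and> x = (\<Sum>b\<in>B. a b * b)" by blast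
  then obtain m where "\<forall>x. x \<in> F \<longrightarrow> (\<forall>b\<in>B. m x b \<in> M) \<and> x = (\<Sum>b\<in>B. m x b * b)"
    by (rule choice[THEN exE])
  then have m: "\<And>x b. x \<in> F \<Longrightarrow> b \<in> B \<Longrightarrow> m x b \<in> M" "\<And>x. x \<in> F \<Longrightarrow> x = (\<Sum>b\<in>B. m x b * b)"
    by auto
  have SF: "S \<subseteq> F" using ring_adjoin_gens S(2) by blast
  have sbF: "s * b \<in> F" if "s \<in> S" "b \<in> B" for s b
    using that SF B subring_mult[OF subfield_subring[OF F]] by blast
  \<comment> \<open>\<open>h\<close> clears the denominators of the matrices of multiplication by the generators.\<close>
  obtain h where h: "h \<in> A" "h \<noteq> 0"
    "\<And>s b b'. s \<in> S \<Longrightarrow> b \<in> B \<Longrightarrow> b' \<in> B \<Longrightarrow> h * m (s * b) b' \<in> A"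
  proof -
    have "\<exists>d\<in>A. d \<noteq> 0 \<and> (\<forall>i\<in>S \<times> B \<times> B. d * (case i of (s, b, b') \<Rightarrow> m (s * b) b') \<in> A)"
      using S(1) finB m(1) sbF by (intro common_denominator[OF A(1)]) (auto simp: M_def)
    then show ?thesis using that by auto
  qed
  have mF: "m 1 b \<in> M" if "b \<in> B" for b using m(1) that subring_1[OF subfield_subring[OF F]] by blast
  \<comment> \<open>The span of \<open>B\<close> over K[t][1/h], expressed without forming the
    localization.\<close>
  define Y where "Y = {y. \<exists>n. h ^ n * y \<in> lin_span A B}"
  have Y_ge: "h ^ n * y \<in> lin_span A B" if "h ^ k * y \<in> lin_span A B" "k \<le> n" for k n y
  proof -
    have "h ^ n * y = h ^ (n - k) * (h ^ k * y)"
      using that by (simp flip: power_add mult.assoc)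
    then show ?thesis using lin_span_smult[OF A(1) that(1)] subring_power[OF A(1) h(1)] by metis
  qed
  have Y_add: "x + y \<in> Y" if xy: "x \<in> Y" "y \<in> Y" for x y
  proof -
    obtain i j where ij: "h ^ i * x \<in> lin_span A B" "h ^ j * y \<in> lin_span A B"
      using xy unfolding Y_def by blast
    then have "h ^ (max i j) * x + h ^ (max i j) * y \<in> lin_span A B"
      using Y_ge by (intro lin_span_add[OF A(1)]) auto
    then show ?thesis by (auto simp: Y_def distrib_left)
  qed
  have Y_A: "a * x \<in> Y" if x: "x \<in> Y" and a: "a \<in> A" for a x
  proof -
    obtain i where "h ^ i * x \<in> lin_span A B" using x by (auto simp: Y_def)
    then have "a * (h ^ i * x) \<in> lin_span A B" using lin_span_smult[OF A(1)] a by blast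
    then have "h ^ i * (a * x) \<in> lin_span A B" by (simp add: ac_simps)
    then show ?thesis unfolding Y_def by blast
  qed
  have Y_B: "b \<in> Y" if "b \<in> B" for b
    unfolding Y_def using lin_span_base[OF A(1) finB that] by (intro CollectI exI[of _ 0]) simp
  have Y_sum: "sum f I \<in> Y" if "\<And>i. i \<in> I \<Longrightarrow> f i \<in> Y" for f and I :: "'a set"
    using that
  proof (induction I rule: infinite_finite_induct)
    case (insert x J)
    then show ?case using Y_add by simp
  qed (use lin_span_0[OF A(1)] in \<open>auto simp: Y_def\<close>)
  have Y_div: "y \<in> Y" if "h * y \<in> Y" for y
  proof -
    obtain i where "h ^ i * (h * y) \<in> lin_span A B" using \<open>h * y \<in> Y\<close> unfolding Y_def by blast
    moreover have "h ^ i * (h * y) = h ^ Suc i * y" by simp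
    ultimately show ?thesis unfolding Y_def by (metis mem_Collect_eq)
  qed
  have Y_S: "s * y \<in> Y" if y: "y \<in> Y" and s: "s \<in> S" for s y
  proof -
    have sb: "s * b \<in> Y" if "b \<in> B" for b
    proof (rule Y_div)
      have "h * (s * b) = (\<Sum>b'\<in>B. h * m (s * b) b' * b')"
        by (subst m(2)[OF sbF[OF s that]]) (simp add: sum_distrib_left mult.assoc)
      also have "\<dots> \<in> Y" using h(3)[OF s that] by (intro Y_sum Y_A Y_B) auto
      finally show "h * (s * b) \<in> Y" .
    qed
    obtain i where "h ^ i * y \<in> lin_span A B" using y by (auto simp: Y_def)
    then obtain a where a: "\<And>b. b \<in> B \<Longrightarrow> a b \<in> A" "h ^ i * y = (\<Sum>b\<in>B. a b * b)"
      by (auto elim!: lin_spanE)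
    have "h ^ i * (s * y) = s * (h ^ i * y)" by (simp add: ac_simps)
    also have "\<dots> = (\<Sum>b\<in>B. a b * (s * b))" by (simp add: a(2) sum_distrib_left mult.left_commute)
    also have "\<dots> \<in> Y" by (intro Y_sum Y_A[OF sb a(1)])
    finally obtain j where "h ^ j * (h ^ i * (s * y)) \<in> lin_span A B" by (auto simp: Y_def)
    then show ?thesis unfolding Y_def by (auto simp flip: mult.assoc power_add)
  qed
  \<comment> \<open>The multipliers of \<open>Y\<close> form a ring containing \<open>K\<close> and
    \<open>S\<close>, hence all of \<open>F\<close>; applied to the element 1 of \<open>B\<close>,
    this puts \<open>F\<close> inside \<open>Y\<close>.\<close>
  define R where "R = {x. \<forall>y\<in>Y. x * y \<in> Y}"
  have "subring R"
  proof (rule subringI)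
    fix x y assume xy: "x \<in> R" "y \<in> R"
    have "- 1 \<in> A" using subring_1[OF A(1)] subring_uminus[OF A(1)] by blast
    then have "x * z + - 1 * (y * z) \<in> Y" if "z \<in> Y" for z
      using xy that by (intro Y_add Y_A[OF _ \<open>- 1 \<in> A\<close>]) (auto simp: R_def)
    then show "x - y \<in> R" by (simp add: R_def left_diff_distrib)
    show "x * y \<in> R" using xy by (simp add: R_def mult.assoc)
  qed (simp add: R_def)
  then have "F \<subseteq> R" unfolding S(2) using Y_A A(2) Y_S
    by (intro ring_adjoin_least) (auto simp: R_def)
  then have FY: "F \<subseteq> Y" using Y_B[OF B(2)] by (force simp: R_def)
  obtain hp where hp: "hp \<in> poly_over K" "h = poly hp t" using h A_eq by blast
  \<comment> \<open>The polynomial 1 + X h: nonconstant since \<open>h\<close> is nonzero, and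
    congruent to 1 modulo \<open>h\<close>.\<close>
  define q where "q = pCons 1 hp"
  have q: "q \<in> poly_over K" unfolding q_def using hp by (intro poly_over_pCons[OF sK] subring_1[OF sK])
  have "hp \<noteq> 0" using hp h by auto
  then have deg_q: "degree q > 0" by (simp add: q_def)
  have tr: "f = 0" if "f \<in> poly_over K" "poly f t = 0" for f
    using that t(2) algebraic_over_iff[OF sK] by blast
  have qt: "poly q t \<noteq> 0" using tr[OF q] deg_q by auto
  have "poly q t \<in> F" using q t(1) poly_over_mono[of K F] poly_over_eval[OF subfield_subring[OF F]]
      S ring_adjoin_base by blast
  then have "inverse (poly q t) \<in> Y" using FY subfield_inverse[OF F] by blast
  then obtain N where N: "h ^ N * inverse (poly q t) \<in> lin_span A B" by (auto simp: Y_def)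
  then obtain a where a: "\<And>b. b \<in> B \<Longrightarrow> a b \<in> A" "h ^ N * inverse (poly q t) = (\<Sum>b\<in>B. a b * b)"
    by (auto elim!: lin_spanE)
  have "h ^ N * inverse (poly q t) \<in> M"
  proof -
    have "poly q t \<in> M" using q A_eq M(2) by blast
    then show ?thesis using h(1) M subfield_inverse[OF M(1)] by (intro subring_mult[OF sM] subring_power[OF sM]) auto
  qed
  \<comment> \<open>Two expansions of one element of \<open>M\<close>. As 1 is a basis vector,
    comparing its coefficients shows that the element lies in \<open>A\<close>.\<close>
  have "(\<Sum>b\<in>B. a b * b) = (\<Sum>b\<in>B. (if b = 1 then h ^ N * inverse (poly q t) else 0) * b)"
  proof -
    have "(\<Sum>b\<in>B. (if b = 1 then h ^ N * inverse (poly q t) else 0) * b)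
      = (\<Sum>b\<in>B. if b = 1 then h ^ N * inverse (poly q t) else 0)"
      by (intro sum.cong) auto
    then show ?thesis using a(2) B(2) finB by simp
  qed
  from lin_indep_unique[OF sM B(1) _ _ this B(2)]
  have "a 1 = (if (1::'l) = 1 then h ^ N * inverse (poly q t) else 0)"
    using a(1) M(2) \<open>h ^ N * inverse (poly q t) \<in> M\<close> subring_0[OF sM] by (meson subsetD)
  then have "a 1 = h ^ N * inverse (poly q t)" by simp
  moreover obtain g where g: "g \<in> poly_over K" "a 1 = poly g t" using a(1)[OF B(2)] A_eq by blast
  ultimately have "poly (g * q) t = poly (hp ^ N) t" using qt by (simp add: hp field_simps)
  then have "poly (g * q - hp ^ N) t = 0" by simp
  moreover have "g * q - hp ^ N \<in> poly_over K"
    by (intro poly_over_diff[OF sK] poly_over_mult[OF sK] poly_over_power[OF sK] g q hp)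
  ultimately have "g * q = hp ^ N" using tr by fastforce
  then have "q dvd hp ^ N" by (metis dvd_triv_right)
  \<comment> \<open>From X h = q - 1, divisibility of h^(n+1) by \<open>q\<close> implies that of
    h^n, so the exponent descends to 0.\<close>
  moreover have "is_unit q" if "q dvd hp ^ n" for n
    using that
  proof (induction n)
    case (Suc n)
    have Xhp: "[:0, 1:] * hp = q - 1" by (simp add: q_def one_pCons)
    have "[:0, 1:] * hp ^ Suc n = ([:0, 1:] * hp) * hp ^ n" by (simp only: power_Suc mult.assoc)
    also have "\<dots> = q * hp ^ n - hp ^ n" by (simp only: Xhp left_diff_distrib mult_1)
    finally have "[:0, 1:] * hp ^ Suc n = q * hp ^ n - hp ^ n" .
    moreover have "q dvd [:0, 1:] * hp ^ Suc n" using Suc.prems dvd_mult by blast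
    ultimately have "q dvd hp ^ n" by (metis dvd_diff_right_iff dvd_triv_left)
    then show ?case by (rule Suc.IH)
  qed simp
  ultimately have "is_unit q" by blast
  moreover have "q \<noteq> 0" using deg_q by auto
  ultimately show False using deg_q by (simp add: is_unit_iff_degree)
qed

section \<open>Valuation rings\<close>

lemma nonunits_iff: "x \<in> nonunits R \<longleftrightarrow> x \<in> R \<and> (x = 0 \<or> inverse x \<notin> R)"
  by (auto simp: nonunits_def)

lemma unit_in: "x \<in> R \<Longrightarrow> x \<notin> nonunits R \<Longrightarrow> inverse x \<in> R \<and> x \<noteq> 0"
  by (auto simp: nonunits_def)

lemma valuation_ring_subring: "valuation_ring F V \<Longrightarrow> subring V"
  by (simp add: valuation_ring_def)

lemma valuation_ring_sub: "valuation_ring F V \<Longrightarrow> V \<subseteq> F"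
  by (simp add: valuation_ring_def)

lemma nonunits_mult:
  assumes "subring R" "x \<in> nonunits R" "a \<in> R"
  shows "a * x \<in> nonunits R"
proof (cases "a * x = 0")
  case True
  then show ?thesis using assms by (auto simp: nonunits_iff subring_0)
next
  case False
  have "inverse (a * x) \<notin> R"
  proof
    assume "inverse (a * x) \<in> R"
    then have "a * inverse (a * x) \<in> R" using assms subring_mult by blast
    moreover have "a * inverse (a * x) = inverse x" using False by (simp add: field_simps)
    ultimately have "inverse x \<in> R" by metis
    then show False using assms(2) False by (auto simp: nonunits_iff)
  qed
  then show ?thesis using assms by (auto simp: nonunits_iff subring_mult)
qed

lemma one_notin_nonunits: "subring R \<Longrightarrow> 1 \<notin> nonunits R"
  by (simp add: nonunits_iff subring_1)

lemma zero_in_nonunits: "subring R \<Longrightarrow> 0 \<in> nonunits R"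
  by (simp add: nonunits_iff subring_0)

text \<open>Of two nonzero nonunits one divides the other, say x = a y, and then x - y is the
  multiple (a - 1) y of a nonunit.\<close>

lemma valuation_ring_local:
  assumes F: "subfield F" and V: "valuation_ring F V"
  shows "local_ring V"
proof -
  note sV = valuation_ring_subring[OF V]
  have *: "x - y \<in> nonunits V" if xy: "x \<in> nonunits V" "y \<in> nonunits V" and d: "x \<noteq> 0" "x / y \<in> V" for x y
  proof -
    have "x / y - 1 \<in> V" using d sV subring_1 subring_diff by blast
    then have "(x / y - 1) * y \<in> nonunits V" using nonunits_mult[OF sV xy(2)] by blast
    then show ?thesis using xy(1) by (cases "y = 0") (simp_all add: left_diff_distrib)
  qed
  have "x - y \<in> nonunits V" if xy: "x \<in> nonunits V" "y \<in> nonunits V" for x y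
  proof (cases "x = 0 \<or> y = 0")
    case True
    then show ?thesis using xy nonunits_mult[OF sV xy(2), of "- 1"] subring_uminus[OF sV subring_1[OF sV]]
      by auto
  next
    case False
    then have "x / y \<in> V \<or> y / x \<in> V"
    proof -
      have "x / y \<in> F" using xy V F
        by (intro subfield_divide) (auto simp: valuation_ring_def nonunits_iff)
      then have "x / y \<in> V \<or> inverse (x / y) \<in> V" using V unfolding valuation_ring_def by blast
      then show ?thesis by simp
    qed
    then show ?thesis
    proof
      assume "y / x \<in> V"
      then have "y - x \<in> nonunits V" using * xy False by blast
      then have "- 1 * (y - x) \<in> nonunits V"
        using nonunits_mult[OF sV] subring_uminus[OF sV subring_1[OF sV]] by blast
      then show ?thesis by simp
    qed (use * xy False in blast)
  qed
  then show ?thesis unfolding local_ring_def ideal_def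
    using sV nonunits_mult[OF sV] zero_in_nonunits[OF sV] by (auto simp: nonunits_iff)
qed

lemma local_ring_nonunits_diff:
  "local_ring R \<Longrightarrow> x \<in> nonunits R \<Longrightarrow> y \<in> nonunits R \<Longrightarrow> x - y \<in> nonunits R"
  by (simp add: local_ring_def ideal_def)

lemma local_ring_nonunits_add:
  assumes R: "local_ring R" and "x \<in> nonunits R" "y \<in> nonunits R"
  shows "x + y \<in> nonunits R"
proof -
  have "subring R" using R by (simp add: local_ring_def)
  then have "x - (0 - y) \<in> nonunits R"
    using assms by (intro local_ring_nonunits_diff zero_in_nonunits)
  then show ?thesis by simp
qed

lemma prime_ideal_nonunits:
  assumes R: "local_ring R"
  shows "prime_ideal R (nonunits R)"
proof -
  have sR: "subring R" using R by (simp add: local_ring_def)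
  have "x \<in> nonunits R \<or> y \<in> nonunits R" if "x \<in> R" "y \<in> R" "x * y \<in> nonunits R" for x y
    using that subring_mult[OF sR, of "inverse x" "inverse y"] by (auto simp: nonunits_iff)
  then show ?thesis using R one_notin_nonunits[OF sR] by (simp add: prime_ideal_def local_ring_def)
qed

text \<open>Valuation rings are maximal under domination: an element of \<open>W\<close> outside
  \<open>V\<close> has its inverse among the nonunits of \<open>V\<close>, hence among those of
  \<open>W\<close>.\<close>

lemma dominates_valuation_ring_eq:
  assumes V: "valuation_ring F V" and W: "valuation_ring F W"
    and le: "V \<subseteq> W" "nonunits V \<subseteq> nonunits W"
  shows "V = W"
proof (rule ccontr)
  assume "V \<noteq> W"
  then obtain x where x: "x \<in> W" "x \<notin> V" using le by blast
  then have "inverse x \<in> V" using V W by (auto simp: valuation_ring_def)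
  then have "inverse x \<in> nonunits V" using x by (simp add: nonunits_iff)
  then have "inverse x \<in> nonunits W" using le by blast
  then have "x = 0" using x by (simp add: nonunits_iff)
  then show False using x V subring_0[OF valuation_ring_subring] by blast
qed

text \<open>The inverse of a nonzero algebraic element is a polynomial in it over \<open>K\<close>,
  so it would lie in \<open>V\<close>.\<close>

lemma nonunit_not_algebraic:
  assumes K: "subfield K" and V: "subring V" "K \<subseteq> V" and x: "x \<in> nonunits V" "x \<noteq> 0"
  shows "\<not> algebraic_over K x"
proof
  assume "algebraic_over K x"
  then obtain g where "g \<in> poly_over K" "inverse x = poly g x"
    using poly_over_inverse[OF K] x(2) algebraic_over_iff[OF subfield_subring[OF K]] by blast
  then have "inverse x \<in> V" using poly_over_eval[OF V(1)] poly_over_mono[OF V(2)] x by (auto simp: nonunits_iff)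
  then show False using x by (simp add: nonunits_iff)
qed

section \<open>Local rings of regular curves\<close>

text \<open>The class of \<open>g\<close> modulo \<open>I\<close> is transcendental over
  \<open>K\<close>: factors \<open>g\<close> cancel modulo the prime \<open>I\<close>, and a nonzero
  constant term would fall into \<open>J\<close> and make it the whole ring.\<close>

lemma prime_ideal_poly_residue:
  assumes K: "subfield K" and R: "subring R" "K \<subseteq> R" and I: "prime_ideal R I" and J: "prime_ideal R J"
    and IJ: "I \<subseteq> J" and g: "g \<in> J" "g \<notin> I"
  shows "q \<in> poly_over K \<Longrightarrow> q \<noteq> 0 \<Longrightarrow> poly q g \<notin> I"
proof (induction q)
  case (pCons c h)
  have h: "h \<in> poly_over K" "c \<in> K"
    using pCons.prems(1) unfolding poly_over_def by (auto simp: coeff_pCons split: nat.splits)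
  have gR: "g \<in> R" using g J by (auto simp: prime_ideal_def ideal_def)
  have hg: "poly h g \<in> R" using h gR R poly_over_eval poly_over_mono by blast
  show ?case
  proof (cases "c = 0")
    case True
    then have "poly h g \<notin> I" using pCons h by auto
    then have "g * poly h g \<notin> I" using I g gR hg by (auto simp: prime_ideal_def)
    then show ?thesis using True by simp
  next
    case False
    show ?thesis
    proof
      assume "poly (pCons c h) g \<in> I"
      then have "c + g * poly h g \<in> J" using IJ by auto
      moreover have "poly h g * g \<in> J" using J hg g by (auto simp: prime_ideal_def ideal_def)
      ultimately have "(c + g * poly h g) - poly h g * g \<in> J" using J unfolding prime_ideal_def ideal_def by blast
      then have "c \<in> J" by (simp add: mult.commute)
      moreover have "inverse c \<in> R" using h K R subfield_inverse by blast
      ultimately have "inverse c * c \<in> J" using J by (auto simp: prime_ideal_def ideal_def)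
      then show False using False J by (simp add: prime_ideal_def)
    qed
  qed
qed simp

text \<open>Divide an algebraic relation between \<open>f\<close> and \<open>g\<close> by the
  largest common power of \<open>f\<close>, then reduce modulo \<open>f\<close>. A nonzero
  polynomial over \<open>K\<close> remains. It bounds the dimension here and later shows that
  residues are algebraic.\<close>

lemma residue_polynomial:
  assumes K: "subfield K" and R: "subring R" "K \<subseteq> R" and fg: "f \<in> R" "g \<in> R" "f \<noteq> 0"
    and alg: "algebraic_over (fraction_field (ring_adjoin K {f})) g"
  obtains q r where "q \<in> poly_over K" "q \<noteq> 0" "r \<in> R" "poly q g = r * f"
proof -
  note sK = subfield_subring[OF K]
  obtain H where H: "H \<in> poly_over (ring_adjoin K {f})" "H \<noteq> 0" "poly H g = 0"
    using algebraic_over_fraction_field[OF subring_ring_adjoin alg] by blast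
  obtain h where h: "\<And>i. h i \<in> poly_over K" "\<And>i. coeff H i = poly (h i) f"
    using poly_over_adjoin_coeffs[OF sK H(1)] by blast
  define d where "d = degree H"
  have "h d \<noteq> 0" using h(2)[of d] H by (auto simp: d_def)
  then have "\<exists>r i. i \<le> d \<and> coeff (h i) r \<noteq> 0"
    by (metis leading_coeff_0_iff order_refl)
  \<comment> \<open>The largest power of the variable dividing all \<open>h i\<close>; their
    coefficients of degree \<open>r\<close> form the reduced relation \<open>q\<close>.\<close>
  define r where "r = (LEAST r. \<exists>i\<le>d. coeff (h i) r \<noteq> 0)"
  have "\<exists>i\<le>d. coeff (h i) r \<noteq> 0" unfolding r_def
    using \<open>\<exists>r i. i \<le> d \<and> coeff (h i) r \<noteq> 0\<close> by (rule LeastI_ex)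
  then obtain i0 where i0: "i0 \<le> d" "coeff (h i0) r \<noteq> 0" by blast
  have low: "coeff (h i) j = 0" if "i \<le> d" "j < r" for i j
    using not_less_Least[of j "\<lambda>r. \<exists>i\<le>d. coeff (h i) r \<noteq> 0"] that by (auto simp: r_def)
  have shift: "h i = monom 1 r * poly_shift r (h i)" if "i \<le> d" for i
    using low that by (intro poly_eqI) (auto simp: coeff_monom_mult coeff_poly_shift)
  define q where "q = (\<Sum>i\<le>d. monom (coeff (h i) r) i)"
  have coeff_q: "coeff q i = (if i \<le> d then coeff (h i) r else 0)" for i
    by (simp add: q_def coeff_sum)
  have q: "q \<in> poly_over K" using h(1) subring_0[OF sK] by (auto simp: poly_over_def coeff_q)
  have "coeff q i0 \<noteq> 0" using i0 by (simp add: coeff_q)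
  then have "q \<noteq> 0" by auto
  have s: "(\<Sum>i\<le>d. g ^ i * poly (poly_shift r (h i)) f) = 0"
  proof -
    have "f ^ r * (\<Sum>i\<le>d. g ^ i * poly (poly_shift r (h i)) f)
        = (\<Sum>i\<le>d. poly (monom 1 r * poly_shift r (h i)) f * g ^ i)"
      by (simp add: sum_distrib_left poly_monom mult_ac)
    also have "\<dots> = (\<Sum>i\<le>d. coeff H i * g ^ i)"
      by (intro sum.cong refl) (metis shift h(2) atMost_iff)
    also have "\<dots> = 0" using H by (simp add: poly_altdef d_def)
    finally show ?thesis using fg by simp
  qed
  have "\<exists>e\<in>R. poly (poly_shift r (h i)) f = coeff (h i) r + e * f" for i
  proof -
    have hs: "poly_shift r (h i) \<in> poly_over K" using h(1) by (auto simp: poly_over_def coeff_poly_shift)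
    obtain c h' where ch: "poly_shift r (h i) = pCons c h'" by (rule pCons_cases)
    then have "h' \<in> poly_over K" using hs by (auto simp: poly_over_def coeff_pCons split: nat.splits)
    then have "poly h' f \<in> R" using poly_over_eval[OF R(1)] poly_over_mono[OF R(2)] fg by blast
    moreover have "coeff (h i) r = c" using coeff_poly_shift[of r "h i" 0] ch by simp
    ultimately show ?thesis by (intro bexI[of _ "poly h' f"]) (simp_all add: ch mult.commute)
  qed
  then obtain e where e: "\<And>i. e i \<in> R" "\<And>i. poly (poly_shift r (h i)) f = coeff (h i) r + e i * f"
    by metis
  have "poly q g + (\<Sum>i\<le>d. g ^ i * e i) * f = 0"
  proof -
    have "(\<Sum>i\<le>d. g ^ i * e i) * f = (\<Sum>i\<le>d. g ^ i * (e i * f))"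
      by (simp add: sum_distrib_right mult.assoc)
    moreover have "poly q g = (\<Sum>i\<le>d. g ^ i * coeff (h i) r)"
      by (simp add: q_def poly_sum poly_monom mult.commute)
    ultimately show ?thesis using s by (simp add: e(2) distrib_left sum.distrib)
  qed
  then have "poly q g = - (\<Sum>i\<le>d. g ^ i * e i) * f" by (simp add: eq_neg_iff_add_eq_0)
  moreover have "- (\<Sum>i\<le>d. g ^ i * e i) \<in> R"
    using e(1) fg by (intro subring_uminus[OF R(1)] subring_sum[OF R(1)] subring_mult[OF R(1)] subring_power[OF R(1)]) auto
  ultimately show ?thesis using that q \<open>q \<noteq> 0\<close> by blast
qed

text \<open>Modulo the middle prime, \<open>g\<close> is transcendental over \<open>K\<close>. But
  \<open>f\<close> is transcendental over \<open>K\<close> as well, so in transcendence degree one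
  \<open>g\<close> depends on \<open>f\<close>, and reducing that relation modulo \<open>f\<close>
  makes \<open>g\<close> algebraic.\<close>

lemma prime_chain_length:
  assumes K: "subfield K" and R: "subring R" "K \<subseteq> R" "R \<subseteq> F" and F: "transcendence_degree_one K F"
    and primes: "prime_ideal R I0" "prime_ideal R I1" "prime_ideal R I2" and chain: "I0 \<subset> I1" "I1 \<subset> I2"
  shows False
proof -
  obtain f where f: "f \<in> I1" "f \<notin> I0" using chain by blast
  obtain g where g: "g \<in> I2" "g \<notin> I1" using chain by blast
  have ideals: "ideal R I0" "ideal R I1" "ideal R I2" using primes by (auto simp: prime_ideal_def)
  have "f \<noteq> 0" using f ideals by (auto simp: ideal_def)
  have fg: "f \<in> R" "g \<in> R" using f g ideals by (auto simp: ideal_def)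
  have "inverse f \<notin> R"
  proof
    assume "inverse f \<in> R"
    then have "inverse f * f \<in> I1" using ideals f by (simp add: ideal_def)
    then show False using primes \<open>f \<noteq> 0\<close> by (simp add: prime_ideal_def)
  qed
  then have "f \<in> nonunits R" using fg by (simp add: nonunits_iff)
  then have tr: "\<not> algebraic_over K f"
    using nonunit_not_algebraic[OF K R(1,2)] \<open>f \<noteq> 0\<close> by blast
  have "algebraic_over (fraction_field (ring_adjoin K {f})) g"
    using algebraic_over_transcendental[OF K F _ tr] fg R by blast
  then obtain q r where q: "q \<in> poly_over K" "q \<noteq> 0" "r \<in> R" "poly q g = r * f"
    using residue_polynomial[OF K R(1,2) fg \<open>f \<noteq> 0\<close>] by blast
  then have "poly q g \<in> I1" using ideals(2) f by (simp add: ideal_def)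
  then show False
    using prime_ideal_poly_residue[OF K R(1,2) primes(2,3) _ g q(1,2)] chain by blast
qed

lemma krull_dim_le_one:
  assumes K: "subfield K" and R: "subring R" "K \<subseteq> R" "R \<subseteq> F" and F: "transcendence_degree_one K F"
  shows "krull_dim R \<le> 1"
  unfolding krull_dim_def
proof (rule Sup_least)
  fix m assume "m \<in> {enat n | n. \<exists>c. (\<forall>i\<le>n. prime_ideal R (c i)) \<and> (\<forall>i<n. c i \<subset> c (Suc i))}"
  then obtain n c where n: "m = enat n" "\<forall>i\<le>n. prime_ideal R (c i)" "\<forall>i<n. c i \<subset> c (Suc i)"
    by blast
  have "n \<le> 1"
  proof (rule ccontr)
    assume "\<not> n \<le> 1"
    then have "prime_ideal R (c 0)" "prime_ideal R (c 1)" "prime_ideal R (c 2)" "c 0 \<subset> c 1" "c 1 \<subset> c 2"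
      using n(2) n(3)[rule_format, of 0] n(3)[rule_format, of 1] by (auto simp: numeral_2_eq_2)
    then show False using prime_chain_length[OF K R F] by blast
  qed
  then show "m \<le> 1" using n by (simp add: one_enat_def)
qed

lemma ideal_subset: "ideal R I \<Longrightarrow> I \<subseteq> R"
  and ideal_0: "ideal R I \<Longrightarrow> 0 \<in> I"
  and ideal_diff: "ideal R I \<Longrightarrow> x \<in> I \<Longrightarrow> y \<in> I \<Longrightarrow> x - y \<in> I"
  and ideal_mult: "ideal R I \<Longrightarrow> a \<in> R \<Longrightarrow> x \<in> I \<Longrightarrow> a * x \<in> I"
  by (simp_all add: ideal_def)

lemma ideal_principal:
  assumes R: "subring R" and x: "x \<in> R"
  shows "ideal R ((\<lambda>a. a * x) ` R)"
  unfolding ideal_def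
proof (intro conjI ballI)
  show "(\<lambda>a. a * x) ` R \<subseteq> R" using R x subring_mult by blast
  show "0 \<in> (\<lambda>a. a * x) ` R" using subring_0[OF R] by (rule rev_image_eqI) simp
  fix y z assume "y \<in> (\<lambda>a. a * x) ` R" "z \<in> (\<lambda>a. a * x) ` R"
  then obtain a b where "a \<in> R" "b \<in> R" "y = a * x" "z = b * x" by blast
  then show "y - z \<in> (\<lambda>a. a * x) ` R"
    using subring_diff[OF R, of a b] by (intro image_eqI[of _ _ "a - b"]) (auto simp: left_diff_distrib)
next
  fix c y assume "c \<in> R" "y \<in> (\<lambda>a. a * x) ` R"
  then obtain a where "a \<in> R" "y = a * x" by blast
  then show "c * y \<in> (\<lambda>a. a * x) ` R"
    using subring_mult[OF R \<open>c \<in> R\<close>, of a] by (intro image_eqI[of _ _ "c * a"]) auto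
qed

text \<open>Regularity in dimension at most one makes the maximal ideal principal; the Noetherian
  property then writes each nonzero element as a unit times a power of the generator.\<close>

lemma regular_local_ring_valuation_ring:
  assumes R: "regular_local_ring R" and F: "subfield F" "fraction_field R = F" and dim: "krull_dim R \<le> 1"
  shows "valuation_ring F R"
proof -
  have loc: "local_ring R" and noeth: "noetherian R" using R by (auto simp: regular_local_ring_def)
  have sR: "subring R" using loc by (simp add: local_ring_def)
  obtain S where S: "finite S" "S \<subseteq> R" "enat (card S) = krull_dim R" "nonunits R = ideal R hull S"
    using R by (auto simp: regular_local_ring_def)
  have "card S \<le> 1" using dim S(3) by (metis enat_ord_simps(1) one_enat_def)
  \<comment> \<open>The choice \<pi> = 0 covers dimension 0, where the ring is a field.\<close>
  then obtain \<pi> where p: "\<pi> \<in> R" "S \<subseteq> {\<pi>}"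
  proof (cases "S = {}")
    case True
    then show ?thesis using that[of 0] subring_0[OF sR] by auto
  next
    case False
    then have "card S = 1" using \<open>card S \<le> 1\<close> S(1) by (simp add: le_Suc_eq)
    then obtain s where "S = {s}" by (rule card_1_singletonE)
    then show ?thesis using that[of s] S by auto
  qed
  have princ: "\<exists>a\<in>R. x = a * \<pi>" if "x \<in> nonunits R" for x
  proof -
    have "S \<subseteq> (\<lambda>a. a * \<pi>) ` R" using p subring_1[OF sR] by force
    then have "ideal R hull S \<subseteq> (\<lambda>a. a * \<pi>) ` R" using ideal_principal[OF sR p(1)] by (rule hull_minimal)
    then show ?thesis using that S by blast
  qed
  have pn: "\<pi> \<in> nonunits R \<or> nonunits R = {0}"
  proof (cases "\<pi> \<in> S")
    case True
    then show ?thesis using S(4) hull_inc[of \<pi> S "ideal R"] by simp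
  next
    case False
    then have "S = {}" using p by blast
    moreover have "ideal R {0}" using subring_0[OF sR] by (simp add: ideal_def)
    ultimately have "nonunits R \<subseteq> {0}" using S(4) by (metis empty_subsetI hull_minimal)
    then show ?thesis using zero_in_nonunits[OF sR] by blast
  qed
  have factor: "\<exists>n u. x = u * \<pi> ^ n \<and> u \<in> R - nonunits R" if x: "x \<in> R" "x \<noteq> 0" for x
  proof (rule ccontr)
    assume contr: "\<not> ?thesis"
    \<comment> \<open>Otherwise \<open>x\<close> is divisible by every power of \<pi>, and the
      cofactors generate an ascending chain of principal ideals; where it stabilizes, \<pi> becomes
      a unit.\<close>
    have "\<exists>y\<in>R. y \<in> nonunits R \<and> x = y * \<pi> ^ n" for n
    proof (induction n)
      case 0
      then show ?case using contr x by (metis DiffI mult.right_neutral power_0)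
    next
      case (Suc n)
      then obtain y where y: "y \<in> nonunits R" "x = y * \<pi> ^ n" by blast
      then obtain a where a: "a \<in> R" "y = a * \<pi>" using princ by blast
      then have "x = a * \<pi> ^ Suc n" using y by simp
      then show ?case using contr a by blast
    qed
    then obtain y where y: "\<And>n. y n \<in> nonunits R" "\<And>n. x = y n * \<pi> ^ n" by metis
    have p0: "\<pi> \<noteq> 0" using y(2)[of 1] x by auto
    have y0: "y n \<noteq> 0" for n using y(2)[of n] x by auto
    have yR: "y n \<in> R" for n using y(1) by (simp add: nonunits_iff)
    have ystep: "y n = y (Suc n) * \<pi>" for n
    proof -
      have "y n * \<pi> ^ n = (y (Suc n) * \<pi>) * \<pi> ^ n" using y(2)[of n] y(2)[of "Suc n"]
        by (simp only: power_Suc mult.assoc)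
      then show ?thesis using p0 by simp
    qed
    define J where "J n = (\<lambda>a. a * y n) ` R" for n
    have J: "ideal R (J n)" for n unfolding J_def by (rule ideal_principal[OF sR yR])
    have Jstep: "J n \<subseteq> J (Suc n)" for n
    proof
      fix z assume "z \<in> J n"
      then obtain a where a: "a \<in> R" "z = a * y n" by (auto simp: J_def)
      then have "z = (a * \<pi>) * y (Suc n)" using ystep[of n] by simp
      then show "z \<in> J (Suc n)" unfolding J_def using subring_mult[OF sR a(1) p(1)] by blast
    qed
    have Jmono: "J m \<subseteq> J n" if "m \<le> n" for m n using that Jstep by (rule lift_Suc_mono_le[rotated])
    have "ideal R (\<Union>n. J n)"
      unfolding ideal_def
    proof (intro conjI ballI)
      show "(\<Union>n. J n) \<subseteq> R" "0 \<in> (\<Union>n. J n)" using ideal_subset[OF J] ideal_0[OF J] by blast+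
      show "a * z \<in> (\<Union>n. J n)" if "a \<in> R" "z \<in> (\<Union>n. J n)" for a z
        using that ideal_mult[OF J] by blast
      show "z - w \<in> (\<Union>n. J n)" if zw: "z \<in> (\<Union>n. J n)" "w \<in> (\<Union>n. J n)" for z w
      proof -
        obtain m n where "z \<in> J m" "w \<in> J n" using zw by blast
        then have "z \<in> J (max m n)" "w \<in> J (max m n)" using Jmono by (meson max.cobounded1 max.cobounded2 subsetD)+
        then show ?thesis using ideal_diff[OF J] by blast
      qed
    qed
    then obtain T where T: "finite T" "(\<Union>n. J n) = ideal R hull T"
      using noeth unfolding noetherian_def by metis
    have "T \<subseteq> (\<Union>n. J n)" using T(2) hull_subset by metis
    with T(1) have "\<exists>n. T \<subseteq> J n"
    proof (induction T rule: finite_induct)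
      case (insert z T)
      then obtain m n where "z \<in> J m" "T \<subseteq> J n" by blast
      then have "z \<in> J (max m n)" "T \<subseteq> J (max m n)" using Jmono by (meson max.cobounded1 max.cobounded2 subsetD subset_trans)+
      then show ?case by blast
    qed simp
    then obtain n where "T \<subseteq> J n" by blast
    then have "(\<Union>n. J n) \<subseteq> J n" using T(2) J[of n] hull_minimal by metis
    moreover have "y (Suc n) \<in> J (Suc n)" unfolding J_def using subring_1[OF sR] by force
    ultimately have "y (Suc n) \<in> J n" by blast
    then obtain a where a: "a \<in> R" "y (Suc n) = a * y n" by (auto simp: J_def)
    then have "y (Suc n) = (a * \<pi>) * y (Suc n)" using ystep[of n] by simp
    then have "a * \<pi> = 1" using y0 by simp
    then have "inverse \<pi> = a" by (metis inverse_unique mult.commute)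
    then have "\<pi> \<notin> nonunits R" using a p0 by (simp add: nonunits_iff)
    then show False using pn y y0 by auto
  qed
  have "x \<in> R \<or> inverse x \<in> R" if xF: "x \<in> F" for x
  proof (cases "x = 0")
    case True
    then show ?thesis using subring_0[OF sR] by simp
  next
    case False
    obtain a b where ab: "x = a / b" "a \<in> R" "b \<in> R" using xF F(2) unfolding fraction_field_def by blast
    then have "a \<noteq> 0" "b \<noteq> 0" using False by auto
    then obtain m u n v where uv: "a = u * \<pi> ^ m" "b = v * \<pi> ^ n" "u \<in> R - nonunits R" "v \<in> R - nonunits R"
      using factor ab by metis
    have inv: "inverse u \<in> R" "inverse v \<in> R" "u \<in> R" "v \<in> R" using uv unit_in by blast+
    have nz: "u \<noteq> 0" "v \<noteq> 0" using unit_in uv by blast+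
    show ?thesis
    proof (cases "n \<le> m")
      case True
      have "x = u * inverse v * \<pi> ^ (m - n)"
        using True \<open>b \<noteq> 0\<close> \<open>a \<noteq> 0\<close> by (auto simp: ab uv power_diff field_simps)
      then show ?thesis using inv p subring_mult[OF sR] subring_power[OF sR] by metis
    next
      case False
      have "inverse x = v * inverse u * \<pi> ^ (n - m)"
        using False \<open>b \<noteq> 0\<close> \<open>a \<noteq> 0\<close> by (auto simp: ab uv power_diff field_simps)
      then show ?thesis using inv p subring_mult[OF sR] subring_power[OF sR] by metis
    qed
  qed
  then show ?thesis using sR F fraction_field_superset[OF sR] by (auto simp: valuation_ring_def)
qed

text \<open>Zorn's lemma yields an ideal maximal among the proper ones containing \<open>x\<close>,
  and maximal ideals are prime.\<close>

lemma exists_prime_ideal: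
  assumes A: "subring A" and x: "x \<in> nonunits A"
  obtains I where "prime_ideal A I" "x \<in> I"
proof -
  define \<I> where "\<I> = {I. ideal A I \<and> x \<in> I \<and> 1 \<notin> I}"
  have xA: "x \<in> A" using x by (simp add: nonunits_iff)
  have "(\<lambda>a. a * x) ` A \<in> \<I>"
  proof -
    have "1 \<notin> (\<lambda>a. a * x) ` A"
    proof
      assume "1 \<in> (\<lambda>a. a * x) ` A"
      then obtain a where "a \<in> A" "1 = a * x" by blast
      then have "inverse x = a" "x \<noteq> 0" by (auto intro: inverse_unique simp: mult.commute)
      then show False using x \<open>a \<in> A\<close> by (simp add: nonunits_iff)
    qed
    moreover have "x \<in> (\<lambda>a. a * x) ` A" using subring_1[OF A] by force
    ultimately show ?thesis using ideal_principal[OF A xA] by (simp add: \<I>_def)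
  qed
  moreover have "\<Union>\<C> \<in> \<I>" if "\<C> \<noteq> {}" "subset.chain \<I> \<C>" for \<C>
  proof -
    have C: "\<C> \<subseteq> \<I>" "\<And>I J. I \<in> \<C> \<Longrightarrow> J \<in> \<C> \<Longrightarrow> I \<subseteq> J \<or> J \<subseteq> I"
      using that(2) by (auto simp: subset_chain_def)
    have "ideal A (\<Union>\<C>)"
      unfolding ideal_def
    proof (intro conjI ballI)
      have id: "ideal A I" if "I \<in> \<C>" for I using that C(1) by (auto simp: \<I>_def)
      show "\<Union>\<C> \<subseteq> A" using ideal_subset[OF id] by blast
      show "0 \<in> \<Union>\<C>" using ideal_0[OF id] \<open>\<C> \<noteq> {}\<close> by blast
      show "a * z \<in> \<Union>\<C>" if "a \<in> A" "z \<in> \<Union>\<C>" for a z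
        using that ideal_mult[OF id] by blast
      show "z - w \<in> \<Union>\<C>" if zw: "z \<in> \<Union>\<C>" "w \<in> \<Union>\<C>" for z w
      proof -
        obtain I J where IJ: "z \<in> I" "w \<in> J" "I \<in> \<C>" "J \<in> \<C>" using zw by blast
        then obtain L where "L \<in> \<C>" "z \<in> L" "w \<in> L" using C(2)[of I J] by blast
        then show ?thesis using ideal_diff[OF id] by blast
      qed
    qed
    then show ?thesis using that C by (auto simp: \<I>_def)
  qed
  ultimately obtain I where I: "I \<in> \<I>" "\<And>J. J \<in> \<I> \<Longrightarrow> I \<subseteq> J \<Longrightarrow> J = I"
    using subset_Zorn_nonempty[of \<I>] by (metis empty_iff)
  have idI: "ideal A I" using I by (simp add: \<I>_def)
  have max: "\<exists>a\<in>A. \<exists>i\<in>I. 1 = a * y + i" if y: "y \<in> A" "y \<notin> I" for y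
  proof (rule ccontr)
    assume no: "\<not> ?thesis"
    define J where "J = {a * y + i | a i. a \<in> A \<and> i \<in> I}"
    have "ideal A J"
      unfolding ideal_def
    proof (intro conjI ballI)
      show "J \<subseteq> A" using y idI subring_add[OF A] subring_mult[OF A] by (auto simp: J_def ideal_def)
      have "0 = 0 * y + 0" by simp
      then show "0 \<in> J" using subring_0[OF A] ideal_0[OF idI] unfolding J_def by blast
      fix z w assume "z \<in> J" "w \<in> J"
      then obtain a i b j where *: "z = a * y + i" "w = b * y + j" "a \<in> A" "b \<in> A" "i \<in> I" "j \<in> I"
        unfolding J_def by blast
      then have "z - w = (a - b) * y + (i - j)" by (simp add: algebra_simps)
      then show "z - w \<in> J" using * subring_diff[OF A] ideal_diff[OF idI] unfolding J_def by blast
    next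
      fix c z assume "c \<in> A" "z \<in> J"
      then obtain a i where *: "z = a * y + i" "a \<in> A" "i \<in> I"
        unfolding J_def by blast
      then have "c * z = (c * a) * y + c * i" by (simp add: algebra_simps)
      then show "c * z \<in> J" using * subring_mult[OF A] ideal_mult[OF idI] \<open>c \<in> A\<close> unfolding J_def by blast
    qed
    moreover have "I \<subseteq> J"
    proof
      fix i assume "i \<in> I"
      moreover have "i = 0 * y + i" by simp
      ultimately show "i \<in> J" using subring_0[OF A] unfolding J_def by blast
    qed
    moreover have "y \<in> J"
    proof -
      have "y = 1 * y + 0" by simp
      then show ?thesis using subring_1[OF A] ideal_0[OF idI] unfolding J_def by blast
    qed
    moreover have "1 \<notin> J" using no by (auto simp: J_def)
    ultimately have "J = I" using I by (auto simp: \<I>_def)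
    then show False using \<open>y \<in> J\<close> y by blast
  qed
  have "prime_ideal A I"
    unfolding prime_ideal_def
  proof (intro conjI ballI impI idI)
    show "1 \<notin> I" using I by (simp add: \<I>_def)
    fix y z assume yz: "y \<in> A" "z \<in> A" "y * z \<in> I"
    show "y \<in> I \<or> z \<in> I"
    proof (rule ccontr)
      assume *: "\<not> ?thesis"
      then obtain a i where ai: "a \<in> A" "i \<in> I" "1 = a * y + i" using max yz by blast
      have "z = (a * y + i) * z" using ai by simp
      then have "z = a * (y * z) - ((- z) * i)" by (simp add: algebra_simps)
      moreover have "- z \<in> A" using subring_uminus[OF A] yz by blast
      then have "a * (y * z) - ((- z) * i) \<in> I" using ideal_mult[OF idI] ideal_diff[OF idI] ai yz by blast
      ultimately show False using * by simp
    qed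
  qed
  then show ?thesis using that I by (auto simp: \<I>_def)
qed

lemma localization_superset:
  assumes "subring A" "prime_ideal A I"
  shows "A \<subseteq> localization A I"
proof
  fix x assume "x \<in> A"
  moreover have "1 \<in> A - I" "x = x / 1" using assms by (auto simp: prime_ideal_def subring_1)
  ultimately show "x \<in> localization A I" unfolding localization_def by blast
qed

lemma localization_subset_fraction_field: "localization A I \<subseteq> fraction_field A"
  by (auto simp: localization_def fraction_field_def)

lemma integral_curve_cover:
  assumes C: "integral_curve K F C"
  obtains \<A> where "\<A> \<noteq> {}" "\<And>A. A \<in> \<A> \<Longrightarrow> affine_algebra K F A" "C = (\<Union>A\<in>\<A>. spec_points A)"
proof -
  have "\<exists>\<A>. \<A> \<noteq> {} \<and> (\<forall>A\<in>\<A>. affine_algebra K F A) \<and> C = (\<Union>A\<in>\<A>. spec_points A)"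
    using C unfolding integral_curve_def integral_scheme_def by blast
  then obtain \<A> where "\<A> \<noteq> {}" "\<forall>A\<in>\<A>. affine_algebra K F A" "C = (\<Union>A\<in>\<A>. spec_points A)"
    by blast
  then show thesis by (intro that[of \<A>]) auto
qed

lemma regular_curve_point:
  assumes C: "integral_curve K F C" "regular_scheme C" and R: "R \<in> C"
  shows "valuation_ring F R" "K \<subseteq> R"
proof -
  have K: "subfield K" and F: "subfield F" and trdeg: "transcendence_degree_one K F"
    using C by (auto simp: integral_curve_def integral_scheme_def)
  obtain A where A: "affine_algebra K F A" "R \<in> spec_points A"
    using C(1)[THEN integral_curve_cover] R by (metis UN_E)
  then obtain S I where S: "A = ring_adjoin K S" "fraction_field A = F" "R = localization A I" "prime_ideal A I"
    by (auto simp: affine_algebra_def spec_points_def)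
  have AR: "A \<subseteq> R" unfolding S(3) using S subring_ring_adjoin by (intro localization_superset) auto
  then show KR: "K \<subseteq> R" using S ring_adjoin_base by blast
  have RF: "R \<subseteq> F" using S localization_subset_fraction_field by blast
  have reg: "regular_local_ring R" using C R by (simp add: regular_scheme_def)
  then have sR: "subring R" by (simp add: regular_local_ring_def local_ring_def)
  have "fraction_field R = F"
    using fraction_field_mono[OF AR] S fraction_field_least[OF F RF] by blast
  then show "valuation_ring F R"
    using regular_local_ring_valuation_ring[OF reg F] krull_dim_le_one[OF K sR KR RF trdeg] by blast
qed

text \<open>By Zariski's lemma an affine chart is not a field, so some prime contains a nonzero
  nonunit. The local ring there is a point of the curve properly contained in
  \<open>F\<close>.\<close>

lemma closed_point_not_generic:
  assumes C: "integral_curve K F C" "regular_scheme C" and P: "closed_point C P"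
  shows "P \<noteq> F"
proof
  assume PF: "P = F"
  have K: "subfield K" and F: "subfield F" and trdeg: "transcendence_degree_one K F"
    using C by (auto simp: integral_curve_def integral_scheme_def)
  obtain A where A: "affine_algebra K F A" "spec_points A \<subseteq> C"
    using integral_curve_cover[OF C(1)] by (metis UN_upper ex_in_conv)
  then obtain S where S: "finite S" "A = ring_adjoin K S" "fraction_field A = F"
    by (auto simp: affine_algebra_def)
  have sA: "subring A" using S subring_ring_adjoin by simp
  have "A \<noteq> F" using finitely_generated_not_field[OF K F trdeg S(1)] S(2) by blast
  then have "\<not> subfield A" using S fraction_field_subfield by metis
  then obtain x where x: "x \<in> nonunits A" "x \<noteq> 0" using sA by (auto simp: subfield_def nonunits_iff) (metis inverse_zero)
  then obtain I where I: "prime_ideal A I" "x \<in> I" using exists_prime_ideal[OF sA] by blast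
  have "localization A I \<in> C" using A I by (auto simp: spec_points_def)
  moreover have "localization A I \<subseteq> P" using PF S localization_subset_fraction_field by metis
  ultimately have "localization A I = F" using P PF by (auto simp: closed_point_def)
  moreover have "inverse x \<in> F"
    using x S(3) fraction_field_superset[OF sA] subfield_inverse[OF F] by (auto simp: nonunits_iff)
  ultimately obtain a b where ab: "inverse x = a / b" "a \<in> A" "b \<in> A - I"
    unfolding localization_def by blast
  moreover have "b \<noteq> 0" using ab I by (auto simp: prime_ideal_def ideal_def)
  ultimately have "b = a * x" using x by (simp add: field_simps)
  then show False using ab I by (auto simp: prime_ideal_def ideal_def)
qed

section \<open>Purely inseparable extensions\<close>

lemma poly_over_coeff: "f \<in> poly_over A \<Longrightarrow> coeff f i \<in> A"
  by (simp add: poly_over_def)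

lemma degree_pderiv_le: "degree (pderiv f) \<le> degree (f :: 'a::idom poly) - 1"
  by (rule degree_le) (auto simp: coeff_pderiv coeff_eq_0)

locale char_p =
  fixes p :: nat and tp :: "'l::field itself"
  assumes char: "CHAR('l) = p" and p_pos: "p > 0"
begin

lemma prime_p: "prime p"
  using prime_CHAR_semidom[where 'a='l] char p_pos by simp

lemma of_nat_p: "of_nat p = (0 :: 'l)"
  using of_nat_CHAR[where 'a='l] char by simp

lemma of_nat_eq_0: "of_nat n = (0 :: 'l) \<longleftrightarrow> p dvd n"
  using of_nat_eq_0_iff_char_dvd[where 'a='l] char by simp

lemma frob_add: "(x + y :: 'l) ^ (p ^ n) = x ^ (p ^ n) + y ^ (p ^ n)"
  using freshmans_dream'[of "p ^ n" n x y] char prime_p by simp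

lemma frob_sum: "(sum f A :: 'l) ^ (p ^ n) = (\<Sum>i\<in>A. f i ^ (p ^ n))"
  using freshmans_dream_sum'[of "p ^ n" n f A] char prime_p by simp

lemma frob_diff: "(x - y :: 'l) ^ (p ^ n) = x ^ (p ^ n) - y ^ (p ^ n)"
  using frob_add[of "x - y" y n] by simp

lemma frob_inj: "(x :: 'l) ^ (p ^ n) = y ^ (p ^ n) \<Longrightarrow> x = y"
  using frob_diff[of x y n] by simp

lemmas frob_add1 = frob_add[of _ _ 1, simplified]
  and frob_diff1 = frob_diff[of _ _ 1, simplified]
  and frob_sum1 = frob_sum[of _ _ 1, simplified]
  and frob_inj1 = frob_inj[of _ 1, simplified]

text \<open>In characteristic \<open>p\<close> a vanishing derivative leaves only exponents
  divisible by \<open>p\<close>, so \<open>f\<close> is a polynomial in X^p.\<close>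

lemma poly_pderiv_0:
  fixes f :: "'l poly"
  assumes K: "0 \<in> K" and f: "f \<in> poly_over K" "pderiv f = 0" "degree f > 0"
  obtains g where "g \<in> poly_over K" "g \<noteq> 0" "degree g < degree f" "\<And>c. poly f c = poly g (c ^ p)"
proof -
  define d where "d = degree f"
  have f0: "coeff f i = 0" if "\<not> p dvd i" for i
  proof (cases i)
    case (Suc j)
    have "of_nat (Suc j) * coeff f (Suc j) = 0" using f(2) by (metis coeff_0 coeff_pderiv)
    then show ?thesis using that of_nat_eq_0[of i] Suc by simp
  qed (use that in simp)
  have "coeff f d \<noteq> 0" using f(3) by (auto simp: d_def)
  then have "p dvd d" using f0 by blast
  then obtain m where m: "d = p * m" by blast
  have m0: "m > 0" using f(3) m by (auto simp: d_def intro: gr0I)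
  define g where "g = (\<Sum>j\<le>m. monom (coeff f (p * j)) j)"
  have coeff_g: "coeff g j = (if j \<le> m then coeff f (p * j) else 0)" for j
    by (simp add: g_def coeff_sum)
  have "g \<in> poly_over K" using f(1) K by (simp add: poly_over_def coeff_g)
  moreover have "coeff g m \<noteq> 0" using \<open>coeff f d \<noteq> 0\<close> m by (simp add: coeff_g)
  then have "g \<noteq> 0" by auto
  moreover have "degree g \<le> m" by (rule degree_le) (simp add: coeff_g)
  then have "degree g < degree f"
    using m m0 prime_gt_1_nat[OF prime_p] by (simp add: d_def[symmetric])
      (metis le_less_trans n_less_m_mult_n)
  moreover have "poly f c = poly g (c ^ p)" for c
  proof -
    have "poly f c = (\<Sum>i\<in>{..d}. coeff f i * c ^ i)" by (simp add: poly_altdef d_def)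
    also have "\<dots> = (\<Sum>i\<in>(*) p ` {..m}. coeff f i * c ^ i)"
    proof (rule sum.mono_neutral_right)
      show "\<forall>i\<in>{..d} - (*) p ` {..m}. coeff f i * c ^ i = 0"
      proof
        fix i assume i: "i \<in> {..d} - (*) p ` {..m}"
        have "\<not> p dvd i"
        proof
          assume "p dvd i"
          then obtain j where "i = p * j" by blast
          then show False using i m p_pos by auto
        qed
        then show "coeff f i * c ^ i = 0" using f0 by simp
      qed
    qed (use m in auto)
    also have "\<dots> = (\<Sum>j\<le>m. coeff f (p * j) * c ^ (p * j))"
      using p_pos by (subst sum.reindex) (auto simp: inj_on_def)
    finally show ?thesis by (simp add: g_def poly_sum poly_monom power_mult)
  qed
  ultimately show ?thesis using that by blast
qed

text \<open>Induction on the degree. If the derivative vanishes, pass to \<open>c ^ p\<close>; if it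
  shares a factor with \<open>f\<close>, split \<open>f\<close>; otherwise \<open>f\<close> is
  separable and a linear factor over \<open>K\<close> splits off.\<close>

lemma separably_closed_radicial_poly:
  fixes K :: "'l set"
  assumes K: "subfield K" "separably_closed K"
  shows "f \<in> poly_over K \<Longrightarrow> f \<noteq> 0 \<Longrightarrow> poly f c = 0 \<Longrightarrow> \<exists>n. c ^ (p ^ n) \<in> K"
proof (induction "degree f" arbitrary: f c rule: less_induct)
  case less
  note sK = subfield_subring[OF K(1)]
  have deg: "degree f > 0"
  proof (rule ccontr)
    assume "\<not> ?thesis"
    then obtain a where "f = [:a:]" by (metis degree_eq_zeroE gr0I)
    then show False using less.prems by simp
  qed
  have split: "\<exists>n. c ^ (p ^ n) \<in> K" if f: "f = d * e" "degree d < degree f" "degree e < degree f"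
    "d \<in> poly_over K" "e \<in> poly_over K" for d e
  proof -
    have "poly d c = 0 \<or> poly e c = 0" using less.prems f by simp
    moreover have "d \<noteq> 0" "e \<noteq> 0" using less.prems f by auto
    ultimately show ?thesis using less.hyps f by blast
  qed
  show ?case
  proof (cases "pderiv f = 0")
    case True
    then obtain g where g: "g \<in> poly_over K" "g \<noteq> 0" "degree g < degree f" "poly g (c ^ p) = 0"
      using poly_pderiv_0[OF subring_0[OF sK] less.prems(1) _ deg] less.prems(3) by metis
    then obtain n where "(c ^ p) ^ (p ^ n) \<in> K" using less.hyps by blast
    then have "c ^ (p ^ Suc n) \<in> K" by (simp flip: power_mult)
    then show ?thesis by blast
  next
    case False
    have f': "pderiv f \<in> poly_over K" using less.prems poly_over_pderiv[OF sK] by blast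
    obtain d a b where d: "d \<in> poly_over K" "d dvd f" "d dvd pderiv f" "d = a * f + b * pderiv f"
      using poly_over_bezout[OF K(1) less.prems(1) f'] by blast
    have fd: "f = d * (f div d)" using d by simp
    have ed: "f div d \<in> poly_over K" using poly_over_divmod(1)[OF K(1) d(1) less.prems(1)] .
    show ?thesis
    proof (cases "degree d = 0")
      case True
      have "d \<noteq> 0" using fd less.prems by auto
      then have "is_unit d" using True by (simp add: is_unit_iff_degree)
      have "coprime f (pderiv f)"
      proof (rule coprimeI)
        fix e assume "e dvd f" "e dvd pderiv f"
        then have "e dvd d" unfolding d(4) by simp
        then show "is_unit e" using \<open>is_unit d\<close> dvd_trans by blast
      qed
      then obtain r where r: "r \<in> K" "poly f r = 0"
        using K(2) deg less.prems(1) poly_over_iff[OF subring_0[OF sK]] unfolding separably_closed_def by blast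
      define l where "l = [:- r, 1:]"
      have l: "l \<in> poly_over K" unfolding l_def
        using r by (intro poly_over_pCons[OF sK] poly_over_0[OF sK] subring_uminus[OF sK] subring_1[OF sK])
      have "l dvd f" using r by (simp add: l_def poly_eq_0_iff_dvd)
      then have fl: "f = l * (f div l)" by simp
      have "f div l \<in> poly_over K" using poly_over_divmod(1)[OF K(1) l less.prems(1)] .
      moreover have "f div l \<noteq> 0" using fl less.prems by auto
      moreover have "degree f = degree l + degree (f div l)"
        using fl \<open>f div l \<noteq> 0\<close> by (metis degree_mult_eq less.prems(2) mult_zero_left)
      then have "degree (f div l) < degree f" by (simp add: l_def)
      moreover have "poly l c * poly (f div l) c = 0" using fl less.prems(3) by (metis poly_mult)
      then have "c = r \<or> poly (f div l) c = 0" by (simp add: l_def)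
      moreover have "r ^ (p ^ 0) \<in> K" using r by simp
      ultimately show ?thesis using less.hyps by metis
    next
      case dpos: False
      have "degree d \<le> degree (pderiv f)" using d(3) False by (rule dvd_imp_degree_le)
      moreover have "degree (pderiv f) < degree f"
        using deg degree_pderiv_le[of f] by linarith
      moreover have "f div d \<noteq> 0" "d \<noteq> 0" using fd less.prems by auto
      then have "degree f = degree d + degree (f div d)" using fd by (metis degree_mult_eq)
      ultimately show ?thesis using split[OF fd _ _ d(1) ed] dpos by simp
    qed
  qed
qed

text \<open>The perfect closure of \<open>A\<close> inside the ambient field. Base changes and
  normalizations of a local ring will lie in its closure, so that each has a single point over
  it.\<close>

definition proot :: "'l set \<Rightarrow> 'l set" where
  "proot A = {x. \<exists>n. x ^ (p ^ n) \<in> A}"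

lemma proot_superset: "A \<subseteq> proot A"
  unfolding proot_def by (auto intro!: exI[of _ 0])

lemma proot_mono: "A \<subseteq> B \<Longrightarrow> proot A \<subseteq> proot B"
  unfolding proot_def by blast

lemma proot_eventually:
  assumes A: "subring A" and x: "x ^ (p ^ n) \<in> A" "n \<le> m"
  shows "x ^ (p ^ m) \<in> A"
proof -
  have "x ^ (p ^ m) = (x ^ (p ^ n)) ^ (p ^ (m - n))"
    using x(2) by (simp flip: power_mult power_add)
  then show ?thesis using subring_power[OF A x(1)] by simp
qed

lemma proot_uniform:
  assumes A: "subring A"
  shows "finite X \<Longrightarrow> X \<subseteq> proot A \<Longrightarrow> \<exists>n. \<forall>x\<in>X. x ^ (p ^ n) \<in> A"
proof (induction X rule: finite_induct)
  case (insert x X)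
  then obtain n m where "\<forall>y\<in>X. y ^ (p ^ n) \<in> A" "x ^ (p ^ m) \<in> A" by (auto simp: proot_def)
  then have "\<forall>y\<in>insert x X. y ^ (p ^ max n m) \<in> A"
    using proot_eventually[OF A] by (metis insert_iff max.cobounded1 max.cobounded2)
  then show ?case by blast
qed simp

lemma proot_proot: assumes A: "subring A" shows "proot (proot A) = proot A"
proof
  show "proot (proot A) \<subseteq> proot A"
  proof
    fix x assume "x \<in> proot (proot A)"
    then obtain n m where "(x ^ (p ^ n)) ^ (p ^ m) \<in> A" by (auto simp: proot_def)
    then have "x ^ (p ^ (n + m)) \<in> A" by (simp flip: power_mult power_add)
    then show "x \<in> proot A" by (auto simp: proot_def)
  qed
qed (rule proot_superset)

lemma subring_proot: assumes A: "subring A" shows "subring (proot A)"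
proof (rule subringI)
  show "1 \<in> proot A" using subring_1[OF A] proot_superset by blast
  fix x y assume "x \<in> proot A" "y \<in> proot A"
  then obtain n where "x ^ (p ^ n) \<in> A" "y ^ (p ^ n) \<in> A"
    using proot_uniform[OF A, of "{x, y}"] by auto
  then show "x - y \<in> proot A" "x * y \<in> proot A"
    using subring_diff[OF A] subring_mult[OF A] unfolding proot_def
    by (auto simp: frob_diff power_mult_distrib intro!: exI[of _ n])
qed

lemma subfield_proot: assumes A: "subfield A" shows "subfield (proot A)"
proof -
  have "inverse x \<in> proot A" if "x \<in> proot A" for x
    using that subfield_inverse[OF A] by (auto simp: proot_def power_inverse)
  then show ?thesis using subring_proot[OF subfield_subring[OF A]] by (simp add: subfield_def)
qed

text \<open>For q = p^n, the inverse of \<open>x\<close> is x^(q-1) times the \<open>q\<close>-th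
  power of that inverse.\<close>

lemma proot_unit:
  assumes A: "subring A" and x: "x \<in> A" "inverse x \<in> proot A"
  shows "inverse x \<in> A"
proof -
  obtain n where "inverse x ^ (p ^ n) \<in> A" using x by (auto simp: proot_def)
  moreover have "inverse x = x ^ (p ^ n - 1) * inverse x ^ (p ^ n)"
  proof (cases "x = 0")
    case False
    have "x ^ (p ^ n) = x ^ (p ^ n - 1) * x"
      using p_pos by (metis power_minus_mult zero_less_power)
    then show ?thesis using False by (simp add: field_simps power_inverse)
  qed (use p_pos in simp)
  ultimately show ?thesis using subring_mult[OF A subring_power[OF A x(1)]] by metis
qed

lemma valuation_ring_proot:
  assumes V: "valuation_ring F V" and x: "x \<in> F" "x \<in> proot V"
  shows "x \<in> V"
proof (rule ccontr)
  assume "x \<notin> V"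
  then have "inverse x \<in> V" using V x by (auto simp: valuation_ring_def)
  then have "inverse (inverse x) \<in> V"
    using proot_unit[OF valuation_ring_subring[OF V], of "inverse x"] x by simp
  then show False using \<open>x \<notin> V\<close> by simp
qed

lemma nonunits_radicial:
  assumes A: "subring A" and B: "A \<subseteq> B" "B \<subseteq> proot A"
  shows "nonunits B \<inter> A = nonunits A"
  using subsetD[OF B(1)] subsetD[OF B(2)] proot_unit[OF A] by (auto simp: nonunits_iff)

lemma nonunits_power:
  assumes B: "subring B" and x: "x \<in> B"
  shows "x ^ (p ^ n) \<in> nonunits B \<longleftrightarrow> x \<in> nonunits B"
proof
  assume "x ^ (p ^ n) \<in> nonunits B"
  then show "x \<in> nonunits B"
    using x subring_power[OF B, of "inverse x" "p ^ n"] by (auto simp: nonunits_iff power_inverse)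
next
  assume "x \<in> nonunits B"
  then have "x ^ (p ^ n - 1) * x \<in> nonunits B"
    using nonunits_mult[OF B] subring_power[OF B x] by blast
  then show "x ^ (p ^ n) \<in> nonunits B" using p_pos by (metis power_minus_mult zero_less_power)
qed

lemma local_ring_radicial:
  assumes A: "local_ring A" and B: "subring B" "A \<subseteq> B" "B \<subseteq> proot A"
  shows "local_ring B"
proof -
  have sA: "subring A" using A by (simp add: local_ring_def)
  have "x - y \<in> nonunits B" if xy: "x \<in> nonunits B" "y \<in> nonunits B" for x y
  proof -
    have xyB: "x \<in> B" "y \<in> B" using xy by (auto simp: nonunits_iff)
    then obtain n where n: "x ^ (p ^ n) \<in> A" "y ^ (p ^ n) \<in> A"
      using proot_uniform[OF sA, of "{x, y}"] B by auto
    then have "x ^ (p ^ n) \<in> nonunits A" "y ^ (p ^ n) \<in> nonunits A"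
      using nonunits_radicial[OF sA B(2,3)] nonunits_power[OF B(1)] xy xyB by blast+
    then have "(x - y) ^ (p ^ n) \<in> nonunits A"
      using A local_ring_nonunits_diff by (simp add: frob_diff)
    then have "(x - y) ^ (p ^ n) \<in> nonunits B"
      using nonunits_radicial[OF sA B(2,3)] by blast
    then show ?thesis using nonunits_power[OF B(1) subring_diff[OF B(1) xyB]] by simp
  qed
  then show ?thesis using B(1) nonunits_mult[OF B(1)] zero_in_nonunits[OF B(1)]
    by (auto simp: local_ring_def ideal_def nonunits_iff)
qed

lemma localization_nonunits:
  assumes "subring (B :: 'l set)"
  shows "localization B (nonunits B) = B"
proof
  show "localization B (nonunits B) \<subseteq> B"
    using unit_in subring_mult[OF assms] by (fastforce simp: localization_def divide_inverse)
  have "x = x / 1" for x :: 'l by simp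
  then show "B \<subseteq> localization B (nonunits B)"
    using subring_1[OF assms] one_notin_nonunits[OF assms] unfolding localization_def by blast
qed

text \<open>A prime contains \<open>x\<close> exactly when it contains the power of \<open>x\<close>
  lying in \<open>A\<close>. So the only prime over the maximal ideal consists of the nonunits, and
  localizing there changes nothing.\<close>

lemma points_above_radicial:
  assumes A: "local_ring A" and B: "subring B" "A \<subseteq> B" "B \<subseteq> proot A"
  shows "points_above B A = {B}"
proof -
  have sA: "subring A" using A by (simp add: local_ring_def)
  note nu = nonunits_radicial[OF sA B(2,3)]
  have "prime_ideal B (nonunits B)" using prime_ideal_nonunits local_ring_radicial assms by blast
  moreover have "I = nonunits B" if I: "prime_ideal B I" "I \<inter> A = nonunits A" for I
  proof -
    have "x \<in> I \<longleftrightarrow> x \<in> nonunits B" if x: "x \<in> B" for x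
    proof -
      obtain n where n: "x ^ (p ^ n) \<in> A" using x B by (auto simp: proot_def)
      have "x ^ k \<in> I \<longleftrightarrow> x \<in> I" if "k > 0" for k
        using that
      proof (induction k)
        case (Suc k)
        then show ?case
        proof (cases "k = 0")
          case False
          have "x * x ^ k \<in> I \<longleftrightarrow> x \<in> I \<or> x ^ k \<in> I"
            using I x subring_power[OF B(1) x, of k] unfolding prime_ideal_def ideal_def
            by (metis mult.commute)
          then show ?thesis using Suc False by simp
        qed simp
      qed simp
      then have "x \<in> I \<longleftrightarrow> x ^ (p ^ n) \<in> I" using p_pos by simp
      also have "\<dots> \<longleftrightarrow> x ^ (p ^ n) \<in> nonunits A" using n I by blast
      also have "\<dots> \<longleftrightarrow> x ^ (p ^ n) \<in> nonunits B" using n nu by blast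
      finally show ?thesis using nonunits_power[OF B(1) x] by simp
    qed
    moreover have "I \<subseteq> B" using I by (simp add: prime_ideal_def ideal_def)
    ultimately show ?thesis by (auto simp: nonunits_iff)
  qed
  ultimately show ?thesis
    unfolding points_above_def using nu localization_nonunits[OF B(1)] by blast
qed

lemma valuation_ring_integrally_closed:
  assumes V: "valuation_ring F V" and y: "y \<in> F"
    and f: "f \<in> poly_over V" "lead_coeff f = 1" "poly f y = 0"
  shows "y \<in> V"
proof (rule ccontr)
  assume "y \<notin> V"
  note sV = valuation_ring_subring[OF V]
  define z where "z = inverse y"
  have z: "z \<in> V" using \<open>y \<notin> V\<close> V y by (auto simp: valuation_ring_def z_def)
  have y0: "y \<noteq> 0" using \<open>y \<notin> V\<close> subring_0[OF sV] by auto
  define d where "d = degree f"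
  have d0: "d > 0"
  proof (rule ccontr)
    assume "\<not> d > 0"
    then obtain a where "f = [:a:]" by (metis d_def degree_eq_zeroE gr0I)
    then show False using f by simp
  qed
  \<comment> \<open>Dividing the integral equation by y^(d-1) leaves \<open>y\<close> plus a
    polynomial in \<open>z\<close> over \<open>V\<close>.\<close>
  have "0 = z ^ (d - 1) * poly f y" using f by simp
  also have "\<dots> = (\<Sum>i\<le>d. coeff f i * (z ^ (d - 1) * y ^ i))"
    by (simp add: poly_altdef d_def sum_distrib_left mult.left_commute)
  also have "\<dots> = (\<Sum>i<d. coeff f i * (z ^ (d - 1) * y ^ i)) + z ^ (d - 1) * y ^ d"
    using f(2) by (simp add: lessThan_Suc_atMost[symmetric] d_def)
  also have "z ^ (d - 1) * y ^ d = y"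
    using d0 y0 by (cases d) (auto simp: z_def power_inverse)
  also have "(\<Sum>i<d. coeff f i * (z ^ (d - 1) * y ^ i)) = (\<Sum>i<d. coeff f i * z ^ (d - 1 - i))"
  proof (intro sum.cong refl)
    fix i assume "i \<in> {..<d}"
    then have "z ^ (d - 1) = z ^ (d - 1 - i) * z ^ i" by (simp flip: power_add)
    then show "coeff f i * (z ^ (d - 1) * y ^ i) = coeff f i * z ^ (d - 1 - i)"
      using y0 by (simp add: z_def power_inverse)
  qed
  finally have "y = - (\<Sum>i<d. coeff f i * z ^ (d - 1 - i))" by (simp add: eq_neg_iff_add_eq_0 add.commute)
  also have "\<dots> \<in> V"
    using f(1) z by (intro subring_uminus[OF sV] subring_sum[OF sV] subring_mult[OF sV] subring_power[OF sV] poly_over_coeff)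
  finally show False using \<open>y \<notin> V\<close> by simp
qed

text \<open>An element with a power \<open>x ^ (p ^ n)\<close> in \<open>A\<close> is a root of a
  monic binomial. Conversely, a high Frobenius power of the coefficients turns an integral equation
  into one over \<open>R\<close>, which is integrally closed.\<close>

lemma integral_closure_radicial:
  assumes F: "subfield F" and R: "valuation_ring F R"
    and A: "subring A" "A \<subseteq> proot R" "R \<subseteq> proot A"
  shows "integral_closure A = fraction_field A \<inter> proot R"
proof -
  note sR = valuation_ring_subring[OF R]
  have Fr: "fraction_field A \<subseteq> proot F"
    using A(2) proot_mono[OF valuation_ring_sub[OF R]] subfield_proot[OF F] by (intro fraction_field_least) auto
  have "integral_over A x" if x: "x \<in> proot R" for x
  proof -
    have "x \<in> proot A" using x proot_mono[OF A(3)] proot_proot[OF A(1)] by blast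
    then obtain n where n: "x ^ (p ^ n) \<in> A" by (auto simp: proot_def)
    define f where "f = monom 1 (p ^ n) - [:x ^ (p ^ n):]"
    have "f \<in> poly_over A" unfolding f_def
      using n by (intro poly_over_diff[OF A(1)] poly_over_monom[OF A(1)] poly_over_const[OF A(1)] subring_1[OF A(1)])
    moreover have "degree f = p ^ n" "lead_coeff f = 1"
    proof -
      have "degree [:x ^ (p ^ n):] < degree (monom (1::'l) (p ^ n))" using p_pos by (simp add: degree_monom_eq)
      then have "degree f = degree (monom (1::'l) (p ^ n))" unfolding f_def by (metis degree_add_eq_left degree_minus diff_conv_add_uminus)
      then show d: "degree f = p ^ n" by (simp add: degree_monom_eq)
      show "lead_coeff f = 1" unfolding d using p_pos by (simp add: f_def coeff_pCons split: nat.split)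
    qed
    moreover have "poly f x = 0" by (simp add: f_def poly_monom)
    ultimately show ?thesis using poly_over_iff[OF subring_0[OF A(1)]] by (auto simp: integral_over_def)
  qed
  moreover have "x \<in> proot R" if x: "x \<in> fraction_field A" "integral_over A x" for x
  proof -
    obtain f where f: "f \<in> poly_over A" "lead_coeff f = 1" "poly f x = 0"
      using x(2) poly_over_iff[OF subring_0[OF A(1)]] by (auto simp: integral_over_def)
    have "coeff f ` {..degree f} \<subseteq> proot R" using f(1) A(2) by (auto simp: poly_over_def)
    then obtain n where n: "\<And>i. i \<le> degree f \<Longrightarrow> coeff f i ^ (p ^ n) \<in> R"
      using proot_uniform[OF sR, of "coeff f ` {..degree f}"] by auto
    obtain k where k: "x ^ (p ^ k) \<in> F" using x Fr by (auto simp: proot_def)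
    define m where "m = max n k"
    have m: "coeff f i ^ (p ^ m) \<in> R" "x ^ (p ^ m) \<in> F" if "i \<le> degree f" for i
      using proot_eventually[OF sR n[OF that]] proot_eventually[OF subfield_subring[OF F] k] by (auto simp: m_def)
    define g where "g = (\<Sum>i\<le>degree f. monom (coeff f i ^ (p ^ m)) i)"
    have coeff_g: "coeff g i = (if i \<le> degree f then coeff f i ^ (p ^ m) else 0)" for i
      by (simp add: g_def coeff_sum)
    have "g \<in> poly_over R" using m subring_0[OF sR] by (auto simp: poly_over_def coeff_g)
    moreover have "lead_coeff g = 1"
    proof -
      have "coeff g (degree f) = 1" using f by (simp add: coeff_g)
      moreover have "degree g \<le> degree f" by (rule degree_le) (simp add: coeff_g)
      ultimately show ?thesis by (metis coeff_0 le_antisym le_degree zero_neq_one)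
    qed
    moreover have "poly g (x ^ (p ^ m)) = 0"
    proof -
      have "poly g (x ^ (p ^ m)) = (\<Sum>i\<le>degree f. (coeff f i * x ^ i) ^ (p ^ m))"
        by (simp add: g_def poly_sum poly_monom power_mult_distrib flip: power_mult) (simp add: mult.commute)
      also have "\<dots> = poly f x ^ (p ^ m)" by (simp add: poly_altdef frob_sum)
      finally show ?thesis using f p_pos by simp
    qed
    ultimately have "x ^ (p ^ m) \<in> R"
      using valuation_ring_integrally_closed[OF R] m(2) by blast
    then show ?thesis by (auto simp: proot_def)
  qed
  ultimately show ?thesis by (auto simp: integral_closure_def)
qed

text \<open>High Frobenius powers transfer the domination of \<open>A\<close> by \<open>S\<close> to
  that of \<open>P\<close> by \<open>R\<close>, and valuation rings are maximal for it. This is the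
  uniqueness behind each \<open>point_over\<close>.\<close>

lemma dominates_unique:
  assumes R: "valuation_ring F R" and P: "valuation_ring F P"
    and S: "subring S" "S \<subseteq> proot R" "R \<subseteq> proot S"
    and A: "subring A" "A \<subseteq> proot P" "P \<subseteq> proot A"
    and dom: "dominates S A"
  shows "R = P"
proof -
  note sR = valuation_ring_subring[OF R] and sP = valuation_ring_subring[OF P]
  have AS: "A \<subseteq> S" "nonunits S \<inter> A = nonunits A" using dom by (auto simp: dominates_def)
  have PR: "P \<subseteq> R"
  proof
    fix x assume x: "x \<in> P"
    then have "x \<in> proot (proot R)" using A(3) AS(1) S(2) proot_mono by blast
    then show "x \<in> R" using valuation_ring_proot[OF R] x valuation_ring_sub[OF P] proot_proot[OF sR] by blast
  qed
  moreover have "nonunits P \<subseteq> nonunits R"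
  proof
    fix x assume x: "x \<in> nonunits P"
    then have xP: "x \<in> P" by (simp add: nonunits_iff)
    then obtain n where n: "x ^ (p ^ n) \<in> A" using A(3) by (auto simp: proot_def)
    have "x ^ (p ^ n) \<in> nonunits P" using nonunits_power[OF sP xP] x by blast
    then have "x ^ (p ^ n) \<in> nonunits A"
      using n proot_unit[OF sP, of "x ^ (p ^ n)"] A(2) by (auto simp: nonunits_iff)
    then have "x ^ (p ^ n) \<in> nonunits S" using AS n by blast
    moreover have "x ^ (p ^ n) \<in> R" using xP PR subring_power[OF sR] by blast
    ultimately have "x ^ (p ^ n) \<in> nonunits R"
      using proot_unit[OF S(1), of "x ^ (p ^ n)"] S(3) by (auto simp: nonunits_iff)
    then show "x \<in> nonunits R" using nonunits_power[OF sR] xP PR by blast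
  qed
  ultimately show ?thesis using dominates_valuation_ring_eq[OF P R] by simp
qed

lemma point_over_eqI:
  assumes "S \<in> X" "dominates S R" "\<And>T. T \<in> X \<Longrightarrow> dominates T R \<Longrightarrow> T = S"
  shows "point_over X R = S"
  unfolding point_over_def using assms by (intro the_equality) blast+

end

locale radicial_base = char_p p "TYPE('l)"
  for p :: nat and K k :: "'l::field set" +
  assumes K: "subfield K" and k: "subfield k" and Kk: "K \<subseteq> k" and kK: "k \<subseteq> proot K"
begin

lemma ring_adjoin_radicial:
  assumes R: "subring R" "K \<subseteq> R"
  shows "ring_adjoin k R \<subseteq> proot R"
  using kK proot_mono[OF R(2)] proot_superset by (intro ring_adjoin_least subring_proot R) blast+

text \<open>An element of k[F] has a Frobenius power in the field \<open>F\<close>, so its inverse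
  is radicial over k[F] and hence lies in it. The generated ring is already the compositum.\<close>

lemma subfield_ring_adjoin:
  assumes F: "subfield F" "K \<subseteq> F"
  shows "subfield (ring_adjoin k F)"
proof -
  have sF: "subring F" using F subfield_subring by blast
  have "inverse x \<in> ring_adjoin k F" if x: "x \<in> ring_adjoin k F" for x
  proof (rule proot_unit[OF subring_ring_adjoin x])
    have "x \<in> proot F" using x ring_adjoin_radicial[OF sF F(2)] by blast
    then have "inverse x \<in> proot F" using subfield_inverse[OF subfield_proot[OF F(1)]] by blast
    then show "inverse x \<in> proot (ring_adjoin k F)" using proot_mono[OF ring_adjoin_gens] by blast
  qed
  then show ?thesis using subring_ring_adjoin by (auto simp: subfield_def)
qed

lemma fraction_field_ring_adjoin:
  assumes F: "subfield F" "K \<subseteq> F" and R: "fraction_field R = F" "subring R"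
  shows "fraction_field (ring_adjoin k R) = ring_adjoin k F"
proof
  have "R \<subseteq> F" using R fraction_field_superset by blast
  then show "fraction_field (ring_adjoin k R) \<subseteq> ring_adjoin k F"
    by (intro fraction_field_least subfield_ring_adjoin F ring_adjoin_mono) auto
  have "F \<subseteq> fraction_field (ring_adjoin k R)" using R ring_adjoin_gens fraction_field_mono by blast
  moreover have "k \<subseteq> fraction_field (ring_adjoin k R)"
    using ring_adjoin_base fraction_field_superset[OF subring_ring_adjoin] by blast
  ultimately show "ring_adjoin k F \<subseteq> fraction_field (ring_adjoin k R)"
    by (intro ring_adjoin_least subfield_subring subfield_fraction_field subring_ring_adjoin)
qed

section \<open>Points over a point, for an abstract family of valuation rings: \<open>C\<close>, and
  later its normalized Frobenius curve\<close>

context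
  fixes F :: "'l set" and E :: "'l set set"
  assumes F: "subfield F" "K \<subseteq> F" and E: "\<And>R. R \<in> E \<Longrightarrow> valuation_ring F R" "\<And>R. R \<in> E \<Longrightarrow> K \<subseteq> R"
begin

lemma point_radicial:
  assumes R: "R \<in> E"
  shows "local_ring R" "ring_adjoin k R \<subseteq> proot R"
  using valuation_ring_local[OF F(1) E(1)[OF R]]
    ring_adjoin_radicial[OF valuation_ring_subring[OF E(1)[OF R]] E(2)[OF R]] .

lemma local_base_change:
  assumes R: "R \<in> E" shows "local_ring (ring_adjoin k R)"
  using local_ring_radicial[OF point_radicial(1)[OF R] subring_ring_adjoin ring_adjoin_gens point_radicial(2)[OF R]] .

lemma base_change_eq: "base_change k E = ring_adjoin k ` E"
proof -
  have "points_above (ring_adjoin k R) R = {ring_adjoin k R}" if "R \<in> E" for R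
    using points_above_radicial[OF point_radicial(1)[OF that] subring_ring_adjoin ring_adjoin_gens point_radicial(2)[OF that]] .
  then show ?thesis by (auto simp: base_change_def)
qed

lemma integral_closure_ring_adjoin:
  assumes R: "R \<in> E"
  shows "integral_closure (ring_adjoin k R) = ring_adjoin k F \<inter> proot R"
proof -
  have sR: "subring R" "K \<subseteq> R" "fraction_field R = F"
    using R E valuation_ring_subring valuation_ring_fraction_field[OF F(1)] by blast+
  have "R \<subseteq> proot (ring_adjoin k R)" using ring_adjoin_gens proot_superset by blast
  then show ?thesis
    using integral_closure_radicial[OF F(1) E(1)[OF R] subring_ring_adjoin ring_adjoin_radicial[OF sR(1,2)]]
      fraction_field_ring_adjoin[OF F sR(3,1)] by simp
qed

lemma normalization_radicial:
  assumes R: "R \<in> E"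
  shows "ring_adjoin k R \<subseteq> ring_adjoin k F \<inter> proot R"
    "ring_adjoin k F \<inter> proot R \<subseteq> proot (ring_adjoin k R)"
    "subring (ring_adjoin k F \<inter> proot R)"
proof -
  have sR: "subring R" "K \<subseteq> R" "R \<subseteq> F"
    using R E valuation_ring_subring valuation_ring_sub by blast+
  show "ring_adjoin k R \<subseteq> ring_adjoin k F \<inter> proot R"
    using ring_adjoin_radicial[OF sR(1,2)] ring_adjoin_mono[OF _ sR(3)] by blast
  show "ring_adjoin k F \<inter> proot R \<subseteq> proot (ring_adjoin k R)" using proot_mono[OF ring_adjoin_gens] by blast
  show "subring (ring_adjoin k F \<inter> proot R)" using subring_Int subring_ring_adjoin subring_proot[OF sR(1)] by blast
qed

lemma normalization_base_change_eq:
  "normalization (base_change k E) = (\<lambda>R. ring_adjoin k F \<inter> proot R) ` E"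
proof -
  have "points_above (integral_closure (ring_adjoin k R)) (ring_adjoin k R) = {ring_adjoin k F \<inter> proot R}"
    if R: "R \<in> E" for R
    unfolding integral_closure_ring_adjoin[OF R]
    using points_above_radicial[OF local_base_change[OF R]] normalization_radicial[OF R] by blast
  then show ?thesis unfolding normalization_def base_change_eq by auto
qed

lemma point_over_base_change:
  assumes P: "P \<in> E"
  shows "point_over (base_change k E) P = ring_adjoin k P"
proof (rule point_over_eqI)
  have *: "subring R" "K \<subseteq> R" if "R \<in> E" for R using that E valuation_ring_subring by blast+
  show "ring_adjoin k P \<in> base_change k E" using P base_change_eq by blast
  show "dominates (ring_adjoin k P) P"
    using nonunits_radicial[OF *(1)[OF P] ring_adjoin_gens ring_adjoin_radicial[OF *[OF P]]] ring_adjoin_gens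
    by (auto simp: dominates_def)
  fix T assume T: "T \<in> base_change k E" "dominates T P"
  then obtain R where R: "R \<in> E" "T = ring_adjoin k R" using base_change_eq by blast
  have "R = P"
  proof (rule dominates_unique[of F R P T P])
    show "valuation_ring F R" "valuation_ring F P" using R P E by blast+
    show "subring T" "T \<subseteq> proot R" using R subring_ring_adjoin point_radicial(2) by blast+
    show "R \<subseteq> proot T" using R ring_adjoin_gens proot_superset by blast
    show "subring P" "P \<subseteq> proot P" "dominates T P" using P * T proot_superset by blast+
  qed (rule proot_superset)
  then show "T = ring_adjoin k P" using R by simp
qed

lemma point_over_normalization:
  assumes P: "P \<in> E"
  shows "point_over (normalization (base_change k E)) P = ring_adjoin k F \<inter> proot P"
proof (rule point_over_eqI)
  have *: "subring R" "K \<subseteq> R" "R \<subseteq> F" if "R \<in> E" for R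
    using that E valuation_ring_subring valuation_ring_sub by blast+
  have sub: "R \<subseteq> ring_adjoin k F \<inter> proot R" if "R \<in> E" for R
    using *(3)[OF that] ring_adjoin_gens proot_superset by blast
  show "ring_adjoin k F \<inter> proot P \<in> normalization (base_change k E)"
    using P normalization_base_change_eq by blast
  show "dominates (ring_adjoin k F \<inter> proot P) P"
    using nonunits_radicial[OF *(1)[OF P] sub[OF P]] sub[OF P] by (simp add: dominates_def)
  fix T assume T: "T \<in> normalization (base_change k E)" "dominates T P"
  then obtain R where R: "R \<in> E" "T = ring_adjoin k F \<inter> proot R" using normalization_base_change_eq by blast
  have "R = P"
  proof (rule dominates_unique[of F R P T P])
    show "valuation_ring F R" "valuation_ring F P" using R P E by blast+
    show "subring T" "T \<subseteq> proot R" "R \<subseteq> proot T"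
      using R normalization_radicial(3) sub proot_superset by blast+
    show "subring P" "P \<subseteq> proot P" "dominates T P" using P * T proot_superset by blast+
  qed (rule proot_superset)
  then show "T = ring_adjoin k F \<inter> proot P" using R by simp
qed

lemma subfield_frobenius_image: "subfield (frobenius_image K F)"
  and frobenius_image_sub: "frobenius_image K F \<subseteq> F"
proof -
  have "(\<lambda>x. x ^ p) ` F \<subseteq> F" using subring_power[OF subfield_subring[OF F(1)]] by blast
  then show sub: "frobenius_image K F \<subseteq> F" unfolding frobenius_image_def char
    using F by (intro ring_adjoin_least subfield_subring) auto
  have "inverse x \<in> frobenius_image K F" if x: "x \<in> frobenius_image K F" for x
  proof (rule proot_unit[OF _ x])
    show "subring (frobenius_image K F)" unfolding frobenius_image_def by (rule subring_ring_adjoin)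
    have "inverse x \<in> F" using x sub F subfield_inverse by blast
    then have "inverse x ^ (p ^ 1) \<in> frobenius_image K F"
      using ring_adjoin_gens[of "(\<lambda>x. x ^ p) ` F" K] unfolding frobenius_image_def char by auto
    then show "inverse x \<in> proot (frobenius_image K F)" unfolding proot_def by blast
  qed
  then show "subfield (frobenius_image K F)"
    by (auto simp: subfield_def frobenius_image_def subring_ring_adjoin)
qed

lemma frobenius_image_radicial:
  assumes R: "R \<in> E"
  shows "frobenius_image K R \<subseteq> R" "R \<subseteq> proot (frobenius_image K R)" "subring (frobenius_image K R)"
    "fraction_field (frobenius_image K R) = frobenius_image K F"
proof -
  have sR: "subring R" "K \<subseteq> R" "R \<subseteq> F" "fraction_field R = F"
    using R E valuation_ring_subring valuation_ring_sub valuation_ring_fraction_field[OF F(1)] by blast+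
  show "frobenius_image K R \<subseteq> R" unfolding frobenius_image_def
    using sR subring_power by (intro ring_adjoin_least) blast+
  have pw: "x ^ p \<in> frobenius_image K R" if "x \<in> R" for x
    using that ring_adjoin_gens[of "(\<lambda>x. x ^ p) ` R" K] unfolding frobenius_image_def char by auto
  then show "R \<subseteq> proot (frobenius_image K R)"
    unfolding proot_def by (auto intro!: exI[of _ 1])
  show sub: "subring (frobenius_image K R)" unfolding frobenius_image_def by (rule subring_ring_adjoin)
  show "fraction_field (frobenius_image K R) = frobenius_image K F"
  proof
    show "fraction_field (frobenius_image K R) \<subseteq> frobenius_image K F"
    proof (intro fraction_field_least subfield_frobenius_image)
      show "frobenius_image K R \<subseteq> frobenius_image K F"
        unfolding frobenius_image_def using sR(3) by (intro ring_adjoin_mono image_mono) auto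
    qed
    note sf = subfield_subring[OF subfield_fraction_field[OF sub]]
    have "x ^ p \<in> fraction_field (frobenius_image K R)" if xF: "x \<in> F" for x
    proof -
      obtain a b where "x = a / b" "a \<in> R" "b \<in> R" using xF sR(4) unfolding fraction_field_def by blast
      then show ?thesis using pw unfolding fraction_field_def by (auto simp: power_divide)
    qed
    moreover have "K \<subseteq> fraction_field (frobenius_image K R)"
      using fraction_field_superset[OF sub] ring_adjoin_base unfolding frobenius_image_def by blast
    ultimately show "frobenius_image K F \<subseteq> fraction_field (frobenius_image K R)"
      unfolding frobenius_image_def[of K F] char using sf by (intro ring_adjoin_least) auto
  qed
qed

text \<open>\<open>R\<close> is closed under \<open>p\<close>-power roots inside \<open>F\<close>,
  so the integral closure of K[R^p] is cut out by \<open>R\<close> itself.\<close>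

lemma integral_closure_frobenius:
  assumes R: "R \<in> E"
  shows "integral_closure (frobenius_image K R) = R \<inter> frobenius_image K F"
proof -
  note fr = frobenius_image_radicial[OF R]
  have "integral_closure (frobenius_image K R) = frobenius_image K F \<inter> proot R"
    using integral_closure_radicial[OF F(1) E(1)[OF R] fr(3) _ fr(2)] fr(1,4) proot_superset by (metis order_trans)
  also have "\<dots> = R \<inter> frobenius_image K F"
    using valuation_ring_proot[OF E(1)[OF R]] frobenius_image_sub proot_superset[of R] by blast
  finally show ?thesis .
qed

lemma frobenius_subring:
  assumes R: "R \<in> E"
  shows "subring (R \<inter> frobenius_image K F)" "frobenius_image K R \<subseteq> R \<inter> frobenius_image K F"
    "R \<inter> frobenius_image K F \<subseteq> proot (frobenius_image K R)"
proof -
  note fr = frobenius_image_radicial[OF R]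
  show "subring (R \<inter> frobenius_image K F)"
    using subring_Int[OF valuation_ring_subring[OF E(1)[OF R]] subfield_subring[OF subfield_frobenius_image]] .
  show "frobenius_image K R \<subseteq> R \<inter> frobenius_image K F"
    using fr(1) fraction_field_superset[OF fr(3)] fr(4) by simp
  show "R \<inter> frobenius_image K F \<subseteq> proot (frobenius_image K R)"
    using fr(2) by blast
qed

text \<open>Here the smaller ring is to be local: its nonunits are the nonunits of \<open>R\<close>
  that it contains, so closure under differences is inherited from above.\<close>

lemma local_frobenius_image:
  assumes R: "R \<in> E" shows "local_ring (frobenius_image K R)"
proof -
  note fr = frobenius_image_radicial[OF R]
  have sR: "subring R" "local_ring R"
    using R E valuation_ring_subring valuation_ring_local[OF F(1)] by blast+
  have "nonunits R \<inter> frobenius_image K R = nonunits (frobenius_image K R)"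
    by (rule nonunits_radicial[OF fr(3,1,2)])
  then show ?thesis
    using fr(3) nonunits_mult[OF fr(3)] zero_in_nonunits[OF fr(3)] local_ring_nonunits_diff[OF sR(2)] subring_diff[OF fr(3)]
    unfolding local_ring_def ideal_def by (metis Int_iff inf_le2)
qed

lemma normalized_frobenius_curve_eq:
  "normalized_frobenius_curve K E = (\<lambda>R. R \<inter> frobenius_image K F) ` E"
proof -
  have "points_above (integral_closure (frobenius_image K R)) (frobenius_image K R) = {R \<inter> frobenius_image K F}"
    if R: "R \<in> E" for R
    unfolding integral_closure_frobenius[OF R]
    using points_above_radicial[OF local_frobenius_image[OF R] frobenius_subring[OF R]] .
  then show ?thesis
    unfolding normalized_frobenius_curve_def normalization_def frobenius_curve_def by auto
qed

lemma normalized_frobenius_point_eq: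
  assumes P: "P \<in> E"
  shows "normalized_frobenius_point K E P = P \<inter> frobenius_image K F"
  unfolding normalized_frobenius_point_def
proof (rule point_over_eqI)
  show "P \<inter> frobenius_image K F \<in> normalized_frobenius_curve K E" using P normalized_frobenius_curve_eq by blast
  show "dominates (P \<inter> frobenius_image K F) (frobenius_image K P)"
    using nonunits_radicial[OF frobenius_image_radicial(3)[OF P] frobenius_subring(2,3)[OF P]] frobenius_subring(2)[OF P]
    by (simp add: dominates_def)
  fix T assume T: "T \<in> normalized_frobenius_curve K E" "dominates T (frobenius_image K P)"
  then obtain R where R: "R \<in> E" "T = R \<inter> frobenius_image K F" using normalized_frobenius_curve_eq by blast
  have "R = P"
  proof (rule dominates_unique[of F R P T "frobenius_image K P"])
    show "valuation_ring F R" "valuation_ring F P" using R P E by blast+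
    show "subring T" "T \<subseteq> proot R" using R frobenius_subring(1) proot_superset by blast+
    show "R \<subseteq> proot T" using R frobenius_image_radicial(2) proot_mono frobenius_subring(2) by blast
    show "subring (frobenius_image K P)" "frobenius_image K P \<subseteq> proot P" "P \<subseteq> proot (frobenius_image K P)"
      using P frobenius_image_radicial proot_superset by blast+
  qed (rule T)
  then show "T = P \<inter> frobenius_image K F" using R by simp
qed

end

end

section \<open>Linear disjointness\<close>

text \<open>Pairs under componentwise multiplication, written additively, so that the monoid ring of the
  formal tensors is an instance of the ring type of polynomial mappings.\<close>

datatype 'a mpair = MPair 'a 'a

instantiation mpair :: (comm_monoid_mult) comm_monoid_add
begin

definition zero_mpair :: "'a mpair" where "0 = MPair 1 1"

fun plus_mpair :: "'a mpair \<Rightarrow> 'a mpair \<Rightarrow> 'a mpair" where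
  "plus_mpair (MPair a b) (MPair c d) = MPair (a * c) (b * d)"

instance
proof
  fix x y z :: "'a mpair"
  show "x + y + z = x + (y + z)" "x + y = y + x" "0 + x = x"
    by (cases x; cases y; cases z; simp add: zero_mpair_def ac_simps)+
qed

end

lemma inj_MPair: "inj (\<lambda>(a, b). MPair a b)"
  by (auto simp: inj_on_def)

text \<open>Undoes the renaming of pairs, so that the ring laws of the monoid ring become available
  for \<open>tensor_mult\<close>.\<close>

definition tensor_of :: "('a mpair \<Rightarrow>\<^sub>0 int) \<Rightarrow> (('a \<times> 'a) \<Rightarrow>\<^sub>0 int)" where
  "tensor_of = Poly_Mapping.map_key (\<lambda>(a, b). MPair a b)"

lemma tensor_of_add: "tensor_of (x + y) = tensor_of x + tensor_of y"
  unfolding tensor_of_def by (rule map_key_plus[OF inj_MPair])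

lemma tensor_of_0: "tensor_of 0 = 0"
  unfolding tensor_of_def by (rule map_key_zero[OF inj_MPair])

lemma tensor_of_sum: "tensor_of (sum f A) = (\<Sum>i\<in>A. tensor_of (f i))"
  by (induction A rule: infinite_finite_induct) (auto simp: tensor_of_0 tensor_of_add)

lemma tensor_of_single: "tensor_of (Poly_Mapping.single (MPair a b) n) = Poly_Mapping.single (a, b) n"
  using map_key_single[OF inj_MPair, of "(a, b)"] by (simp add: tensor_of_def)

lemma poly_mapping_sum_keys: "x = (\<Sum>m\<in>Poly_Mapping.keys x. Poly_Mapping.single m (Poly_Mapping.lookup x m))"
proof (rule poly_mapping_eqI)
  fix k
  have "Poly_Mapping.lookup (\<Sum>m\<in>Poly_Mapping.keys x. Poly_Mapping.single m (Poly_Mapping.lookup x m)) k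
    = (\<Sum>m\<in>Poly_Mapping.keys x. if m = k then Poly_Mapping.lookup x m else 0)"
    by (simp add: lookup_sum lookup_single when_def)
  also have "\<dots> = Poly_Mapping.lookup x k" by (simp add: in_keys_iff)
  finally show "Poly_Mapping.lookup x k
    = Poly_Mapping.lookup (\<Sum>m\<in>Poly_Mapping.keys x. Poly_Mapping.single m (Poly_Mapping.lookup x m)) k"
    by simp
qed

lemma lookup_tensor_of: "Poly_Mapping.lookup (tensor_of x) (a, b) = Poly_Mapping.lookup x (MPair a b)"
  unfolding tensor_of_def by (simp add: map_key.rep_eq[OF inj_MPair])

lemma keys_tensor_of: "Poly_Mapping.keys (tensor_of x) = (\<lambda>(a, b). MPair a b) -` Poly_Mapping.keys x"
  unfolding tensor_of_def by (rule keys_map_key[OF inj_MPair])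

lemma sum_keys_tensor_of:
  "(\<Sum>m\<in>Poly_Mapping.keys x. g m) = (\<Sum>(a, b)\<in>Poly_Mapping.keys (tensor_of x). g (MPair a b))"
proof -
  have "(\<lambda>(a, b). MPair a b) ` Poly_Mapping.keys (tensor_of x) = Poly_Mapping.keys x"
  proof -
    have "m \<in> (\<lambda>(a, b). MPair a b) ` Poly_Mapping.keys (tensor_of x)" if "m \<in> Poly_Mapping.keys x" for m
      using that by (cases m) (force simp: keys_tensor_of)
    then show ?thesis by (auto simp: keys_tensor_of)
  qed
  then have "sum g (Poly_Mapping.keys x) = sum g ((\<lambda>(a, b). MPair a b) ` Poly_Mapping.keys (tensor_of x))" by simp
  also have "\<dots> = sum (g \<circ> (\<lambda>(a, b). MPair a b)) (Poly_Mapping.keys (tensor_of x))"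
    by (rule sum.reindex) (auto simp: inj_on_def)
  finally show ?thesis by (simp add: comp_def case_prod_unfold)
qed

lemma tensor_of_mult: "tensor_of (x * y) = tensor_mult (tensor_of x) (tensor_of y)"
proof -
  have "x * y = (\<Sum>m\<in>Poly_Mapping.keys x. \<Sum>n\<in>Poly_Mapping.keys y.
      Poly_Mapping.single (m + n) (Poly_Mapping.lookup x m * Poly_Mapping.lookup y n))"
    by (subst (1) poly_mapping_sum_keys[of x], subst (1) poly_mapping_sum_keys[of y])
      (simp only: sum_product mult_single)
  then show ?thesis
    by (simp add: tensor_of_sum sum_keys_tensor_of tensor_mult_def tensor_of_single lookup_tensor_of
        case_prod_unfold)
qed

text \<open>The monoid ring has integer coefficients, so Frobenius is additive only up to multiples
  of \<open>p\<close>. The error is tracked inside \<open>R\<close>, which will be the formal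
  tensors with entries in the given rings, where multiples of \<open>p\<close> are
  relations.\<close>

lemma binomial_prime:
  fixes x y :: "'a::comm_ring_1"
  assumes p: "prime p"
    and R: "1 \<in> R" "\<And>x y. x \<in> R \<Longrightarrow> y \<in> R \<Longrightarrow> x + y \<in> R" "\<And>x y. x \<in> R \<Longrightarrow> y \<in> R \<Longrightarrow> x * y \<in> R" "0 \<in> R"
    and xy: "x \<in> R" "y \<in> R"
  shows "\<exists>w\<in>R. (x + y) ^ p = x ^ p + y ^ p + of_nat p * w"
proof -
  have R_pow: "z ^ n \<in> R" if "z \<in> R" for z n using that R by (induction n) auto
  have R_nat: "of_nat n \<in> R" for n using R by (induction n) auto
  have R_sum: "sum f A \<in> R" if "\<And>i. i \<in> A \<Longrightarrow> f i \<in> R" for f and A :: "nat set"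
    using that R by (induction A rule: infinite_finite_induct) auto
  define w where "w = (\<Sum>i\<in>{1..<p}. of_nat ((p choose i) div p) * x ^ i * y ^ (p - i))"
  have "w \<in> R" unfolding w_def using xy R by (intro R_sum R R_nat R_pow)
  have p1: "p > 1" using p prime_gt_1_nat by blast
  have "(x + y) ^ p = (\<Sum>i\<le>p. of_nat (p choose i) * x ^ i * y ^ (p - i))" by (rule binomial_ring)
  also have "{..p} = insert 0 (insert p {1..<p})" using p1 by auto
  also have "(\<Sum>i\<in>insert 0 (insert p {1..<p}). of_nat (p choose i) * x ^ i * y ^ (p - i))
    = y ^ p + (x ^ p + (\<Sum>i\<in>{1..<p}. of_nat (p choose i) * x ^ i * y ^ (p - i)))"
    using p1 by simp
  also have "(\<Sum>i\<in>{1..<p}. of_nat (p choose i) * x ^ i * y ^ (p - i)) = of_nat p * w"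
    unfolding w_def sum_distrib_left
  proof (intro sum.cong refl)
    fix i assume "i \<in> {1..<p}"
    then have "p dvd (p choose i)" using p by (intro dvd_choose_prime) auto
    then have "(of_nat (p choose i) :: 'a) = of_nat p * of_nat ((p choose i) div p)"
      by (metis dvd_mult_div_cancel of_nat_mult)
    then show "of_nat (p choose i) * x ^ i * y ^ (p - i) = of_nat p * (of_nat ((p choose i) div p) * x ^ i * y ^ (p - i))"
      by (simp add: mult.assoc)
  qed
  finally show ?thesis using \<open>w \<in> R\<close> by (auto simp: ac_simps)
qed

lemma sum_power_prime_power:
  fixes f :: "'b \<Rightarrow> 'a::comm_ring_1"
  assumes p: "prime p"
    and R: "1 \<in> R" "\<And>x y. x \<in> R \<Longrightarrow> y \<in> R \<Longrightarrow> x + y \<in> R" "\<And>x y. x \<in> R \<Longrightarrow> y \<in> R \<Longrightarrow> x * y \<in> R" "0 \<in> R"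
    and J: "finite J" and f: "\<And>j. j \<in> J \<Longrightarrow> f j \<in> R"
  shows "\<exists>w\<in>R. (\<Sum>j\<in>J. f j) ^ (p ^ n) = (\<Sum>j\<in>J. f j ^ (p ^ n)) + of_nat p * w"
proof (induction n)
  case 0
  then show ?case using R by (intro bexI[of _ 0]) auto
next
  case (Suc n)
  then obtain w where w: "w \<in> R" "(\<Sum>j\<in>J. f j) ^ (p ^ n) = (\<Sum>j\<in>J. f j ^ (p ^ n)) + of_nat p * w" by blast
  have R_pow: "z ^ n \<in> R" if "z \<in> R" for z n using that R by (induction n) auto
  have R_nat: "of_nat n \<in> R" for n using R by (induction n) auto
  have R_sum: "sum f A \<in> R" if "\<And>i. i \<in> A \<Longrightarrow> f i \<in> R" for f and A :: "'b set"
    using that R by (induction A rule: infinite_finite_induct) auto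
  have sum_p: "\<exists>w\<in>R. (\<Sum>j\<in>J. g j) ^ p = (\<Sum>j\<in>J. g j ^ p) + of_nat p * w"
    if "\<And>j. j \<in> J \<Longrightarrow> g j \<in> R" for g
    using J that
  proof (induction J rule: finite_induct)
    case empty
    have "(0 :: 'a) ^ p = 0" by (rule zero_power[OF prime_gt_0_nat[OF p]])
    then show ?case using R by (intro bexI[of _ 0]) auto
  next
    case (insert j J)
    then obtain v where v: "v \<in> R" "(\<Sum>j\<in>J. g j) ^ p = (\<Sum>j\<in>J. g j ^ p) + of_nat p * v" by auto
    have "g j \<in> R" "sum g J \<in> R" using insert by (auto intro: R_sum)
    then obtain u where u: "u \<in> R" "(g j + sum g J) ^ p = g j ^ p + sum g J ^ p + of_nat p * u"
      using binomial_prime[of p R, OF p R] by blast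
    have "(\<Sum>j\<in>insert j J. g j) ^ p = (\<Sum>j\<in>insert j J. g j ^ p) + of_nat p * (v + u)"
      using insert u v by (simp add: algebra_simps)
    then show ?case using u v R by blast
  qed
  define x y where "x = (\<Sum>j\<in>J. f j ^ (p ^ n))" and "y = of_nat p * w"
  have xy: "x \<in> R" "y \<in> R" unfolding x_def y_def using f w R R_pow R_nat by (auto intro: R_sum)
  obtain u where u: "u \<in> R" "(x + y) ^ p = x ^ p + y ^ p + of_nat p * u"
    using binomial_prime[of p R, OF p R xy] by blast
  obtain v where v: "v \<in> R" "x ^ p = (\<Sum>j\<in>J. (f j ^ (p ^ n)) ^ p) + of_nat p * v"
    using sum_p[of "\<lambda>j. f j ^ (p ^ n)"] f R_pow unfolding x_def by blast
  have "y ^ p = of_nat p * (w * y ^ (p - 1))"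
    using prime_gt_0_nat[OF p] by (simp add: y_def power_eq_if mult.assoc)
  then have "(\<Sum>j\<in>J. f j) ^ (p ^ Suc n) = (\<Sum>j\<in>J. f j ^ (p ^ Suc n)) + of_nat p * (v + w * y ^ (p - 1) + u)"
    using w(2) u v by (simp add: x_def y_def power_mult mult.commute[of p] distrib_left flip: power_mult)
      (simp add: power_mult)
  moreover have "v + w * y ^ (p - 1) + u \<in> R" using u v w xy R R_pow by auto
  ultimately show ?case by blast
qed

lemma group_closure_sum: "(\<And>i. i \<in> I \<Longrightarrow> f i \<in> group_closure S) \<Longrightarrow> sum f I \<in> group_closure S"
  by (induction I rule: infinite_finite_induct) (auto intro: group_closure_add)

context char_p
begin

context
  fixes K A k :: "'l set"
  assumes K: "subring K" and A: "subring A" "K \<subseteq> A" and k: "subring k" "K \<subseteq> k"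
begin

lemma tensor_relations_add_left:
  "a \<in> A \<Longrightarrow> a' \<in> A \<Longrightarrow> b \<in> k \<Longrightarrow>
    pure_tensor (a + a') b - pure_tensor a b - pure_tensor a' b \<in> tensor_relations K A k"
  unfolding tensor_relations_def by (rule group_closure.base) blast

lemma tensor_relations_scale:
  "c \<in> K \<Longrightarrow> a \<in> A \<Longrightarrow> b \<in> k \<Longrightarrow> pure_tensor (c * a) b - pure_tensor a (c * b) \<in> tensor_relations K A k"
  unfolding tensor_relations_def by (rule group_closure.base) blast

lemma tensor_relations_closed:
  "0 \<in> tensor_relations K A k"
  "x \<in> tensor_relations K A k \<Longrightarrow> y \<in> tensor_relations K A k \<Longrightarrow> x + y \<in> tensor_relations K A k"
  "x \<in> tensor_relations K A k \<Longrightarrow> y \<in> tensor_relations K A k \<Longrightarrow> x - y \<in> tensor_relations K A k"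
  "x \<in> tensor_relations K A k \<Longrightarrow> - x \<in> tensor_relations K A k"
  unfolding tensor_relations_def by (auto intro: group_closure_add group_closure.diff)

lemma tensor_relations_sum:
  "(\<And>i. i \<in> I \<Longrightarrow> f i \<in> tensor_relations K A k) \<Longrightarrow> sum f I \<in> tensor_relations K A k"
  unfolding tensor_relations_def by (rule group_closure_sum)

lemma pure_tensor_0:
  assumes "b \<in> k" shows "pure_tensor 0 b \<in> tensor_relations K A k"
  using tensor_relations_closed(4)[OF tensor_relations_add_left[OF subring_0[OF A(1)] subring_0[OF A(1)] assms]]
  by simp

lemma pure_tensor_sum:
  assumes "finite J" "\<And>j. j \<in> J \<Longrightarrow> a j \<in> A" and b: "b \<in> k"
  shows "pure_tensor (\<Sum>j\<in>J. a j) b - (\<Sum>j\<in>J. pure_tensor (a j) b) \<in> tensor_relations K A k"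
  using assms(1,2)
proof (induction J rule: finite_induct)
  case empty
  then show ?case using pure_tensor_0[OF b] by simp
next
  case (insert j J)
  have "pure_tensor (a j + (\<Sum>j\<in>J. a j)) b - pure_tensor (a j) b - pure_tensor (\<Sum>j\<in>J. a j) b \<in> tensor_relations K A k"
    using insert b by (intro tensor_relations_add_left subring_sum[OF A(1)]) auto
  moreover have "pure_tensor (\<Sum>j\<in>J. a j) b - (\<Sum>j\<in>J. pure_tensor (a j) b) \<in> tensor_relations K A k"
    using insert by simp
  ultimately have "(pure_tensor (a j + (\<Sum>j\<in>J. a j)) b - pure_tensor (a j) b - pure_tensor (\<Sum>j\<in>J. a j) b)
      + (pure_tensor (\<Sum>j\<in>J. a j) b - (\<Sum>j\<in>J. pure_tensor (a j) b)) \<in> tensor_relations K A k"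
    by (rule tensor_relations_closed)
  then show ?case using insert by (simp add: algebra_simps)
qed

text \<open>Integer coefficients are absorbed into the left entry; a coefficient divisible by
  \<open>p\<close> therefore makes the tensor trivial.\<close>

lemma single_pure_tensor:
  assumes a: "a \<in> A" and b: "b \<in> k"
  shows "Poly_Mapping.single (a, b) n - pure_tensor (of_int n * a) b \<in> tensor_relations K A k"
proof -
  have step: "pure_tensor (of_int (m + 1) * a) b - pure_tensor (of_int m * a) b - pure_tensor a b
      \<in> tensor_relations K A k" for m
    using tensor_relations_add_left[of "of_int m * a" a b] a b subring_mult[OF A(1) subring_of_int[OF A(1)] a]
    by (simp add: distrib_right)
  have sing: "Poly_Mapping.single (a, b) (m + 1) = Poly_Mapping.single (a, b) m + pure_tensor a b" for m :: int
    by (simp add: pure_tensor_def single_add)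
  show ?thesis
  proof (induction n rule: int_induct[where k = 0])
    case base
    then show ?case using tensor_relations_closed(4)[OF pure_tensor_0[OF b]] by simp
  next
    case (step1 m)
    have "(Poly_Mapping.single (a, b) m - pure_tensor (of_int m * a) b)
        - (pure_tensor (of_int (m + 1) * a) b - pure_tensor (of_int m * a) b - pure_tensor a b)
        \<in> tensor_relations K A k"
      using step1(2) step by (rule tensor_relations_closed)
    also have "(Poly_Mapping.single (a, b) m - pure_tensor (of_int m * a) b)
        - (pure_tensor (of_int (m + 1) * a) b - pure_tensor (of_int m * a) b - pure_tensor a b)
        = Poly_Mapping.single (a, b) (m + 1) - pure_tensor (of_int (m + 1) * a) b"
      unfolding sing by (simp only: diff_diff_eq2 algebra_simps)
    finally show ?case .
  next
    case (step2 m)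
    have "(Poly_Mapping.single (a, b) m - pure_tensor (of_int m * a) b)
        + (pure_tensor (of_int (m - 1 + 1) * a) b - pure_tensor (of_int (m - 1) * a) b - pure_tensor a b)
        \<in> tensor_relations K A k"
      using step2(2) step by (rule tensor_relations_closed)
    also have "(Poly_Mapping.single (a, b) m - pure_tensor (of_int m * a) b)
        + (pure_tensor (of_int (m - 1 + 1) * a) b - pure_tensor (of_int (m - 1) * a) b - pure_tensor a b)
        = Poly_Mapping.single (a, b) (m - 1) - pure_tensor (of_int (m - 1) * a) b"
      using sing[of "m - 1"] by (simp add: algebra_simps)
    finally show ?case .
  qed
qed

text \<open>If \<open>k\<close> is purely inseparable over \<open>K\<close>, the kernel of the multiplication map on \<open>A \<otimes> k\<close> is nil:
  a large Frobenius power moves every tensor into \<open>A \<otimes> 1\<close>.\<close>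

lemma tensor_zero_of_sum_zero:
  assumes kK: "k \<subseteq> proot K" and dom: "tensor_product_is_domain K A k"
    and J: "finite J" "\<And>j. j \<in> J \<Longrightarrow> a j \<in> A" "\<And>j. j \<in> J \<Longrightarrow> c j \<in> k"
    and zero: "(\<Sum>j\<in>(J :: 'b set). a j * c j) = 0"
  shows "(\<Sum>j\<in>J. pure_tensor (a j) (c j)) \<in> tensor_relations K A k"
proof -
  define R where "R = {x :: 'l mpair \<Rightarrow>\<^sub>0 int. Poly_Mapping.keys x \<subseteq> (\<lambda>(a, b). MPair a b) ` (A \<times> k)}"
  have sing: "Poly_Mapping.single (MPair a b) n \<in> R" if "a \<in> A" "b \<in> k" for a b n
    using that by (auto simp: R_def)
  have one: "(1 :: 'l mpair \<Rightarrow>\<^sub>0 int) = Poly_Mapping.single (MPair 1 1) 1"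
    by (simp add: zero_mpair_def[symmetric])
  have R: "1 \<in> R" "\<And>x y. x \<in> R \<Longrightarrow> y \<in> R \<Longrightarrow> x + y \<in> R" "\<And>x y. x \<in> R \<Longrightarrow> y \<in> R \<Longrightarrow> x * y \<in> R" "0 \<in> R"
  proof -
    show "1 \<in> R" unfolding one using subring_1 A k by (intro sing) auto
    show "0 \<in> R" by (simp add: R_def)
    show "x + y \<in> R" if "x \<in> R" "y \<in> R" for x y
      using that keys_add[of x y] unfolding R_def by blast
    show "x * y \<in> R" if xy: "x \<in> R" "y \<in> R" for x y
    proof -
      have "m \<in> (\<lambda>(a, b). MPair a b) ` (A \<times> k)" if "m \<in> Poly_Mapping.keys (x * y)" for m
      proof -
        obtain m1 m2 where m: "m = m1 + m2" "m1 \<in> Poly_Mapping.keys x" "m2 \<in> Poly_Mapping.keys y"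
          using \<open>m \<in> Poly_Mapping.keys (x * y)\<close> keys_mult[of x y] by blast
        then obtain a b a' b' where "m1 = MPair a b" "m2 = MPair a' b'" "a \<in> A" "b \<in> k" "a' \<in> A" "b' \<in> k"
          using xy unfolding R_def by fast
        then show ?thesis using m(1) subring_mult A k by (force intro!: image_eqI[of _ _ "(a * a', b * b')"])
      qed
      then show ?thesis by (auto simp: R_def)
    qed
  qed
  have formal: "tensor_of x \<in> formal_tensors A k" if "x \<in> R" for x
    using that by (auto simp: R_def formal_tensors_def keys_tensor_of)
  define S where "S = (\<Sum>j\<in>J. Poly_Mapping.single (MPair (a j) (c j)) (1::int))"
  have SR: "S \<in> R"
  proof -
    have "sum f I \<in> R" if "\<And>i. i \<in> I \<Longrightarrow> f i \<in> R" for f and I :: "'b set"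
      using that R by (induction I rule: infinite_finite_induct) auto
    then show ?thesis unfolding S_def using J sing by simp
  qed
  have S_eq: "tensor_of S = (\<Sum>j\<in>J. pure_tensor (a j) (c j))"
    by (simp add: S_def tensor_of_sum tensor_of_single pure_tensor_def)
  \<comment> \<open>A domain has no nilpotents, so it suffices to kill some power of
    \<open>S\<close>.\<close>
  have pow: "tensor_of S \<in> tensor_relations K A k" if "tensor_of (S ^ n) \<in> tensor_relations K A k" for n
    using that
  proof (induction n)
    case 0
    then have "pure_tensor 1 1 \<in> tensor_relations K A k"
      by (simp add: one tensor_of_single pure_tensor_def del: single_one)
    then show ?case using dom by (simp add: tensor_product_is_domain_def)
  next
    case (Suc n)
    have "S ^ n \<in> R" using SR R by (induction n) auto
    moreover have "tensor_mult (tensor_of S) (tensor_of (S ^ n)) \<in> tensor_relations K A k"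
      using Suc.prems by (simp add: tensor_of_mult)
    ultimately show ?case using dom Suc.IH formal SR unfolding tensor_product_is_domain_def by blast
  qed
  have "c ` J \<subseteq> proot K" using J(3) kK by blast
  then have "\<exists>n. \<forall>x\<in>c ` J. x ^ (p ^ n) \<in> K"
    by (rule proot_uniform[OF K finite_imageI[OF J(1)]])
  then obtain n where "\<forall>x\<in>c ` J. x ^ (p ^ n) \<in> K" by blast
  then have n: "c j ^ (p ^ n) \<in> K" if "j \<in> J" for j using that by blast
  define q where "q = p ^ n"
  \<comment> \<open>Up to a multiple of \<open>p\<close>, the power of the sum is the sum of the
    powers, whose right entries lie in \<open>K\<close>.\<close>
  obtain w where w: "w \<in> R" "S ^ q = (\<Sum>j\<in>J. Poly_Mapping.single (MPair (a j) (c j)) 1 ^ q) + of_nat p * w"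
    using sum_power_prime_power[OF prime_p R J(1), of "\<lambda>j. Poly_Mapping.single (MPair (a j) (c j)) 1"]
      sing J unfolding S_def q_def by blast
  have single_pow: "Poly_Mapping.single (MPair x y) (1::int) ^ m = Poly_Mapping.single (MPair (x ^ m) (y ^ m)) 1" for x y :: 'l and m
    by (induction m) (simp_all add: mult_single one del: single_one)
  have pw: "tensor_of (of_nat p * w) \<in> tensor_relations K A k"
  proof -
    have "of_nat p * w = (\<Sum>m\<in>Poly_Mapping.keys w. Poly_Mapping.single m (int p * Poly_Mapping.lookup w m))"
      by (subst (1) poly_mapping_sum_keys[of w])
        (simp add: sum_distrib_left mult_single flip: single_of_nat)
    moreover have "tensor_of (Poly_Mapping.single m (int p * Poly_Mapping.lookup w m)) \<in> tensor_relations K A k"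
      if mw: "m \<in> Poly_Mapping.keys w" for m
    proof -
      obtain x y where m: "m = MPair x y" "x \<in> A" "y \<in> k" using mw w(1) unfolding R_def by fast
      have z: "of_int (int p * i) * x = 0" for i using of_nat_p by simp
      show ?thesis
        using tensor_relations_closed(2)[OF single_pure_tensor[OF m(2,3)] pure_tensor_0[OF m(3)]]
        unfolding m(1) tensor_of_single by (metis z diff_add_cancel)
    qed
    ultimately show ?thesis by (simp add: tensor_of_sum tensor_relations_sum)
  qed
  \<comment> \<open>The scalars from \<open>K\<close> move to the left entries, where they add up to
    the \<open>q\<close>-th power of the given vanishing sum.\<close>
  have "(\<Sum>j\<in>J. pure_tensor (a j ^ q) (c j ^ q)) \<in> tensor_relations K A k"
  proof -
    have cq: "c j ^ q \<in> K" "a j ^ q \<in> A" "c j ^ q * a j ^ q \<in> A" if "j \<in> J" for j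
    proof -
      show cK: "c j ^ q \<in> K" and aA: "a j ^ q \<in> A"
        using n that J subring_power[OF A(1)] by (auto simp: q_def)
      show "c j ^ q * a j ^ q \<in> A" using cK aA A subring_mult by blast
    qed
    have 1: "(\<Sum>j\<in>J. pure_tensor (c j ^ q * a j ^ q) 1 - pure_tensor (a j ^ q) (c j ^ q * 1)) \<in> tensor_relations K A k"
      using cq subring_1[OF k(1)] by (intro tensor_relations_sum tensor_relations_scale) auto
    have "(\<Sum>j\<in>J. c j ^ q * a j ^ q) = (\<Sum>j\<in>J. a j * c j) ^ q"
      by (simp add: frob_sum q_def power_mult_distrib mult.commute)
    also have "\<dots> = 0" using zero p_pos by (simp add: q_def)
    finally have "pure_tensor (\<Sum>j\<in>J. c j ^ q * a j ^ q) 1 \<in> tensor_relations K A k"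
      using pure_tensor_0[OF subring_1[OF k(1)]] by simp
    moreover have "pure_tensor (\<Sum>j\<in>J. c j ^ q * a j ^ q) 1 - (\<Sum>j\<in>J. pure_tensor (c j ^ q * a j ^ q) 1) \<in> tensor_relations K A k"
      using cq(3) J(1) subring_1[OF k(1)] by (intro pure_tensor_sum) auto
    ultimately have "pure_tensor (\<Sum>j\<in>J. c j ^ q * a j ^ q) 1
        - (pure_tensor (\<Sum>j\<in>J. c j ^ q * a j ^ q) 1 - (\<Sum>j\<in>J. pure_tensor (c j ^ q * a j ^ q) 1)) \<in> tensor_relations K A k"
      by (rule tensor_relations_closed)
    then have 2: "(\<Sum>j\<in>J. pure_tensor (c j ^ q * a j ^ q) 1) \<in> tensor_relations K A k" by simp
    show ?thesis using tensor_relations_closed(3)[OF 2 1] by (simp add: sum_subtractf)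
  qed
  moreover have "tensor_of (S ^ q) = (\<Sum>j\<in>J. pure_tensor (a j ^ q) (c j ^ q)) + tensor_of (of_nat p * w)"
    by (simp add: w(2) tensor_of_add tensor_of_sum single_pow tensor_of_single pure_tensor_def)
  ultimately have "tensor_of (S ^ q) \<in> tensor_relations K A k"
    using pw tensor_relations_closed(2) by simp
  then show ?thesis using pow S_eq by metis
qed

text \<open>A \<open>K\<close>-linear \<open>lam\<close> induces the additive map from a \<otimes> c
  to the product of \<open>a\<close> and \<open>lam c\<close>, and each defining relation goes to 0.
  This evaluates tensors without a basis of \<open>k\<close> over \<open>K\<close>.\<close>

lemma tensor_relations_functional:
  assumes lam: "\<And>x y. x \<in> k \<Longrightarrow> y \<in> k \<Longrightarrow> lam (x + y) = lam x + lam y"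
    "\<And>c x. c \<in> K \<Longrightarrow> x \<in> k \<Longrightarrow> lam (c * x) = c * lam x"
    and J: "finite J" and rel: "(\<Sum>j\<in>J. pure_tensor (a j) (c j)) \<in> tensor_relations K A k"
  shows "(\<Sum>j\<in>J. a j * lam (c j)) = (0 :: 'l)"
proof -
  define \<psi> where "\<psi> z = (\<Sum>m\<in>Poly_Mapping.keys z. of_int (Poly_Mapping.lookup z m) * (fst m * lam (snd m)))"
    for z :: "'l formal_tensor"
  have add: "\<psi> (x + y) = \<psi> x + \<psi> y" for x y
    unfolding \<psi>_def by (rule setsum_keys_plus_distrib) (simp_all add: distrib_right)
  have zero: "\<psi> 0 = 0" by (simp add: \<psi>_def)
  have diff: "\<psi> (x - y) = \<psi> x - \<psi> y" for x y using add[of "x - y" y] by simp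
  have sum: "\<psi> (sum f J) = (\<Sum>j\<in>J. \<psi> (f j))" for f and J :: "'b set"
    by (induction J rule: infinite_finite_induct) (auto simp: zero add)
  have pure: "\<psi> (pure_tensor x y) = x * lam y" for x y
    by (simp add: \<psi>_def pure_tensor_def)
  have "\<psi> z = 0" if "z \<in> tensor_relations K A k" for z
    using that unfolding tensor_relations_def
  proof (induction rule: group_closure.induct)
    case (base z)
    then show ?case
    proof (elim insertE UnE CollectE exE conjE)
      show "\<psi> z = 0" if "z = 0" using that zero by simp
      show "\<psi> z = 0" if "z = pure_tensor (a + a') b - pure_tensor a b - pure_tensor a' b" for a a' b
        unfolding that by (simp add: diff pure distrib_right)
      show "\<psi> z = 0" if "z = pure_tensor a (b + b') - pure_tensor a b - pure_tensor a b'" "b \<in> k" "b' \<in> k" for a b b'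
        unfolding that(1) using that(2,3) by (simp add: diff pure lam distrib_left)
      show "\<psi> z = 0" if "z = pure_tensor (c * a) b - pure_tensor a (c * b)" "c \<in> K" "b \<in> k" for c a b
        unfolding that(1) using that(2,3) by (simp add: diff pure lam)
    qed
  qed (simp add: diff)
  then have "\<psi> (\<Sum>j\<in>J. pure_tensor (a j) (c j)) = 0" using rel by blast
  then show ?thesis by (simp add: sum pure)
qed

end

end

text \<open>Zorn's lemma gives a \<open>K\<close>-subspace \<open>H\<close> of \<open>k\<close>
  maximal among those without 1; maximality makes it a complement of \<open>K\<close>, and
  \<open>lam\<close> is the projection along it.\<close>

lemma exists_linear_functional:
  fixes K k :: "'l::field set"
  assumes K: "subfield K" and k: "subring k" "K \<subseteq> k"
  obtains lam where "lam 1 = 1" "\<And>x. x \<in> k \<Longrightarrow> lam x \<in> K"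
    "\<And>x y. x \<in> k \<Longrightarrow> y \<in> k \<Longrightarrow> lam (x + y) = lam x + lam y"
    "\<And>c x. c \<in> K \<Longrightarrow> x \<in> k \<Longrightarrow> lam (c * x) = c * lam x"
proof -
  note sK = subfield_subring[OF K]
  define sub where "sub H \<longleftrightarrow> H \<subseteq> k \<and> 0 \<in> H \<and> (\<forall>x\<in>H. \<forall>y\<in>H. x - y \<in> H) \<and> (\<forall>c\<in>K. \<forall>x\<in>H. c * x \<in> H) \<and> 1 \<notin> H"
    for H
  have "sub {0}" using subring_0[OF k(1)] by (simp add: sub_def)
  moreover have "sub (\<Union>\<C>)" if "\<C> \<noteq> {}" "subset.chain {H. sub H} \<C>" for \<C>
  proof -
    have C: "\<And>H. H \<in> \<C> \<Longrightarrow> sub H" "\<And>I J. I \<in> \<C> \<Longrightarrow> J \<in> \<C> \<Longrightarrow> I \<subseteq> J \<or> J \<subseteq> I"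
      using that(2) by (auto simp: subset_chain_def)
    have "x - y \<in> \<Union>\<C>" if "x \<in> \<Union>\<C>" "y \<in> \<Union>\<C>" for x y
    proof -
      obtain I J where IJ: "x \<in> I" "y \<in> J" "I \<in> \<C>" "J \<in> \<C>" using \<open>x \<in> \<Union>\<C>\<close> \<open>y \<in> \<Union>\<C>\<close> by blast
      then obtain L where "L \<in> \<C>" "x \<in> L" "y \<in> L" using C(2)[of I J] by blast
      then show ?thesis using C(1)[of L] unfolding sub_def by blast
    qed
    then show ?thesis using C(1) \<open>\<C> \<noteq> {}\<close> unfolding sub_def by blast
  qed
  ultimately have "\<exists>M\<in>{H. sub H}. \<forall>X\<in>{H. sub H}. M \<subseteq> X \<longrightarrow> X = M"
    by (intro subset_Zorn_nonempty) auto
  then obtain H where H: "sub H" "\<And>X. sub X \<Longrightarrow> H \<subseteq> X \<Longrightarrow> X = H" by auto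
  have H_diff: "x - y \<in> H" if "x \<in> H" "y \<in> H" for x y using that H(1) by (simp add: sub_def)
  have H_mult: "c * x \<in> H" if "c \<in> K" "x \<in> H" for c x using that H(1) by (simp add: sub_def)
  have H0: "0 \<in> H" "1 \<notin> H" "H \<subseteq> k" using H(1) by (auto simp: sub_def)
  have H_add: "x + y \<in> H" if "x \<in> H" "y \<in> H" for x y
    using H_diff[OF that(1) H_diff[OF H0(1) that(2)]] by simp
  have ex: "\<exists>c\<in>K. z - c \<in> H" if z: "z \<in> k" for z
  proof (rule ccontr)
    assume no: "\<not> ?thesis"
    define X where "X = {h + c * z | h c. h \<in> H \<and> c \<in> K}"
    have HX: "H \<subseteq> X"
    proof
      fix h assume "h \<in> H"
      moreover have "h = h + 0 * z" by simp
      ultimately show "h \<in> X" unfolding X_def using subring_0[OF sK] by blast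
    qed
    have zX: "z \<in> X"
    proof -
      have "z = 0 + 1 * z" by simp
      then show ?thesis unfolding X_def using H0 subring_1[OF sK] by blast
    qed
    have "z \<notin> H" using no subring_0[OF sK] by force
    then have "\<not> sub X" using H(2) HX zX by blast
    moreover have "X \<subseteq> k" unfolding X_def using H0(3) z k subring_add[OF k(1)] subring_mult[OF k(1)] by blast
    moreover have "x - y \<in> X" if "x \<in> X" "y \<in> X" for x y
    proof -
      obtain h c h' c' where "x = h + c * z" "y = h' + c' * z" "h \<in> H" "h' \<in> H" "c \<in> K" "c' \<in> K"
        using \<open>x \<in> X\<close> \<open>y \<in> X\<close> unfolding X_def by blast
      then have "x - y = (h - h') + (c - c') * z" "h - h' \<in> H" "c - c' \<in> K"
        using H_diff subring_diff[OF sK] by (auto simp: algebra_simps)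
      then show ?thesis unfolding X_def by blast
    qed
    moreover have "d * x \<in> X" if "d \<in> K" "x \<in> X" for d x
    proof -
      obtain h c where "x = h + c * z" "h \<in> H" "c \<in> K" using \<open>x \<in> X\<close> unfolding X_def by blast
      then have "d * x = d * h + (d * c) * z" "d * h \<in> H" "d * c \<in> K"
        using H_mult subring_mult[OF sK] \<open>d \<in> K\<close> by (auto simp: algebra_simps)
      then show ?thesis unfolding X_def by blast
    qed
    ultimately have "1 \<in> X" using HX H0(1) unfolding sub_def by blast
    then obtain h c where hc: "1 = h + c * z" "h \<in> H" "c \<in> K" unfolding X_def by blast
    then have "c \<noteq> 0" using H0 by auto
    have "c * z = 1 - h" using hc(1) by (metis add_diff_cancel_left')
    then have "z = inverse c * (1 - h)" using \<open>c \<noteq> 0\<close> by (metis left_inverse mult.assoc mult_1)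
    then have "z - inverse c = - inverse c * h" by (simp add: right_diff_distrib)
    moreover have "inverse c \<in> K" using hc(3) K subfield_inverse by blast
    ultimately have "z - inverse c \<in> H" using H_mult[OF subring_uminus[OF sK] hc(2)] by simp
    then show False using no \<open>inverse c \<in> K\<close> by blast
  qed
  have uniq: "c = c'" if "c \<in> K" "c' \<in> K" "z - c \<in> H" "z - c' \<in> H" for z c c'
  proof (rule ccontr)
    assume "c \<noteq> c'"
    have "c' - c \<in> H" using H_diff[OF that(3,4)] by simp
    moreover have "inverse (c' - c) \<in> K" using that subring_diff[OF sK] subfield_inverse[OF K] by blast
    ultimately have "inverse (c' - c) * (c' - c) \<in> H" using H_mult by blast
    then show False using H0 \<open>c \<noteq> c'\<close> by simp
  qed
  define lam where "lam z = (SOME c. c \<in> K \<and> z - c \<in> H)" for z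
  have lam: "lam z \<in> K" "z - lam z \<in> H" if "z \<in> k" for z
    using someI_ex[of "\<lambda>c. c \<in> K \<and> z - c \<in> H"] ex[OF that] unfolding lam_def by blast+
  have lam_eq: "lam z = c" if "c \<in> K" "z - c \<in> H" "z \<in> k" for z c
    using uniq[OF lam(1)[OF that(3)] that(1) lam(2)[OF that(3)] that(2)] .
  show ?thesis
  proof (rule that)
    show "lam 1 = 1" using H0 subring_1[OF sK] subring_1[OF k(1)] by (intro lam_eq) auto
    show "lam x \<in> K" if "x \<in> k" for x using lam that by blast
    show "lam (x + y) = lam x + lam y" if "x \<in> k" "y \<in> k" for x y
    proof (rule lam_eq)
      have "(x - lam x) + (y - lam y) \<in> H" using H_add lam that by blast
      then show "x + y - (lam x + lam y) \<in> H" by (simp add: algebra_simps)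
    qed (use lam that subring_add[OF sK] subring_add[OF k(1)] in auto)
    show "lam (c * x) = c * lam x" if "c \<in> K" "x \<in> k" for c x
    proof (rule lam_eq)
      have "c * (x - lam x) \<in> H" using H_mult lam that by blast
      then show "c * x - c * lam x \<in> H" by (simp add: algebra_simps)
      show "c * x \<in> k" using that k subring_mult by blast
    qed (use lam that subring_mult[OF sK] in auto)
  qed
qed

text \<open>The graph of the map that applies \<open>lam\<close> to the right factors of a sum of
  products. As a relation it can be handled before the sum is known to determine the value.\<close>

inductive lin_rep :: "'l::field set \<Rightarrow> 'l set \<Rightarrow> ('l \<Rightarrow> 'l) \<Rightarrow> 'l \<Rightarrow> 'l \<Rightarrow> bool" for k F lam where
  zero: "lin_rep k F lam 0 0"
| add: "lin_rep k F lam x y \<Longrightarrow> f \<in> F \<Longrightarrow> c \<in> k \<Longrightarrow> lin_rep k F lam (x + f * c) (y + f * lam c)"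

lemma lin_rep_plus: "lin_rep k F lam x y \<Longrightarrow> lin_rep k F lam x' y' \<Longrightarrow> lin_rep k F lam (x + x') (y + y')"
proof (induction rule: lin_rep.induct)
  case (add x y f c)
  then have "lin_rep k F lam (x + x' + f * c) (y + y' + f * lam c)" by (intro lin_rep.add) auto
  then show ?case by (simp add: ac_simps)
qed simp

lemma lin_rep_scale:
  assumes F: "subring F" and g: "g \<in> F"
  shows "lin_rep k F lam x y \<Longrightarrow> lin_rep k F lam (g * x) (g * y)"
proof (induction rule: lin_rep.induct)
  case (add x y f c)
  then have "lin_rep k F lam (g * x + (g * f) * c) (g * y + (g * f) * lam c)"
    using F g by (intro lin_rep.add) (auto intro: subring_mult)
  then show ?case by (simp add: algebra_simps)
qed (simp add: lin_rep.zero)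

lemma lin_rep_scale_right:
  assumes k: "subring k" and d: "d \<in> k"
  shows "lin_rep k F lam x y \<Longrightarrow> \<exists>y'. lin_rep k F lam (x * d) y'"
proof (induction rule: lin_rep.induct)
  case (add x y f c)
  then obtain y' where "lin_rep k F lam (x * d) y'" by blast
  then have "lin_rep k F lam (x * d + f * (c * d)) (y' + f * lam (c * d))"
    using add k d by (intro lin_rep.add) (auto intro: subring_mult)
  then show ?case by (auto simp: algebra_simps)
qed (auto intro: lin_rep.zero)

lemma lin_rep_ex:
  assumes F: "subring F" and k: "subring k" and x: "x \<in> ring_adjoin k F"
  shows "\<exists>y. lin_rep k F lam x y"
proof -
  define R where "R = {x. \<exists>y. lin_rep k F lam x y}"
  have fc: "f * c \<in> R" if "f \<in> F" "c \<in> k" for f c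
    using lin_rep.add[OF lin_rep.zero that, of lam] by (auto simp: R_def)
  have diff: "x - y \<in> R" if xy: "x \<in> R" "y \<in> R" for x y
  proof -
    obtain x' y' where "lin_rep k F lam x x'" "lin_rep k F lam y y'" using xy by (auto simp: R_def)
    then have "lin_rep k F lam (x + - 1 * y) (x' + - 1 * y')"
      using lin_rep_plus lin_rep_scale[OF F subring_uminus[OF F subring_1[OF F]]] by blast
    then show ?thesis by (auto simp: R_def)
  qed
  have add: "x + y \<in> R" if xy: "x \<in> R" "y \<in> R" for x y
    using xy lin_rep_plus unfolding R_def by blast
  have mult: "x * y \<in> R" if "x \<in> R" "y \<in> R" for x y
  proof -
    obtain y' where "lin_rep k F lam y y'" using \<open>y \<in> R\<close> by (auto simp: R_def)
    then show ?thesis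
    proof (induction rule: lin_rep.induct)
      case zero
      then show ?case using lin_rep.zero by (auto simp: R_def)
    next
      case (add z z' f c)
      obtain x' where "lin_rep k F lam x x'" using \<open>x \<in> R\<close> by (auto simp: R_def)
      then have "lin_rep k F lam (f * x) (f * x')" using lin_rep_scale[OF F] add by blast
      then have "(f * x) * c \<in> R" using lin_rep_scale_right[OF k] add by (auto simp: R_def)
      then have "x * z + (f * x) * c \<in> R" using add \<open>\<And>x y. x \<in> R \<Longrightarrow> y \<in> R \<Longrightarrow> x + y \<in> R\<close> by blast
      then show ?case by (simp add: algebra_simps)
    qed
  qed
  have "subring R" using fc[OF subring_1[OF F] subring_1[OF k]] diff mult by (intro subringI) auto
  moreover have "k \<subseteq> R" "F \<subseteq> R" using fc[OF subring_1[OF F]] fc[OF _ subring_1[OF k]] by auto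
  ultimately have "ring_adjoin k F \<subseteq> R" by (intro ring_adjoin_least)
  then show ?thesis using x by (auto simp: R_def)
qed

lemma lin_rep_sum:
  "lin_rep k F lam x y \<Longrightarrow> \<exists>(n::nat) f c. (\<forall>j<n. f j \<in> F \<and> c j \<in> k) \<and> x = (\<Sum>j<n. f j * c j) \<and> y = (\<Sum>j<n. f j * lam (c j))"
proof (induction rule: lin_rep.induct)
  case zero
  show ?case by (rule exI[of _ 0]) simp
next
  case (add x y f c)
  then obtain n :: nat and g d where *: "\<forall>j<n. g j \<in> F \<and> d j \<in> k"
    "x = (\<Sum>j<n. g j * d j)" "y = (\<Sum>j<n. g j * lam (d j))" by blast
  have "(\<forall>j<Suc n. (g(n := f)) j \<in> F \<and> (d(n := c)) j \<in> k) \<and> x + f * c = (\<Sum>j<Suc n. (g(n := f)) j * (d(n := c)) j)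
    \<and> y + f * lam c = (\<Sum>j<Suc n. (g(n := f)) j * lam ((d(n := c)) j))"
    using * add by (auto simp: less_Suc_eq intro!: sum.cong)
  then show ?case by blast
qed

lemma lin_rep_mono: "lin_rep k F' lam x y \<Longrightarrow> F' \<subseteq> F \<Longrightarrow> lin_rep k F lam x y"
  by (induction rule: lin_rep.induct) (auto intro: lin_rep.intros)

lemma lin_rep_range:
  assumes "subring F" "\<And>c. c \<in> k \<Longrightarrow> lam c \<in> F"
  shows "lin_rep k F lam x y \<Longrightarrow> y \<in> F"
  by (induction rule: lin_rep.induct) (use assms in \<open>auto intro: subring_closed\<close>)

text \<open>Vanishing of the kernel on A \<otimes> k makes \<open>lin_rep\<close> a function: an
  \<open>F\<close>-linear retraction of k[F] onto \<open>F\<close> that respects every ring between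
  \<open>K\<close> and \<open>F\<close>. Linear disjointness is used in this form only.\<close>

lemma (in radicial_base) linearly_disjoint_projection:
  assumes F: "subfield F" and A: "subring A" "K \<subseteq> A" "fraction_field A = F"
    and dom: "tensor_product_is_domain K A k"
  obtains \<rho> where "\<And>x y. x \<in> ring_adjoin k F \<Longrightarrow> y \<in> ring_adjoin k F \<Longrightarrow> \<rho> (x + y) = \<rho> x + \<rho> y"
    "\<And>f x. f \<in> F \<Longrightarrow> x \<in> ring_adjoin k F \<Longrightarrow> \<rho> (f * x) = f * \<rho> x"
    "\<And>f. f \<in> F \<Longrightarrow> \<rho> f = f"
    "\<And>F' x. subring F' \<Longrightarrow> K \<subseteq> F' \<Longrightarrow> F' \<subseteq> F \<Longrightarrow> x \<in> ring_adjoin k F' \<Longrightarrow> \<rho> x \<in> F'"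
proof -
  have sF: "subring F" and sk: "subring k" and sK: "subring K" using F k K subfield_subring by blast+
  obtain lam where lam: "lam 1 = 1" "\<And>x. x \<in> k \<Longrightarrow> lam x \<in> K"
    "\<And>x y. x \<in> k \<Longrightarrow> y \<in> k \<Longrightarrow> lam (x + y) = lam x + lam y"
    "\<And>c x. c \<in> K \<Longrightarrow> x \<in> k \<Longrightarrow> lam (c * x) = c * lam x"
    using exists_linear_functional[OF K sk Kk] by blast
  \<comment> \<open>Clearing denominators brings the coefficients from \<open>F\<close> into
    \<open>A\<close>, where the domain hypothesis applies.\<close>
  have zero: "y = 0" if rep: "lin_rep k F lam 0 y" for y
  proof -
    obtain n :: nat and f c where *: "\<And>j. j < n \<Longrightarrow> f j \<in> F" "\<And>j. j < n \<Longrightarrow> c j \<in> k"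
      "0 = (\<Sum>j<n. f j * c j)" "y = (\<Sum>j<n. f j * lam (c j))" using lin_rep_sum[OF rep] by blast
    obtain d where d: "d \<in> A" "d \<noteq> 0" "\<And>j. j < n \<Longrightarrow> d * f j \<in> A"
      using common_denominator[OF A(1), of "{..<n}" f] * A(3) by auto
    have "(\<Sum>j<n. (d * f j) * c j) = d * (\<Sum>j<n. f j * c j)" by (simp add: sum_distrib_left mult.assoc)
    then have "(\<Sum>j<n. (d * f j) * c j) = 0" using *(3) by simp
    then have "(\<Sum>j<n. pure_tensor (d * f j) (c j)) \<in> tensor_relations K A k"
      using tensor_zero_of_sum_zero[OF sK A(1,2) sk Kk kK dom, of "{..<n}" "\<lambda>j. d * f j" c] d * by simp
    then have "(\<Sum>j<n. (d * f j) * lam (c j)) = 0"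
      using tensor_relations_functional[OF sK A(1,2) sk Kk lam(3,4), of "{..<n}"] by simp
    then have "d * y = 0" by (simp add: *(4) sum_distrib_left mult.assoc)
    then show ?thesis using d by simp
  qed
  have neg: "lin_rep k F lam x y \<Longrightarrow> lin_rep k F lam (- x) (- y)" for x y
    using lin_rep_scale[OF sF subring_uminus[OF sF subring_1[OF sF]], of k lam x y] by simp
  have uniq: "y = y'" if "lin_rep k F lam x y" "lin_rep k F lam x y'" for x y y'
    using zero[of "y + - y'"] lin_rep_plus[OF that(1) neg[OF that(2)]] by simp
  define \<rho> where "\<rho> x = (SOME y. lin_rep k F lam x y)" for x
  have \<rho>: "lin_rep k F lam x (\<rho> x)" if "x \<in> ring_adjoin k F" for x
    unfolding \<rho>_def using lin_rep_ex[OF sF sk that] by (rule someI_ex)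
  have \<rho>_eq: "\<rho> x = y" if "lin_rep k F lam x y" for x y
    unfolding \<rho>_def using that uniq by blast
  show ?thesis
  proof (rule that)
    show "\<rho> (x + y) = \<rho> x + \<rho> y" if "x \<in> ring_adjoin k F" "y \<in> ring_adjoin k F" for x y
      using \<rho>_eq lin_rep_plus \<rho> that by blast
    show "\<rho> (f * x) = f * \<rho> x" if "f \<in> F" "x \<in> ring_adjoin k F" for f x
      using \<rho>_eq lin_rep_scale[OF sF] \<rho> that by blast
    show "\<rho> f = f" if "f \<in> F" for f
      using \<rho>_eq[OF lin_rep.add[OF lin_rep.zero that subring_1[OF sk]]] lam(1) by simp
    show "\<rho> x \<in> F'" if F': "subring F'" "K \<subseteq> F'" "F' \<subseteq> F" and x: "x \<in> ring_adjoin k F'" for F' x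
    proof -
      obtain y where y: "lin_rep k F' lam x y" using lin_rep_ex[OF F'(1) sk x] by blast
      then have "y \<in> F'" using lin_rep_range[OF F'(1)] lam(2) F'(2) by blast
      moreover have "\<rho> x = y" using \<rho>_eq lin_rep_mono[OF y F'(3)] by blast
      ultimately show ?thesis by simp
    qed
  qed
qed

section \<open>Discrete valuations on function fields\<close>

definition units :: "'l::field set \<Rightarrow> 'l set" where
  "units R = {x \<in> R. x \<noteq> 0 \<and> inverse x \<in> R}"

lemma units_iff: "x \<in> units R \<longleftrightarrow> x \<in> R \<and> x \<noteq> 0 \<and> inverse x \<in> R"
  by (simp add: units_def)

lemma units_iff_nonunits: "x \<in> units R \<longleftrightarrow> x \<in> R \<and> x \<notin> nonunits R"
  by (auto simp: units_def nonunits_def)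

lemma units_mult: "subring R \<Longrightarrow> x \<in> units R \<Longrightarrow> y \<in> units R \<Longrightarrow> x * y \<in> units R"
  by (auto simp: units_def subring_mult)

lemma units_inverse: "x \<in> units R \<Longrightarrow> inverse x \<in> units R"
  by (auto simp: units_def)

lemma units_divide: "subring R \<Longrightarrow> x \<in> units R \<Longrightarrow> y \<in> units R \<Longrightarrow> x / y \<in> units R"
  by (simp add: divide_inverse units_mult units_inverse)

lemma units_1: "subring R \<Longrightarrow> 1 \<in> units R"
  by (simp add: units_def subring_1)

lemma units_power: "subring R \<Longrightarrow> x \<in> units R \<Longrightarrow> x ^ n \<in> units R"
  by (induction n) (auto intro: units_1 units_mult)

lemma units_add_nonunit:
  assumes R: "local_ring R" and "x \<in> units R" "y \<in> nonunits R"
  shows "x + y \<in> units R"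
proof -
  have sR: "subring R" using R by (simp add: local_ring_def)
  have "x + y \<notin> nonunits R"
  proof
    assume "x + y \<in> nonunits R"
    then have "(x + y) - y \<in> nonunits R" using assms local_ring_nonunits_diff by blast
    then show False using assms by (simp add: units_iff_nonunits)
  qed
  moreover have "x + y \<in> R" using assms sR subring_add by (auto simp: units_def nonunits_def)
  ultimately show ?thesis by (simp add: units_iff_nonunits)
qed

text \<open>The rule that terms of distinct values cannot cancel, stated before a valuation is
  available: two elements have equal value when their quotient is a unit.\<close>

lemma valuation_ring_sum_unit:
  assumes L: "subfield L" and V: "valuation_ring L V"
  shows "finite T \<Longrightarrow> T \<noteq> {} \<Longrightarrow> (\<And>t. t \<in> T \<Longrightarrow> x t \<in> L - {0}) \<Longrightarrow>
    (\<And>s t. s \<in> T \<Longrightarrow> t \<in> T \<Longrightarrow> s \<noteq> t \<Longrightarrow> x s / x t \<notin> units V) \<Longrightarrow>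
    \<exists>t\<in>T. (\<Sum>t\<in>T. x t) / x t \<in> units V"
proof (induction T rule: finite_ne_induct)
  case (singleton t)
  then show ?case using units_1[OF valuation_ring_subring[OF V]] by simp
next
  case (insert s T)
  note sV = valuation_ring_subring[OF V] and loc = valuation_ring_local[OF L V]
  obtain t where t: "t \<in> T" "(\<Sum>t\<in>T. x t) / x t \<in> units V" using insert by auto
  define y where "y = (\<Sum>t\<in>T. x t)"
  have nz: "x s \<noteq> 0" "x t \<noteq> 0" using insert.prems(1) t(1) by blast+
  have y0: "y \<noteq> 0" using t(2) unfolding y_def units_def by auto
  have st: "x s / x t \<notin> units V" using insert.prems(2)[of s t] insert.hyps t(1) by blast
  have ys: "x s / y \<notin> units V"
  proof
    assume "x s / y \<in> units V"
    then have "(x s / y) * (y / x t) \<in> units V" using t(2) units_mult[OF sV] unfolding y_def by blast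
    then show False using st y0 by simp
  qed
  have "x s \<in> L" using insert.prems(1) by blast
  moreover have "y \<in> L" unfolding y_def
    using insert.prems(1) by (intro subring_sum[OF subfield_subring[OF L]]) blast
  ultimately have "x s / y \<in> L" using L subfield_divide by blast
  then have "x s / y \<in> V \<or> inverse (x s / y) \<in> V" using V by (auto simp: valuation_ring_def)
  then have "(x s + y) / y \<in> units V \<or> (x s + y) / x s \<in> units V"
  proof
    assume "x s / y \<in> V"
    then have "x s / y \<in> nonunits V" using ys by (simp add: units_iff_nonunits)
    then have "1 + x s / y \<in> units V" by (rule units_add_nonunit[OF loc units_1[OF sV]])
    then show ?thesis using y0 by (simp add: add_divide_distrib add.commute)
  next
    assume i: "inverse (x s / y) \<in> V"
    then have "y / x s \<in> V" by simp
    moreover have "y / x s \<notin> units V" using ys units_inverse[of "y / x s" V] by auto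
    ultimately have "y / x s \<in> nonunits V" by (simp add: units_iff_nonunits)
    then have "1 + y / x s \<in> units V" by (rule units_add_nonunit[OF loc units_1[OF sV]])
    then show ?thesis using nz(1) by (simp add: add_divide_distrib)
  qed
  moreover have "(x s + y) / x t \<in> units V" if "(x s + y) / y \<in> units V"
  proof -
    have "((x s + y) / y) * (y / x t) \<in> units V"
      using that t(2) units_mult[OF sV] unfolding y_def by blast
    then show ?thesis using y0 by simp
  qed
  moreover have "(\<Sum>t\<in>insert s T. x t) = x s + y" using insert.hyps by (simp add: y_def)
  ultimately show ?case using t(1) by (metis insertCI)
qed

text \<open>The values form a nonzero subgroup of the integers, with least positive element
  \<open>g\<close>. It is applied to \<open>L\<close> and again to \<open>F\<close>, whose value
  group may be smaller.\<close>

lemma int_hom_normalize: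
  fixes w :: "'l::field \<Rightarrow> int"
  assumes L: "subfield L" and hom: "\<And>x y. x \<in> L - {0} \<Longrightarrow> y \<in> L - {0} \<Longrightarrow> w (x * y) = w x + w y"
    and u: "u \<in> L - {0}" "w u \<noteq> 0"
  obtains g t where "g > 0" "t \<in> L - {0}" "w t = g" "\<And>x. x \<in> L - {0} \<Longrightarrow> g dvd w x"
proof -
  note sL = subfield_subring[OF L]
  have w1: "w 1 = 0" using hom[of 1 1] subring_1[OF sL] by simp
  have closed: "x * y \<in> L - {0}" "inverse x \<in> L - {0}" if "x \<in> L - {0}" "y \<in> L - {0}" for x y
    using that L subfield_inverse subring_mult[OF sL] by auto
  have inv: "w (inverse x) = - w x" if "x \<in> L - {0}" for x
    using hom[of x "inverse x"] closed(2)[OF that that] that w1 by simp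
  have pow: "w (x ^ n) = int n * w x" "x ^ n \<in> L - {0}" if "x \<in> L - {0}" for x n
  proof -
    have "w (x ^ n) = int n * w x \<and> x ^ n \<in> L - {0}"
      using that by (induction n) (auto simp: w1 hom closed subring_1[OF sL] distrib_right intro: subring_mult[OF sL])
    then show "w (x ^ n) = int n * w x" "x ^ n \<in> L - {0}" by auto
  qed
  define G where "G = {n::nat. n > 0 \<and> (\<exists>x\<in>L - {0}. w x = int n)}"
  have "G \<noteq> {}"
  proof (cases "w u > 0")
    case True
    then have "nat (w u) \<in> G" using u by (auto simp: G_def)
    then show ?thesis by blast
  next
    case False
    then have "nat (- w u) \<in> G" using u inv[OF u(1)] closed(2)[OF u(1) u(1)] by (auto simp: G_def)
    then show ?thesis by blast
  qed
  define g where "g = (LEAST n. n \<in> G)"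
  have g: "g \<in> G" unfolding g_def using \<open>G \<noteq> {}\<close> by (metis LeastI ex_in_conv)
  have g_le: "g \<le> n" if "n \<in> G" for n unfolding g_def using that by (rule Least_le)
  obtain t where t: "t \<in> L - {0}" "w t = int g" "g > 0" using g by (auto simp: G_def)
  have "int g dvd w x" if x: "x \<in> L - {0}" for x
  proof -
    define q where "q = w x div int g"
    have tn: "t ^ n \<in> L - {0}" "w (t ^ n) = int n * int g" for n using pow[OF t(1)] t(2) by auto
    have "\<exists>z\<in>L - {0}. w z = - (q * int g)"
    proof (cases "q \<ge> 0")
      case True
      have "w (inverse (t ^ nat q)) = - (q * int g)" using True inv[OF tn(1)] tn(2) by simp
      then show ?thesis using closed(2)[OF tn(1) tn(1)] by blast
    next
      case False
      then have "w (t ^ nat (- q)) = - (q * int g)" using tn(2) by simp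
      then show ?thesis using tn(1) by blast
    qed
    then obtain z where z: "z \<in> L - {0}" "w z = - (q * int g)" by blast
    have "w (x * z) = w x mod int g"
      using hom[OF x z(1)] z(2) by (simp add: q_def minus_div_mult_eq_mod)
    then have "\<exists>y\<in>L - {0}. w y = w x mod int g" using closed(1)[OF x z(1)] by blast
    then obtain y where y: "y \<in> L - {0}" "w y = w x mod int g" by blast
    have "w x mod int g = 0"
    proof (rule ccontr)
      assume "w x mod int g \<noteq> 0"
      then have "w x mod int g > 0" using t(3) pos_mod_sign[of "int g" "w x"] by linarith
      then have "nat (w x mod int g) \<in> G" using y by (auto simp: G_def intro!: bexI[of _ y])
      then have "g \<le> nat (w x mod int g)" by (rule g_le)
      moreover have "w x mod int g < int g" using t(3) by simp
      ultimately show False using \<open>w x mod int g > 0\<close> by linarith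
    qed
    then show ?thesis by (simp add: dvd_eq_mod_eq_0)
  qed
  then show ?thesis using that[of "int g" t] t by simp
qed

locale function_field_place = char_p p "TYPE('l)"
  for p :: nat and k L V :: "'l::field set" and u :: 'l +
  assumes k: "subfield k" and alg_closed: "algebraically_closed k" and L: "subfield L"
    and V: "valuation_ring L V" and kV: "k \<subseteq> V" and u: "u \<in> nonunits V" "u \<noteq> 0"
    and fin: "\<exists>B. finite B \<and> L \<subseteq> lin_span (fraction_field (ring_adjoin k {u})) B"
begin

lemma sk: "subring k" and sL: "subring L" and sV: "subring V" and VL: "V \<subseteq> L" and locV: "local_ring V"
  and uV: "u \<in> V" and uL: "u \<in> L"
proof -
  show "subring k" "subring L" using k L subfield_subring by blast+
  show "subring V" "V \<subseteq> L" "local_ring V"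
    using V valuation_ring_subring valuation_ring_sub valuation_ring_local[OF L V] by blast+
  then show "u \<in> V" "u \<in> L" using u by (auto simp: nonunits_iff)
qed

definition M :: "'l set" where "M = fraction_field (ring_adjoin k {u})"

lemma M: "subfield M" and sM: "subring M" and M_sub: "M \<subseteq> L" and kM: "k \<subseteq> M" and uM: "u \<in> M"
proof -
  show "subfield M" unfolding M_def by (rule subfield_fraction_field[OF subring_ring_adjoin])
  then show "subring M" by (rule subfield_subring)
  show "M \<subseteq> L" unfolding M_def
    using kV VL uL by (intro fraction_field_least L ring_adjoin_least sL) auto
  have "ring_adjoin k {u} \<subseteq> M" unfolding M_def by (rule fraction_field_superset[OF subring_ring_adjoin])
  then show "k \<subseteq> M" "u \<in> M" using ring_adjoin_base ring_adjoin_gens by blast+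
qed

lemma const_unit: "c \<in> k \<Longrightarrow> c \<noteq> 0 \<Longrightarrow> c \<in> units V"
  using kV k subfield_inverse by (auto simp: units_def)

text \<open>Strip factors \<open>u\<close> until the constant term is a nonzero element of
  \<open>k\<close>, hence a unit: on k(u) the ring \<open>V\<close> induces the
  \<open>u\<close>-adic order.\<close>

lemma poly_unit_power: "f \<in> poly_over k \<Longrightarrow> f \<noteq> 0 \<Longrightarrow> \<exists>n. poly f u / u ^ n \<in> units V"
proof (induction f)
  case (pCons c h)
  have h: "h \<in> poly_over k" "c \<in> k"
    using pCons.prems(1) unfolding poly_over_def by (auto simp: coeff_pCons split: nat.splits)
  show ?case
  proof (cases "c = 0")
    case True
    then obtain n where "poly h u / u ^ n \<in> units V" using pCons h by auto
    then have "poly (pCons c h) u / u ^ Suc n \<in> units V" using True u by simp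
    then show ?thesis by blast
  next
    case False
    have "poly h u \<in> V" using h poly_over_mono[OF kV] poly_over_eval[OF sV] uV by blast
    then have "poly h u * u \<in> nonunits V" using nonunits_mult[OF sV u(1)] by blast
    then have "c + poly h u * u \<in> units V" using units_add_nonunit[OF locV const_unit] h False by blast
    then have "poly (pCons c h) u / u ^ 0 \<in> units V" by (simp add: mult.commute)
    then show ?thesis by blast
  qed
qed simp

lemma M_unit_power:
  assumes m: "m \<in> M" "m \<noteq> 0"
  shows "\<exists>i. m * u powi i \<in> units V"
proof -
  obtain a b where ab: "m = a / b" "a \<in> ring_adjoin k {u}" "b \<in> ring_adjoin k {u}"
    using m(1) unfolding M_def fraction_field_def by blast
  then obtain f g where fg: "a = poly f u" "b = poly g u" "f \<in> poly_over k" "g \<in> poly_over k"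
    using ring_adjoin_singleton[OF sk] by blast
  have "f \<noteq> 0" "g \<noteq> 0" using m ab fg by auto
  then obtain i j where ij: "poly f u / u ^ i \<in> units V" "poly g u / u ^ j \<in> units V"
    using poly_unit_power fg by metis
  then have "(poly f u / u ^ i) / (poly g u / u ^ j) \<in> units V" by (rule units_divide[OF sV])
  also have "(poly f u / u ^ i) / (poly g u / u ^ j) = m * u powi (int j - int i)"
    using u by (simp add: ab fg power_int_diff)
  finally show ?thesis by blast
qed

text \<open>\<open>L\<close> is finite over k(u), so \<open>x\<close> satisfies an equation there,
  and two of its terms must have equal value. Hence some power of \<open>x\<close> with exponent at
  most \<open>card B\<close> is a unit times a power of \<open>u\<close>.\<close>

lemma power_unit_bound: "\<exists>N>0. \<forall>x\<in>L - {0}. \<exists>i. x ^ N * u powi i \<in> units V"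
proof -
  obtain B where B: "finite B" "L \<subseteq> lin_span M B" using fin by (auto simp: M_def)
  have step: "\<exists>j\<in>{1..card B}. \<exists>i. x ^ j * u powi i \<in> units V" if x: "x \<in> L - {0}" for x
  proof -
    have "x ^ i \<in> lin_span M B" for i using x B subring_power[OF sL] by blast
    then obtain f where f: "f \<in> poly_over M" "f \<noteq> 0" "degree f \<le> card B" "poly f x = 0"
      using powers_dependent[OF sM B(1)] by metis
    define T where "T = {i. i \<le> degree f \<and> coeff f i \<noteq> 0}"
    have T: "finite T" "T \<noteq> {}" using f by (auto simp: T_def)
    have cM: "coeff f i \<in> M" for i using f by (simp add: poly_over_def)
    have terms: "coeff f i * x ^ i \<in> L - {0}" if "i \<in> T" for i
    proof -
      have "coeff f i \<in> L" "x ^ i \<in> L" using cM M_sub x subring_power[OF sL] by blast+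
      then have "coeff f i * x ^ i \<in> L" by (rule subring_mult[OF sL])
      then show ?thesis using that x by (simp add: T_def)
    qed
    have zero: "(\<Sum>i\<in>T. coeff f i * x ^ i) = 0"
    proof -
      have "(\<Sum>i\<in>T. coeff f i * x ^ i) = (\<Sum>i\<le>degree f. coeff f i * x ^ i)"
        by (intro sum.mono_neutral_left) (auto simp: T_def)
      then show ?thesis using f by (simp add: poly_altdef)
    qed
    have "\<exists>s\<in>T. \<exists>t\<in>T. s \<noteq> t \<and> (coeff f s * x ^ s) / (coeff f t * x ^ t) \<in> units V"
    proof (rule ccontr)
      assume "\<not> ?thesis"
      then have "\<exists>t\<in>T. (\<Sum>t\<in>T. coeff f t * x ^ t) / (coeff f t * x ^ t) \<in> units V"
        using valuation_ring_sum_unit[OF L V T, of "\<lambda>t. coeff f t * x ^ t"] terms by blast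
      then show False using zero by (simp add: units_def)
    qed
    then obtain s t where st: "s \<in> T" "t \<in> T" "s \<noteq> t" "(coeff f s * x ^ s) / (coeff f t * x ^ t) \<in> units V"
      by blast
    have main: "\<exists>j\<in>{1..card B}. \<exists>i. x ^ j * u powi i \<in> units V"
      if "s \<in> T" "t \<in> T" "t < s" "(coeff f s * x ^ s) / (coeff f t * x ^ t) \<in> units V" for s t
    proof -
      define m where "m = coeff f s / coeff f t"
      have m: "m \<in> M" "m \<noteq> 0" using that cM subfield_divide[OF M] by (auto simp: m_def T_def)
      obtain i where i: "m * u powi i \<in> units V" using M_unit_power[OF m] by blast
      have "(coeff f s * x ^ s) / (coeff f t * x ^ t) = m * x ^ (s - t)"
        using that x by (simp add: m_def power_diff)
      then have "(m * x ^ (s - t)) / (m * u powi i) \<in> units V"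
        using that(4) units_divide[OF sV _ i] by metis
      moreover have "(m * x ^ (s - t)) / (m * u powi i) = x ^ (s - t) * u powi (- i)"
        using m by (simp add: power_int_minus divide_inverse)
      ultimately have "x ^ (s - t) * u powi (- i) \<in> units V" by metis
      moreover have "s - t \<in> {1..card B}" using that f(3) by (auto simp: T_def)
      ultimately show ?thesis by blast
    qed
    show ?thesis
    proof (cases "t < s")
      case True
      then show ?thesis using main st by blast
    next
      case False
      have "inverse ((coeff f s * x ^ s) / (coeff f t * x ^ t)) \<in> units V" using st units_inverse by blast
      then have "(coeff f t * x ^ t) / (coeff f s * x ^ s) \<in> units V" by simp
      then show ?thesis using main[of t s] st False by simp
    qed
  qed
  \<comment> \<open>The factorial is a common multiple of all exponents that can occur, so a single
    \<open>N\<close> serves every \<open>x\<close>.\<close>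
  have "\<exists>i. x ^ fact (card B) * u powi i \<in> units V" if x: "x \<in> L - {0}" for x
  proof -
    obtain j i where ji: "j \<in> {1..card B}" "x ^ j * u powi i \<in> units V" using step[OF x] by blast
    then have "j dvd fact (card B)" by (intro dvd_fact) auto
    then obtain m where m: "fact (card B) = j * m" by blast
    have "(x ^ j * u powi i) ^ m \<in> units V" using ji units_power[OF sV] by blast
    also have "(x ^ j * u powi i) ^ m = x ^ fact (card B) * u powi (i * int m)"
      by (simp add: m power_mult_distrib power_mult power_int_mult)
    finally show ?thesis by blast
  qed
  then show ?thesis by (intro exI[of _ "fact (card B)"]) auto
qed

lemma u_power_in: "u powi i \<in> V \<longleftrightarrow> i \<ge> 0"
proof
  assume uV': "u powi i \<in> V"
  show "i \<ge> 0"
  proof (rule ccontr)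
    assume "\<not> i \<ge> 0"
    then have "nat (- i) > 0" by simp
    then have "u ^ (nat (- i) - 1) * u powi i \<in> V"
      using uV' uV subring_mult[OF sV] subring_power[OF sV] by blast
    also have "u ^ (nat (- i) - 1) * u powi i = u powi (int (nat (- i) - 1) + i)"
      using u by (simp add: power_int_add)
    also have "int (nat (- i) - 1) + i = -1" using \<open>nat (- i) > 0\<close> by linarith
    finally have "inverse u \<in> V" by (simp add: power_int_minus)
    then show False using u by (simp add: nonunits_iff)
  qed
next
  assume "i \<ge> 0"
  then show "u powi i \<in> V" using uV subring_power[OF sV] by (simp add: power_int_def)
qed

lemma exists_normalized_valuation: "\<exists>v. is_normalized_valuation V v"
proof -
  obtain N where N: "N > 0" "\<And>x. x \<in> L - {0} \<Longrightarrow> \<exists>i. x ^ N * u powi i \<in> units V"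
    using power_unit_bound by blast
  have u_unit: "i = 0" if "u powi i \<in> units V" for i
    using that u_power_in[of i] u_power_in[of "- i"] by (auto simp: units_def power_int_minus)
  \<comment> \<open>The \<open>u\<close>-adic order of \<open>x ^ N\<close>. It is a multiple of the
    valuation sought and will be divided by the generator \<open>g\<close> of its values.\<close>
  define w where "w x = - (SOME i. x ^ N * u powi i \<in> units V)" for x
  have w: "x ^ N * u powi (- w x) \<in> units V" if "x \<in> L - {0}" for x
    using someI_ex[OF N(2)[OF that]] by (simp add: w_def)
  have w_eq: "w x = i" if "x \<in> L - {0}" "x ^ N * u powi (- i) \<in> units V" for x i
  proof -
    have "(x ^ N * u powi (- i)) / (x ^ N * u powi (- w x)) \<in> units V"
      using units_divide[OF sV that(2) w[OF that(1)]] .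
    also have "(x ^ N * u powi (- i)) / (x ^ N * u powi (- w x)) = u powi (w x - i)"
      using that u by (simp add: power_int_diff power_int_minus field_simps)
    finally show ?thesis using u_unit by fastforce
  qed
  have hom: "w (x * y) = w x + w y" if "x \<in> L - {0}" "y \<in> L - {0}" for x y
  proof (rule w_eq)
    show "x * y \<in> L - {0}" using that subring_mult[OF sL] by auto
    have "(x ^ N * u powi (- w x)) * (y ^ N * u powi (- w y)) \<in> units V" using w that units_mult[OF sV] by blast
    also have "(x ^ N * u powi (- w x)) * (y ^ N * u powi (- w y)) = (x * y) ^ N * u powi (- (w x + w y))"
      using u by (simp add: power_mult_distrib power_int_diff power_int_minus field_simps)
    finally show "(x * y) ^ N * u powi (- (w x + w y)) \<in> units V" .
  qed
  have w_V: "x \<in> V \<longleftrightarrow> w x \<ge> 0" if x: "x \<in> L - {0}" for x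
  proof -
    have wx: "x ^ N * u powi (- w x) \<in> units V" using w[OF x] .
    have "x \<in> V \<longleftrightarrow> x ^ N \<in> V"
    proof
      assume xN: "x ^ N \<in> V"
      show "x \<in> V"
      proof (rule ccontr)
        assume "x \<notin> V"
        then have ix: "inverse x \<in> V" using x V by (auto simp: valuation_ring_def)
        have "inverse x ^ (N - 1) * x ^ N \<in> V" using subring_mult[OF sV subring_power[OF sV ix] xN] .
        moreover have "inverse x ^ (N - 1) * x ^ N = x"
          using x N(1) by (cases N) (auto simp: power_inverse)
        ultimately show False using \<open>x \<notin> V\<close> by simp
      qed
    qed (rule subring_power[OF sV])
    also have "\<dots> \<longleftrightarrow> u powi (w x) \<in> V"
    proof
      assume "x ^ N \<in> V"
      then have "x ^ N * inverse (x ^ N * u powi (- w x)) \<in> V" using wx subring_mult[OF sV] by (auto simp: units_def)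
      moreover have "x ^ N * inverse (x ^ N * u powi (- w x)) = u powi (w x)"
        using x by (simp add: power_int_minus)
      ultimately show "u powi (w x) \<in> V" by simp
    next
      assume "u powi (w x) \<in> V"
      then have "u powi (w x) * (x ^ N * u powi (- w x)) \<in> V" using wx subring_mult[OF sV] by (auto simp: units_def)
      moreover have "u powi (w x) * (x ^ N * u powi (- w x)) = x ^ N"
        using u by (simp add: power_int_minus)
      ultimately show "x ^ N \<in> V" by simp
    qed
    finally show ?thesis using u_power_in by simp
  qed
  have wu: "w u = int N"
    using uL u by (intro w_eq) (auto simp: power_int_minus units_1[OF sV])
  have uL0: "u \<in> L - {0}" using uL u by blast
  obtain g t where gt: "g > 0" "t \<in> L - {0}" "w t = g" "\<And>x. x \<in> L - {0} \<Longrightarrow> g dvd w x"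
  proof -
    have "w u \<noteq> 0" using wu N(1) by simp
    from int_hom_normalize[OF L hom uL0 this] show ?thesis using that by blast
  qed
  have tpow: "w (t powi n) = n * g \<and> t powi n \<in> L - {0}" for n
  proof -
    have tL: "t powi n \<in> L - {0}" for n using gt(2) subfield_power_int[OF L] by (auto simp: power_int_eq_0_iff)
    have w1: "w 1 = 0" using hom[of 1 1] subring_1[OF sL] by simp
    have pos: "w (t powi int m) = int m * g" for m
    proof (induction m)
      case (Suc m)
      have "t powi int (Suc m) = t powi int m * t" by (simp only: power_int_of_nat power_Suc2)
      then show ?case using hom[OF tL gt(2), of "int m"] Suc gt(3) by (simp add: algebra_simps)
    qed (simp add: w1)
    have neg: "w (t powi (- int m)) = - int m * g" for m
    proof -
      have "w (t powi (- int m) * t powi int m) = w (t powi (- int m)) + w (t powi int m)" by (rule hom[OF tL tL])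
      moreover have "t powi (- int m) * t powi int m = 1" using gt(2) by (simp add: power_int_minus)
      ultimately show ?thesis using w1 pos[of m] by simp
    qed
    show ?thesis using tL[of n] pos neg by (cases n rule: int_cases2) auto
  qed
  define v where "v x = (if x \<in> L - {0} then w x div g else 0)" for x
  have frac: "fraction_field V = L" using valuation_ring_fraction_field[OF L V] .
  have v_hom: "v (x * y) = v x + v y" if "x \<in> L - {0}" "y \<in> L - {0}" for x y
  proof -
    have "x * y \<in> L - {0}" using that subring_mult[OF sL] by auto
    then show ?thesis using that hom gt(4) by (simp add: v_def div_plus_div_distrib_dvd_left)
  qed
  have v_V: "x \<in> V \<longleftrightarrow> v x \<ge> 0" if "x \<in> L - {0}" for x
    using w_V[OF that] that gt(1) by (simp add: v_def pos_imp_zdiv_nonneg_iff)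
  have v_add: "min (v x) (v y) \<le> v (x + y)" if xy: "x \<in> L - {0}" "y \<in> L - {0}" "x + y \<noteq> 0" for x y
  proof -
    have *: "v x \<le> v (x + y)" if xy: "x \<in> L - {0}" "y \<in> L - {0}" "x + y \<noteq> 0" and d: "y / x \<in> V" for x y
    proof -
      have "(x + y) / x = 1 + y / x" using xy by (simp add: add_divide_distrib)
      then have V': "(x + y) / x \<in> V" using d subring_add[OF sV subring_1[OF sV]] by simp
      have L': "(x + y) / x \<in> L - {0}" using V' VL xy by auto
      have "v (x * ((x + y) / x)) = v x + v ((x + y) / x)" using v_hom[OF xy(1) L'] .
      moreover have "v ((x + y) / x) \<ge> 0" using v_V[OF L'] V' by simp
      ultimately show ?thesis using xy by simp
    qed
    have "y / x \<in> L" using xy subfield_divide[OF L] by blast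
    then have "y / x \<in> V \<or> inverse (y / x) \<in> V" using V by (auto simp: valuation_ring_def)
    then show ?thesis
    proof
      assume "y / x \<in> V"
      then show ?thesis using *[OF xy] by simp
    next
      assume "inverse (y / x) \<in> V"
      then have "x / y \<in> V" by simp
      then show ?thesis using *[of y x] xy by (simp add: add.commute)
    qed
  qed
  have "v ` (L - {0}) = UNIV"
  proof -
    have "v (t powi n) = n" for n using tpow[of n] gt(1) by (simp add: v_def)
    then show ?thesis using tpow by (metis UNIV_eq_I image_eqI)
  qed
  moreover have "V = {x \<in> L. x = 0 \<or> v x \<ge> 0}"
    using v_V VL subring_0[OF sV] by auto
  moreover have "v x = 0" if "x \<notin> L - {0}" for x using that by (auto simp: v_def)
  ultimately have "is_normalized_valuation V v"
    unfolding is_normalized_valuation_def frac using v_hom v_add by blast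
  then show ?thesis by blast
qed

text \<open>Over the algebraically closed \<open>k\<close> the polynomial splits, and the nonunits
  form a prime ideal, so some factor x - c is a nonunit.\<close>

lemma residue_root:
  "q \<in> poly_over k \<Longrightarrow> q \<noteq> 0 \<Longrightarrow> x \<in> V \<Longrightarrow> poly q x \<in> nonunits V \<Longrightarrow> \<exists>c\<in>k. x - c \<in> nonunits V"
proof (induction "degree q" arbitrary: q)
  case 0
  then obtain a where a: "q = [:a:]" by (metis degree_eq_zeroE)
  then have "a \<in> k" "a \<noteq> 0" using 0 by (auto simp: poly_over_def coeff_pCons split: nat.splits)
  then show ?case using const_unit[of a] 0 a by (simp add: units_iff_nonunits)
next
  case (Suc n)
  have "set (coeffs q) \<subseteq> k" using Suc.prems(1) poly_over_iff[OF subring_0[OF sk]] by blast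
  then obtain c where c: "c \<in> k" "poly q c = 0"
    using alg_closed Suc.hyps(2) unfolding algebraically_closed_def by (metis zero_less_Suc)
  define l where "l = [:- c, 1:]"
  have l: "l \<in> poly_over k" unfolding l_def
    using c by (intro poly_over_pCons[OF sk] poly_over_0[OF sk] subring_uminus[OF sk] subring_1[OF sk])
  have "l dvd q" using c by (simp add: l_def poly_eq_0_iff_dvd)
  then have ql: "q = l * (q div l)" by simp
  have h: "q div l \<in> poly_over k" "q div l \<noteq> 0"
    using poly_over_divmod(1)[OF k l Suc.prems(1)] ql Suc.prems by auto
  have "degree q = degree l + degree (q div l)"
    using ql h by (metis degree_mult_eq Suc.prems(2) mult_zero_left)
  then have deg: "n = degree (q div l)" using Suc.hyps(2) by (simp add: l_def)
  have "poly q x = (x - c) * poly (q div l) x" by (subst ql) (simp add: l_def left_diff_distrib)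
  moreover have "x - c \<in> V" using Suc.prems c kV subring_diff[OF sV] by blast
  moreover have "poly (q div l) x \<in> V" using h poly_over_mono[OF kV] poly_over_eval[OF sV] Suc.prems by blast
  ultimately have "x - c \<in> nonunits V \<or> poly (q div l) x \<in> nonunits V"
    using prime_ideal_nonunits[OF locV] Suc.prems(4) unfolding prime_ideal_def by metis
  then show ?case using Suc.hyps(1)[OF deg h Suc.prems(3)] c by blast
qed

text \<open>The residue field of \<open>V\<close> is \<open>k\<close>: reducing a relation between
  \<open>x\<close> and \<open>u\<close> modulo \<open>u\<close> makes the residue of
  \<open>x\<close> algebraic over \<open>k\<close>.\<close>

lemma residue_exists:
  assumes x: "x \<in> V"
  shows "\<exists>c\<in>k. x - c \<in> nonunits V"
proof -
  obtain B where B: "finite B" "L \<subseteq> lin_span M B" using fin by (auto simp: M_def)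
  have "algebraic_over M x" using algebraic_over_of_finite_span[OF sM sL B] x VL by blast
  then obtain q r where q: "q \<in> poly_over k" "q \<noteq> 0" "r \<in> V" "poly q x = r * u"
    using residue_polynomial[OF k sV kV uV x u(2)] by (auto simp: M_def)
  then have "poly q x \<in> nonunits V" using nonunits_mult[OF sV u(1)] by simp
  then show ?thesis using residue_root q x by blast
qed

subsection \<open>Frobenius powers\<close>

abbreviation Lp :: "'l set" where "Lp \<equiv> (\<lambda>x. x ^ p) ` L"

lemma subfield_frobenius: "subfield E \<Longrightarrow> subfield ((\<lambda>x. x ^ p) ` (E :: 'l set))"
  unfolding subfield_def subring_def
  by (auto simp: image_iff frob_diff1[symmetric] power_mult_distrib[symmetric] power_inverse[symmetric])
    (metis power_one)

lemma k_perfect: "c \<in> k \<Longrightarrow> \<exists>d\<in>k. d ^ p = c"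
proof -
  assume c: "c \<in> k"
  define f where "f = monom 1 p - [:c:]"
  have "f \<in> poly_over k" unfolding f_def
    using c by (intro poly_over_diff[OF sk] poly_over_monom[OF sk] poly_over_const[OF sk] subring_1[OF sk])
  moreover have "coeff f p = 1" using p_pos by (simp add: f_def coeff_pCons split: nat.split)
  then have "degree f > 0" using p_pos le_degree[of f p] by simp
  ultimately obtain d where "d \<in> k" "poly f d = 0"
    using alg_closed poly_over_iff[OF subring_0[OF sk]] unfolding algebraically_closed_def by blast
  then show ?thesis by (auto simp: f_def poly_monom)
qed

text \<open>Write a / b as a b^(p-1) over b^p. The numerator is a polynomial in \<open>u\<close>
  over the perfect \<open>k\<close>, so each of its terms is a \<open>p\<close>-th power times u^r
  with r < p.\<close>

lemma M_frobenius_span: "M \<subseteq> lin_span ((\<lambda>x. x ^ p) ` M) ((\<lambda>r. u ^ r) ` {..<p})"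
proof -
  let ?Mp = "(\<lambda>x. x ^ p) ` M" and ?U = "(\<lambda>r. u ^ r) ` {..<p}"
  have sMp: "subring ?Mp" using subfield_subring[OF subfield_frobenius[OF M]] .
  have fU: "finite ?U" by simp
  have poly: "poly f u \<in> lin_span ?Mp ?U" if f: "f \<in> poly_over k" for f
  proof -
    have "coeff f i * u ^ i \<in> lin_span ?Mp ?U" for i
    proof -
      obtain d where d: "d \<in> k" "d ^ p = coeff f i" using k_perfect f by (auto simp: poly_over_def)
      have "d * u ^ (i div p) \<in> M" using d kM uM subring_mult[OF sM] subring_power[OF sM] by blast
      then have "(d * u ^ (i div p)) ^ p \<in> ?Mp" by blast
      moreover have "u ^ (i mod p) \<in> lin_span ?Mp ?U"
        using p_pos by (intro lin_span_base[OF sMp fU]) auto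
      ultimately have "(d * u ^ (i div p)) ^ p * u ^ (i mod p) \<in> lin_span ?Mp ?U"
        using lin_span_smult[OF sMp] by blast
      moreover have "(d * u ^ (i div p)) ^ p * u ^ (i mod p) = coeff f i * u ^ i"
        by (simp add: d power_mult_distrib mult.assoc flip: power_mult power_add)
      ultimately show ?thesis by simp
    qed
    then show ?thesis unfolding poly_altdef by (intro lin_span_sum[OF sMp]) auto
  qed
  show ?thesis
  proof
    fix m assume "m \<in> M"
    then obtain a b where ab: "m = a / b" "a \<in> ring_adjoin k {u}" "b \<in> ring_adjoin k {u}"
      unfolding M_def fraction_field_def by blast
    then obtain f g where fg: "a = poly f u" "b = poly g u" "f \<in> poly_over k" "g \<in> poly_over k"
      using ring_adjoin_singleton[OF sk] by blast
    have "f * g ^ (p - 1) \<in> poly_over k" using fg poly_over_mult[OF sk] poly_over_power[OF sk] by blast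
    then have "poly (f * g ^ (p - 1)) u \<in> lin_span ?Mp ?U" by (rule poly)
    moreover have "inverse b ^ p \<in> ?Mp"
    proof -
      have "b \<in> M" using ab(3) fraction_field_superset[OF subring_ring_adjoin] unfolding M_def by blast
      then show ?thesis using subfield_inverse[OF M] by blast
    qed
    ultimately have "inverse b ^ p * poly (f * g ^ (p - 1)) u \<in> lin_span ?Mp ?U"
      using lin_span_smult[OF sMp] by blast
    moreover have "inverse b ^ p * poly (f * g ^ (p - 1)) u = m"
      using p_pos by (cases "b = 0"; cases p) (auto simp: ab(1) fg(1,2)[symmetric] power_inverse field_simps)
    ultimately show "m \<in> lin_span ?Mp ?U" by simp
  qed
qed

text \<open>The degree of \<open>L\<close> over \<open>Lp\<close> is at most \<open>p\<close>, by
  counting over the \<open>p\<close>-th powers of \<open>M\<close>. With n = [L:M], at most n p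
  elements span \<open>L\<close> over them, so the n (p + 1) elements b^p e_j are dependent.\<close>

lemma Lp_dependent:
  assumes e: "\<And>j. j \<le> p \<Longrightarrow> e j \<in> L"
  shows "\<exists>l. (\<forall>j\<le>p. l j \<in> Lp) \<and> (\<exists>j\<le>p. l j \<noteq> 0) \<and> (\<Sum>j\<le>p. l j * e j) = 0"
proof -
  let ?Mp = "(\<lambda>x. x ^ p) ` M" and ?U = "(\<lambda>r. u ^ r) ` {..<p}"
  have sMp: "subring ?Mp" using subfield_subring[OF subfield_frobenius[OF M]] .
  obtain B0 where B0: "finite B0" "L \<subseteq> lin_span M B0" using fin by (auto simp: M_def)
  obtain B where B: "lin_indep M B" "B \<subseteq> L" "L \<subseteq> lin_span M B"
    using extend_to_basis[OF M B0, of "{}"] by (auto simp: lin_indep_def)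
  have fB: "finite B" using B by (simp add: lin_indep_def)
  have cB: "card B > 0"
  proof -
    have "B \<noteq> {}"
    proof
      assume "B = {}"
      then have "1 \<in> lin_span M {}" using B subring_1[OF sL] by blast
      then show False by (simp add: lin_span_def)
    qed
    then show ?thesis using fB by (simp add: card_gt_0_iff)
  qed
  define B' where "B' = (\<lambda>(b, r). r * b) ` (B \<times> ?U)"
  have fB': "finite B'" using fB by (simp add: B'_def)
  have cB': "card B' \<le> card B * p"
  proof -
    have "card B' \<le> card (B \<times> ?U)" unfolding B'_def using fB by (intro card_image_le) auto
    also have "\<dots> = card B * card ?U" by (rule card_cartesian_product)
    also have "\<dots> \<le> card B * p" using card_image_le[of "{..<p}" "\<lambda>r. u ^ r"] by simp
    finally show ?thesis .
  qed
  have L_span: "x \<in> lin_span ?Mp B'" if x: "x \<in> L" for x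
  proof -
    obtain a where a: "\<And>b. b \<in> B \<Longrightarrow> a b \<in> M" "x = (\<Sum>b\<in>B. a b * b)"
      using x B by (auto elim!: lin_spanE)
    have "a b * b \<in> lin_span ?Mp B'" if b: "b \<in> B" for b
    proof (rule lin_span_mult_right[OF sMp])
      show "a b \<in> lin_span ?Mp ?U" using a(1)[OF b] M_frobenius_span by blast
      show "r * b \<in> lin_span ?Mp B'" if "r \<in> ?U" for r
        using that b by (intro lin_span_base[OF sMp fB']) (auto simp: B'_def)
    qed
    then show ?thesis unfolding a(2) by (intro lin_span_sum[OF sMp]) auto
  qed
  define I where "I = B \<times> {..p}"
  have "card B' < card I" using cB' cB by (simp add: I_def card_cartesian_product)
  moreover have "(case i of (b, j) \<Rightarrow> b ^ p * e j) \<in> lin_span ?Mp B'" if "i \<in> I" for i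
    using that B(2) e by (auto simp: I_def intro!: L_span subring_mult[OF sL] subring_power[OF sL])
  ultimately obtain c where c: "\<forall>i\<in>I. c i \<in> ?Mp" "\<exists>i\<in>I. c i \<noteq> 0"
    "(\<Sum>i\<in>I. c i * (case i of (b, j) \<Rightarrow> b ^ p * e j)) = 0"
    using lin_span_dependent[OF sMp fB', of I "\<lambda>i. case i of (b, j) \<Rightarrow> b ^ p * e j"] fB
    by (auto simp: I_def)
  have "\<forall>i\<in>I. \<exists>d. d \<in> M \<and> c i = d ^ p" using c(1) by blast
  then obtain d where d: "\<And>i. i \<in> I \<Longrightarrow> d i \<in> M" "\<And>i. i \<in> I \<Longrightarrow> c i = d i ^ p" by metis
  \<comment> \<open>For fixed \<open>j\<close> the coefficients assemble into the
    \<open>p\<close>-th power of one element of \<open>L\<close>; it is nonzero for some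
    \<open>j\<close> because \<open>B\<close> is independent.\<close>
  define y where "y j = (\<Sum>b\<in>B. d (b, j) * b)" for j
  have yL: "y j \<in> L" if "j \<le> p" for j unfolding y_def
    using that d(1) B(2) M_sub by (intro subring_sum[OF sL] subring_mult[OF sL]) (auto simp: I_def)
  have "(\<Sum>j\<le>p. y j ^ p * e j) = (\<Sum>j\<le>p. \<Sum>b\<in>B. c (b, j) * (b ^ p * e j))"
    by (intro sum.cong refl)
      (simp add: y_def frob_sum1 d(2) I_def power_mult_distrib sum_distrib_right mult.assoc)
  also have "\<dots> = (\<Sum>b\<in>B. \<Sum>j\<le>p. c (b, j) * (b ^ p * e j))" by (rule sum.swap)
  also have "\<dots> = (\<Sum>i\<in>I. c i * (case i of (b, j) \<Rightarrow> b ^ p * e j))"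
    unfolding I_def by (simp add: sum.cartesian_product case_prod_unfold)
  finally have "(\<Sum>j\<le>p. y j ^ p * e j) = 0" using c(3) by simp
  moreover have "\<exists>j\<le>p. y j ^ p \<noteq> 0"
  proof -
    obtain b j where bj: "b \<in> B" "j \<le> p" "c (b, j) \<noteq> 0" using c(2) by (auto simp: I_def)
    have "y j \<noteq> 0"
    proof
      assume "y j = 0"
      then have "d (b, j) = 0"
        using lin_indepD[OF B(1), of "\<lambda>b. d (b, j)" b] d(1) bj by (auto simp: y_def I_def)
      then show False using bj d(2)[of "(b, j)"] p_pos by (simp add: I_def)
    qed
    then show ?thesis using bj by auto
  qed
  ultimately show ?thesis using yL by (intro exI[of _ "\<lambda>j. y j ^ p"]) auto
qed

end

text \<open>The units are determined by \<open>V\<close>, so both valuations have the same zeros and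
  are proportional; as both attain 1, the factor is 1. This makes the definite description in
  \<open>normalized_valuation\<close> meaningful.\<close>

lemma normalized_valuation_unique:
  assumes v: "is_normalized_valuation V v" and v': "is_normalized_valuation V v'"
    and L: "subfield (fraction_field V)"
  shows "v = v'"
proof
  fix x
  let ?L = "fraction_field V - {0}"
  note sL = subfield_subring[OF L]
  have hom: "f (x * y) = f x + f y"
    if "is_normalized_valuation V f" "x \<in> ?L" "y \<in> ?L" for f x y
    using that unfolding is_normalized_valuation_def by blast
  have ring: "x \<in> V \<longleftrightarrow> f x \<ge> 0" if "is_normalized_valuation V f" "x \<in> ?L" for f x
    using that unfolding is_normalized_valuation_def by blast
  have mult: "x * y \<in> ?L" and inv: "inverse x \<in> ?L" if "x \<in> ?L" "y \<in> ?L" for x y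
    using that subring_mult[OF sL] subfield_inverse[OF L] by auto
  have one: "f 1 = 0" if "is_normalized_valuation V f" for f
    using hom[OF that, of 1 1] subring_1[OF sL] by simp
  have f_inv: "f (inverse x) = - f x" if "is_normalized_valuation V f" "x \<in> ?L" for f x
    using hom[OF that(1) that(2) inv[OF that(2) that(2)]] one[OF that(1)] that(2) by simp
  have zero_iff: "f x = 0 \<longleftrightarrow> x \<in> V \<and> inverse x \<in> V" if "is_normalized_valuation V f" "x \<in> ?L" for f x
    using ring[OF that] ring[OF that(1) inv[OF that(2) that(2)]] f_inv[OF that] by auto
  have pw: "f (t powi n) = n * f t" if f: "is_normalized_valuation V f" "t \<in> ?L" for f t n
  proof -
    have tL: "t ^ m \<in> ?L" for m using that(2) subring_power[OF sL] by simp
    have pos: "f (t ^ m) = int m * f t" for m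
      by (induction m) (simp_all add: one[OF f(1)] hom[OF f(1) f(2) tL] algebra_simps)
    show ?thesis
    proof (cases "n \<ge> 0")
      case True
      then show ?thesis using pos[of "nat n"] by (simp add: power_int_def)
    next
      case False
      then show ?thesis using pos[of "nat (- n)"] f_inv[OF f(1) tL, of "nat (- n)"]
        by (simp add: power_int_def power_inverse)
    qed
  qed
  have surj: "1 \<in> f ` ?L" if "is_normalized_valuation V f" for f
    using that unfolding is_normalized_valuation_def by simp
  obtain t where t: "t \<in> ?L" "v t = 1" using surj[OF v] by (elim imageE) simp
  have tp: "t powi n \<in> ?L" for n
    using t(1) subfield_power_int[OF L] by (auto simp: power_int_eq_0_iff)
  have lin: "v' y = v y * v' t" if y: "y \<in> ?L" for y
  proof -
    have yt: "y * t powi (- v y) \<in> ?L" using mult[OF y tp] .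
    have "v (y * t powi (- v y)) = 0" using hom[OF v y tp] pw[OF v t(1)] t(2) by simp
    then have "v' (y * t powi (- v y)) = 0" using zero_iff[OF v yt] zero_iff[OF v' yt] by blast
    then show ?thesis using hom[OF v' y tp] pw[OF v' t(1)] by simp
  qed
  obtain s where s: "s \<in> ?L" "v' s = 1" using surj[OF v'] by (elim imageE) simp
  have "v s * v' t = 1" using lin[OF s(1)] s(2) by simp
  moreover have "v' t \<ge> 0" using ring[OF v' t(1)] ring[OF v t(1)] t(2) by simp
  ultimately have "v' t = 1" by (simp add: zmult_eq_1_iff)
  then show "v x = v' x"
    using lin[of x] v v' unfolding is_normalized_valuation_def by (cases "x \<in> ?L") auto
qed

context function_field_place
begin

definition v :: "'l \<Rightarrow> int" where "v = normalized_valuation V"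

lemma fraction_field_V: "fraction_field V = L"
  using valuation_ring_fraction_field[OF L V] .

lemma is_normalized_valuation_v: "is_normalized_valuation V v"
proof -
  obtain w where w: "is_normalized_valuation V w" using exists_normalized_valuation by blast
  have "normalized_valuation V = w"
    unfolding normalized_valuation_def
  proof (rule the_equality)
    show "is_normalized_valuation V w" by (rule w)
    fix w' assume "is_normalized_valuation V w'"
    then show "w' = w" using normalized_valuation_unique[OF _ w] L fraction_field_V by simp
  qed
  then show ?thesis using w by (simp add: v_def)
qed

lemma v_mult: "x \<in> L \<Longrightarrow> y \<in> L \<Longrightarrow> x \<noteq> 0 \<Longrightarrow> y \<noteq> 0 \<Longrightarrow> v (x * y) = v x + v y"
  and v_add: "x \<in> L \<Longrightarrow> y \<in> L \<Longrightarrow> x \<noteq> 0 \<Longrightarrow> y \<noteq> 0 \<Longrightarrow> x + y \<noteq> 0 \<Longrightarrow> min (v x) (v y) \<le> v (x + y)"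
  and V_iff: "x \<in> V \<longleftrightarrow> x \<in> L \<and> (x = 0 \<or> v x \<ge> 0)"
  and v_surj: "\<exists>t\<in>L. t \<noteq> 0 \<and> v t = n"
proof -
  note nv = is_normalized_valuation_v[unfolded is_normalized_valuation_def fraction_field_V]
  show "x \<in> L \<Longrightarrow> y \<in> L \<Longrightarrow> x \<noteq> 0 \<Longrightarrow> y \<noteq> 0 \<Longrightarrow> v (x * y) = v x + v y" using nv by blast
  show "x \<in> L \<Longrightarrow> y \<in> L \<Longrightarrow> x \<noteq> 0 \<Longrightarrow> y \<noteq> 0 \<Longrightarrow> x + y \<noteq> 0 \<Longrightarrow> min (v x) (v y) \<le> v (x + y)"
    using nv by blast
  show "x \<in> V \<longleftrightarrow> x \<in> L \<and> (x = 0 \<or> v x \<ge> 0)" using nv by blast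
  have "v ` (L - {0}) = UNIV" using nv by blast
  then have "n \<in> v ` (L - {0})" by simp
  then show "\<exists>t\<in>L. t \<noteq> 0 \<and> v t = n" by blast
qed

lemma v_1: "v 1 = 0"
  using v_mult[of 1 1] subring_1[OF sL] by simp

lemma v_inverse: "x \<in> L \<Longrightarrow> x \<noteq> 0 \<Longrightarrow> v (inverse x) = - v x"
  using v_mult[of x "inverse x"] v_1 subfield_inverse[OF L] by simp

lemma v_divide: "x \<in> L \<Longrightarrow> y \<in> L \<Longrightarrow> x \<noteq> 0 \<Longrightarrow> y \<noteq> 0 \<Longrightarrow> v (x / y) = v x - v y"
  using v_mult[of x "inverse y"] v_inverse subfield_inverse[OF L] by (simp add: divide_inverse)

lemma v_power: "x \<in> L \<Longrightarrow> x \<noteq> 0 \<Longrightarrow> v (x ^ n) = int n * v x"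
  by (induction n) (simp_all add: v_1 v_mult subring_power[OF sL] algebra_simps)

lemma v_unit: "x \<in> units V \<longleftrightarrow> x \<in> L \<and> x \<noteq> 0 \<and> v x = 0"
  unfolding units_iff V_iff using v_inverse subfield_inverse[OF L] by fastforce

lemma v_nonunit: "x \<in> nonunits V \<longleftrightarrow> x \<in> L \<and> (x = 0 \<or> v x > 0)"
proof -
  have "x \<in> nonunits V \<longleftrightarrow> x \<in> V \<and> x \<notin> units V" by (auto simp: units_iff_nonunits nonunits_iff)
  then show ?thesis using V_iff[of x] v_unit[of x] by auto
qed

lemma v_const: "c \<in> k \<Longrightarrow> v c = 0"
proof (cases "c = 0")
  case True
  then show ?thesis using is_normalized_valuation_v unfolding is_normalized_valuation_def by simp
qed (use const_unit v_unit in blast)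

lemma kL: "k \<subseteq> L"
  using kV VL by blast

lemma v_uminus: "x \<in> L \<Longrightarrow> x \<noteq> 0 \<Longrightarrow> v (- x) = v x"
  using v_mult[of "- 1" x] v_const[of "- 1"] subring_uminus[OF sk subring_1[OF sk]] kL by auto

lemma v_add_less:
  assumes "x \<in> L" "y \<in> L" "x \<noteq> 0" "y \<noteq> 0" "v x < v y"
  shows "x + y \<noteq> 0 \<and> v (x + y) = v x"
proof -
  have nz: "x + y \<noteq> 0"
  proof
    assume "x + y = 0"
    then have "y = - x" by (simp add: eq_neg_iff_add_eq_0 add.commute)
    then show False using assms v_uminus by simp
  qed
  have "v x \<le> v (x + y)" using v_add[OF assms(1-4) nz] assms(5) by simp
  moreover have "min (v (x + y)) (v (- y)) \<le> v (x + y + - y)"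
    using assms nz by (intro v_add subring_add[OF sL] subring_uminus[OF sL]) auto
  then have "min (v (x + y)) (v y) \<le> v x" using assms v_uminus by simp
  ultimately show ?thesis using nz assms(5) by linarith
qed

lemma v_sum_distinct:
  "finite T \<Longrightarrow> T \<noteq> {} \<Longrightarrow> (\<And>i. i \<in> T \<Longrightarrow> x i \<in> L \<and> x i \<noteq> 0) \<Longrightarrow> inj_on (\<lambda>i. v (x i)) T \<Longrightarrow>
    sum x T \<noteq> 0 \<and> (\<exists>m\<in>T. v (sum x T) = v (x m) \<and> (\<forall>i\<in>T. v (x m) \<le> v (x i)))"
proof (induction T rule: finite_ne_induct)
  case (insert s T)
  then obtain m where m: "m \<in> T" "v (sum x T) = v (x m)" "\<forall>i\<in>T. v (x m) \<le> v (x i)" and nz: "sum x T \<noteq> 0"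
    by (auto simp: inj_on_insert)
  have xs: "x s \<in> L" "x s \<noteq> 0" using insert.prems by blast+
  have sT: "sum x T \<in> L" using insert.prems by (intro subring_sum[OF sL]) blast
  have eq: "sum x (insert s T) = x s + sum x T" using insert.hyps by simp
  have "v (x s) \<noteq> v (x m)"
  proof
    assume "v (x s) = v (x m)"
    then have "s = m" using insert.prems(2) m(1) by (auto dest: inj_onD)
    then show False using insert.hyps m(1) by blast
  qed
  then consider "v (x s) < v (x m)" | "v (x m) < v (x s)" by linarith
  then show ?case
  proof cases
    case 1
    then have "x s + sum x T \<noteq> 0 \<and> v (x s + sum x T) = v (x s)" using v_add_less xs sT nz m by simp
    moreover have "\<forall>i\<in>insert s T. v (x s) \<le> v (x i)" using 1 m(3) by fastforce
    ultimately show ?thesis unfolding eq by blast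
  next
    case 2
    then have "sum x T + x s \<noteq> 0 \<and> v (sum x T + x s) = v (x m)" using v_add_less[OF sT xs(1) nz xs(2)] m by simp
    moreover have "\<forall>i\<in>insert s T. v (x m) \<le> v (x i)" using 2 m(3) by fastforce
    ultimately show ?thesis unfolding eq using m(1) by (auto simp: add.commute)
  qed
qed simp

lemma LpL: "Lp \<subseteq> L" and sLp: "subring Lp" and Lp_field: "subfield Lp" and kLp: "k \<subseteq> Lp"
proof -
  show "Lp \<subseteq> L" using subring_power[OF sL] by blast
  show "subfield Lp" using subfield_frobenius[OF L] .
  then show "subring Lp" by (rule subfield_subring)
  show "k \<subseteq> Lp"
  proof
    fix c assume "c \<in> k"
    then obtain d where "d \<in> k" "d ^ p = c" using k_perfect by blast
    then show "c \<in> Lp" using kL by blast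
  qed
qed

lemma v_Lp:
  assumes "l \<in> Lp" shows "int p dvd v l"
proof (cases "l = 0")
  case True
  then show ?thesis using v_const subring_0[OF sk] by simp
next
  case False
  then obtain y where "y \<in> L" "l = y ^ p" "y \<noteq> 0" using assms p_pos by auto
  then show ?thesis using v_power by simp
qed

lemma v_poly_distinct:
  assumes s: "s \<in> L" "s \<noteq> 0" and g: "g \<in> poly_over L" "g \<noteq> 0"
    and distinct: "\<And>i j. coeff g i \<noteq> 0 \<Longrightarrow> coeff g j \<noteq> 0 \<Longrightarrow>
      v (coeff g i) + int i * v s = v (coeff g j) + int j * v s \<Longrightarrow> i = j"
  shows "poly g s \<noteq> 0 \<and> (\<exists>m. coeff g m \<noteq> 0 \<and> v (poly g s) = v (coeff g m) + int m * v s \<and>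
    (\<forall>i. coeff g i \<noteq> 0 \<longrightarrow> v (coeff g m) + int m * v s \<le> v (coeff g i) + int i * v s))"
proof -
  define T where "T = {i. coeff g i \<noteq> 0}"
  have T_le: "i \<le> degree g" if "i \<in> T" for i using that by (simp add: T_def le_degree)
  then have fT: "finite T" using finite_subset[of T "{..degree g}"] by auto
  have "T \<noteq> {}" using g(2) by (auto simp: T_def poly_eq_iff)
  have cL: "coeff g i \<in> L" for i using g(1) by (auto simp: poly_over_def)
  have terms: "coeff g i * s ^ i \<in> L \<and> coeff g i * s ^ i \<noteq> 0" if "i \<in> T" for i
    using that s subring_mult[OF sL cL subring_power[OF sL s(1)]] by (simp add: T_def)
  have v_term: "v (coeff g i * s ^ i) = v (coeff g i) + int i * v s" if "i \<in> T" for i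
    using that s v_mult[OF cL subring_power[OF sL s(1)]] v_power by (simp add: T_def)
  have "inj_on (\<lambda>i. v (coeff g i * s ^ i)) T"
    using v_term distinct by (intro inj_onI) (auto simp: T_def)
  from v_sum_distinct[OF fT \<open>T \<noteq> {}\<close> terms this]
  have "(\<Sum>i\<in>T. coeff g i * s ^ i) \<noteq> 0" and "\<exists>m\<in>T. v (\<Sum>i\<in>T. coeff g i * s ^ i) = v (coeff g m * s ^ m) \<and>
    (\<forall>i\<in>T. v (coeff g m * s ^ m) \<le> v (coeff g i * s ^ i))" by blast+
  moreover have "(\<Sum>i\<in>T. coeff g i * s ^ i) = poly g s"
    unfolding poly_altdef using T_le by (intro sum.mono_neutral_left) (auto simp: T_def)
  ultimately have "poly g s \<noteq> 0" and "\<exists>m\<in>T. v (poly g s) = v (coeff g m) + int m * v s \<and>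
    (\<forall>i\<in>T. v (coeff g m) + int m * v s \<le> v (coeff g i) + int i * v s)" using v_term by auto
  then show ?thesis by (auto simp: T_def)
qed

text \<open>The coefficients have values divisible by \<open>p\<close> and \<open>v s\<close> is
  prime to \<open>p\<close>, so terms of degree below \<open>p\<close> have values distinct modulo
  \<open>p\<close> and cannot cancel.\<close>

lemma v_poly_Lp:
  assumes s: "s \<in> L" "s \<noteq> 0" "\<not> int p dvd v s" and g: "g \<in> poly_over Lp" "g \<noteq> 0" "degree g < p"
  shows "poly g s \<noteq> 0 \<and> (\<exists>m. coeff g m \<noteq> 0 \<and> v (poly g s) = v (coeff g m) + int m * v s \<and>
    (\<forall>i. coeff g i \<noteq> 0 \<longrightarrow> v (coeff g m) + int m * v s \<le> v (coeff g i) + int i * v s))"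
proof (rule v_poly_distinct[OF s(1,2) _ g(2)])
  show "g \<in> poly_over L" using g(1) poly_over_mono[OF LpL] by blast
  fix i j assume ij: "coeff g i \<noteq> 0" "coeff g j \<noteq> 0"
    "v (coeff g i) + int i * v s = v (coeff g j) + int j * v s"
  have cLp: "coeff g i \<in> Lp" for i using g(1) by (simp add: poly_over_def)
  have "(int i - int j) * v s = v (coeff g j) - v (coeff g i)" using ij(3) by (simp add: algebra_simps)
  moreover have "int p dvd v (coeff g j) - v (coeff g i)" using v_Lp cLp by (intro dvd_diff) auto
  ultimately have "int p dvd (int i - int j) * v s" by simp
  then have "int p dvd int i - int j" using s(3) prime_p by (simp add: prime_dvd_mult_iff)
  moreover have "\<bar>int i - int j\<bar> < int p" using le_degree[OF ij(1)] le_degree[OF ij(2)] g(3) by linarith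
  ultimately have "int i - int j = 0" using dvd_imp_le_int[of "int i - int j" "int p"] by linarith
  then show "i = j" by simp
qed

text \<open>The p + 1 elements 1, s, ..., s^(p-1), x are dependent over \<open>Lp\<close>;
  independence of the powers of \<open>s\<close> makes the coefficient of \<open>x\<close>
  nonzero.\<close>

lemma Lp_expansion:
  assumes s: "s \<in> L" and indep: "\<And>g. g \<in> poly_over Lp \<Longrightarrow> degree g < p \<Longrightarrow> poly g s = 0 \<Longrightarrow> g = 0"
    and x: "x \<in> L"
  obtains g where "g \<in> poly_over Lp" "degree g < p" "poly g s = x"
proof -
  define e where "e j = (if j < p then s ^ j else x)" for j
  have "e j \<in> L" for j using s x subring_power[OF sL] by (simp add: e_def)
  then obtain l where l: "\<And>j. j \<le> p \<Longrightarrow> l j \<in> Lp" "\<exists>j\<le>p. l j \<noteq> 0" "(\<Sum>j\<le>p. l j * e j) = 0"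
    using Lp_dependent by meson
  define g where "g = (\<Sum>j<p. monom (l j) j)"
  have coeff_g: "coeff g j = (if j < p then l j else 0)" for j by (simp add: g_def coeff_sum)
  have g: "g \<in> poly_over Lp" using l(1) subring_0[OF sLp] by (auto simp: poly_over_def coeff_g)
  have deg: "degree h < p" if "\<And>j. j \<ge> p \<Longrightarrow> coeff h j = 0" for h :: "'l poly"
    using that degree_le[of "p - 1" h] p_pos by (cases p) force+
  have dg: "degree g < p" by (rule deg) (simp add: coeff_g)
  have eq: "poly g s + l p * x = 0"
  proof -
    have "(\<Sum>j\<le>p. l j * e j) = (\<Sum>j<p. l j * e j) + l p * x"
      by (simp add: lessThan_Suc_atMost[symmetric] e_def)
    also have "(\<Sum>j<p. l j * e j) = poly g s"
      by (simp add: g_def poly_sum poly_monom e_def)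
    finally show ?thesis using l(3) by simp
  qed
  have lp: "l p \<noteq> 0"
  proof
    assume "l p = 0"
    then have "g = 0" using indep[OF g dg] eq by simp
    then have "l j = 0" if "j < p" for j using that coeff_g[of j] by simp
    then show False using l(2) \<open>l p = 0\<close> by (metis le_neq_implies_less)
  qed
  define h where "h = smult (- inverse (l p)) g"
  have "- inverse (l p) \<in> Lp" using l(1) subfield_inverse[OF Lp_field] subring_uminus[OF sLp] by blast
  then have "h \<in> poly_over Lp" unfolding h_def using g poly_over_smult[OF sLp] by blast
  moreover have "degree h < p" using dg by (simp add: h_def)
  moreover have "poly h s = x"
  proof -
    have "poly g s = - (l p * x)" using eq by (simp add: eq_neg_iff_add_eq_0)
    then show ?thesis using lp by (simp add: h_def)
  qed
  ultimately show ?thesis by (rule that)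
qed

definition t :: 'l where "t = (SOME t. t \<in> L \<and> t \<noteq> 0 \<and> v t = 1)"

lemma t: "t \<in> L" "t \<noteq> 0" "v t = 1"
  using someI_ex[of "\<lambda>t. t \<in> L \<and> t \<noteq> 0 \<and> v t = 1"] v_surj[of 1] unfolding t_def by blast+

lemma p_gt_1: "p > 1"
  using prime_gt_1_nat[OF prime_p] .

lemma v_t_not_dvd: "\<not> int p dvd v t"
  using t(3) p_gt_1 by simp

lemma t_indep: "g \<in> poly_over Lp \<Longrightarrow> degree g < p \<Longrightarrow> poly g t = 0 \<Longrightarrow> g = 0"
  using v_poly_Lp[OF t(1,2) v_t_not_dvd, of g] by blast

lemma t_expansion:
  assumes "x \<in> L"
  obtains g where "g \<in> poly_over Lp" "degree g < p" "poly g t = x"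
  using Lp_expansion[OF t(1) t_indep assms] by blast

lemma tV: "t \<in> V"
  using V_iff t by simp

subsection \<open>The derivation with respect to a uniformizer\<close>

text \<open>The derivation d/dt of \<open>L\<close> over \<open>Lp\<close>. The representing
  polynomial carries no degree bound, so that sums and products of representatives are again
  representatives.\<close>

definition D :: "'l \<Rightarrow> 'l" where
  "D x = poly (pderiv (SOME f. f \<in> poly_over Lp \<and> poly f t = x)) t"

text \<open>A polynomial over \<open>Lp\<close> vanishing at \<open>t\<close> is a multiple of X^p -
  t^p, whose derivative is 0.\<close>

lemma pderiv_well_defined:
  assumes f: "f \<in> poly_over Lp" "poly f t = 0"
  shows "poly (pderiv f) t = 0"
proof -
  define g where "g = monom 1 p - [:t ^ p:]"
  have "g \<in> poly_over Lp" unfolding g_def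
    using t(1) by (intro poly_over_diff[OF sLp] poly_over_monom[OF sLp] poly_over_const[OF sLp] subring_1[OF sLp]) auto
  have cg: "coeff g i = (if i = p then 1 else if i = 0 then - (t ^ p) else 0)" for i
    using p_pos by (auto simp: g_def coeff_pCons split: nat.split)
  have dg: "degree g = p"
    using le_degree[of g p] degree_le[of p g] by (simp add: cg)
  have g0: "g \<noteq> 0" using dg p_pos by auto
  have gt: "poly g t = 0" by (simp add: g_def poly_monom)
  have eq: "f = f div g * g + f mod g" by simp
  have "poly f t = poly (f div g) t * poly g t + poly (f mod g) t" by (metis eq poly_add poly_mult)
  then have "poly (f mod g) t = 0" using f gt by simp
  moreover have "f mod g \<in> poly_over Lp" using poly_over_divmod(2)[OF Lp_field \<open>g \<in> poly_over Lp\<close> f(1)] .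
  moreover have "degree (f mod g) < p" using degree_mod_less[OF g0, of f] dg p_pos by fastforce
  ultimately have "f mod g = 0" using t_indep by blast
  then have "f = f div g * g" using eq by simp
  moreover have "pderiv g = 0"
    using of_nat_p by (intro poly_eqI) (auto simp: coeff_pderiv cg simp del: of_nat_Suc)
  ultimately have "pderiv f = pderiv (f div g) * g" by (metis pderiv_mult mult_zero_right add_0 mult.commute)
  then show ?thesis using gt by simp
qed

lemma D_poly_t:
  assumes f: "f \<in> poly_over Lp"
  shows "D (poly f t) = poly (pderiv f) t"
proof -
  define g where "g = (SOME g. g \<in> poly_over Lp \<and> poly g t = poly f t)"
  have g: "g \<in> poly_over Lp" "poly g t = poly f t"
    using someI[of "\<lambda>g. g \<in> poly_over Lp \<and> poly g t = poly f t" f] f unfolding g_def by auto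
  have "poly (pderiv (g - f)) t = 0"
    using g f by (intro pderiv_well_defined poly_over_diff[OF sLp]) auto
  then show ?thesis by (simp add: D_def g_def[symmetric] pderiv_diff)
qed

lemma D_L: assumes "x \<in> L" shows "D x \<in> L"
proof -
  obtain f where f: "f \<in> poly_over Lp" "poly f t = x" using t_expansion[OF assms] by blast
  have "pderiv f \<in> poly_over L" using f poly_over_mono[OF LpL] poly_over_pderiv[OF sL] by blast
  then show ?thesis using D_poly_t f poly_over_eval[OF sL _ t(1)] by metis
qed

lemma D_add: assumes "x \<in> L" "y \<in> L" shows "D (x + y) = D x + D y"
proof -
  obtain f g where "f \<in> poly_over Lp" "poly f t = x" "g \<in> poly_over Lp" "poly g t = y"
    using t_expansion assms by metis
  then show ?thesis
    using D_poly_t[of f] D_poly_t[of g] D_poly_t[OF poly_over_add[OF sLp, of f g]] by (simp add: pderiv_add)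
qed

lemma D_mult: assumes "x \<in> L" "y \<in> L" shows "D (x * y) = x * D y + y * D x"
proof -
  obtain f g where "f \<in> poly_over Lp" "poly f t = x" "g \<in> poly_over Lp" "poly g t = y"
    using t_expansion assms by metis
  then show ?thesis
    using D_poly_t[of f] D_poly_t[of g] D_poly_t[OF poly_over_mult[OF sLp, of f g]] by (simp add: pderiv_mult)
qed

lemma D_Lp: assumes "x \<in> Lp" shows "D x = 0"
  using D_poly_t[OF poly_over_const[OF sLp assms]] by simp

lemma D_k: "c \<in> k \<Longrightarrow> D c = 0"
  using D_Lp kLp by blast

lemma D_t: "D t = 1"
proof -
  have "[:0, 1:] \<in> poly_over Lp"
    by (intro poly_over_pCons[OF sLp] poly_over_0[OF sLp] subring_0[OF sLp] subring_1[OF sLp])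
  from D_poly_t[OF this] show ?thesis by (simp add: pderiv_pCons)
qed

lemma D_diff: assumes "x \<in> L" "y \<in> L" shows "D (x - y) = D x - D y"
  using D_add[of "x - y" y] assms subring_diff[OF sL] by simp

lemma D_poly: "g \<in> poly_over Lp \<Longrightarrow> x \<in> L \<Longrightarrow> D (poly g x) = poly (pderiv g) x * D x"
proof (induction g)
  case 0
  then show ?case using D_Lp[OF subring_0[OF sLp]] by simp
next
  case (pCons c h)
  have h: "h \<in> poly_over Lp" "c \<in> Lp"
    using pCons.prems(1) unfolding poly_over_def by (auto simp: coeff_pCons split: nat.splits)
  have hx: "poly h x \<in> L" using h poly_over_mono[OF LpL] poly_over_eval[OF sL] pCons.prems by blast
  have cL: "c \<in> L" using h LpL by blast
  have "D (c + x * poly h x) = D c + (x * D (poly h x) + poly h x * D x)"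
    using D_add[OF cL subring_mult[OF sL pCons.prems(2) hx]] D_mult[OF pCons.prems(2) hx] by simp
  then show ?case using pCons h D_Lp[OF h(2)] by (simp add: pderiv_pCons algebra_simps)
qed

lemma v_of_nat: "of_nat n \<noteq> (0 :: 'l) \<Longrightarrow> v (of_nat n) = 0"
  using v_const subring_of_nat[OF sk] by blast

text \<open>In the expansion by powers of \<open>t\<close>, \<open>D\<close> drops the constant term
  and lowers the value of every other term by one, since its exponent is a unit modulo
  \<open>p\<close>. If \<open>p\<close> does not divide \<open>v x\<close>, the term of least value
  is not the constant one and survives.\<close>

lemma v_D_aux:
  assumes x: "x \<in> L" "x \<noteq> 0"
  shows "(D x \<noteq> 0 \<longrightarrow> v (D x) \<ge> v x - 1) \<and> (\<not> int p dvd v x \<longrightarrow> D x \<noteq> 0 \<and> v (D x) = v x - 1)"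
proof -
  obtain g where g: "g \<in> poly_over Lp" "degree g < p" "poly g t = x" using t_expansion[OF x(1)] .
  have gL: "coeff g i \<in> Lp" "coeff g i \<in> L" for i using g LpL by (auto simp: poly_over_def)
  have g0: "g \<noteq> 0" using g x by auto
  obtain m where m: "coeff g m \<noteq> 0" "v x = v (coeff g m) + int m"
    "\<And>i. coeff g i \<noteq> 0 \<Longrightarrow> v (coeff g m) + int m \<le> v (coeff g i) + int i"
    using v_poly_Lp[OF t(1,2) v_t_not_dvd g(1) g0 g(2)] g(3) t(3) by auto
  have Dx: "D x = poly (pderiv g) t" using D_poly_t[OF g(1)] g(3) by simp
  have g': "pderiv g \<in> poly_over Lp" "degree (pderiv g) < p"
    using poly_over_pderiv[OF sLp g(1)] degree_pderiv_le[of g] g(2) by auto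
  have cv: "v (coeff (pderiv g) i) = v (coeff g (Suc i)) \<and> coeff g (Suc i) \<noteq> 0" if "coeff (pderiv g) i \<noteq> 0" for i
  proof -
    have *: "of_nat (Suc i) \<noteq> (0::'l)" "coeff g (Suc i) \<noteq> 0" using that by (auto simp: coeff_pderiv simp del: of_nat_Suc)
    have "v (of_nat (Suc i) * coeff g (Suc i)) = v (of_nat (Suc i)) + v (coeff g (Suc i))"
      using * gL(2) subring_of_nat[OF sL] by (intro v_mult)
    then show ?thesis using * v_of_nat[OF *(1)] by (simp add: coeff_pderiv del: of_nat_Suc)
  qed
  have main: "D x \<noteq> 0 \<and> (\<exists>n. coeff (pderiv g) n \<noteq> 0 \<and> v (D x) = v (coeff g (Suc n)) + int n \<and>
      (\<forall>i. coeff (pderiv g) i \<noteq> 0 \<longrightarrow> v (coeff g (Suc n)) + int n \<le> v (coeff g (Suc i)) + int i))"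
    if "pderiv g \<noteq> 0"
    using v_poly_Lp[OF t(1,2) v_t_not_dvd g'(1) that g'(2)] cv t(3) unfolding Dx by auto
  have "v (D x) \<ge> v x - 1" if "D x \<noteq> 0"
  proof -
    have "pderiv g \<noteq> 0" using that Dx by auto
    then obtain n where n: "coeff (pderiv g) n \<noteq> 0" "v (D x) = v (coeff g (Suc n)) + int n" using main by blast
    then show ?thesis using m(3)[of "Suc n"] m(2) cv[OF n(1)] by simp
  qed
  moreover have "D x \<noteq> 0 \<and> v (D x) = v x - 1" if nd: "\<not> int p dvd v x"
  proof -
    have "m \<noteq> 0" using nd m(2) v_Lp[OF gL(1)] by (metis add.right_neutral of_nat_0)
    then obtain m' where m': "m = Suc m'" by (cases m) auto
    have "m < p" using m(1) g(2) le_degree[of g m] by linarith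
    then have "\<not> p dvd Suc m'" using m' by (auto dest: dvd_imp_le)
    then have c: "coeff (pderiv g) m' \<noteq> 0"
      using m(1) m' of_nat_eq_0[of "Suc m'"] by (simp add: coeff_pderiv del: of_nat_Suc)
    then have "pderiv g \<noteq> 0" by auto
    then obtain n where n: "D x \<noteq> 0" "coeff (pderiv g) n \<noteq> 0" "v (D x) = v (coeff g (Suc n)) + int n"
      "v (coeff g (Suc n)) + int n \<le> v (coeff g (Suc m')) + int m'" using main c by blast
    have "v (coeff g m) + int m \<le> v (coeff g (Suc n)) + int (Suc n)" using m(3) cv[OF n(2)] by blast
    then show ?thesis using n m(2) m' by simp
  qed
  ultimately show ?thesis by blast
qed

lemma v_D_ge: "x \<in> L \<Longrightarrow> x \<noteq> 0 \<Longrightarrow> D x \<noteq> 0 \<Longrightarrow> v (D x) \<ge> v x - 1"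
  and v_D_eq: "x \<in> L \<Longrightarrow> x \<noteq> 0 \<Longrightarrow> \<not> int p dvd v x \<Longrightarrow> D x \<noteq> 0 \<and> v (D x) = v x - 1"
  using v_D_aux by blast+

text \<open>Below degree \<open>p\<close> the derivative of a nonconstant polynomial is nonzero, and
  it cannot vanish at \<open>t\<close>.\<close>

lemma D_eq_0: assumes x: "x \<in> L" and D: "D x = 0" shows "x \<in> Lp"
proof -
  obtain g where g: "g \<in> poly_over Lp" "degree g < p" "poly g t = x" using t_expansion[OF x] .
  have "poly (pderiv g) t = 0" using D D_poly_t[OF g(1)] g(3) by simp
  then have "pderiv g = 0"
    using t_indep[OF poly_over_pderiv[OF sLp g(1)]] degree_pderiv_le[of g] g(2) by simp
  have "degree g = 0"
  proof (rule ccontr)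
    assume "degree g \<noteq> 0"
    then obtain n where n: "degree g = Suc n" by (cases "degree g") auto
    have "of_nat (Suc n) * coeff g (Suc n) = 0" using \<open>pderiv g = 0\<close> by (metis coeff_0 coeff_pderiv)
    moreover have "coeff g (Suc n) \<noteq> 0" using n by (metis leading_coeff_0_iff degree_0 nat.distinct(1))
    moreover have "\<not> p dvd Suc n" using n g(2) by (auto dest: dvd_imp_le)
    ultimately show False using of_nat_eq_0[of "Suc n"] by (simp del: of_nat_Suc)
  qed
  then obtain a where "g = [:a:]" by (metis degree_eq_zeroE)
  then show ?thesis using g by (auto simp: poly_over_def coeff_pCons split: nat.splits)
qed

lemma residue_nonunit:
  assumes x: "x \<in> V"
  obtains c where "c \<in> k" "x - c \<in> V" "x - c = 0 \<or> v (x - c) > 0"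
  using residue_exists[OF x] v_nonunit V_iff by (metis less_imp_le)

text \<open>Subtracting the residue makes the value positive without changing \<open>D x\<close>,
  and \<open>D\<close> lowers values by at most one.\<close>

lemma D_V: assumes x: "x \<in> V" shows "D x \<in> V"
proof -
  obtain c where c: "c \<in> k" "x - c \<in> V" "x - c = 0 \<or> v (x - c) > 0" using residue_nonunit[OF x] .
  have xL: "x \<in> L" "x - c \<in> L" using x c VL by blast+
  have "D x = D (x - c)" using D_diff[OF xL(1), of c] c kL D_k by auto
  moreover have "D (x - c) \<in> V"
  proof (cases "D (x - c) = 0")
    case False
    then have "x - c \<noteq> 0" using D_k[OF subring_0[OF sk]] by auto
    then have "v (D (x - c)) \<ge> 0" using v_D_ge[OF xL(2) _ False] c by fastforce
    then show ?thesis using V_iff D_L[OF xL(2)] by blast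
  qed (simp add: subring_0[OF sV])
  ultimately show ?thesis by simp
qed

text \<open>Applying \<open>D\<close> to a relation for \<open>x\<close> gives the derived relation
  of smaller degree, because \<open>D x\<close> is nonzero. Hence every \<open>x\<close> outside
  \<open>Lp\<close> generates \<open>L\<close> over \<open>Lp\<close>.\<close>

lemma Lp_powers_indep:
  assumes x: "x \<in> L" "x \<notin> Lp"
  shows "g \<in> poly_over Lp \<Longrightarrow> degree g < p \<Longrightarrow> poly g x = 0 \<Longrightarrow> g = 0"
proof (induction "degree g" arbitrary: g rule: less_induct)
  case less
  have Dx: "D x \<noteq> 0" using D_eq_0 x by blast
  have "poly (pderiv g) x * D x = 0"
    using D_poly[OF less.prems(1) x(1)] less.prems(3) D_Lp[OF subring_0[OF sLp]] by simp
  then have g'x: "poly (pderiv g) x = 0" using Dx by simp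
  show ?case
  proof (cases "degree g")
    case 0
    then obtain a where "g = [:a:]" by (metis degree_eq_zeroE)
    then show ?thesis using less.prems by simp
  next
    case (Suc n)
    have "degree (pderiv g) < degree g" using degree_pderiv_le[of g] Suc by linarith
    then have "pderiv g = 0"
      using less.hyps[OF _ poly_over_pderiv[OF sLp less.prems(1)] _ g'x] less.prems(2) by simp
    then have "of_nat (Suc n) * coeff g (Suc n) = 0" by (metis coeff_0 coeff_pderiv)
    moreover have "\<not> p dvd Suc n" using Suc less.prems(2) by (auto dest: dvd_imp_le)
    ultimately have "coeff g (Suc n) = 0" using of_nat_eq_0[of "Suc n"] by (simp del: of_nat_Suc)
    then show ?thesis using Suc by (metis leading_coeff_0_iff)
  qed
qed

text \<open>All x - l have the same derivative as \<open>x\<close>, and \<open>D\<close> lowers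
  values by at most one. So \<open>x\<close> is not a limit of \<open>p\<close>-th powers.\<close>

lemma Lp_distance_bound:
  assumes x: "x \<in> L" "x \<notin> Lp" and l: "l \<in> Lp"
  shows "v (x - l) \<le> v (D x) + 1"
proof -
  have lL: "l \<in> L" using l LpL by blast
  have "x - l \<noteq> 0" using x l by auto
  have "D (x - l) = D x" using D_diff[OF x(1) lL] D_Lp[OF l] by simp
  moreover have "D x \<noteq> 0" using D_eq_0 x by blast
  ultimately show ?thesis using v_D_ge[OF subring_diff[OF sL x(1) lL] \<open>x - l \<noteq> 0\<close>] by simp
qed

end

section \<open>Differentials\<close>

lemma scale_eq_mult: "scale r u = Poly_Mapping.single 0 r * u"
  unfolding scale_def by (rule mult_map_scale_conv_mult)

lemma lookup_scale: "Poly_Mapping.lookup (scale r u) x = r * Poly_Mapping.lookup u x"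
  unfolding scale_def by (simp add: Poly_Mapping.map.rep_eq when_def)

lemma scale_diff: "scale r (u - w) = scale r u - scale r w"
  and scale_add_left: "scale (r + s) u = scale r u + scale s u"
  and scale_scale: "scale r (scale s u) = scale (r * s) u"
  and scale_1: "scale 1 u = u"
  and scale_0: "scale 0 u = 0"
  and scale_0_right: "scale r 0 = 0"
  by (rule poly_mapping_eqI; simp add: lookup_scale lookup_add lookup_minus algebra_simps)+

lemma scale_sum_left: "scale (sum c A) u = (\<Sum>i\<in>A. scale (c i) u)"
  by (induction A rule: infinite_finite_induct) (auto simp: scale_add_left scale_0)

text \<open>The linear map on differentials that a derivation induces by the universal
  property.\<close>

definition differential_map :: "('l::field \<Rightarrow> 'l) \<Rightarrow> 'l formal_differential \<Rightarrow> 'l" where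
  "differential_map D u = (\<Sum>x\<in>Poly_Mapping.keys u. Poly_Mapping.lookup u x * D x)"

lemma differential_map_add: "differential_map D (u + w) = differential_map D u + differential_map D w"
  unfolding differential_map_def by (rule setsum_keys_plus_distrib) (simp_all add: distrib_right)

lemma differential_map_diff: "differential_map D (u - w) = differential_map D u - differential_map D w"
  using differential_map_add[of D "u - w" w] by simp

lemma differential_map_0: "differential_map D 0 = 0"
  by (simp add: differential_map_def)

lemma differential_map_sum: "differential_map D (sum f A) = (\<Sum>i\<in>A. differential_map D (f i))"
  by (induction A rule: infinite_finite_induct) (auto simp: differential_map_add differential_map_0)

lemma differential_map_scale: "differential_map D (scale r u) = r * differential_map D u"
proof (cases "r = 0")
  case False
  then have "Poly_Mapping.keys (scale r u) = Poly_Mapping.keys u"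
    by (auto simp: in_keys_iff lookup_scale)
  then show ?thesis by (simp add: differential_map_def lookup_scale sum_distrib_left mult.assoc)
qed (simp add: scale_0 differential_map_0)

lemma differential_map_d: "differential_map D (formal_d x) = D x"
  by (simp add: differential_map_def formal_d_def)

lemma differential_map_in:
  assumes B: "subring B" and u: "u \<in> formal_differentials B" and D: "\<And>x. x \<in> B \<Longrightarrow> D x \<in> B"
  shows "differential_map D u \<in> B"
  using u D unfolding differential_map_def formal_differentials_def
  by (intro subring_sum[OF B] subring_mult[OF B]) auto

text \<open>Kaehler relations map to 0 and generators \<open>da\<close> to \<open>D a\<close>. With
  a proper \<open>J\<close> this shows that a differential survives in the cokernel.\<close>

lemma differential_map_relations:
  assumes D: "\<And>x y. x \<in> B \<Longrightarrow> y \<in> B \<Longrightarrow> D (x + y) = D x + D y"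
    "\<And>x y. x \<in> B \<Longrightarrow> y \<in> B \<Longrightarrow> D (x * y) = x * D y + y * D x" "\<And>c. c \<in> k \<Longrightarrow> D c = 0"
    and J: "0 \<in> J" "\<And>x y. x \<in> J \<Longrightarrow> y \<in> J \<Longrightarrow> x - y \<in> J" "\<And>r x. r \<in> B \<Longrightarrow> x \<in> J \<Longrightarrow> r * x \<in> J"
    and A: "\<And>a. a \<in> A \<Longrightarrow> D a \<in> J"
    and u: "u \<in> submodule_generated B (kaehler_relations k B \<union> formal_d ` A)"
  shows "differential_map D u \<in> J"
  using u unfolding submodule_generated_def
proof (induction rule: group_closure.induct)
  case (base u)
  have gen: "differential_map D g \<in> J" if "g \<in> kaehler_relations k B \<union> formal_d ` A" for g
    using that
  proof
    assume "g \<in> kaehler_relations k B"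
    then have "differential_map D g = 0"
      unfolding kaehler_relations_def
      by (auto simp: differential_map_diff differential_map_scale differential_map_d D)
    then show ?thesis using J by simp
  qed (auto simp: differential_map_d A)
  show ?case
  proof (cases "u = 0")
    case True
    then show ?thesis using J by (simp add: differential_map_0)
  next
    case False
    then obtain r g where "u = scale r g" "r \<in> B" "g \<in> kaehler_relations k B \<union> formal_d ` A"
      using base by auto
    then show ?thesis using gen J by (simp add: differential_map_scale)
  qed
next
  case (diff u w)
  then show ?case using J by (simp add: differential_map_diff)
qed

lemma submodule_generated_closed:
  assumes B: "subring B"
  shows "u \<in> submodule_generated B G \<Longrightarrow> w \<in> submodule_generated B G \<Longrightarrow> u - w \<in> submodule_generated B G"
    and "u \<in> submodule_generated B G \<Longrightarrow> w \<in> submodule_generated B G \<Longrightarrow> u + w \<in> submodule_generated B G"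
    and "(\<And>i. i \<in> I \<Longrightarrow> f i \<in> submodule_generated B G) \<Longrightarrow> sum f I \<in> submodule_generated B G"
    and "g \<in> G \<Longrightarrow> g \<in> submodule_generated B G"
    and "r \<in> B \<Longrightarrow> u \<in> submodule_generated B G \<Longrightarrow> scale r u \<in> submodule_generated B G"
proof -
  show "u \<in> submodule_generated B G \<Longrightarrow> w \<in> submodule_generated B G \<Longrightarrow> u - w \<in> submodule_generated B G"
    unfolding submodule_generated_def by (rule group_closure.diff)
  show "u \<in> submodule_generated B G \<Longrightarrow> w \<in> submodule_generated B G \<Longrightarrow> u + w \<in> submodule_generated B G"
    unfolding submodule_generated_def by (rule group_closure_add)
  show "(\<And>i. i \<in> I \<Longrightarrow> f i \<in> submodule_generated B G) \<Longrightarrow> sum f I \<in> submodule_generated B G"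
    unfolding submodule_generated_def by (rule group_closure_sum)
  show "g \<in> submodule_generated B G" if "g \<in> G"
  proof -
    have "scale 1 g \<in> {scale r g | r g. r \<in> B \<and> g \<in> G}" using that subring_1[OF B] by blast
    then show ?thesis unfolding submodule_generated_def scale_1 by (intro group_closure.base) blast
  qed
  show "scale r u \<in> submodule_generated B G" if r: "r \<in> B" and u: "u \<in> submodule_generated B G"
    using u unfolding submodule_generated_def
  proof (induction rule: group_closure.induct)
    case (base u)
    show ?case
    proof (cases "u = 0")
      case True
      then show ?thesis by (simp add: scale_0_right)
    next
      case False
      then obtain s g where "u = scale s g" "s \<in> B" "g \<in> G" using base by auto
      then have "scale r u = scale (r * s) g" "r * s \<in> B" using subring_mult[OF B r] by (auto simp: scale_scale)
      then show ?thesis using \<open>g \<in> G\<close> by (intro group_closure.base) blast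
    qed
  next
    case (diff u w)
    then show ?case by (simp add: scale_diff group_closure.diff)
  qed
qed

lemma quotient_dim_eqI:
  fixes M N :: "'l::field formal_differential set"
  assumes indep: "\<And>i. i < n \<Longrightarrow> b i \<in> M"
    "\<And>c. (\<And>i. i < n \<Longrightarrow> c i \<in> k) \<Longrightarrow> (\<Sum>i<n. scale (c i) (b i)) \<in> N \<Longrightarrow> \<forall>i<n. c i = 0"
    and dep: "\<And>m b. n < m \<Longrightarrow> (\<And>i. i < m \<Longrightarrow> b i \<in> M) \<Longrightarrow>
      \<exists>c. (\<forall>i<m. c i \<in> k) \<and> (\<exists>i<m. c i \<noteq> 0) \<and> (\<Sum>i<(m::nat). scale (c i) (b i)) \<in> N"
  shows "quotient_dim k M N = enat n"
  unfolding quotient_dim_def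
proof (rule Sup_eqI)
  fix y assume "y \<in> {enat n | n. \<exists>b :: nat \<Rightarrow> 'l formal_differential. (\<forall>i<n. b i \<in> M) \<and>
     (\<forall>c. (\<forall>i<n. c i \<in> k) \<and> (\<Sum>i<n. scale (c i) (b i)) \<in> N \<longrightarrow> (\<forall>i<n. c i = 0))}"
  then obtain m and b :: "nat \<Rightarrow> 'l formal_differential" where m: "y = enat m" "\<And>i. i < m \<Longrightarrow> b i \<in> M"
    "\<And>c. (\<forall>i<m. c i \<in> k) \<and> (\<Sum>i<m. scale (c i) (b i)) \<in> N \<Longrightarrow> (\<forall>i<m. c i = 0)" by blast
  have "\<not> n < m"
  proof
    assume "n < m"
    then obtain c where "\<forall>i<m. c i \<in> k" "\<exists>i<m. c i \<noteq> 0" "(\<Sum>i<m. scale (c i) (b i)) \<in> N"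
      using dep[of m b] m(2) by blast
    then show False using m(3) by blast
  qed
  then show "y \<le> enat n" using m by simp
next
  fix y assume *: "\<And>z. z \<in> {enat n | n. \<exists>b :: nat \<Rightarrow> 'l formal_differential. (\<forall>i<n. b i \<in> M) \<and>
     (\<forall>c. (\<forall>i<n. c i \<in> k) \<and> (\<Sum>i<n. scale (c i) (b i)) \<in> N \<longrightarrow> (\<forall>i<n. c i = 0))} \<Longrightarrow> z \<le> y"
  show "enat n \<le> y"
    using indep by (intro *) blast
qed

lemma quotient_dim_0:
  fixes M N :: "'l::field formal_differential set"
  assumes k: "subfield k" and dim: "quotient_dim k M N = 0" and b: "b \<in> M"
    and N: "\<And>r u. r \<in> k \<Longrightarrow> u \<in> N \<Longrightarrow> scale r u \<in> N"
  shows "b \<in> N"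
proof (rule ccontr)
  assume "b \<notin> N"
  have "\<forall>i<1. c i = 0" if "(\<forall>i<1. c i \<in> k) \<and> (\<Sum>i<(1::nat). scale (c i) b) \<in> N" for c
  proof (rule ccontr)
    assume "\<not> ?thesis"
    then have "c 0 \<noteq> 0" "c 0 \<in> k" "scale (c 0) b \<in> N" using that by auto
    then have "scale (inverse (c 0)) (scale (c 0) b) \<in> N" using N subfield_inverse[OF k] by blast
    then show False using \<open>b \<notin> N\<close> \<open>c 0 \<noteq> 0\<close> by (simp add: scale_scale scale_1)
  qed
  then have "enat 1 \<le> quotient_dim k M N"
    unfolding quotient_dim_def using b by (intro Sup_upper) (auto intro!: exI[of _ "\<lambda>_. b"])
  then show False using dim by (simp add: zero_enat_def)
qed

context function_field_place
begin

abbreviation Vp :: "'l set" where "Vp \<equiv> (\<lambda>x. x ^ p) ` V"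

text \<open>The coefficient of t^i has value at least -i > -p and divisible by \<open>p\<close>,
  hence nonnegative. So \<open>V\<close> is generated by \<open>t\<close> over \<open>Vp\<close>,
  and \<open>dt\<close> generates the differentials.\<close>

lemma V_expansion:
  assumes x: "x \<in> V"
  obtains g where "g \<in> poly_over Vp" "poly g t = x"
proof -
  have xL: "x \<in> L" using x VL by blast
  obtain g where g: "g \<in> poly_over Lp" "degree g < p" "poly g t = x" using t_expansion[OF xL] .
  have "coeff g i \<in> Vp" for i
  proof (cases "coeff g i = 0")
    case True
    then show ?thesis using subring_0[OF sV] p_pos by (auto intro!: image_eqI[of _ _ 0])
  next
    case False
    then have "g \<noteq> 0" by auto
    then have x0: "x \<noteq> 0" and "v x \<le> v (coeff g i) + int i"
      using v_poly_Lp[OF t(1,2) v_t_not_dvd g(1) _ g(2)] g(3) t(3) False by auto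
    moreover have "v x \<ge> 0" using x V_iff x0 by blast
    moreover have "i < p" using False g(2) le_degree[of g i] by linarith
    ultimately have "v (coeff g i) > - int p" by linarith
    obtain y where y: "y \<in> L" "coeff g i = y ^ p" using g(1) by (auto simp: poly_over_def)
    then have "y \<noteq> 0" using False p_pos by auto
    then have "int p * v y > - int p" using \<open>v (coeff g i) > - int p\<close> y v_power by simp
    then have "int p * (v y + 1) > 0" by (simp add: distrib_left)
    then have "v y \<ge> 0" using p_pos by (simp add: zero_less_mult_iff)
    then have "y \<in> V" using y V_iff by blast
    then show ?thesis using y by blast
  qed
  then show ?thesis using that g(3) by (auto simp: poly_over_def)
qed

context
  fixes A :: "'l set"
begin

definition rels :: "'l formal_differential set" where
  "rels = submodule_generated V (kaehler_relations k V \<union> formal_d ` A)"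

lemmas rels_diff = submodule_generated_closed(1)[OF sV, where G = "kaehler_relations k V \<union> formal_d ` A", folded rels_def]
  and rels_add = submodule_generated_closed(2)[OF sV, where G = "kaehler_relations k V \<union> formal_d ` A", folded rels_def]
  and rels_sum = submodule_generated_closed(3)[OF sV, where G = "kaehler_relations k V \<union> formal_d ` A", folded rels_def]
  and rels_gen = submodule_generated_closed(4)[OF sV, where G = "kaehler_relations k V \<union> formal_d ` A", folded rels_def]
  and rels_scale = submodule_generated_closed(5)[OF sV, where G = "kaehler_relations k V \<union> formal_d ` A", folded rels_def]

lemma d_add: "x \<in> V \<Longrightarrow> y \<in> V \<Longrightarrow> formal_d (x + y) - formal_d x - formal_d y \<in> rels"
  and d_mult: "x \<in> V \<Longrightarrow> y \<in> V \<Longrightarrow> formal_d (x * y) - scale x (formal_d y) - scale y (formal_d x) \<in> rels"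
  and d_const: "c \<in> k \<Longrightarrow> formal_d c \<in> rels"
  by (rule rels_gen; unfold kaehler_relations_def; blast)+

lemma d_power: "x \<in> V \<Longrightarrow> formal_d (x ^ n) - scale (of_nat n * x ^ (n - 1)) (formal_d x) \<in> rels"
proof (induction n)
  case 0
  then show ?case using d_const[OF subring_1[OF sk]] by (simp add: scale_0)
next
  case (Suc n)
  have xn: "x ^ n \<in> V" using Suc.prems subring_power[OF sV] by blast
  have "(formal_d (x * x ^ n) - scale x (formal_d (x ^ n)) - scale (x ^ n) (formal_d x))
      + scale x (formal_d (x ^ n) - scale (of_nat n * x ^ (n - 1)) (formal_d x)) \<in> rels"
    using Suc xn by (intro rels_add d_mult rels_scale) auto
  also have "(formal_d (x * x ^ n) - scale x (formal_d (x ^ n)) - scale (x ^ n) (formal_d x))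
      + scale x (formal_d (x ^ n) - scale (of_nat n * x ^ (n - 1)) (formal_d x))
      = formal_d (x ^ Suc n) - scale (x ^ n + x * (of_nat n * x ^ (n - 1))) (formal_d x)"
    by (simp add: scale_diff scale_scale scale_add_left)
  also have "x ^ n + x * (of_nat n * x ^ (n - 1)) = of_nat (Suc n) * x ^ (Suc n - 1)"
    by (cases n) (auto simp: algebra_simps)
  finally show ?case .
qed

text \<open>Differentials of \<open>p\<close>-th powers vanish, so only the powers of
  \<open>t\<close> contribute.\<close>

lemma d_poly: "g \<in> poly_over Vp \<Longrightarrow> formal_d (poly g t) - scale (poly (pderiv g) t) (formal_d t) \<in> rels"
proof (induction g)
  case 0
  then show ?case using d_const[OF subring_0[OF sk]] by (simp add: scale_0)
next
  case (pCons c h)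
  have h: "h \<in> poly_over Vp" "c \<in> Vp"
    using pCons.prems(1) unfolding poly_over_def by (auto simp: coeff_pCons split: nat.splits)
  obtain y where y: "y \<in> V" "c = y ^ p" using h by blast
  have VpV: "Vp \<subseteq> V" using subring_power[OF sV] by blast
  have hV: "poly h t \<in> V" using h poly_over_mono[OF VpV] poly_over_eval[OF sV _ tV] by blast
  have dc: "formal_d c \<in> rels" using d_power[OF y(1), of p] y(2) of_nat_p by (simp add: scale_0)
  have cV: "c \<in> V" using h VpV by blast
  have thV: "t * poly h t \<in> V" using tV hV subring_mult[OF sV] by blast
  have "(formal_d (c + t * poly h t) - formal_d c - formal_d (t * poly h t)) + formal_d c
      + (formal_d (t * poly h t) - scale t (formal_d (poly h t)) - scale (poly h t) (formal_d t))
      + scale t (formal_d (poly h t) - scale (poly (pderiv h) t) (formal_d t)) \<in> rels"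
    using pCons.IH[OF h(1)] dc cV thV tV hV by (intro rels_add d_add d_mult rels_scale) auto
  also have "(formal_d (c + t * poly h t) - formal_d c - formal_d (t * poly h t)) + formal_d c
      + (formal_d (t * poly h t) - scale t (formal_d (poly h t)) - scale (poly h t) (formal_d t))
      + scale t (formal_d (poly h t) - scale (poly (pderiv h) t) (formal_d t))
      = formal_d (poly (pCons c h) t) - scale (poly (pderiv (pCons c h)) t) (formal_d t)"
    by (simp add: scale_diff scale_scale scale_add_left pderiv_pCons)
  finally show ?case .
qed

lemma d_eq: assumes x: "x \<in> V" shows "formal_d x - scale (D x) (formal_d t) \<in> rels"
proof -
  obtain g where g: "g \<in> poly_over Vp" "poly g t = x" using V_expansion[OF x] .
  have "g \<in> poly_over Lp" using g(1) VL unfolding poly_over_def by blast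
  then show ?thesis using d_poly[OF g(1)] D_poly_t g(2) by metis
qed

lemma differential_eq:
  assumes z: "z \<in> formal_differentials V"
  shows "z - scale (differential_map D z) (formal_d t) \<in> rels"
proof -
  have "z = (\<Sum>x\<in>Poly_Mapping.keys z. scale (Poly_Mapping.lookup z x) (formal_d x))"
    by (subst poly_mapping_sum_keys) (simp add: scale_eq_mult formal_d_def mult_single)
  then have "z - scale (differential_map D z) (formal_d t)
    = (\<Sum>x\<in>Poly_Mapping.keys z. scale (Poly_Mapping.lookup z x) (formal_d x - scale (D x) (formal_d t)))"
    by (simp add: differential_map_def scale_sum_left scale_diff scale_scale sum_subtractf)
  also have "\<dots> \<in> rels"
    using z by (intro rels_sum rels_scale d_eq) (auto simp: formal_differentials_def)
  finally show ?thesis .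
qed

text \<open>Residues lie in \<open>k\<close>: peel off a constant, divide by \<open>t\<close>, and
  repeat.\<close>

lemma taylor_expansion:
  assumes x: "x \<in> V"
  shows "\<exists>c. (\<forall>j<n. c j \<in> k) \<and> (\<exists>r\<in>V. x - (\<Sum>j<n. c j * t ^ j) = r * t ^ n)"
proof (induction n)
  case 0
  then show ?case using x by auto
next
  case (Suc n)
  then obtain c r where c: "\<forall>j<n. c j \<in> k" "r \<in> V" "x - (\<Sum>j<n. c j * t ^ j) = r * t ^ n" by blast
  obtain b where b: "b \<in> k" "r - b \<in> V" "r - b = 0 \<or> v (r - b) > 0" using residue_nonunit[OF c(2)] .
  have "(r - b) / t \<in> V"
  proof (cases "r - b = 0")
    case True
    then show ?thesis using subring_0[OF sV] by simp
  next
    case False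
    have rL: "r - b \<in> L" using b(2) VL by blast
    have "v ((r - b) / t) = v (r - b) - 1" using v_divide[OF rL t(1) False t(2)] t(3) by simp
    then show ?thesis using b(3) False V_iff subfield_divide[OF L rL t(1)] by simp
  qed
  moreover have "x - (\<Sum>j<Suc n. (c(n := b)) j * t ^ j) = ((r - b) / t) * t ^ Suc n"
  proof -
    have "((r - b) / t) * t ^ Suc n = (r - b) * t ^ n" using t(2) by simp
    then have "((r - b) / t) * t ^ Suc n = r * t ^ n - b * t ^ n" by (simp only: left_diff_distrib)
    then show ?thesis using c(3) by simp
  qed
  moreover have "\<forall>j<Suc n. (c(n := b)) j \<in> k" using c b by (simp add: less_Suc_eq)
  ultimately show ?case by blast
qed

text \<open>The differentials of \<open>V\<close> are V dt, and those coming from \<open>A\<close>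
  generate t^n V dt, where \<open>n\<close> is the least value of a derivative. The quotient V / t^n
  V has the basis 1, ..., t^(n-1).\<close>

lemma kaehler_coker_dim_eq:
  assumes kA: "k \<subseteq> A" and AV: "A \<subseteq> V"
    and ge: "\<And>a. a \<in> A \<Longrightarrow> D a \<noteq> 0 \<Longrightarrow> v (D a) \<ge> int n" and a0: "a0 \<in> A" "D a0 \<noteq> 0" "v (D a0) = int n"
  shows "kaehler_coker_dim k A V = enat n"
  unfolding kaehler_coker_dim_def rels_def[symmetric]
proof (rule quotient_dim_eqI)
  define J where "J = {y \<in> V. y = 0 \<or> v y \<ge> int n}"
  have JV: "y \<in> J \<longleftrightarrow> y \<in> L \<and> (y = 0 \<or> v y \<ge> int n)" for y
    using V_iff[of y] by (auto simp: J_def)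
  have J: "0 \<in> J" "\<And>x y. x \<in> J \<Longrightarrow> y \<in> J \<Longrightarrow> x - y \<in> J" "\<And>r x. r \<in> V \<Longrightarrow> x \<in> J \<Longrightarrow> r * x \<in> J"
  proof -
    show "0 \<in> J" using JV subring_0[OF sL] by simp
    show mult: "r * x \<in> J" if rx: "r \<in> V" "x \<in> J" for r x
    proof (cases "r = 0 \<or> x = 0")
      case True
      then show ?thesis using \<open>0 \<in> J\<close> by auto
    next
      case False
      have "r \<in> L" "x \<in> L" "v r \<ge> 0" "v x \<ge> int n" using rx V_iff JV False by auto
      then show ?thesis unfolding JV using v_mult[of r x] subring_mult[OF sL] False by auto
    qed
    show "x - y \<in> J" if xy: "x \<in> J" "y \<in> J" for x y
    proof (cases "x = 0 \<or> y = 0 \<or> x - y = 0")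
      case True
      have "- 1 * y \<in> J" using mult[OF subring_uminus[OF sV subring_1[OF sV]] xy(2)] .
      then show ?thesis using True xy \<open>0 \<in> J\<close> by auto
    next
      case False
      have xyL: "x \<in> L" "- y \<in> L" "y \<in> L" using xy JV subring_uminus[OF sL] by auto
      have "min (v x) (v (- y)) \<le> v (x + - y)" using False xyL by (intro v_add) auto
      then have "v (x - y) \<ge> int n" using xy JV False v_uminus[OF xyL(3)] by auto
      then show ?thesis unfolding JV using subring_diff[OF sL xyL(1,3)] by blast
    qed
  qed
  have DA: "D a \<in> J" if "a \<in> A" for a
    using ge[OF that] D_L that AV VL unfolding JV by blast
  have map_J: "differential_map D u \<in> J" if "u \<in> rels" for u
  proof (rule differential_map_relations[of V D k J A])
    show "D (x + y) = D x + D y" "D (x * y) = x * D y + y * D x" if "x \<in> V" "y \<in> V" for x y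
      using D_add D_mult that VL by blast+
    show "u \<in> submodule_generated V (kaehler_relations k V \<union> formal_d ` A)"
      using \<open>u \<in> rels\<close> by (simp add: rels_def)
  qed (rule D_k J DA; assumption)+
  have dt_M: "scale r (formal_d t) \<in> formal_differentials V" if "r \<in> V" for r
    using that tV subring_0[OF sV]
    by (auto simp: formal_differentials_def scale_eq_mult formal_d_def mult_single lookup_single when_def)
  \<comment> \<open>The basis of the cokernel. Under \<open>D\<close> a combination has the value of
    one of its terms, which is below \<open>n\<close>, while relations have value at least
    \<open>n\<close>.\<close>
  define b where "b i = scale (t ^ i) (formal_d t)" for i
  show "b i \<in> formal_differentials V" for i
    unfolding b_def using subring_power[OF sV tV] by (rule dt_M)
  show "\<forall>i<n. c i = 0" if ck: "\<And>i. i < n \<Longrightarrow> c i \<in> k" and cN: "(\<Sum>i<n. scale (c i) (b i)) \<in> rels" for c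
  proof (rule ccontr)
    assume "\<not> ?thesis"
    define T where "T = {i. i < n \<and> c i \<noteq> 0}"
    have T: "finite T" "T \<noteq> {}" using \<open>\<not> (\<forall>i<n. c i = 0)\<close> by (auto simp: T_def)
    have cL: "c i \<in> L" if "i < n" for i using ck[OF that] kL by blast
    have terms: "c i * t ^ i \<in> L \<and> c i * t ^ i \<noteq> 0" if "i \<in> T" for i
      using that cL t subring_mult[OF sL] subring_power[OF sL t(1)] by (simp add: T_def)
    have v_term: "v (c i * t ^ i) = int i" if "i \<in> T" for i
      using that v_mult[OF cL subring_power[OF sL t(1)]] v_const[OF ck] v_power[OF t(1,2)] t by (simp add: T_def)
    have "inj_on (\<lambda>i. v (c i * t ^ i)) T" using v_term by (auto simp: inj_on_def)
    from v_sum_distinct[OF T terms this] obtain m where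
      m: "m \<in> T" "(\<Sum>i\<in>T. c i * t ^ i) \<noteq> 0" "v (\<Sum>i\<in>T. c i * t ^ i) = v (c m * t ^ m)" by blast
    have "differential_map D (\<Sum>i<n. scale (c i) (b i)) = (\<Sum>i<n. c i * t ^ i)"
      by (simp add: b_def differential_map_sum differential_map_scale differential_map_d D_t)
    also have "\<dots> = (\<Sum>i\<in>T. c i * t ^ i)" by (intro sum.mono_neutral_right) (auto simp: T_def)
    finally have "(\<Sum>i\<in>T. c i * t ^ i) \<in> J" using map_J[OF cN] by simp
    then show False using m v_term[OF m(1)] unfolding JV by (auto simp: T_def)
  qed
  have J_rels: "scale y (formal_d t) \<in> rels" if y: "y \<in> J" for y
  proof -
    define r where "r = y / D a0"
    have a0V: "a0 \<in> V" using a0(1) AV by blast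
    then have DL: "D a0 \<in> L" using D_L VL by blast
    have rV: "r \<in> V"
    proof (cases "y = 0")
      case False
      then have yv: "y \<in> L" "v y \<ge> int n" using y JV by auto
      then have "v r \<ge> 0" using v_divide[OF yv(1) DL False a0(2)] a0(3) by (simp add: r_def)
      then show ?thesis using V_iff subfield_divide[OF L yv(1) DL] by (simp add: r_def)
    qed (simp add: r_def subring_0[OF sV])
    have "formal_d a0 \<in> rels" using a0(1) rels_gen by blast
    then have "scale r (formal_d a0 - (formal_d a0 - scale (D a0) (formal_d t))) \<in> rels"
      using rels_scale[OF rV rels_diff[OF _ d_eq[OF a0V]]] by blast
    then show ?thesis using a0(2) by (simp add: scale_scale r_def)
  qed
  fix m and b :: "nat \<Rightarrow> 'l formal_differential"
  assume m: "n < m" and b: "\<And>i. i < m \<Longrightarrow> b i \<in> formal_differentials V"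
  have phiV: "differential_map D (b i) \<in> V" if "i < m" for i
    using differential_map_in[OF sV b[OF that] D_V] .
  have "\<forall>i\<in>{..<m}. \<exists>c. (\<forall>j<n. c j \<in> k) \<and> (\<exists>r\<in>V. differential_map D (b i) - (\<Sum>j<n. c j * t ^ j) = r * t ^ n)"
    using taylor_expansion[OF phiV] by simp
  then obtain a where "\<forall>i\<in>{..<m}. (\<forall>j<n. a i j \<in> k) \<and>
      (\<exists>r\<in>V. differential_map D (b i) - (\<Sum>j<n. a i j * t ^ j) = r * t ^ n)"
    by (rule bchoice[THEN exE])
  then have a: "\<And>i j. i < m \<Longrightarrow> j < n \<Longrightarrow> a i j \<in> k"
    "\<And>i. i < m \<Longrightarrow> \<exists>r\<in>V. differential_map D (b i) - (\<Sum>j<n. a i j * t ^ j) = r * t ^ n" by auto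
  \<comment> \<open>More than \<open>n\<close> vectors of Taylor coefficients below t^n are
    dependent over \<open>k\<close>.\<close>
  obtain x where x: "\<forall>i\<in>{..<m}. x i \<in> k" "\<exists>i\<in>{..<m}. x i \<noteq> 0" "\<forall>j\<in>{..<n}. (\<Sum>i\<in>{..<m}. x i * a i j) = 0"
    using homogeneous_system[OF sk, of "{..<n}" "{..<m}" a] m a(1) by auto
  define w where "w = (\<Sum>i<m. scale (x i) (b i))"
  have xV: "x i \<in> V" if "i < m" for i using x(1) that kV by auto
  have phi_w: "differential_map D w = (\<Sum>i<m. x i * differential_map D (b i))"
    by (simp add: w_def differential_map_sum differential_map_scale)
  have tn_J: "r * t ^ n \<in> J" if "r \<in> V" for r
  proof (rule J(3)[OF that])
    show "t ^ n \<in> J" unfolding JV using t v_power[OF t(1,2)] subring_power[OF sL t(1)] by simp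
  qed
  have "(\<Sum>i<m. x i * (\<Sum>j<n. a i j * t ^ j)) = (\<Sum>j<n. (\<Sum>i<m. x i * a i j) * t ^ j)"
    unfolding sum_distrib_left sum_distrib_right by (subst sum.swap) (simp add: mult.assoc)
  also have "\<dots> = 0" using x(3) by simp
  finally have "differential_map D w = (\<Sum>i<m. x i * (differential_map D (b i) - (\<Sum>j<n. a i j * t ^ j)))"
    by (simp add: phi_w right_diff_distrib sum_subtractf)
  also have "\<dots> \<in> J"
  proof -
    have terms: "x i * (differential_map D (b i) - (\<Sum>j<n. a i j * t ^ j)) \<in> J" if "i < m" for i
      using a(2)[OF that] tn_J J(3)[OF xV[OF that]] by metis
    have sum_J: "sum f I \<in> J" if "\<And>i. i \<in> I \<Longrightarrow> f i \<in> J" for f and I :: "nat set"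
      using that
    proof (induction I rule: infinite_finite_induct)
      case (insert i I)
      have "f i - (0 - sum f I) \<in> J" using insert J by (intro J(2)) auto
      then show ?case using insert by simp
    qed (use J in auto)
    show ?thesis by (rule sum_J) (use terms in auto)
  qed
  finally have wJ: "differential_map D w \<in> J" .
  have "(\<Sum>i<m. scale (x i) (b i - scale (differential_map D (b i)) (formal_d t))) \<in> rels"
    using xV b by (intro rels_sum rels_scale differential_eq) auto
  also have "(\<Sum>i<m. scale (x i) (b i - scale (differential_map D (b i)) (formal_d t)))
    = w - scale (differential_map D w) (formal_d t)"
    unfolding phi_w by (simp add: w_def scale_diff sum_subtractf scale_scale scale_sum_left)
  finally have "w - scale (differential_map D w) (formal_d t) + scale (differential_map D w) (formal_d t) \<in> rels"
    using J_rels[OF wJ] by (rule rels_add)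
  then show "\<exists>c. (\<forall>i<m. c i \<in> k) \<and> (\<exists>i<m. c i \<noteq> 0) \<and> (\<Sum>i<m. scale (c i) (b i)) \<in> rels"
    using x(1,2) by (intro exI[of _ x]) (auto simp: w_def)
qed

end

text \<open>The Frobenius transports the derivation to \<open>V\<^sup>p\<close>; a trivial cokernel there forces an element
  whose derivative is a unit, that is, an element of value one up to a constant.\<close>

lemma frobenius_unramified:
  assumes A1: "subring A1" "k \<subseteq> A1" "A1 \<subseteq> Vp" and dim: "kaehler_coker_dim k A1 Vp = 0"
  obtains a where "a \<in> A1" "a \<noteq> 0" "v a = int p"
proof -
  define root where "root y = (SOME x. x \<in> L \<and> x ^ p = y)" for y
  have root: "root y \<in> L" "root y ^ p = y" if "y \<in> Lp" for y
    using that someI_ex[of "\<lambda>x. x \<in> L \<and> x ^ p = y"] unfolding root_def by blast+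
  have root_eq: "root (x ^ p) = x" if "x \<in> L" for x
    using root(2)[of "x ^ p"] that frob_inj1 by blast
  \<comment> \<open>It sends x^p to the \<open>p\<close>-th power of \<open>D x\<close>, and thus
    t^p to 1.\<close>
  define D1 where "D1 y = D (root y) ^ p" for y
  have D1: "D1 (x ^ p) = D x ^ p" if "x \<in> L" for x using root_eq[OF that] by (simp add: D1_def)
  have D1_Vp: "D1 y \<in> Vp" if "y \<in> Vp" for y using that D1 VL D_V by auto
  have sVp: "subring Vp"
    using sV unfolding subring_def
    by (auto simp: image_iff frob_diff1[symmetric] power_mult_distrib[symmetric]) (metis power_one)
  have D1_add: "D1 (x + y) = D1 x + D1 y" and D1_mult: "D1 (x * y) = x * D1 y + y * D1 x"
    if xy: "x \<in> Vp" "y \<in> Vp" for x y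
  proof -
    obtain a b where ab: "a \<in> L" "b \<in> L" "x = a ^ p" "y = b ^ p" using xy VL by blast
    have sum: "x + y = (a + b) ^ p" and prod: "x * y = (a * b) ^ p"
      using ab by (auto simp: frob_add1 power_mult_distrib)
    note D1ab = D1[OF ab(1)] D1[OF ab(2)]
    have "D1 (x + y) = D (a + b) ^ p" unfolding sum by (rule D1[OF subring_add[OF sL ab(1,2)]])
    then show "D1 (x + y) = D1 x + D1 y" using ab D1ab by (simp add: D_add frob_add1)
    have "D1 (x * y) = D (a * b) ^ p" unfolding prod by (rule D1[OF subring_mult[OF sL ab(1,2)]])
    then show "D1 (x * y) = x * D1 y + y * D1 x"
      using ab D1ab by (simp add: D_mult frob_add1 power_mult_distrib)
  qed
  have D1_k: "D1 c = 0" if "c \<in> k" for c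
  proof -
    obtain d where "d \<in> k" "d ^ p = c" using k_perfect[OF \<open>c \<in> k\<close>] by blast
    then show ?thesis using D1[of d] kL D_k p_pos by auto
  qed
  define N where "N = submodule_generated Vp (kaehler_relations k Vp \<union> formal_d ` A1)"
  have kVp: "k \<subseteq> Vp" using A1 by blast
  have "formal_d (t ^ p) \<in> formal_differentials Vp"
    using tV subring_0[OF sVp] subring_1[OF sVp]
    by (auto simp: formal_differentials_def formal_d_def lookup_single when_def)
  then have tN: "formal_d (t ^ p) \<in> N"
    using quotient_dim_0[OF k dim[unfolded kaehler_coker_dim_def]] submodule_generated_closed(5)[OF sVp] kVp
    unfolding N_def by blast
  \<comment> \<open>The trivial cokernel makes d(t^p) a combination of relations and differentials
    from \<open>A1\<close>. If \<open>D1\<close> mapped \<open>A1\<close> into the nonunits, it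
    would map t^p there too, yet the image is 1.\<close>
  have "\<exists>a\<in>A1. D1 a \<notin> nonunits V"
  proof (rule ccontr)
    assume no: "\<not> ?thesis"
    have "differential_map D1 (formal_d (t ^ p)) \<in> nonunits V"
    proof (rule differential_map_relations[of Vp D1 k "nonunits V" A1])
      show "0 \<in> nonunits V" by (rule zero_in_nonunits[OF sV])
      show "x - y \<in> nonunits V" if "x \<in> nonunits V" "y \<in> nonunits V" for x y
        using that local_ring_nonunits_diff[OF locV] by blast
      show "r * x \<in> nonunits V" if "r \<in> Vp" "x \<in> nonunits V" for r x
        using that nonunits_mult[OF sV] subring_power[OF sV] by blast
    qed (use D1_add D1_mult D1_k no tN in \<open>auto simp: N_def\<close>)
    then show False using D1[OF t(1)] D_t one_notin_nonunits[OF sV] by (simp add: differential_map_d)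
  qed
  then obtain a where a: "a \<in> A1" "D1 a \<notin> nonunits V" by blast
  obtain x where x: "x \<in> V" "a = x ^ p" using a A1 by blast
  have xL: "x \<in> L" using x VL by blast
  have Dx: "D x \<notin> nonunits V"
  proof
    assume "D x \<in> nonunits V"
    then have "D x ^ p \<in> nonunits V" using nonunits_power[OF sV D_V[OF x(1)], of 1] by simp
    then show False using a x D1[OF xL] by simp
  qed
  \<comment> \<open>\<open>x\<close> itself may be a unit; after removing its residue the value is
    positive, and the unit derivative forces it to be 1.\<close>
  obtain c where c: "c \<in> k" "x - c \<in> V" "x - c = 0 \<or> v (x - c) > 0" using residue_nonunit[OF x(1)] .
  have xcL: "x - c \<in> L" using c VL by blast
  have Dxc: "D (x - c) = D x" using D_diff[OF xL, of c] c(1) kL D_k by auto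
  have Dx0: "D x \<noteq> 0" "v (D x) \<le> 0"
    using Dx v_nonunit[of "D x"] D_L[OF xL] by (auto simp: not_less)
  have xc: "x - c \<noteq> 0" using Dxc Dx0 D_k[OF subring_0[OF sk]] by auto
  have "v (x - c) \<le> 1" using v_D_ge[OF xcL xc] Dxc Dx0 by simp
  then have "v (x - c) = 1" using c(3) xc by simp
  then have "v ((x - c) ^ p) = int p" using v_power[OF xcL xc] by simp
  moreover have "(x - c) ^ p = a - c ^ p" by (simp add: frob_diff1 x)
  moreover have "a - c ^ p \<in> A1" using a c(1) A1 subring_diff[OF A1(1)] subring_power[OF A1(1)] by blast
  ultimately show ?thesis using that xc p_pos by (metis power_not_zero)
qed

end

section \<open>Places of geometrically integral curves\<close>

lemma linear_power_divisor:
  fixes d :: "'l::field poly"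
  shows "d * f = [:- c, 1:] ^ n \<Longrightarrow> \<exists>a m. d = smult a ([:- c, 1:] ^ m)"
proof (induction n arbitrary: d f)
  case 0
  then have "is_unit d" by (metis dvdI power_0)
  then obtain a where "d = [:a:]" by (metis is_unit_polyE)
  then have "d = smult a ([:- c, 1:] ^ 0)" by simp
  then show ?case by blast
next
  case (Suc n)
  have "poly (d * f) c = 0" using Suc.prems by simp
  then consider "poly f c = 0" | "poly d c = 0" by auto
  then show ?case
  proof cases
    case 1
    then obtain f' where "f = [:- c, 1:] * f'" by (auto simp: poly_eq_0_iff_dvd)
    then have "[:- c, 1:] * (d * f') = [:- c, 1:] * [:- c, 1:] ^ n"
      using Suc.prems by (simp only: power_Suc mult.left_commute)
    then have "d * f' = [:- c, 1:] ^ n" by (subst (asm) mult_cancel_left) auto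
    then show ?thesis by (rule Suc.IH)
  next
    case 2
    then obtain d' where d': "d = [:- c, 1:] * d'" by (auto simp: poly_eq_0_iff_dvd)
    then have "[:- c, 1:] * (d' * f) = [:- c, 1:] * [:- c, 1:] ^ n"
      using Suc.prems by (simp only: power_Suc mult.assoc)
    then have "d' * f = [:- c, 1:] ^ n" by (subst (asm) mult_cancel_left) auto
    then obtain a m where "d' = smult a ([:- c, 1:] ^ m)" using Suc.IH by blast
    then have "d = smult a ([:- c, 1:] ^ Suc m)" using d' by (simp only: power_Suc mult_smult_right)
    then show ?thesis by blast
  qed
qed

text \<open>Since X^p - c^p is (X - c)^p, a nonzero \<open>r\<close> shares with it a factor (X -
  c)^m over \<open>E\<close>, where 0 < m < p. Its constant term puts (-c)^m into \<open>E\<close>;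
  as c^p is there too, Bezout for \<open>m\<close> and \<open>p\<close> yields
  \<open>c\<close>.\<close>

lemma (in char_p) radicial_powers_indep:
  fixes E :: "'l set"
  assumes E: "subfield E" and c: "c ^ p \<in> E" "c \<notin> E"
    and r: "r \<in> poly_over E" "degree r < p" "poly r c = 0"
  shows "r = 0"
proof (rule ccontr)
  assume r0: "r \<noteq> 0"
  note sE = subfield_subring[OF E]
  define f where "f = monom 1 p - [:c ^ p:]"
  have f: "f \<in> poly_over E" unfolding f_def
    using c by (intro poly_over_diff[OF sE] poly_over_monom[OF sE] poly_over_const[OF sE] subring_1[OF sE])
  have f_eq: "f = [:- c, 1:] ^ p"
  proof -
    have "CHAR('l poly) = p" using char by simp
    then have "([:0, 1:] + [:- c:]) ^ p = [:0, 1:] ^ p + [:- c:] ^ p"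
      using prime_p by (intro freshmans_dream) auto
    moreover have "[:0, 1:] ^ p = (monom 1 p :: 'l poly)" by (simp add: monom_altdef)
    moreover have "[:- c:] ^ p = - [:c ^ p:]"
    proof -
      have "(- c) ^ p = - (c ^ p)" using frob_diff1[of 0 c] p_pos by simp
      then show ?thesis by (simp add: poly_const_pow)
    qed
    ultimately show ?thesis by (simp add: f_def)
  qed
  obtain d a b where d: "d \<in> poly_over E" "d dvd r" "d dvd f" "d = a * r + b * f"
    using poly_over_bezout[OF E r(1) f] by blast
  obtain e where "f = d * e" using d(3) by blast
  then obtain l m where lm: "d = smult l ([:- c, 1:] ^ m)"
    using linear_power_divisor[of d e c p] f_eq by auto
  have d0: "d \<noteq> 0" using d(2) r0 by auto
  then have l0: "l \<noteq> 0" using lm by auto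
  have "degree d = m" using lm l0 by (simp add: degree_linear_power)
  moreover have "degree d \<le> degree r" using d(2) r0 by (rule dvd_imp_degree_le)
  ultimately have m: "m < p" using r(2) by simp
  have "poly d c = 0" using d(4) r(3) by (simp add: f_eq p_pos)
  then have m0: "m > 0" using lm l0 by (intro gr0I) auto
  have "lead_coeff d = l" using lm by (simp add: lead_coeff_smult lead_coeff_power)
  then have lE: "l \<in> E" using d(1) by (auto simp: poly_over_def)
  have "poly d 0 \<in> E" using poly_over_eval[OF sE d(1) subring_0[OF sE]] .
  then have "inverse l * (l * (- c) ^ m) \<in> E"
    using lm lE subfield_inverse[OF E] subring_mult[OF sE] by simp
  moreover have "inverse l * (l * (- c) ^ m) = (- c) ^ m" using l0 by (simp flip: mult.assoc)
  ultimately have cm: "(- c) ^ m \<in> E" by simp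
  have "(- c) ^ p = - (c ^ p)" using frob_diff1[of 0 c] p_pos by simp
  then have cp: "(- c) ^ p \<in> E" using c(1) subring_uminus[OF sE] by metis
  have c0: "- c \<noteq> 0" using c(2) subring_0[OF sE] by auto
  have "coprime (int m) (int p)"
    using prime_p m m0 by (metis coprime_commute coprime_int_iff nat_dvd_not_less prime_imp_coprime)
  then obtain x y where xy: "x * int m + y * int p = 1" using bezout_int[of "int m" "int p"] by auto
  have "((- c) ^ m) powi x * ((- c) ^ p) powi y \<in> E"
    using cm cp subfield_power_int[OF E] subring_mult[OF sE] by blast
  also have "((- c) ^ m) powi x * ((- c) ^ p) powi y = (- c) powi (int m * x) * (- c) powi (int p * y)"
    by (simp only: power_int_power)
  also have "\<dots> = (- c) powi (int m * x + int p * y)" using c0 by (simp add: power_int_add)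
  also have "int m * x + int p * y = 1" using xy by (simp add: mult.commute)
  finally have "- c \<in> E" by simp
  then show False using c(2) subring_uminus[OF sE, of "- c"] by simp
qed

lemma (in function_field_place) v_power_int:
  assumes x: "x \<in> L" "x \<noteq> 0"
  shows "v (x powi n) = n * v x"
  using v_power[OF x, of "nat n"] v_power[of "inverse x" "nat (- n)"] v_inverse[OF x] subfield_inverse[OF L x(1)] x(2)
  by (auto simp: power_int_def)

text \<open>A place of \<open>F\<close>, its base change to \<open>L\<close>, and the Frobenius
  subfield \<open>F1\<close>. Linear disjointness is present only through the retraction
  \<open>\<rho>\<close>.\<close>

locale disjoint_place = radicial_base p K k + function_field_place p k L V u
  for p :: nat and K k L V :: "'l::field set" and u :: 'l +
  fixes F P F1 :: "'l set" and \<rho> :: "'l \<Rightarrow> 'l"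
  assumes F: "subfield F" "K \<subseteq> F" and P: "valuation_ring F P" "K \<subseteq> P" and uP: "u \<in> P"
    and L_eq: "L = ring_adjoin k F" and V_eq: "V = L \<inter> proot P"
    and F1: "subfield F1" "K \<subseteq> F1" "F1 \<subseteq> F" "\<And>x. x \<in> F \<Longrightarrow> x ^ p \<in> F1"
    and Lp_eq: "(\<lambda>x. x ^ p) ` L = ring_adjoin k F1"
    and \<rho>: "\<And>x y. x \<in> L \<Longrightarrow> y \<in> L \<Longrightarrow> \<rho> (x + y) = \<rho> x + \<rho> y"
      "\<And>f x. f \<in> F \<Longrightarrow> x \<in> L \<Longrightarrow> \<rho> (f * x) = f * \<rho> x"
      "\<And>f. f \<in> F \<Longrightarrow> \<rho> f = f" "\<And>x. x \<in> ring_adjoin k F1 \<Longrightarrow> \<rho> x \<in> F1"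
begin

lemma sF: "subring F" and sF1: "subring F1" and sP: "subring P" and PF: "P \<subseteq> F"
  using F(1) F1(1) subfield_subring valuation_ring_subring[OF P(1)] valuation_ring_sub[OF P(1)] by blast+

lemma FL: "F \<subseteq> L" and F1_Lp: "F1 \<subseteq> Lp"
  unfolding L_eq[symmetric] Lp_eq using ring_adjoin_gens[of F k] ring_adjoin_gens[of F1 k] L_eq by auto

lemma P_iff: "x \<in> P \<longleftrightarrow> x \<in> F \<and> (x = 0 \<or> v x \<ge> 0)"
proof -
  have "x \<in> P \<longleftrightarrow> x \<in> F \<and> x \<in> V"
    using valuation_ring_proot[OF P(1)] proot_superset[of P] PF FL unfolding V_eq by blast
  then show ?thesis using V_iff[of x] FL by blast
qed

lemma PV: "P \<subseteq> V"
  using P_iff V_iff FL by blast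

text \<open>\<open>\<rho>\<close> fixes \<open>x\<close> as an element of \<open>F\<close> and sends
  it into \<open>F1\<close> as an element of k[F1].\<close>

lemma F_Lp: "x \<in> F \<Longrightarrow> x \<in> Lp \<Longrightarrow> x \<in> F1"
  using \<rho>(3,4) unfolding Lp_eq by metis

text \<open>Expand over \<open>Lp\<close> and apply the \<open>F\<close>-linear
  \<open>\<rho>\<close>: it moves the coefficients into \<open>F1\<close> and passes over the powers
  of \<open>x\<close>.\<close>

lemma F_expansion:
  assumes x: "x \<in> F" "x \<notin> F1" and z: "z \<in> F"
  obtains g where "g \<in> poly_over F1" "degree g < p" "poly g x = z"
proof -
  have xL: "x \<in> L" "x \<notin> Lp" "z \<in> L" using x z FL F_Lp by blast+
  obtain g where g: "g \<in> poly_over Lp" "degree g < p" "poly g x = z"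
    using Lp_expansion[OF xL(1) Lp_powers_indep[OF xL(1,2)] xL(3)] by blast
  have cLp: "coeff g i \<in> Lp" and cL: "coeff g i \<in> L" for i using g(1) LpL by (auto simp: poly_over_def)
  have \<rho>_sum: "\<rho> (\<Sum>i\<in>I. f i) = (\<Sum>i\<in>I. \<rho> (f i))" if "\<And>i. i \<in> I \<Longrightarrow> f i \<in> L" for f and I :: "nat set"
    using that
  proof (induction I rule: infinite_finite_induct)
    case (insert i I)
    then show ?case using \<rho>(1)[of "f i" "sum f I"] subring_sum[OF sL, of I f] by simp
  qed (use \<rho>(3) subring_0[OF sF] in auto)
  define h where "h = (\<Sum>i\<le>degree g. monom (\<rho> (coeff g i)) i)"
  have coeff_h: "coeff h i = (if i \<le> degree g then \<rho> (coeff g i) else 0)" for i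
    by (simp add: h_def coeff_sum)
  have "h \<in> poly_over F1"
    using cLp \<rho>(4) subring_0[OF sF1] unfolding Lp_eq by (simp add: poly_over_def coeff_h)
  moreover have "degree h < p"
    using degree_le[of "degree g" h] g(2) by (simp add: coeff_h)
  moreover have "poly h x = z"
  proof -
    have "z = \<rho> (\<Sum>i\<le>degree g. x ^ i * coeff g i)"
      using \<rho>(3)[OF z] g(3) by (simp add: poly_altdef mult.commute)
    also have "\<dots> = (\<Sum>i\<le>degree g. \<rho> (x ^ i * coeff g i))"
      using cL xL subring_mult[OF sL] subring_power[OF sL] by (intro \<rho>_sum) auto
    also have "\<dots> = (\<Sum>i\<le>degree g. x ^ i * \<rho> (coeff g i))"
      using \<rho>(2)[OF subring_power[OF sF x(1)] cL] by simp
    also have "\<dots> = poly h x" by (simp add: h_def poly_sum poly_monom mult.commute)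
    finally show ?thesis by simp
  qed
  ultimately show ?thesis by (rule that)
qed

text \<open>\<open>P\<close> is generated by one element over \<open>P \<inter> F1\<close>: a uniformizer if \<open>F/F1\<close> is ramified at
  \<open>P\<close>, a lift of a generator of the residue extension if that is nontrivial.  In the remaining case
  of an immediate extension, \<open>P\<close> would lie in the closure of \<open>P \<inter> F1\<close> and hence in \<open>L\<^sup>p\<close>.\<close>

lemma monogenic_ramified:
  assumes g: "g > 0" and \<pi>: "\<pi> \<in> F" "\<pi> \<noteq> 0" "v \<pi> = g" and dvd: "\<And>x. x \<in> F \<Longrightarrow> x \<noteq> 0 \<Longrightarrow> g dvd v x"
    and ram: "\<And>y. y \<in> F1 \<Longrightarrow> y \<noteq> 0 \<Longrightarrow> v y \<noteq> g"
  shows "\<pi> \<in> P \<and> \<pi> \<notin> F1 \<and> (\<forall>z\<in>P. \<exists>h\<in>poly_over (P \<inter> F1). poly h \<pi> = z)"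
proof (intro conjI ballI)
  show "\<pi> \<in> P" using \<pi> g P_iff by simp
  show \<pi>1: "\<pi> \<notin> F1" using ram \<pi> by blast
  \<comment> \<open>\<open>F1\<close> contains \<pi>^p, of value p g, but nothing of value
    \<open>g\<close>. As \<open>p\<close> is prime, Bezout shows that all its values are multiples
    of p g.\<close>
  have F1_dvd: "int p * g dvd v y" if y: "y \<in> F1" "y \<noteq> 0" for y
  proof -
    obtain m where m: "v y = g * m" using dvd[of y] y F1(3) by blast
    have "int p dvd m"
    proof (rule ccontr)
      assume "\<not> int p dvd m"
      then have "coprime m (int p)"
        using prime_p by (metis coprime_commute prime_imp_coprime prime_nat_int_transfer)
      then obtain a b where ab: "a * m + b * int p = 1" using bezout_int[of m "int p"] by auto
      define w where "w = y powi a * (\<pi> ^ p) powi b"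
      have pw: "x powi n \<in> L \<and> x powi n \<noteq> 0 \<and> v (x powi n) = n * v x" if "x \<in> L" "x \<noteq> 0" for x n
        using that subfield_power_int[OF L] v_power_int[OF that] by (simp add: power_int_eq_0_iff)
      have "\<pi> ^ p \<in> F1" using F1(4) \<pi> by blast
      then have "w \<in> F1" unfolding w_def using y(1) subfield_power_int[OF F1(1)] subring_mult[OF sF1] by blast
      moreover have yL: "y \<in> L" "\<pi> \<in> L" using y F1(3) \<pi> FL by blast+
      have \<pi>pL: "\<pi> ^ p \<in> L" "\<pi> ^ p \<noteq> 0" using yL \<pi> subring_power[OF sL] by auto
      have "v w = a * v y + b * v (\<pi> ^ p)"
        unfolding w_def using pw[OF yL(1) y(2)] pw[OF \<pi>pL] v_mult by simp
      then have "v w = g * (a * m + b * int p)"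
        using v_power[OF yL(2) \<pi>(2)] m \<pi>(3) by (simp add: algebra_simps)
      then have "v w = g" using ab by simp
      moreover have "w \<noteq> 0" unfolding w_def using pw[OF yL(1) y(2)] pw[OF \<pi>pL] by simp
      ultimately show False using ram by blast
    qed
    then show ?thesis using m by (simp add: mult.commute)
  qed
  fix z assume z: "z \<in> P"
  obtain h where h: "h \<in> poly_over F1" "degree h < p" "poly h \<pi> = z"
    using F_expansion[OF \<pi>(1) \<pi>1] z PF by blast
  have cF1: "coeff h i \<in> F1" for i using h(1) by (simp add: poly_over_def)
  have "coeff h i \<in> P \<inter> F1" for i
  proof (cases "coeff h i = 0")
    case True
    then show ?thesis using subring_0[OF sP] subring_0[OF sF1] by simp
  next
    case False
    then have h0: "h \<noteq> 0" by auto
    have hL: "h \<in> poly_over L" using h(1) F1(3) FL by (auto simp: poly_over_def)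
    have small: "j < p" if "coeff h j \<noteq> 0" for j using that le_degree[of h j] h(2) by linarith
    have *: "z \<noteq> 0 \<and> (\<exists>m. coeff h m \<noteq> 0 \<and> v z = v (coeff h m) + int m * v \<pi> \<and>
      (\<forall>i. coeff h i \<noteq> 0 \<longrightarrow> v (coeff h m) + int m * v \<pi> \<le> v (coeff h i) + int i * v \<pi>))"
      unfolding h(3)[symmetric]
    proof (rule v_poly_distinct[OF _ \<pi>(2) hL h0])
      show "\<pi> \<in> L" using \<pi> FL by blast
      fix i j assume ij: "coeff h i \<noteq> 0" "coeff h j \<noteq> 0"
        "v (coeff h i) + int i * v \<pi> = v (coeff h j) + int j * v \<pi>"
      then have "(int i - int j) * g = v (coeff h j) - v (coeff h i)"
        using \<pi>(3) by (simp add: algebra_simps)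
      moreover have "int p * g dvd v (coeff h j) - v (coeff h i)"
        using F1_dvd cF1 ij by (intro dvd_diff) auto
      ultimately have "int p * g dvd (int i - int j) * g" by simp
      then have "g = 0 \<or> int p dvd int i - int j" by (simp only: dvd_mult_cancel_right)
      then have "int p dvd int i - int j" using g by blast
      moreover have "i < p" "j < p" using small ij(1,2) by blast+
      then have "\<bar>int i - int j\<bar> < int p" by linarith
      ultimately have "int i - int j = 0" using dvd_imp_le_int[of "int i - int j" "int p"] by linarith
      then show "i = j" by simp
    qed
    then have "v z \<le> v (coeff h i) + int i * g" "z \<noteq> 0" using False \<pi>(3) by auto
    moreover have "v z \<ge> 0" using z \<open>z \<noteq> 0\<close> P_iff by blast
    moreover have "int i * g < int p * g" using small[OF False] g by simp
    \<comment> \<open>Being a multiple of p g, a value above -p g is nonnegative.\<close>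
    ultimately have "v (coeff h i) > - (int p * g)" by linarith
    moreover obtain n where n: "v (coeff h i) = int p * g * n" using F1_dvd[OF cF1 False] by blast
    ultimately have "int p * g * (n + 1) > 0" by (simp add: distrib_left)
    moreover have "int p * g > 0" using g p_pos by simp
    ultimately have "n + 1 > 0" by (rule zero_less_mult_pos)
    then have "n \<ge> 0" by simp
    then have "v (coeff h i) \<ge> 0" using n g by simp
    then show ?thesis using cF1 F1(3) P_iff by blast
  qed
  then show "\<exists>h\<in>poly_over (P \<inter> F1). poly h \<pi> = z" using h(3) by (auto simp: poly_over_def)
qed

text \<open>The residue field of \<open>R\<close>, realized inside \<open>k\<close>, which is the
  residue field of \<open>V\<close>.\<close>

definition residues :: "'l set \<Rightarrow> 'l set" where
  "residues R = {c \<in> k. \<exists>x\<in>R. x - c \<in> nonunits V}"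

lemma residue_0:
  assumes "c \<in> k" "c \<in> nonunits V" shows "c = 0"
  using assms const_unit units_iff_nonunits by blast

lemma subfield_residues: "subfield (residues (P \<inter> F1))"
proof -
  have sP1: "subring (P \<inter> F1)" using subring_Int[OF sP sF1] .
  have P1V: "P \<inter> F1 \<subseteq> V" using PV by blast
  have closed: "x - y \<in> residues (P \<inter> F1)" "x * y \<in> residues (P \<inter> F1)"
    if xy: "x \<in> residues (P \<inter> F1)" "y \<in> residues (P \<inter> F1)" for x y
  proof -
    obtain a b where ab: "x \<in> k" "y \<in> k" "a \<in> P \<inter> F1" "b \<in> P \<inter> F1" "a - x \<in> nonunits V" "b - y \<in> nonunits V"
      using xy unfolding residues_def by blast
    have "(a - x) - (b - y) \<in> nonunits V" using ab local_ring_nonunits_diff[OF locV] by blast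
    moreover have "(a - x) - (b - y) = (a - b) - (x - y)" by simp
    ultimately show "x - y \<in> residues (P \<inter> F1)"
      using ab subring_diff[OF sP1] subring_diff[OF sk] unfolding residues_def by force
    have "b * (a - x) + x * (b - y) \<in> nonunits V"
      using ab P1V kV by (intro local_ring_nonunits_add[OF locV] nonunits_mult[OF sV]) auto
    moreover have "b * (a - x) + x * (b - y) = a * b - x * y" by (simp add: algebra_simps)
    ultimately show "x * y \<in> residues (P \<inter> F1)"
      using ab subring_mult[OF sP1] subring_mult[OF sk] unfolding residues_def by force
  qed
  have inv: "inverse x \<in> residues (P \<inter> F1)" if x: "x \<in> residues (P \<inter> F1)" for x
  proof (cases "x = 0")
    case False
    obtain a where a: "x \<in> k" "a \<in> P \<inter> F1" "a - x \<in> nonunits V" using x unfolding residues_def by blast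
    have "x + (a - x) \<in> units V" using units_add_nonunit[OF locV const_unit[OF a(1) False] a(3)] .
    then have aV: "a \<in> units V" by simp
    then have "v a = 0" "a \<noteq> 0" using v_unit by auto
    then have "v (inverse a) = 0" "inverse a \<in> F1" using a F1 FL v_inverse subfield_inverse by auto
    then have "inverse a \<in> P \<inter> F1" using P_iff F1(3) by auto
    moreover have "(- (inverse a * inverse x)) * (a - x) \<in> nonunits V"
    proof (rule nonunits_mult[OF sV a(3)])
      have "inverse a \<in> V" "inverse x \<in> V" using aV const_unit[OF a(1) False] units_inverse units_iff by blast+
      then show "- (inverse a * inverse x) \<in> V" using subring_uminus[OF sV] subring_mult[OF sV] by blast
    qed
    moreover have "(- (inverse a * inverse x)) * (a - x) = inverse a - inverse x"
      using False \<open>a \<noteq> 0\<close> by (simp add: field_simps)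
    moreover have "inverse x \<in> k" using a(1) subfield_inverse[OF k] by blast
    ultimately show ?thesis unfolding residues_def by force
  qed (use x in simp)
  have "1 \<in> residues (P \<inter> F1)"
    unfolding residues_def using subring_1[OF sk] subring_1[OF sP1] zero_in_nonunits[OF sV] by force
  then show ?thesis using closed inv by (simp add: subfield_def subring_def)
qed

text \<open>If the expansion of \<open>z\<close> had a coefficient of negative value, a power of
  \<pi> would bring the least value to 0. Reduction then gives a nonzero polynomial of degree below
  \<open>p\<close> over the smaller residue field with root \<open>c\<close>, against
  \<open>radicial_powers_indep\<close>.\<close>

lemma monogenic_residual:
  assumes g: "g > 0" and \<pi>: "\<pi> \<in> F1" "\<pi> \<noteq> 0" "v \<pi> = g" and dvd: "\<And>x. x \<in> F \<Longrightarrow> x \<noteq> 0 \<Longrightarrow> g dvd v x"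
    and x: "x \<in> P" and c: "c \<in> k" "x - c \<in> nonunits V" "c \<notin> residues (P \<inter> F1)"
  shows "x \<notin> F1 \<and> (\<forall>z\<in>P. \<exists>h\<in>poly_over (P \<inter> F1). poly h x = z)"
proof (intro conjI ballI)
  show x1: "x \<notin> F1" using x c unfolding residues_def by blast
  have xF: "x \<in> F" and xV: "x \<in> V" using x PF PV by blast+
  have sP1: "subring (P \<inter> F1)" using subring_Int[OF sP sF1] .
  have cp: "c ^ p \<in> residues (P \<inter> F1)"
  proof -
    have "(x - c) ^ p \<in> nonunits V"
      using c(2) nonunits_power[OF sV, of "x - c" 1] by (simp add: nonunits_iff)
    moreover have "(x - c) ^ p = x ^ p - c ^ p" by (rule frob_diff1)
    moreover have "x ^ p \<in> P \<inter> F1" using x xF F1(4) subring_power[OF sP] by blast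
    moreover have "c ^ p \<in> k" using c subring_power[OF sk] by blast
    ultimately show ?thesis unfolding residues_def by auto
  qed
  fix z assume z: "z \<in> P"
  obtain h where h: "h \<in> poly_over F1" "degree h < p" "poly h x = z"
    using F_expansion[OF xF x1] z PF by blast
  have cF1: "coeff h i \<in> F1" for i using h(1) by (simp add: poly_over_def)
  have "coeff h i \<in> P \<inter> F1" for i
  proof (rule ccontr)
    assume "coeff h i \<notin> P \<inter> F1"
    then have "coeff h i \<notin> P" using cF1 by blast
    then have "\<not> (coeff h i = 0 \<or> v (coeff h i) \<ge> 0)" using P_iff cF1 F1(3) by blast
    then have i: "coeff h i \<noteq> 0" "v (coeff h i) < 0" by auto
    define T where "T = {j. coeff h j \<noteq> 0}"
    have "T \<subseteq> {..degree h}" by (auto simp: T_def le_degree)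
    then have T: "finite T" "i \<in> T" using i(1) finite_subset by (auto simp: T_def)
    define m where "m = Min ((\<lambda>j. v (coeff h j)) ` T)"
    have "m \<in> (\<lambda>j. v (coeff h j)) ` T" unfolding m_def using T by (intro Min_in) auto
    then obtain j0 where j0: "coeff h j0 \<noteq> 0" "v (coeff h j0) = m" by (auto simp: T_def)
    have m_le: "m \<le> v (coeff h j)" if "coeff h j \<noteq> 0" for j
      unfolding m_def using T that by (intro Min_le) (auto simp: T_def)
    have "m < 0" using m_le[OF i(1)] i(2) by linarith
    \<comment> \<open>All values of \<open>F\<close> are multiples of \<open>g\<close>, so a power
      of \<pi> has exactly the opposite value.\<close>
    obtain n' where n': "m = g * n'" using dvd[of "coeff h j0"] j0 cF1 F1(3) by blast
    then have "n' < 0" using \<open>m < 0\<close> g by (simp add: mult_less_0_iff)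
    define n where "n = nat (- n')"
    have n: "n > 0" "m = - (g * int n)" using n' \<open>n' < 0\<close> by (auto simp: n_def)
    have \<pi>L: "\<pi> \<in> L" using \<pi> F1(3) FL by blast
    define f where "f = smult (\<pi> ^ n) h"
    have coeff_f: "coeff f j = \<pi> ^ n * coeff h j" for j by (simp add: f_def)
    have v_f: "v (coeff f j) = v (coeff h j) - m" if "coeff h j \<noteq> 0" for j
    proof -
      have "coeff h j \<in> L" using cF1 F1(3) FL by blast
      then show ?thesis unfolding coeff_f
        using that \<pi> v_mult[OF subring_power[OF sL \<pi>L]] v_power[OF \<pi>L \<pi>(2)] n(2) by (simp add: mult.commute)
    qed
    have fP1: "coeff f j \<in> P \<inter> F1" for j
    proof -
      have "coeff f j \<in> F1" unfolding coeff_f using cF1 \<pi>(1) subring_mult[OF sF1] subring_power[OF sF1] by blast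
      moreover have "coeff f j = 0 \<or> v (coeff f j) \<ge> 0"
      proof (cases "coeff h j = 0")
        case False
        then show ?thesis using v_f[OF False] m_le[OF False] by simp
      qed (simp add: coeff_f)
      ultimately show ?thesis using P_iff F1(3) by blast
    qed
    have fV: "coeff f j \<in> V" for j using fP1[of j] PV by blast
    have "\<forall>j. \<exists>b. b \<in> k \<and> coeff f j - b \<in> nonunits V" using residue_exists[OF fV] by blast
    then obtain b where b: "\<And>j. b j \<in> k" "\<And>j. coeff f j - b j \<in> nonunits V" by metis
    define r where "r = (\<Sum>j<p. monom (b j) j)"
    have coeff_r: "coeff r j = (if j < p then b j else 0)" for j by (simp add: r_def coeff_sum)
    have "b j \<in> residues (P \<inter> F1)" for j using b fP1 unfolding residues_def by blast
    then have r1: "r \<in> poly_over (residues (P \<inter> F1))"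
      using subring_0[OF subfield_subring[OF subfield_residues]] by (simp add: poly_over_def coeff_r)
    have "degree r \<le> p - 1" by (rule degree_le) (auto simp: coeff_r)
    then have r2: "degree r < p" using p_pos by linarith
    have fz: "poly f x = \<pi> ^ n * z" using h(3) by (simp add: f_def)
    have f_sum: "poly f x = (\<Sum>j<p. coeff f j * x ^ j)"
    proof -
      have "degree f < p" using h(2) \<pi> by (simp add: f_def)
      then show ?thesis unfolding poly_altdef
        by (intro sum.mono_neutral_left) (auto simp: coeff_eq_0)
    qed
    have cV: "c \<in> V" using c kV by blast
    have nonunits_sum: "sum e I \<in> nonunits V" if "\<And>j. j \<in> I \<Longrightarrow> e j \<in> nonunits V" for e and I :: "nat set"
      using that by (induction I rule: infinite_finite_induct)
        (auto intro: zero_in_nonunits[OF sV] local_ring_nonunits_add[OF locV])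
    have xc_pow: "x ^ j - c ^ j \<in> nonunits V" for j
    proof -
      have "x ^ j - c ^ j = (\<Sum>i<j. c ^ (j - Suc i) * x ^ i) * (x - c)"
        by (simp add: power_diff_sumr2 mult.commute)
      also have "\<dots> \<in> nonunits V"
        using cV xV by (intro nonunits_mult[OF sV c(2)] subring_sum[OF sV] subring_mult[OF sV] subring_power[OF sV]) auto
      finally show ?thesis .
    qed
    have "poly f x - poly r c = (\<Sum>j<p. x ^ j * (coeff f j - b j) + b j * (x ^ j - c ^ j))"
      unfolding f_sum by (simp add: r_def poly_sum poly_monom sum_subtractf[symmetric] algebra_simps)
    also have "\<dots> \<in> nonunits V"
      using b kV xV subring_power[OF sV] xc_pow
      by (intro nonunits_sum local_ring_nonunits_add[OF locV] nonunits_mult[OF sV]) auto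
    finally have fr: "poly f x - poly r c \<in> nonunits V" .
    have "poly f x \<in> nonunits V"
    proof -
      have "v (\<pi> ^ n) > 0" using v_power[OF \<pi>L \<pi>(2)] \<pi>(3) g n(1) by simp
      then have "\<pi> ^ n \<in> nonunits V" using v_nonunit subring_power[OF sL \<pi>L] by simp
      then have "z * \<pi> ^ n \<in> nonunits V" using nonunits_mult[OF sV] z PV by blast
      then show ?thesis using fz by (simp add: mult.commute)
    qed
    then have "poly f x - (poly f x - poly r c) \<in> nonunits V" using fr local_ring_nonunits_diff[OF locV] by blast
    then have "poly r c \<in> nonunits V" by simp
    moreover have "poly r c \<in> k"
    proof -
      have "r \<in> poly_over k" using b subring_0[OF sk] by (simp add: poly_over_def coeff_r)
      then show ?thesis using poly_over_eval[OF sk _ c(1)] by blast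
    qed
    ultimately have "poly r c = 0" using residue_0 by blast
    then have "r = 0" using radicial_powers_indep[OF subfield_residues cp c(3) r1 r2] by blast
    moreover have "j0 < p" using j0(1) le_degree[of h j0] h(2) by linarith
    ultimately have "b j0 = 0" using coeff_r[of j0] by simp
    then have "coeff f j0 \<in> nonunits V" using b(2)[of j0] by simp
    moreover have "v (coeff f j0) = 0" using v_f[OF j0(1)] j0(2) by simp
    ultimately have "coeff f j0 = 0" using v_nonunit by force
    then show False using coeff_f[of j0] j0(1) \<pi>(2) by simp
  qed
  then show "\<exists>h\<in>poly_over (P \<inter> F1). poly h x = z" using h(3) by (auto simp: poly_over_def)
qed

text \<open>With equal value groups and residue fields, elements of P \<inter> F1 approximate every
  \<open>z\<close> in \<open>P\<close>, each step gaining a factor \<pi>. By the distance bound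
  \<open>z\<close> lies in \<open>Lp\<close>; then \<open>L\<close> equals \<open>Lp\<close> and
  \<open>D\<close> vanishes, against D t = 1.\<close>

lemma not_immediate:
  assumes g: "g > 0" and \<pi>: "\<pi> \<in> F1" "\<pi> \<noteq> 0" "v \<pi> = g" and dvd: "\<And>x. x \<in> F \<Longrightarrow> x \<noteq> 0 \<Longrightarrow> g dvd v x"
    and res: "\<And>x c. x \<in> P \<Longrightarrow> c \<in> k \<Longrightarrow> x - c \<in> nonunits V \<Longrightarrow> c \<in> residues (P \<inter> F1)"
  shows False
proof -
  have \<pi>F: "\<pi> \<in> F" "\<pi> \<in> L" "\<pi> \<in> P" using \<pi> g F1(3) FL P_iff by auto
  have step: "\<exists>f\<in>P \<inter> F1. z - f = 0 \<or> v (z - f) \<ge> g" if z: "z \<in> P" for z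
  proof -
    have zV: "z \<in> V" using z PV by blast
    obtain c where c: "c \<in> k" "z - c \<in> nonunits V" using residue_exists[OF zV] by blast
    then have "c \<in> residues (P \<inter> F1)" using res z by blast
    then obtain f where f: "f \<in> P \<inter> F1" "f - c \<in> nonunits V" unfolding residues_def by blast
    have "(z - c) - (f - c) \<in> nonunits V" using c f local_ring_nonunits_diff[OF locV] by blast
    then have "z - f \<in> nonunits V" by simp
    moreover have "z - f \<in> F" using z f PF subring_diff[OF sF] by blast
    ultimately have "z - f = 0 \<or> (v (z - f) > 0 \<and> g dvd v (z - f))" using v_nonunit dvd by blast
    then have "z - f = 0 \<or> v (z - f) \<ge> g" using zdvd_imp_le by blast
    then show ?thesis using f by blast
  qed
  have approx: "\<exists>f\<in>P \<inter> F1. z - f = 0 \<or> v (z - f) \<ge> int n * g" if z: "z \<in> P" for z n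
  proof (induction n)
    case 0
    have "z = 0 \<or> v z \<ge> 0" using z P_iff by blast
    then show ?case using subring_0[OF sP] subring_0[OF sF1] by (intro bexI[of _ 0]) auto
  next
    case (Suc n)
    then obtain f where f: "f \<in> P" "f \<in> F1" "z - f = 0 \<or> v (z - f) \<ge> int n * g" by blast
    show ?case
    proof (cases "z - f = 0")
      case True
      then show ?thesis using f by blast
    next
      case False
      define w where "w = (z - f) / \<pi> ^ n"
      have zf: "z - f \<in> F" "z - f \<in> L" using z f PF FL subring_diff[OF sF] by blast+
      have wF: "w \<in> F" unfolding w_def using zf \<pi>F subring_power[OF sF] subfield_divide[OF F(1)] by blast
      have "v w = v (z - f) - int n * g" unfolding w_def
        using v_divide[OF zf(2) subring_power[OF sL \<pi>F(2)] False] \<pi> v_power[OF \<pi>F(2) \<pi>(2)] by simp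
      then have "w \<in> P" using f(3) False wF P_iff by simp
      then obtain f' where f': "f' \<in> P \<inter> F1" "w - f' = 0 \<or> v (w - f') \<ge> g" using step by blast
      have eq: "z - (f + \<pi> ^ n * f') = \<pi> ^ n * (w - f')"
      proof -
        have "\<pi> ^ n * w = z - f" using \<pi>(2) by (simp add: w_def)
        then show ?thesis by (simp add: right_diff_distrib)
      qed
      have new: "f + \<pi> ^ n * f' \<in> P \<inter> F1"
        using f(1,2) f'(1) \<pi>(1) \<pi>F(3)
        by (intro IntI subring_add[OF sP] subring_add[OF sF1] subring_mult[OF sP] subring_mult[OF sF1]
            subring_power[OF sP] subring_power[OF sF1]) auto
      have "\<pi> ^ n * (w - f') = 0 \<or> v (\<pi> ^ n * (w - f')) \<ge> int (Suc n) * g"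
      proof (cases "w - f' = 0")
        case False
        have "w - f' \<in> L" using wF f' PF FL subring_diff[OF sF] by blast
        then have "v (\<pi> ^ n * (w - f')) = int n * g + v (w - f')"
          using v_mult[OF subring_power[OF sL \<pi>F(2)] _ _ False] \<pi> v_power[OF \<pi>F(2) \<pi>(2)] by simp
        then show ?thesis using f'(2) False by (simp add: distrib_right)
      qed simp
      then show ?thesis using new eq by metis
    qed
  qed
  have "P \<subseteq> Lp"
  proof
    fix z assume z: "z \<in> P"
    show "z \<in> Lp"
    proof (rule ccontr)
      assume zLp: "z \<notin> Lp"
      have zL: "z \<in> L" using z PF FL by blast
      \<comment> \<open>One more than the distance bound permits.\<close>
      define n where "n = nat (v (D z) + 2)"
      obtain f where f: "f \<in> P \<inter> F1" "z - f = 0 \<or> v (z - f) \<ge> int n * g" using approx[OF z] by blast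
      have fLp: "f \<in> Lp" using f F1_Lp by blast
      then have "z - f \<noteq> 0" using zLp by auto
      then have "v (z - f) \<ge> int n * g" using f by blast
      moreover have "int n * g \<ge> int n" using g by (simp add: mult_le_cancel_left1)
      moreover have "int n \<ge> v (D z) + 2" by (simp add: n_def)
      ultimately show False using Lp_distance_bound[OF zL zLp fLp] by linarith
    qed
  qed
  then have "F \<subseteq> Lp"
    using valuation_ring_fraction_field[OF F(1) P(1)] fraction_field_least[OF Lp_field] by metis
  then have "L \<subseteq> Lp" unfolding L_eq using kLp sLp unfolding L_eq by (intro ring_adjoin_least) auto
  then have "D t = 0" using t(1) D_Lp by blast
  then show False using D_t by simp
qed

lemma monogenic: "\<exists>x\<in>P. x \<notin> F1 \<and> (\<forall>z\<in>P. \<exists>h\<in>poly_over (P \<inter> F1). poly h x = z)"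
proof -
  have hom: "v (x * y) = v x + v y" if "x \<in> F - {0}" "y \<in> F - {0}" for x y
    using that v_mult FL by blast
  have u0: "u \<in> F - {0}" "v u \<noteq> 0" using uP PF u v_nonunit[of u] by auto
  obtain g \<pi> where g: "g > 0" and \<pi>: "\<pi> \<in> F - {0}" "v \<pi> = g" and dvd: "\<And>x. x \<in> F - {0} \<Longrightarrow> g dvd v x"
    using int_hom_normalize[OF F(1) hom u0] by blast
  have dvd': "g dvd v x" if "x \<in> F" "x \<noteq> 0" for x using that dvd by blast
  show ?thesis
  proof (cases "\<exists>y\<in>F1. y \<noteq> 0 \<and> v y = g")
    case False
    have "\<pi> \<in> F" "\<pi> \<noteq> 0" using \<pi> by auto
    then show ?thesis using monogenic_ramified[OF g _ _ \<pi>(2) dvd'] False by blast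
  next
    case True
    then obtain y where y: "y \<in> F1" "y \<noteq> 0" "v y = g" by blast
    show ?thesis
    proof (cases "\<exists>x c. x \<in> P \<and> c \<in> k \<and> x - c \<in> nonunits V \<and> c \<notin> residues (P \<inter> F1)")
      case True
      then show ?thesis using monogenic_residual[OF g y dvd'] by blast
    next
      case False
      then show ?thesis using not_immediate[OF g y dvd'] by blast
    qed
  qed
qed

text \<open>The number s = n + 1 is the value of the corrected generator \<open>x'\<close>. It
  governs both conclusions: the values of expansions in \<open>x'\<close>, and v (D x') = s -
  1.\<close>

lemma semigroup_and_degree:
  assumes dim: "kaehler_coker_dim k (ring_adjoin k (P \<inter> F1)) Vp = 0"
  obtains n where "kaehler_coker_dim k (ring_adjoin k P) V = enat n"
    "v ` (ring_adjoin k P - {0}) = {int (Suc n * a + p * b) | a b :: nat. True}"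
proof -
  define A A1 where "A = ring_adjoin k P" and "A1 = ring_adjoin k (P \<inter> F1)"
  have sA: "subring A" "k \<subseteq> A" "P \<subseteq> A" and sA1: "subring A1" "k \<subseteq> A1" "P \<inter> F1 \<subseteq> A1"
    unfolding A_def A1_def by (rule subring_ring_adjoin ring_adjoin_base ring_adjoin_gens)+
  have A1A: "A1 \<subseteq> A" unfolding A_def A1_def by (intro ring_adjoin_mono) auto
  have AV: "A \<subseteq> V" unfolding A_def using kV PV sV by (intro ring_adjoin_least) auto
  have A1_Lp: "A1 \<subseteq> Lp" unfolding A1_def using kLp F1_Lp sLp by (intro ring_adjoin_least) auto
  have A1_Vp: "A1 \<subseteq> Vp"
  proof
    fix a assume a: "a \<in> A1"
    then obtain x where x: "x \<in> L" "a = x ^ p" using A1_Lp by blast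
    have "a \<in> V" using a A1A AV by blast
    then have "x \<in> V" using x V_iff[of "x ^ p"] V_iff[of x] v_power[OF x(1), of p] p_pos
      by (cases "x = 0") (auto simp: zero_le_mult_iff)
    then show "a \<in> Vp" using x by blast
  qed
  obtain y where y: "y \<in> A1" "y \<noteq> 0" "v y = int p"
    using frobenius_unramified[OF sA1(1,2) A1_Vp] dim by (auto simp: A1_def)
  have yL: "y \<in> L" using y A1_Lp LpL by blast
  obtain x where x: "x \<in> P" "x \<notin> F1" "\<And>z. z \<in> P \<Longrightarrow> \<exists>h\<in>poly_over (P \<inter> F1). poly h x = z"
    using monogenic by blast
  have xL: "x \<in> L" "x \<notin> Lp" "x \<in> V" using x PF FL F_Lp PV by blast+
  \<comment> \<open>Correcting \<open>x\<close> by elements of \<open>A1\<close> makes its value prime to \<open>p\<close>.\<close>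
  have diff0: "x - a \<noteq> 0" "x - a \<in> L" "v (x - a) \<le> v (D x) + 1" "v (x - a) \<ge> 0" if "a \<in> A1" for a
  proof -
    have "a \<in> Lp" "a \<in> V" using that A1_Lp A1A AV by blast+
    then show nz: "x - a \<noteq> 0" and "v (x - a) \<le> v (D x) + 1" using xL Lp_distance_bound by auto
    have "x - a \<in> V" using xL \<open>a \<in> V\<close> subring_diff[OF sV] by blast
    then show "x - a \<in> L" and "v (x - a) \<ge> 0" using V_iff nz by blast+
  qed
  \<comment> \<open>A best approximation exists because \<open>A1\<close> lies in \<open>Lp\<close>,
    so that the values are bounded.\<close>
  obtain a where a: "a \<in> A1" "\<And>b. b \<in> A1 \<Longrightarrow> v (x - b) \<le> v (x - a)"
  proof -
    have "\<exists>a. a \<in> A1 \<and> (\<forall>b. b \<in> A1 \<longrightarrow> nat (v (x - b)) \<le> nat (v (x - a)))"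
    proof (rule ex_has_greatest_nat)
      show "0 \<in> A1" using subring_0[OF sA1(1)] .
      show "\<forall>b. b \<in> A1 \<longrightarrow> nat (v (x - b)) < Suc (nat (v (D x) + 1))"
        using diff0(3) by (simp add: nat_mono less_Suc_eq_le)
    qed
    then show ?thesis using that diff0(4) by (metis nat_le_eq_zle nat_0_le)
  qed
  define x' where "x' = x - a"
  have x': "x' \<in> L" "x' \<noteq> 0" "x' \<in> A" "v x' \<ge> 0"
    using diff0[OF a(1)] x(1) a(1) sA A1A subring_diff[OF sA(1)] unfolding x'_def by blast+
  have ndvd: "\<not> int p dvd v x'"
  proof
    assume "int p dvd v x'"
    then obtain m where m: "v x' = int p * m" by blast
    then have "m \<ge> 0" using x'(4) p_pos by (simp add: zero_le_mult_iff)
    \<comment> \<open>A unit, as \<open>y\<close> has value \<open>p\<close>. Subtracting the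
      residue of \<open>w\<close> times the power of \<open>y\<close> would approximate
      \<open>x\<close> better than \<open>a\<close> does.\<close>
    define w where "w = x' / y ^ nat m"
    have ym: "y ^ nat m \<in> L" "y ^ nat m \<noteq> 0" "v (y ^ nat m) = v x'"
      using subring_power[OF sL yL] y v_power[OF yL y(2)] m \<open>m \<ge> 0\<close> by (auto simp: mult.commute)
    have "w \<in> L" "v w = 0" "w \<noteq> 0"
      using v_divide[OF x'(1) ym(1) x'(2) ym(2)] ym x' subfield_divide[OF L] by (auto simp: w_def)
    then have "w \<in> V" using V_iff by simp
    then obtain c where c: "c \<in> k" "w - c \<in> V" "w - c = 0 \<or> v (w - c) > 0" using residue_nonunit by blast
    have b: "a + c * y ^ nat m \<in> A1"
      using a(1) c(1) y(1) sA1 subring_add[OF sA1(1)] subring_mult[OF sA1(1)] subring_power[OF sA1(1)] by blast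
    have eq: "x - (a + c * y ^ nat m) = y ^ nat m * (w - c)"
    proof -
      have "y ^ nat m * w = x - a" using ym(2) by (simp add: w_def x'_def)
      then show ?thesis by (simp add: right_diff_distrib mult.commute[of c])
    qed
    have wc: "w - c \<noteq> 0" using diff0(1)[OF b] eq by auto
    have "w - c \<in> L" using c(2) VL by blast
    then have "v (x - (a + c * y ^ nat m)) = v x' + v (w - c)"
      unfolding eq using v_mult[OF ym(1) _ ym(2) wc] ym(3) by simp
    then show False using a(2)[OF b] c(3) wc unfolding x'_def by simp
  qed
  have x'p: "x' ^ p \<in> A1"
  proof -
    have "x ^ p \<in> P \<inter> F1" using x(1) PF F1(4) subring_power[OF sP] by blast
    then have "x ^ p - a ^ p \<in> A1"
      using sA1 subring_diff[OF sA1(1)] subring_power[OF sA1(1) a(1)] by blast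
    then show ?thesis by (simp add: x'_def frob_diff1)
  qed
  \<comment> \<open>\<open>x'\<close> generates \<open>A\<close> over \<open>A1\<close>, because
    \<open>x\<close> generates \<open>P\<close> over P \<inter> F1; since x'^p lies in
    \<open>A1\<close>, division by X^p - x'^p brings the degree below \<open>p\<close>.\<close>
  have expansion: "\<exists>h\<in>poly_over A1. degree h < p \<and> poly h x' = z" if z: "z \<in> A" for z
  proof -
    let ?R = "ring_adjoin A1 {x'}"
    have R: "subring ?R" "A1 \<subseteq> ?R" "x' \<in> ?R"
      using subring_ring_adjoin ring_adjoin_base ring_adjoin_gens[of "{x'}"] by blast+
    have "x = x' + a" by (simp add: x'_def)
    then have xR: "x \<in> ?R" using R a(1) subring_add[OF R(1)] by blast
    have "P \<subseteq> ?R"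
    proof
      fix w assume "w \<in> P"
      then obtain h where h: "h \<in> poly_over (P \<inter> F1)" "poly h x = w" using x(3) by blast
      have "P \<inter> F1 \<subseteq> ?R" using sA1(3) R(2) by blast
      then have "h \<in> poly_over ?R" using h(1) poly_over_mono by blast
      then show "w \<in> ?R" using poly_over_eval[OF R(1) _ xR] h(2) by blast
    qed
    then have "A \<subseteq> ?R" unfolding A_def using R sA1(2) by (intro ring_adjoin_least) auto
    then have "z \<in> {poly f x' | f. f \<in> poly_over A1}"
      using z ring_adjoin_singleton[OF sA1(1), of x'] by auto
    then obtain f where f: "f \<in> poly_over A1" "poly f x' = z" by blast
    define q where "q = monom 1 p - [:x' ^ p:]"
    have q: "q \<in> poly_over A1" unfolding q_def
      using x'p by (intro poly_over_diff[OF sA1(1)] poly_over_monom[OF sA1(1)] poly_over_const[OF sA1(1)] subring_1[OF sA1(1)])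
    have cq: "coeff q i = (if i = p then 1 else if i = 0 then - (x' ^ p) else 0)" for i
      using p_pos by (auto simp: q_def coeff_pCons split: nat.split)
    have dq: "degree q = p" using le_degree[of q p] degree_le[of p q] by (simp add: cq)
    have lq: "lead_coeff q = 1" by (simp add: dq cq)
    have qx: "poly q x' = 0" by (simp add: q_def poly_monom)
    have "f mod q \<in> poly_over A1" using poly_over_divmod_monic[OF sA1(1) q lq f(1)] by blast
    moreover have "q \<noteq> 0" using lq by auto
    then have "degree (f mod q) < p" using degree_mod_less[of q f] dq p_pos by fastforce
    moreover have "poly (f mod q) x' = z"
    proof -
      have "poly f x' = poly (f div q) x' * poly q x' + poly (f mod q) x'"
        by (metis div_mult_mod_eq poly_add poly_mult)
      then show ?thesis using f(2) qx by simp
    qed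
    ultimately show ?thesis by blast
  qed
  define s where "s = nat (v x')"
  have s: "v x' = int s" "s > 0"
  proof -
    show "v x' = int s" using x'(4) by (simp add: s_def)
    then show "s > 0" using ndvd by (auto intro: gr0I)
  qed
  have "v ` (A - {0}) = {int (s * a + p * b) | a b :: nat. True}"
  proof
    show "v ` (A - {0}) \<subseteq> {int (s * a + p * b) | a b :: nat. True}"
    proof
      fix n assume "n \<in> v ` (A - {0})"
      then obtain z where z: "z \<in> A" "z \<noteq> 0" "n = v z" by blast
      obtain h where h: "h \<in> poly_over A1" "degree h < p" "poly h x' = z" using expansion[OF z(1)] by blast
      have hLp: "h \<in> poly_over Lp" using h(1) poly_over_mono[OF A1_Lp] by blast
      have "h \<noteq> 0" using h z by auto
      \<comment> \<open>No two terms have equal value, so the value of \<open>z\<close> is that of a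
        single term: a multiple of \<open>p\<close> plus m s.\<close>
      then obtain m where m: "coeff h m \<noteq> 0" "v z = v (coeff h m) + int m * v x'"
        using v_poly_Lp[OF x'(1,2) ndvd hLp _ h(2)] h(3) by blast
      have cm: "coeff h m \<in> A1" using h(1) by (simp add: poly_over_def)
      then obtain b where b: "v (coeff h m) = int p * b" using v_Lp A1_Lp by blast
      moreover have "v (coeff h m) \<ge> 0" using cm A1A AV V_iff m(1) by blast
      ultimately have "b \<ge> 0" using p_pos by (simp add: zero_le_mult_iff)
      then have "n = int (s * m + p * nat b)" using z(3) m(2) b s(1) by (simp add: mult.commute)
      then show "n \<in> {int (s * a + p * b) | a b :: nat. True}" by blast
    qed
    show "{int (s * a + p * b) | a b :: nat. True} \<subseteq> v ` (A - {0})"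
    proof
      fix n assume "n \<in> {int (s * a + p * b) | a b :: nat. True}"
      then obtain i j :: nat where n: "n = int (s * i + p * j)" by blast
      have "x' ^ i * y ^ j \<in> A"
        using x'(3) y(1) A1A subring_mult[OF sA(1)] subring_power[OF sA(1)] by blast
      moreover have "v (x' ^ i * y ^ j) = n"
        using v_mult[OF subring_power[OF sL x'(1)] subring_power[OF sL yL]] x'(2) y(2,3) s(1) n
          v_power[OF x'(1,2)] v_power[OF yL y(2)] by (simp add: mult.commute)
      ultimately show "n \<in> v ` (A - {0})" using x'(2) y(2) by (auto intro!: image_eqI)
    qed
  qed
  moreover have "kaehler_coker_dim k A V = enat (s - 1)"
  proof (rule kaehler_coker_dim_eq[OF sA(2) AV])
    have Dx': "D x' \<noteq> 0" "v (D x') = int (s - 1)" using v_D_eq[OF x'(1,2) ndvd] s by auto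
    then show "D x' \<noteq> 0" "v (D x') = int (s - 1)" by blast+
    show "x' \<in> A" by (rule x')
    fix z assume z: "z \<in> A" "D z \<noteq> 0"
    obtain h where h: "h \<in> poly_over A1" "poly h x' = z" using expansion[OF z(1)] by blast
    have hLp: "h \<in> poly_over Lp" using h(1) poly_over_mono[OF A1_Lp] by blast
    \<comment> \<open>The coefficients of \<open>h\<close> are constants of \<open>D\<close>, so
      \<open>D z\<close> is a multiple of \<open>D x'\<close> by an element of
      \<open>V\<close>.\<close>
    have Dz: "D z = poly (pderiv h) x' * D x'" using D_poly[OF hLp x'(1)] h(2) by simp
    have "pderiv h \<in> poly_over V" using h(1) poly_over_mono A1A AV poly_over_pderiv[OF sV] by blast
    then have "poly (pderiv h) x' \<in> V" using poly_over_eval[OF sV] x'(3) AV by blast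
    moreover have "poly (pderiv h) x' \<noteq> 0" using Dz z(2) by auto
    ultimately have "poly (pderiv h) x' \<in> L" "v (poly (pderiv h) x') \<ge> 0" using V_iff by blast+
    then show "v (D z) \<ge> int (s - 1)"
      unfolding Dz using v_mult[OF _ D_L[OF x'(1)]] Dx' \<open>poly (pderiv h) x' \<noteq> 0\<close> by simp
  qed
  ultimately show ?thesis using that[of "s - 1"] s(2) by (simp add: A_def)
qed

end

text \<open>By exchange the generators of \<open>F\<close> are algebraic over k(x). Adjoining them
  gives a finite span that is a field, so it contains \<open>F\<close> and \<open>k\<close>.\<close>

lemma (in radicial_base) finite_over_rational_subfield:
  assumes F: "subfield F" "K \<subseteq> F" "transcendence_degree_one K F"
    and S: "finite S" "fraction_field (ring_adjoin K S) = F"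
    and tr: "x \<in> F" "\<not> algebraic_over K x"
  shows "\<exists>B. finite B \<and> ring_adjoin k F \<subseteq> lin_span (fraction_field (ring_adjoin k {x})) B"
proof -
  define M where "M = fraction_field (ring_adjoin k {x})"
  have M: "subfield M" "ring_adjoin k {x} \<subseteq> M"
    unfolding M_def using subfield_fraction_field fraction_field_superset subring_ring_adjoin by blast+
  have kM: "k \<subseteq> M" using M(2) ring_adjoin_base by blast
  have KM: "fraction_field (ring_adjoin K {x}) \<subseteq> M"
    unfolding M_def by (intro fraction_field_mono ring_adjoin_mono Kk) auto
  have alg: "algebraic_over M s" if "s \<in> S" for s
  proof -
    have "s \<in> ring_adjoin K S" using that ring_adjoin_gens by blast
    then have "s \<in> F" using S(2) fraction_field_superset[OF subring_ring_adjoin] by blast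
    then show ?thesis
      using algebraic_over_transcendental[OF K F(3) tr] algebraic_over_mono[OF KM] by blast
  qed
  obtain B where B: "finite B" "ring_adjoin M S \<subseteq> lin_span M B"
    using finite_span_adjoin_algebraic[OF M(1) S(1) alg] by blast
  have R: "subfield (ring_adjoin M S)"
    using subfield_of_finite_span[OF M(1) subring_ring_adjoin ring_adjoin_base B] .
  have "ring_adjoin K S \<subseteq> ring_adjoin M S" using Kk kM by (intro ring_adjoin_mono) auto
  then have "F \<subseteq> ring_adjoin M S" using fraction_field_least[OF R] S(2) by blast
  moreover have "k \<subseteq> ring_adjoin M S" using kM ring_adjoin_base by blast
  ultimately have "ring_adjoin k F \<subseteq> ring_adjoin M S"
    by (intro ring_adjoin_least subring_ring_adjoin)
  then show ?thesis using B by (auto simp: M_def)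
qed

text \<open>Every element of k[F] has a Frobenius power in \<open>F\<close>, where the dichotomy of
  \<open>P\<close> decides.\<close>

lemma (in radicial_base) valuation_ring_base_change:
  assumes F: "subfield F" "K \<subseteq> F" and P: "valuation_ring F P"
  shows "valuation_ring (ring_adjoin k F) (ring_adjoin k F \<inter> proot P)"
proof -
  have "x \<in> proot P \<or> inverse x \<in> proot P" if x: "x \<in> ring_adjoin k F" for x
  proof -
    have "x \<in> proot F" using ring_adjoin_radicial[OF subfield_subring[OF F(1)] F(2)] x by blast
    then obtain n where "x ^ (p ^ n) \<in> F" by (auto simp: proot_def)
    then have "x ^ (p ^ n) \<in> P \<or> inverse x ^ (p ^ n) \<in> P"
      using P by (auto simp: valuation_ring_def power_inverse)
    then show ?thesis by (auto simp: proot_def)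
  qed
  then show ?thesis
    using subring_Int[OF subring_ring_adjoin subring_proot[OF valuation_ring_subring[OF P]]]
      subfield_inverse[OF subfield_ring_adjoin[OF F]]
    unfolding valuation_ring_def by blast
qed

text \<open>Unfolding the points into explicit rings, over \<open>P\<close> and over P \<inter> F1,
  produces an instance of \<open>disjoint_place\<close>.\<close>

lemma (in radicial_base) value_semigroup_eq:
  assumes alg_closed: "algebraically_closed k"
    and curve: "integral_curve K F C" and geom: "geometrically_integral K k F C"
    and reg: "regular_scheme C" and P: "closed_point C P"
    and deg: "differential_degree k (normalized_frobenius_curve K C) (normalized_frobenius_point K C P) = 1"
  shows "value_semigroup k C P =
    {int (the_enat (differential_degree k C P) * a + p * b) | a b :: nat. True}"
proof -
  have F: "subfield F" "K \<subseteq> F" and trdeg: "transcendence_degree_one K F"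
    using curve by (auto simp: integral_curve_def integral_scheme_def)
  have E: "\<And>R. R \<in> C \<Longrightarrow> valuation_ring F R" "\<And>R. R \<in> C \<Longrightarrow> K \<subseteq> R"
    using regular_curve_point[OF curve reg] by blast+
  have PC: "P \<in> C" using P by (simp add: closed_point_def)
  note PF = E(1)[OF PC] and KP = E(2)[OF PC]
  have sP: "subring P" "P \<subseteq> F" using valuation_ring_subring[OF PF] valuation_ring_sub[OF PF] by blast+
  have "P \<noteq> F" using closed_point_not_generic[OF curve reg P] .
  then obtain z where z: "z \<in> F" "z \<notin> P" using sP by blast
  \<comment> \<open>A nonzero nonunit, available because a closed point is not generic. It is
    transcendental over \<open>K\<close> and becomes the variable over which \<open>L\<close> is
    finite.\<close>
  define u where "u = inverse z"
  have uP: "u \<in> nonunits P" "u \<noteq> 0"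
    using z PF subring_0[OF sP(1)] by (auto simp: u_def nonunits_iff valuation_ring_def)
  have uF: "u \<in> F" using uP sP by (auto simp: nonunits_iff)
  obtain A where A: "affine_algebra K F A" "spec_points A \<subseteq> C"
    using integral_curve_cover[OF curve] by (metis UN_upper ex_in_conv)
  then obtain S where S: "finite S" "A = ring_adjoin K S" "fraction_field A = F"
    by (auto simp: affine_algebra_def)
  have dom: "tensor_product_is_domain K A k" using geom A by (simp add: geometrically_integral_def)
  define L where "L = ring_adjoin k F"
  define V where "V = L \<inter> proot P"
  define F1 where "F1 = frobenius_image K F"
  note nr = normalization_radicial[OF F E PC, folded L_def, folded V_def]
  have PV: "P \<subseteq> V" using nr(1) ring_adjoin_gens by blast
  interpret fp: function_field_place p k L V u
  proof
    show "subfield L" unfolding L_def by (rule subfield_ring_adjoin[OF F])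
    show "valuation_ring L V" unfolding V_def L_def by (rule valuation_ring_base_change[OF F PF])
    show "k \<subseteq> V" using nr(1) ring_adjoin_base by blast
    have "V \<subseteq> proot P" by (auto simp: V_def)
    then show "u \<in> nonunits V" using nonunits_radicial[OF sP(1) PV] uP by blast
    show "\<exists>B. finite B \<and> L \<subseteq> lin_span (fraction_field (ring_adjoin k {u})) B"
      unfolding L_def using nonunit_not_algebraic[OF K sP(1) KP uP] S
      by (intro finite_over_rational_subfield[OF F trdeg _ _ uF]) auto
  qed (use k alg_closed uP in auto)
  have F1: "subfield F1" "F1 \<subseteq> F"
    unfolding F1_def using subfield_frobenius_image[OF F E] frobenius_image_sub[OF F E] by blast+
  have KF1: "K \<subseteq> F1" unfolding F1_def frobenius_image_def by (rule ring_adjoin_base)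
  have pF1: "x ^ p \<in> F1" if "x \<in> F" for x
    using that ring_adjoin_gens[of "(\<lambda>x. x ^ p) ` F" K] unfolding F1_def frobenius_image_def char by blast
  \<comment> \<open>\<open>k\<close> is its own field of \<open>p\<close>-th powers, so Frobenius
    carries the compositum of \<open>k\<close> and \<open>F\<close> to that of \<open>k\<close> and
    \<open>F1\<close>.\<close>
  have Lp: "fp.Lp = ring_adjoin k F1"
  proof
    define R where "R = {x. x ^ p \<in> ring_adjoin k F1}"
    have "subring R" unfolding R_def
      using subring_ring_adjoin[of k F1] by (intro subringI) (auto simp: frob_diff1 power_mult_distrib intro: subring_closed)
    moreover have "k \<subseteq> R" unfolding R_def using subring_power[OF fp.sk] ring_adjoin_base by blast
    moreover have "F \<subseteq> R" unfolding R_def using pF1 ring_adjoin_gens by blast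
    ultimately have "L \<subseteq> R" unfolding L_def by (rule ring_adjoin_least)
    then show "fp.Lp \<subseteq> ring_adjoin k F1" by (auto simp: R_def)
    have "(\<lambda>x. x ^ p) ` F \<subseteq> fp.Lp" unfolding L_def using ring_adjoin_gens by blast
    then have "F1 \<subseteq> fp.Lp" unfolding F1_def frobenius_image_def char
      using Kk fp.kLp by (intro ring_adjoin_least fp.sLp) auto
    then show "ring_adjoin k F1 \<subseteq> fp.Lp" using fp.kLp by (intro ring_adjoin_least fp.sLp)
  qed
  obtain \<rho> where \<rho>: "\<And>x y. x \<in> L \<Longrightarrow> y \<in> L \<Longrightarrow> \<rho> (x + y) = \<rho> x + \<rho> y"
    "\<And>f x. f \<in> F \<Longrightarrow> x \<in> L \<Longrightarrow> \<rho> (f * x) = f * \<rho> x" "\<And>f. f \<in> F \<Longrightarrow> \<rho> f = f"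
    "\<And>F' x. subring F' \<Longrightarrow> K \<subseteq> F' \<Longrightarrow> F' \<subseteq> F \<Longrightarrow> x \<in> ring_adjoin k F' \<Longrightarrow> \<rho> x \<in> F'"
  proof (rule linearly_disjoint_projection[OF F(1) _ _ S(3) dom])
    show "subring A" "K \<subseteq> A" using S(2) subring_ring_adjoin ring_adjoin_base by blast+
  qed (use that in \<open>auto simp: L_def\<close>)
  have \<rho>1: "\<rho> x \<in> F1" if "x \<in> ring_adjoin k F1" for x
    using \<rho>(4)[OF subfield_subring[OF F1(1)] KF1 F1(2) that] .
  interpret dp: disjoint_place p K k L V u F P F1 \<rho>
    by unfold_locales (use F PF KP F1 KF1 pF1 Lp \<rho>(1-3) \<rho>1 uP in \<open>auto simp: L_def V_def nonunits_iff\<close>)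
  have curve1: "normalized_frobenius_curve K C = (\<lambda>R. R \<inter> F1) ` C"
    and point1: "normalized_frobenius_point K C P = P \<inter> F1"
    unfolding F1_def by (rule normalized_frobenius_curve_eq[OF F E] normalized_frobenius_point_eq[OF F E PC]; assumption)+
  define C1 where "C1 = (\<lambda>R. R \<inter> F1) ` C"
  have E1: "valuation_ring F1 R" "K \<subseteq> R" if R: "R \<in> C1" for R
  proof -
    obtain R0 where R0: "R0 \<in> C" "R = R0 \<inter> F1" using R by (auto simp: C1_def)
    show "K \<subseteq> R" using R0 E(2) KF1 by blast
    have "valuation_ring F R0" using E(1) R0 by blast
    then show "valuation_ring F1 R"
      using R0(2) F1 subfield_inverse[OF F1(1)] subring_Int[OF _ subfield_subring[OF F1(1)], of R0]
      unfolding valuation_ring_def by blast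
  qed
  have P1C1: "P \<inter> F1 \<in> C1" using PC by (auto simp: C1_def)
  \<comment> \<open>Likewise the normalized local ring over P \<inter> F1 is the Frobenius image of
    \<open>V\<close>; so the degree hypothesis is a statement about \<open>Vp\<close>.\<close>
  have Vp: "fp.Vp = ring_adjoin k F1 \<inter> proot (P \<inter> F1)"
  proof
    show "fp.Vp \<subseteq> ring_adjoin k F1 \<inter> proot (P \<inter> F1)"
    proof
      fix y assume "y \<in> fp.Vp"
      then obtain x where x: "x \<in> L" "x \<in> proot P" "y = x ^ p" by (auto simp: V_def)
      then obtain n where n: "x ^ (p ^ n) \<in> P" by (auto simp: proot_def)
      have "y ^ (p ^ n) = (x ^ (p ^ n)) ^ p" by (simp add: x(3) mult.commute flip: power_mult)
      moreover have "(x ^ (p ^ n)) ^ p \<in> P \<inter> F1" using n sP pF1 subring_power[OF sP(1)] by blast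
      ultimately have "y ^ (p ^ n) \<in> P \<inter> F1" by simp
      then have "y \<in> proot (P \<inter> F1)" unfolding proot_def by blast
      then show "y \<in> ring_adjoin k F1 \<inter> proot (P \<inter> F1)" using x Lp by blast
    qed
    show "ring_adjoin k F1 \<inter> proot (P \<inter> F1) \<subseteq> fp.Vp"
    proof
      fix y assume y: "y \<in> ring_adjoin k F1 \<inter> proot (P \<inter> F1)"
      then obtain x where x: "x \<in> L" "y = x ^ p" using Lp by blast
      obtain n where "y ^ (p ^ n) \<in> P" using y by (auto simp: proot_def)
      then have "x ^ (p ^ Suc n) \<in> P" by (simp add: x(2) flip: power_mult)
      then have "x \<in> V" using x(1) unfolding V_def proot_def by blast
      then show "y \<in> fp.Vp" using x(2) by blast
    qed
  qed
  have "point_over (base_change k C1) (P \<inter> F1) = ring_adjoin k (P \<inter> F1)"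
    "point_over (normalization (base_change k C1)) (P \<inter> F1) = fp.Vp"
    unfolding Vp using point_over_base_change[OF F1(1) KF1 E1 P1C1] point_over_normalization[OF F1(1) KF1 E1 P1C1]
    by simp_all
  then have "differential_degree k C1 (P \<inter> F1) = 1 + kaehler_coker_dim k (ring_adjoin k (P \<inter> F1)) fp.Vp"
    by (simp add: differential_degree_def)
  then have "1 + kaehler_coker_dim k (ring_adjoin k (P \<inter> F1)) fp.Vp = 1"
    using deg unfolding curve1 point1 C1_def by simp
  \<comment> \<open>Cancelling 1 in the extended naturals includes ruling out the infinite
    value.\<close>
  then have "kaehler_coker_dim k (ring_adjoin k (P \<inter> F1)) fp.Vp = 0"
    by (cases "kaehler_coker_dim k (ring_adjoin k (P \<inter> F1)) fp.Vp") (auto simp: one_enat_def zero_enat_def)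
  then obtain n where n: "kaehler_coker_dim k (ring_adjoin k P) V = enat n"
    "fp.v ` (ring_adjoin k P - {0}) = {int (Suc n * a + p * b) | a b :: nat. True}"
    using dp.semigroup_and_degree by blast
  have pts: "point_over (base_change k C) P = ring_adjoin k P"
    "point_over (normalization (base_change k C)) P = V"
    unfolding V_def L_def using point_over_base_change[OF F E PC] point_over_normalization[OF F E PC] by auto
  \<comment> \<open>The degree is finite, so \<open>the_enat\<close> returns a genuine number, the
    one in the semigroup.\<close>
  have "the_enat (differential_degree k C P) = Suc n"
    unfolding differential_degree_def pts n(1) by (simp add: one_enat_def)
  moreover have "value_semigroup k C P = fp.v ` (ring_adjoin k P - {0})"
    unfolding value_semigroup_def pts fp.v_def ..
  ultimately show ?thesis using n(2) by simp
qed

theorem theorem3p19: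
  fixes K Kbar F P :: "'l::field set" and C :: "'l set set" and p :: nat
  assumes "CHAR('l) = p" and "p > 0"
    and "subfield K" and "\<not> perfect K" and "separably_closed K"
    and "algebraic_closure_of K Kbar"
    and "integral_curve K F C" and "geometrically_integral K Kbar F C" and "regular_scheme C"
    and "closed_point C P"
    and "differential_degree Kbar (normalized_frobenius_curve K C)
           (normalized_frobenius_point K C P) = 1"
  shows "value_semigroup Kbar C P =
           {int (the_enat (differential_degree Kbar C P) * a + p * b) | a b :: nat. True}"
proof -
  interpret char_p p "TYPE('l)" by standard (use assms in auto)
  have Kbar: "subfield Kbar" "K \<subseteq> Kbar" "algebraically_closed Kbar" "\<And>x. x \<in> Kbar \<Longrightarrow> algebraic_over K x"
    using assms(6) by (auto simp: algebraic_closure_of_def)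
  \<comment> \<open>Over a separably closed field every algebraic element is purely
    inseparable.\<close>
  have "Kbar \<subseteq> proot K"
  proof
    fix x assume "x \<in> Kbar"
    then obtain f where "f \<in> poly_over K" "f \<noteq> 0" "poly f x = 0"
      using Kbar(4) algebraic_over_iff[OF subfield_subring[OF assms(3)]] by blast
    then show "x \<in> proot K" using separably_closed_radicial_poly[OF assms(3,5)] by (auto simp: proot_def)
  qed
  then interpret radicial_base p K Kbar by unfold_locales (use assms Kbar in auto)
  show ?thesis by (rule value_semigroup_eq[OF Kbar(3) assms(7-11)])
qed

end
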